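(* There is an absolute constant $K$ such that for all positive integers $d_1,d_2,r$ with $rd_2=d_1$ and all $\varepsilon\in(0,1)$, there is an algorithm making at most $$K\min\left\{\frac{d_1^{1.5}}{\varepsilon},\frac{d_1}{\varepsilon^2}\right\}$$ queries to an unknown channel $\mathcal{E}\in\mathbf{QChan}_{d_1,d_2}^r$ which, for every such $\mathcal{E}$, outputs a state $\rho$ on $\mathbb{C}^{d_2}$ with $\|\rho-\mathcal{E}(|0\rangle\langle0|)\|_1\le\varepsilon$ with probability at least $2/3$. (That is, when $\tau=rd_2/d_1=1$, tomography of $\mathcal{E}(|0\rangle\langle0|)$ to within trace norm error $\varepsilon$ can be done using $O(\min\{d_1^{1.5}/\varepsilon,d_1/\varepsilon^2\})$ queries to $\mathcal{E}$.)
   Context: A quantum channel is a completely positive trace-preserving linear map $\mathcal{E}:\mathcal{L}(\mathbb{C}^{d_1})\to\mathcal{L}(\mathbb{C}^{d_2})$. Its Choi operator is $C_{\mathcal{E}}=(\mathcal{E}\otimes\mathcal{I})(|I\rangle\!\rangle\langle\!\langle I|)$ with $|I\rangle\!\rangle=\sum_i|i\rangle|i\rangle\in\mathbb{C}^{d_1}\otimes\mathbb{C}^{d_1}$; the Kraus rank is the rank of $C_{\mathcal{E}}$. $\mathbf{QChan}_{d_1,d_2}^r$ is the set of such channels with Kraus rank at most $r$. $|0\rangle$ is a fixed computational basis vector of $\mathbb{C}^{d_1}$; $\|\cdot\|_1$ is the trace norm. An algorithm (sequential tester) making $n$ queries may use them adaptively and coherently. Formally, with $\mathcal{H}_{A,j}\cong\mathbb{C}^{d_1}$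 and $\mathcal{H}_{B,j}\cong\mathbb{C}^{d_2}$ the input and output spaces of the $j$-th query, it is a finite family $\{T_i\}_i$ of positive semidefinite operators on $\bigotimes_{j=1}^n\mathcal{H}_{A,j}\otimes\mathcal{H}_{B,j}$ for which there are positive semidefinite operators $X_j$ on $\mathcal{H}_{A,1}\otimes\mathcal{H}_{B,1}\otimes\cdots\otimes\mathcal{H}_{B,j-1}\otimes\mathcal{H}_{A,j}$, $1\le j\le n$, with $\sum_iT_i=I_{\mathcal{H}_{B,n}}\otimes X_n$, $\operatorname{tr}_{\mathcal{H}_{A,j}}X_j=I_{\mathcal{H}_{B,j-1}}\otimes X_{j-1}$ for $2\le j\le n$, and $\operatorname{tr}X_1=1$. Applied to $\mathcal{E}$, it outputs $i$ with probability $\operatorname{tr}(T_i(C_{\mathcal{E}}^{\otimes n})^{\mathrm T})$. Here the labels $i$ are (classical descriptions of) states. *)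

theory Defs
  imports "Jordan_Normal_Form.Spectral_Radius" "Jordan_Normal_Form.DL_Rank"
begin

text \<open>
  Operators on finite-dimensional Hilbert spaces are complex matrices in the computational basis,
  with indices starting at 0. The basis vector \<open>|a\<rangle>|b\<rangle>\<close> of a tensor product of spaces of
  dimensions \<open>m\<close> and \<open>k\<close> has index \<open>a * k + b\<close>.
\<close>

definition tensor_mat :: "complex mat \<Rightarrow> complex mat \<Rightarrow> complex mat" where
  "tensor_mat A B = mat (dim_row A * dim_row B) (dim_col A * dim_col B)
     (\<lambda>(i, j). A $$ (i div dim_row B, j div dim_col B) * B $$ (i mod dim_row B, j mod dim_col B))"

primrec tensor_power :: "complex mat \<Rightarrow> nat \<Rightarrow> complex mat" where
  "tensor_power A 0 = 1\<^sub>m 1"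
| "tensor_power A (Suc n) = tensor_mat A (tensor_power A n)"

definition outer_prod :: "complex vec \<Rightarrow> complex vec \<Rightarrow> complex mat" where
  "outer_prod v w = mat (dim_vec v) (dim_vec w) (\<lambda>(i, j). v $ i * cnj (w $ j))"

definition mtrace :: "complex mat \<Rightarrow> complex" where
  "mtrace A = (\<Sum>i<dim_row A. A $$ (i, i))"

text \<open>Partial trace over the left factor of a tensor product of dimension \<open>m * k\<close>.\<close>

definition ptrace_left :: "nat \<Rightarrow> nat \<Rightarrow> complex mat \<Rightarrow> complex mat" where
  "ptrace_left m k A = mat k k (\<lambda>(i, j). \<Sum>a<m. A $$ (a * k + i, a * k + j))"

text \<open>Entrywise, since matrices of varying size do not form a \<open>comm_monoid_add\<close>.\<close>

definition family_sum :: "nat \<Rightarrow> ('i \<Rightarrow> complex mat) \<Rightarrow> 'i set \<Rightarrow> complex mat" where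
  "family_sum N T S = mat N N (\<lambda>(i, j). \<Sum>s\<in>S. T s $$ (i, j))"

text \<open>The order on \<open>complex\<close> is that of \<open>Complex_Order\<close>: \<open>0 \<le> z\<close> means that \<open>z\<close> is real and
  nonnegative. Hermiticity is then automatic.\<close>

definition psd :: "nat \<Rightarrow> complex mat \<Rightarrow> bool" where
  "psd N A \<longleftrightarrow> A \<in> carrier_mat N N \<and> (\<forall>v \<in> carrier_vec N. 0 \<le> (A *\<^sub>v v) \<bullet>c v)"

definition states :: "nat \<Rightarrow> complex mat set" where
  "states d = {\<rho>. psd d \<rho> \<and> mtrace \<rho> = 1}"

text \<open>The sum of the singular values, counted with multiplicity.\<close>

definition trace_norm :: "complex mat \<Rightarrow> real" where
  "trace_norm A = (let H = mat_adjoint A * A in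
     \<Sum>x \<in> spectrum H. real (Polynomial.order x (char_poly H)) * sqrt (Re x))"

text \<open>
  A map \<open>L(C\<^bsup>d1\<^esup>) \<rightarrow> L(C\<^bsup>d2\<^esup>)\<close> is represented by a function on all matrices, of which only the
  values on \<open>carrier_mat d1 d1\<close> matter.
\<close>

definition linear_map :: "nat \<Rightarrow> nat \<Rightarrow> (complex mat \<Rightarrow> complex mat) \<Rightarrow> bool" where
  "linear_map d1 d2 E \<longleftrightarrow>
     (\<forall>A \<in> carrier_mat d1 d1. E A \<in> carrier_mat d2 d2) \<and>
     (\<forall>A \<in> carrier_mat d1 d1. \<forall>B \<in> carrier_mat d1 d1. E (A + B) = E A + E B) \<and>
     (\<forall>c. \<forall>A \<in> carrier_mat d1 d1. E (c \<cdot>\<^sub>m A) = c \<cdot>\<^sub>m E A)"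

text \<open>
  \<open>E \<otimes> I\<close> with \<open>I\<close> the identity map on \<open>L(C\<^sup>k)\<close>: an operator \<open>M\<close> on \<open>C\<^bsup>d1\<^esup> \<otimes> C\<^sup>k\<close> is
  \<open>\<Sum>\<^sub>i\<^sub>j M\<^sub>i\<^sub>j \<otimes> |i\<rangle>\<langle>j|\<close> with \<open>M\<^sub>i\<^sub>j\<close> given by \<open>tensor_block\<close>, and it is mapped to
  \<open>\<Sum>\<^sub>i\<^sub>j E(M\<^sub>i\<^sub>j) \<otimes> |i\<rangle>\<langle>j|\<close>.
\<close>

definition tensor_block :: "nat \<Rightarrow> nat \<Rightarrow> complex mat \<Rightarrow> nat \<Rightarrow> nat \<Rightarrow> complex mat" where
  "tensor_block d1 k M i j = mat d1 d1 (\<lambda>(a, b). M $$ (a * k + i, b * k + j))"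

definition ampliation ::
    "nat \<Rightarrow> nat \<Rightarrow> nat \<Rightarrow> (complex mat \<Rightarrow> complex mat) \<Rightarrow> complex mat \<Rightarrow> complex mat" where
  "ampliation d1 d2 k E M = mat (d2 * k) (d2 * k)
     (\<lambda>(p, q). E (tensor_block d1 k M (p mod k) (q mod k)) $$ (p div k, q div k))"

definition completely_positive :: "nat \<Rightarrow> nat \<Rightarrow> (complex mat \<Rightarrow> complex mat) \<Rightarrow> bool" where
  "completely_positive d1 d2 E \<longleftrightarrow>
     (\<forall>k M. psd (d1 * k) M \<longrightarrow> psd (d2 * k) (ampliation d1 d2 k E M))"

definition trace_preserving :: "nat \<Rightarrow> (complex mat \<Rightarrow> complex mat) \<Rightarrow> bool" where
  "trace_preserving d1 E \<longleftrightarrow> (\<forall>A \<in> carrier_mat d1 d1. mtrace (E A) = mtrace A)"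

definition quantum_channel :: "nat \<Rightarrow> nat \<Rightarrow> (complex mat \<Rightarrow> complex mat) \<Rightarrow> bool" where
  "quantum_channel d1 d2 E \<longleftrightarrow>
     linear_map d1 d2 E \<and> completely_positive d1 d2 E \<and> trace_preserving d1 E"

text \<open>The unnormalised maximally entangled vector \<open>\<Sum>\<^sub>i |i\<rangle>|i\<rangle>\<close> of \<open>C\<^sup>d \<otimes> C\<^sup>d\<close>.\<close>

definition max_entangled :: "nat \<Rightarrow> complex vec" where
  "max_entangled d = vec (d * d) (\<lambda>p. if p div d = p mod d then 1 else 0)"

definition choi :: "nat \<Rightarrow> nat \<Rightarrow> (complex mat \<Rightarrow> complex mat) \<Rightarrow> complex mat" where
  "choi d1 d2 E = ampliation d1 d2 d1 E (outer_prod (max_entangled d1) (max_entangled d1))"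

definition kraus_rank :: "nat \<Rightarrow> nat \<Rightarrow> (complex mat \<Rightarrow> complex mat) \<Rightarrow> nat" where
  "kraus_rank d1 d2 E = vec_space.rank (d2 * d1) (choi d1 d2 E)"

definition QChan :: "nat \<Rightarrow> nat \<Rightarrow> nat \<Rightarrow> (complex mat \<Rightarrow> complex mat) set" where
  "QChan d1 d2 r = {E. quantum_channel d1 d2 E \<and> kraus_rank d1 d2 E \<le> r}"

text \<open>
  The labelled tensor factors are arranged with later ones on the left. With \<open>A\<^sub>j\<close> of dimension
  \<open>d1\<close> and \<open>B\<^sub>j\<close> of dimension \<open>d2\<close>, the operators \<open>T i\<close> act on
  \<open>B\<^sub>n \<otimes> A\<^sub>n \<otimes> \<dots> \<otimes> B\<^sub>1 \<otimes> A\<^sub>1\<close> and \<open>X j\<close> acts on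
  \<open>A\<^sub>j \<otimes> B\<^bsub>j-1\<^esub> \<otimes> A\<^bsub>j-1\<^esub> \<otimes> \<dots> \<otimes> B\<^sub>1 \<otimes> A\<^sub>1\<close>. This agrees with the order
  (output, input) of the factors of the Choi operator, so \<open>tensor_power\<close> of the latter acts on the
  space of the \<open>T i\<close> without reordering.
\<close>

definition sequential_tester ::
    "nat \<Rightarrow> nat \<Rightarrow> nat \<Rightarrow> 'i set \<Rightarrow> ('i \<Rightarrow> complex mat) \<Rightarrow> bool" where
  "sequential_tester d1 d2 n S T \<longleftrightarrow>
     1 \<le> n \<and> finite S \<and> (\<forall>i \<in> S. psd ((d2 * d1) ^ n) (T i)) \<and>
     (\<exists>X :: nat \<Rightarrow> complex mat.
        (\<forall>j \<in> {1..n}. psd (d1 * (d2 * d1) ^ (j - 1)) (X j)) \<and>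
        family_sum ((d2 * d1) ^ n) T S = tensor_mat (1\<^sub>m d2) (X n) \<and>
        (\<forall>j \<in> {2..n}. ptrace_left d1 ((d2 * d1) ^ (j - 1)) (X j)
                         = tensor_mat (1\<^sub>m d2) (X (j - 1))) \<and>
        mtrace (X 1) = 1)"

text \<open>The trace is real and nonnegative when \<open>T\<close> is a tester and \<open>E\<close> a channel.\<close>

definition outcome_prob ::
    "nat \<Rightarrow> nat \<Rightarrow> nat \<Rightarrow> ('i \<Rightarrow> complex mat) \<Rightarrow> (complex mat \<Rightarrow> complex mat) \<Rightarrow> 'i \<Rightarrow> real" where
  "outcome_prob d1 d2 n T E i =
     Re (mtrace (T i * transpose_mat (tensor_power (choi d1 d2 E) n)))"

end

theory Submission
  imports Defs "HOL-Combinatorics.Permutations"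
begin

text \<open>
  A channel of Kraus rank at most \<open>r\<close> with \<open>r * d2 = d1\<close> has the form \<open>X \<mapsto> tr\<^sub>R (U X U\<^sup>*)\<close> with a unitary
  \<open>U\<close> on \<open>C\<^bsup>d1\<^esup> = C\<^bsup>d2\<^esup> \<otimes> R\<close> that is determined up to unitaries \<open>V\<close> on \<open>R = C\<^sup>r\<close>. The queries are made
  in parallel. For a real polynomial \<open>q\<close> there is a homogeneous polynomial \<open>f\<close> in the entries of \<open>U\<close>
  with \<open>|f U|\<^sup>2 = x\<^sup>L (q x)\<^sup>2\<close>, \<open>x = |U\<^sub>0\<^sub>0|\<^sup>2\<close>. The outcome \<open>g\<close>, from a finite list approximating the Haar
  measure, has amplitude \<open>f (g\<^sup>* U)\<close> and label \<open>tr\<^sub>R (g e\<^sub>0 e\<^sub>0\<^sup>* g\<^sup>*)\<close>.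

  Only the average over \<open>V\<close> of the probabilities \<open>|f (g\<^sup>* V U)|\<^sup>2\<close> can be observed. Writing the amplitude as
  the pairing of \<open>U\<^sup>\<otimes>\<^sup>n\<close> with a symmetric tensor \<open>F\<^sub>g\<close>, Schur-Weyl duality shows that the
  outcome operator \<open>Z (tr\<^sub>R F\<^sub>g F\<^sub>g\<^sup>*) Z\<close> has these averages as probabilities, where \<open>Z = K\<^bsup>-1/2\<^esup>\<close> and \<open>K\<close>
  weighs permutations of the factors by their number of fixed basis vectors of \<open>R\<^sup>\<otimes>\<^sup>n\<close>. The same identity
  for \<open>R = C\<^bsup>d1\<^esup>\<close> shows that the average of these operators over \<open>g\<close> is at most a state on the inputs
  tensored with the identity on the outputs, so that they form a tester.

  If the label is farther than \<open>\<epsilon>\<close> from the true state, then \<open>1 - x > \<epsilon>\<^sup>2 / 4\<close>. Hence the failure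
  probability is at most \<open>4 / \<epsilon>\<^sup>2\<close> times the expectation of \<open>(1 - x) x\<^sup>L (q x)\<^sup>2\<close>, if that of \<open>x\<^sup>L (q x)\<^sup>2\<close> is 1. For constant \<open>q\<close> it is
  small when \<open>L\<close> is of order \<open>d1 / \<epsilon>\<^sup>2\<close>. A combination \<open>q\<close> of the Jacobi polynomials of degree
  at most \<open>2 k\<close>, with \<open>L = d1 k\<close> and \<open>k\<close> of order \<open>d1\<^bsup>1/2\<^esup> / \<epsilon>\<close>, makes it small with \<open>3 d1 k\<close> queries.
\<close>

section \<open>Matrices and tuples over index sets\<close>

text \<open>Measuring copies of the output costs of order \<open>d1 / \<epsilon>^2\<close> queries.
  A rate in \<open>1 / \<epsilon>\<close> needs amplitudes with a nonconstant polynomial in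
  \<open>|U 0 0|^2\<close>, but \<open>n\<close> queries only give expressions homogeneous in the
  entries of \<open>U\<close>, without conjugates. For unitary \<open>U\<close> the cofactor at
  \<open>(0, 0)\<close> is \<open>det U * cnj (U 0 0)\<close>, which supplies conjugates at the
  price of \<open>d1\<close> queries per degree in \<open>x\<close>. Degree \<open>2 k\<close> thus
  costs \<open>2 d1 k\<close> queries, and \<open>L = d1 k\<close> does not change the order. With
  this \<open>L\<close> a constant \<open>q\<close> has error of order \<open>1 / k\<close>, the
  chosen \<open>q\<close> one of order \<open>d1 / k^2\<close>; this is an improvement for
  \<open>k\<close> above \<open>d1\<close>, whence the case distinction on
  \<open>\<epsilon> * sqrt d1\<close>. A tester has finitely many outcomes, so Haar integrals become
  averages over finite lists of unitaries, accurate on the finitely many moments that occur. The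
  resulting defect in the operator inequality is absorbed by mixing some identity into the input
  state. The failure budget is \<open>1 / 4\<close> for the polynomial and \<open>1 / 24\<close> for
  the approximation; after mixing, \<open>48 / 49 * 17 / 24 > 2 / 3\<close> remains.\<close>

definition tup :: "nat \<Rightarrow> 'a set \<Rightarrow> 'a list set" where
  "tup n A = {xs. length xs = n \<and> set xs \<subseteq> A}"

lemma tup_0 [simp]: "tup 0 A = {[]}"
  by (auto simp: tup_def)

lemma tup_Suc: "tup (Suc n) A = (\<lambda>(x, xs). x # xs) ` (A \<times> tup n A)"
  by (auto simp: tup_def length_Suc_conv image_iff)

lemma length_tup: "xs \<in> tup n A \<Longrightarrow> length xs = n"
  by (simp add: tup_def)

lemma nth_tup: "xs \<in> tup n A \<Longrightarrow> k < n \<Longrightarrow> xs ! k \<in> A"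
  by (auto simp: tup_def)

lemma finite_tup [simp]: "finite A \<Longrightarrow> finite (tup n A)"
  unfolding tup_def using finite_lists_length_eq[of A n] by (simp add: conj_commute)

lemma card_tup: "finite A \<Longrightarrow> card (tup n A) = card A ^ n"
  unfolding tup_def using card_lists_length_eq[of A n] by (simp add: conj_commute)

lemma sum_tup_Suc: "(\<Sum>xs\<in>tup (Suc n) A. f xs) = (\<Sum>x\<in>A. \<Sum>xs\<in>tup n A. f (x # xs))"
proof -
  have "(\<Sum>xs\<in>tup (Suc n) A. f xs) = (\<Sum>p\<in>A \<times> tup n A. f (fst p # snd p))"
    unfolding tup_Suc by (subst sum.reindex) (auto simp: inj_on_def case_prod_unfold)
  then show ?thesis by (simp add: sum.cartesian_product case_prod_unfold)
qed

lemma sum_tup_prod: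
  fixes f :: "nat \<Rightarrow> 'a \<Rightarrow> 'b::comm_semiring_1"
  shows "(\<Sum>xs\<in>tup n A. \<Prod>k<n. f k (xs ! k)) = (\<Prod>k<n. \<Sum>x\<in>A. f k x)"
proof (induction n arbitrary: f)
  case (Suc n)
  have "(\<Sum>xs\<in>tup (Suc n) A. \<Prod>k<Suc n. f k (xs ! k))
      = (\<Sum>x\<in>A. \<Sum>xs\<in>tup n A. f 0 x * (\<Prod>k<n. f (Suc k) (xs ! k)))"
    by (simp add: sum_tup_Suc prod.lessThan_Suc_shift del: prod.lessThan_Suc)
  also have "\<dots> = (\<Sum>x\<in>A. f 0 x * (\<Prod>k<n. \<Sum>x\<in>A. f (Suc k) x))"
    using Suc.IH[of "\<lambda>k. f (Suc k)"] by (simp add: sum_distrib_left[symmetric])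
  finally show ?case
    by (simp add: prod.lessThan_Suc_shift sum_distrib_right del: prod.lessThan_Suc)
qed simp

section \<open>Matrices as functions on arbitrary index sets\<close>

definition mm :: "'b set \<Rightarrow> ('a \<Rightarrow> 'b \<Rightarrow> complex) \<Rightarrow> ('b \<Rightarrow> 'c \<Rightarrow> complex) \<Rightarrow> 'a \<Rightarrow> 'c \<Rightarrow> complex" where
  "mm R V W = (\<lambda>i j. \<Sum>k\<in>R. V i k * W k j)"

definition adj :: "('a \<Rightarrow> 'b \<Rightarrow> complex) \<Rightarrow> 'b \<Rightarrow> 'a \<Rightarrow> complex" where
  "adj V = (\<lambda>i j. cnj (V j i))"

definition idm :: "'a \<Rightarrow> 'a \<Rightarrow> complex" where
  "idm = (\<lambda>i j. if i = j then 1 else 0)"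

text \<open>Matrices are total functions of which only the values on the index sets matter. Laws
  that need the identity matrix or unitarity hold only there, and \<open>mm_cong\<close> takes the
  place of plain rewriting.\<close>

definition meq :: "'a set \<Rightarrow> 'b set \<Rightarrow> ('a \<Rightarrow> 'b \<Rightarrow> complex) \<Rightarrow> ('a \<Rightarrow> 'b \<Rightarrow> complex) \<Rightarrow> bool" where
  "meq I J V W \<longleftrightarrow> (\<forall>i\<in>I. \<forall>j\<in>J. V i j = W i j)"

definition unitary_on :: "'a set \<Rightarrow> ('a \<Rightarrow> 'a \<Rightarrow> complex) \<Rightarrow> bool" where
  "unitary_on R V \<longleftrightarrow> meq R R (mm R V (adj V)) idm \<and> meq R R (mm R (adj V) V) idm"

definition hermitian_on :: "'a set \<Rightarrow> ('a \<Rightarrow> 'a \<Rightarrow> complex) \<Rightarrow> bool" where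
  "hermitian_on I K \<longleftrightarrow> meq I I (adj K) K"

lemma meqD: "meq I J V W \<Longrightarrow> i \<in> I \<Longrightarrow> j \<in> J \<Longrightarrow> V i j = W i j"
  by (simp add: meq_def)

lemma meqI: "(\<And>i j. i \<in> I \<Longrightarrow> j \<in> J \<Longrightarrow> V i j = W i j) \<Longrightarrow> meq I J V W"
  by (simp add: meq_def)

lemma meq_sym: "meq I J V W \<Longrightarrow> meq I J W V"
  by (simp add: meq_def)

lemma meq_trans [trans]: "meq I J U V \<Longrightarrow> meq I J V W \<Longrightarrow> meq I J U W"
  by (simp add: meq_def)

lemma meq_refl [simp]: "meq I J U U"
  by (simp add: meq_def)

lemma mm_cong: "meq I R V V' \<Longrightarrow> meq R J W W' \<Longrightarrow> meq I J (mm R V W) (mm R V' W')"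
  by (auto simp: meq_def mm_def intro!: sum.cong)

lemma mm_assoc: "mm S (mm R U V) W = mm R U (mm S V W)"
  unfolding mm_def
  by (auto simp: sum_distrib_left sum_distrib_right mult.assoc fun_eq_iff intro: sum.swap)

lemma adj_mm: "adj (mm R V W) = mm R (adj W) (adj V)"
  by (simp add: adj_def mm_def mult.commute)

lemma adj_adj [simp]: "adj (adj V) = V"
  by (simp add: adj_def)

lemma mm_idm_left: "finite R \<Longrightarrow> meq R J (mm R idm V) V"
  by (auto simp: meq_def mm_def idm_def if_distrib[where f="\<lambda>x. x * _"] cong: if_cong)

lemma mm_idm_right: "finite R \<Longrightarrow> meq J R (mm R V idm) V"
  by (auto simp: meq_def mm_def idm_def if_distrib[where f="\<lambda>x. _ * x"] cong: if_cong)

lemma unitary_onD: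
  assumes "unitary_on R V"
  shows "meq R R (mm R V (adj V)) idm" "meq R R (mm R (adj V) V) idm"
  using assms by (auto simp: unitary_on_def)

lemma unitary_on_adj: "unitary_on R V \<Longrightarrow> unitary_on R (adj V)"
  by (auto simp: unitary_on_def)

lemma adj_idm [simp]: "adj idm = idm"
  by (auto simp: adj_def idm_def fun_eq_iff)

lemma unitary_on_idm: "finite R \<Longrightarrow> unitary_on R idm"
  using mm_idm_left[of R R idm] by (simp add: unitary_on_def)

lemma unitary_on_mm:
  assumes R: "finite R" and V: "unitary_on R V" and W: "unitary_on R W"
  shows "unitary_on R (mm R V W)"
proof -
  have *: "meq R R (mm R (mm R A B) (mm R B' A')) idm"
    if "meq R R (mm R A A') idm" "meq R R (mm R B B') idm" for A B A' B'
  proof -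
    have "meq R R (mm R (mm R A B) (mm R B' A')) (mm R A (mm R (mm R B B') A'))"
      by (simp add: mm_assoc)
    also have "meq R R (mm R A (mm R (mm R B B') A')) (mm R A (mm R idm A'))"
      by (intro mm_cong meq_refl that)
    also have "meq R R (mm R A (mm R idm A')) (mm R A A')"
      by (intro mm_cong meq_refl mm_idm_left R)
    finally show ?thesis using that by (meson meq_trans)
  qed
  show ?thesis
    unfolding unitary_on_def adj_mm using unitary_onD[OF V] unitary_onD[OF W] by (auto intro!: *)
qed

definition tpow :: "('a \<Rightarrow> 'b \<Rightarrow> complex) \<Rightarrow> 'a list \<Rightarrow> 'b list \<Rightarrow> complex" where
  "tpow V xs ys = (\<Prod>k<length xs. V (xs ! k) (ys ! k))"

lemma tpow_Nil [simp]: "tpow V [] ys = 1"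
  by (simp add: tpow_def)

lemma tpow_Cons [simp]: "tpow V (x # xs) (y # ys) = V x y * tpow V xs ys"
  by (simp add: tpow_def prod.lessThan_Suc_shift del: prod.lessThan_Suc)

lemma tpow_mm: "length xs = n \<Longrightarrow> tpow (mm R V W) xs ys = mm (tup n R) (tpow V) (tpow W) xs ys"
  unfolding mm_def tpow_def
  by (subst sum_tup_prod[symmetric]) (auto simp: prod.distrib length_tup intro!: sum.cong)

lemma tpow_adj: "length xs = length ys \<Longrightarrow> tpow (adj V) xs ys = adj (tpow V) xs ys"
  by (simp add: tpow_def adj_def)

lemma tpow_cong:
  assumes "meq I J V W"
  shows "meq (tup n I) (tup n J) (tpow V) (tpow W)"
  unfolding tpow_def
  by (intro meqI prod.cong) (auto simp: length_tup intro!: meqD[OF assms] nth_tup)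

lemma tpow_idm: "length xs = length ys \<Longrightarrow> tpow idm xs ys = idm xs ys"
proof (induction xs arbitrary: ys)
  case (Cons x xs)
  then show ?case by (cases ys) (auto simp: idm_def)
qed (auto simp: idm_def)

lemma unitary_on_tpow:
  assumes R: "finite R" and V: "unitary_on R V"
  shows "unitary_on (tup n R) (tpow V)"
proof -
  have *: "meq (tup n R) (tup n R) (mm (tup n R) (tpow A) (tpow B)) idm"
    if "meq R R (mm R A B) idm" for A B
  proof (rule meqI)
    fix xs ys assume xy: "xs \<in> tup n R" "ys \<in> tup n R"
    have "mm (tup n R) (tpow A) (tpow B) xs ys = tpow (mm R A B) xs ys"
      using xy by (simp add: tpow_mm length_tup)
    also have "\<dots> = tpow idm xs ys"
      using tpow_cong[OF that] xy by (auto simp: meq_def)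
    finally show "mm (tup n R) (tpow A) (tpow B) xs ys = idm xs ys"
      using xy by (simp add: tpow_idm length_tup)
  qed
  have a: "meq (tup n R) (tup n R) (adj (tpow V)) (tpow (adj V))"
    by (rule meqI) (simp add: tpow_adj length_tup)
  have "meq (tup n R) (tup n R) (mm (tup n R) (tpow V) (adj (tpow V))) idm"
    using mm_cong[OF meq_refl a] *[OF unitary_onD(1)[OF V]] by (rule meq_trans)
  moreover have "meq (tup n R) (tup n R) (mm (tup n R) (adj (tpow V)) (tpow V)) idm"
    using mm_cong[OF a meq_refl] *[OF unitary_onD(2)[OF V]] by (rule meq_trans)
  ultimately show ?thesis by (simp add: unitary_on_def)
qed

lemma unitary_on_isometry:
  assumes R: "finite R" and V: "unitary_on R V"
  shows "(\<Sum>i\<in>R. (\<Sum>j\<in>R. V i j * x j) * cnj (\<Sum>j\<in>R. V i j * y j)) = (\<Sum>j\<in>R. x j * cnj (y j))"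
proof -
  have "(\<Sum>i\<in>R. (\<Sum>j\<in>R. V i j * x j) * cnj (\<Sum>j\<in>R. V i j * y j))
      = (\<Sum>i\<in>R. \<Sum>j\<in>R. \<Sum>k\<in>R. x j * cnj (y k) * (cnj (V i k) * V i j))"
    by (simp add: sum_product algebra_simps)
  also have "\<dots> = (\<Sum>j\<in>R. \<Sum>k\<in>R. \<Sum>i\<in>R. x j * cnj (y k) * (cnj (V i k) * V i j))"
    by (subst sum.swap) (intro sum.cong refl sum.swap)
  also have "\<dots> = (\<Sum>j\<in>R. \<Sum>k\<in>R. x j * cnj (y k) * mm R (adj V) V k j)"
    by (simp add: mm_def adj_def sum_distrib_left)
  also have "\<dots> = (\<Sum>j\<in>R. \<Sum>k\<in>R. x j * cnj (y k) * idm k j)"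
    using unitary_onD(2)[OF V] by (intro sum.cong refl) (simp add: meq_def)
  also have "\<dots> = (\<Sum>j\<in>R. x j * cnj (y j))"
    using R by (intro sum.cong refl) (simp add: idm_def if_distrib[where f="\<lambda>x. _ * x"] cong: if_cong)
  finally show ?thesis .
qed

section \<open>The spectral theorem\<close>

text \<open>Enumerating the index set gives an ordinary complex matrix, whose spectrum is
  nonempty.\<close>

lemma eigenvector_exists:
  fixes K :: "'i \<Rightarrow> 'i \<Rightarrow> complex"
  assumes "finite I" "I \<noteq> {}"
  shows "\<exists>v l. (\<exists>i\<in>I. v i \<noteq> 0) \<and> (\<forall>i\<in>I. (\<Sum>j\<in>I. K i j * v j) = l * v i)"
proof -
  obtain e where e: "bij_betw e {0..<card I} I"
    using ex_bij_betw_nat_finite[OF \<open>finite I\<close>] by blast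
  define n where "n = card I"
  define f where "f = inv_into {0..<n} e"
  have n: "n > 0" using assms by (simp add: n_def card_gt_0_iff)
  have f: "f i < n" "e (f i) = i" if "i \<in> I" for i
    using e that bij_betw_inv_into_right[OF e that] bij_betw_apply[OF bij_betw_inv_into[OF e] that]
    by (auto simp: f_def n_def)
  have f': "f (e a) = a" if "a < n" for a
    using bij_betw_inv_into_left[OF e, of a] that by (auto simp: f_def n_def)
  define A where "A = mat n n (\<lambda>(a, b). K (e a) (e b))"
  have A: "A \<in> carrier_mat n n" by (simp add: A_def)
  obtain l where "l \<in> spectrum A" using spectrum_non_empty[OF A] n by auto
  then obtain w where w: "eigenvector A w l"
    by (auto simp: spectrum_def eigenvalue_def)
  then have wc: "w \<in> carrier_vec n" "w \<noteq> 0\<^sub>v n" and ev: "A *\<^sub>v w = l \<cdot>\<^sub>v w"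
    using A by (auto simp: eigenvector_def)
  define v where "v = (\<lambda>i. w $ f i)"
  obtain a where a: "a < n" "w $ a \<noteq> 0"
    using wc by (metis carrier_vecD eq_vecI index_zero_vec(1) index_zero_vec(2))
  have "e a \<in> I" using e a by (auto simp: n_def bij_betw_def)
  moreover have "v (e a) \<noteq> 0" using a f' by (simp add: v_def)
  moreover have "(\<Sum>j\<in>I. K i j * v j) = l * v i" if i: "i \<in> I" for i
  proof -
    have "(\<Sum>j\<in>I. K i j * v j) = (\<Sum>b\<in>{0..<n}. K i (e b) * v (e b))"
      using sum.reindex_bij_betw[OF e, of "\<lambda>j. K i j * v j"] by (simp add: n_def)
    also have "\<dots> = (\<Sum>b\<in>{0..<n}. A $$ (f i, b) * w $ b)"
      using f[OF i] f' by (intro sum.cong) (auto simp: A_def v_def)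
    also have "\<dots> = (A *\<^sub>v w) $ f i"
      using f[OF i] wc A by (simp add: scalar_prod_def)
    also have "\<dots> = l * v i" using ev f[OF i] wc by (simp add: v_def)
    finally show ?thesis .
  qed
  ultimately show ?thesis by blast
qed

text \<open>A phase times a Householder reflection.\<close>

lemma unitary_with_column:
  fixes v :: "'i \<Rightarrow> complex"
  assumes I: "finite I" and i0: "i0 \<in> I" and v: "(\<Sum>i\<in>I. v i * cnj (v i)) = 1"
  shows "\<exists>W. unitary_on I W \<and> (\<forall>i\<in>I. W i i0 = v i)"
proof -
  \<comment> \<open>A phase that makes \<open>cnj al * v\<close> real and nonnegative at
    \<open>i0\<close>: a reflection takes one unit vector to another only if their inner product is
    real.\<close>
  obtain al where al: "al * cnj al = 1" "v i0 = of_real (cmod (v i0)) * al"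
  proof (cases "v i0 = 0")
    case True then show ?thesis using that[of 1] by simp
  next
    case False
    have "sgn (v i0) * cnj (sgn (v i0)) = 1"
      using False by (simp add: complex_norm_square[symmetric] norm_sgn)
    moreover have "v i0 = of_real (cmod (v i0)) * sgn (v i0)"
      using False by (simp add: sgn_eq)
    ultimately show ?thesis using that by blast
  qed
  define t where "t = cmod (v i0)"
  define u where "u = (\<lambda>i. cnj al * v i)"
  have "cnj al * (of_real t * al) = of_real t"
    using al(1) by (simp add: algebra_simps)
  then have ui0: "u i0 = of_real t"
    using al(2)[folded t_def] by (simp add: u_def)
  have vu: "v i = al * u i" for i using al by (simp add: u_def mult.assoc[symmetric])
  have u1: "(\<Sum>i\<in>I. u i * cnj (u i)) = 1"
  proof -
    have "u i * cnj (u i) = v i * cnj (v i)" for i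
      using al(1) by (simp add: u_def algebra_simps)
    then show ?thesis using v by simp
  qed
  define x where "x = (\<lambda>i. idm i i0 - u i)"
  define s where "s = (\<Sum>i\<in>I. x i * cnj (x i))"
  have s: "s = 2 * (1 - of_real t)"
  proof -
    have "s = (\<Sum>i\<in>I. idm i i0 * (1 - u i - cnj (u i)) + u i * cnj (u i))"
      unfolding s_def x_def by (intro sum.cong) (auto simp: idm_def algebra_simps)
    also have "\<dots> = (\<Sum>i\<in>I. idm i i0 * (1 - u i - cnj (u i))) + 1"
      by (simp add: sum.distrib u1)
    also have "(\<Sum>i\<in>I. idm i i0 * (1 - u i - cnj (u i))) = 1 - u i0 - cnj (u i0)"
      using I i0 by (simp add: idm_def if_distrib[where f="\<lambda>x. x * _"] cong: if_cong)
    finally show ?thesis by (simp add: ui0)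
  qed
  \<comment> \<open>For \<open>s = 0\<close> the division yields 0 and \<open>W\<close> is
    \<open>al\<close> times the identity, which is right because \<open>x\<close> then
    vanishes.\<close>
  define W where "W = (\<lambda>i j. al * (idm i j - 2 * x i * cnj (x j) / s))"
  have WW: "(\<Sum>k\<in>I. W i k * cnj (W j k)) = idm i j" if "i \<in> I" "j \<in> I" for i j
  proof -
    have sr: "cnj s = s" by (simp add: s)
    have "W i k * cnj (W j k) = idm i k * idm j k - 2 * x i / s * (cnj (x k) * idm j k)
        - 2 * cnj (x j) / s * (x k * idm i k)
        + 4 * x i * cnj (x j) / (s * s) * (x k * cnj (x k))" for k
    proof -
      have "W i k * cnj (W j k) = (al * cnj al) * ((idm i k - 2 * x i * cnj (x k) / s) *
          (idm j k - 2 * cnj (x j) * x k / s))"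
        using sr by (simp add: W_def idm_def)
      then show ?thesis by (simp add: al(1) algebra_simps)
    qed
    then have "(\<Sum>k\<in>I. W i k * cnj (W j k)) = (\<Sum>k\<in>I. idm i k * idm j k)
        - 2 * x i / s * (\<Sum>k\<in>I. cnj (x k) * idm j k)
        - 2 * cnj (x j) / s * (\<Sum>k\<in>I. x k * idm i k) + 4 * x i * cnj (x j) / (s * s) * (\<Sum>k\<in>I. x k * cnj (x k))"
      by (simp only: sum.distrib sum_subtractf sum_distrib_left)
    also have "(\<Sum>k\<in>I. x k * cnj (x k)) = s" by (simp add: s_def)
    also have "(\<Sum>k\<in>I. idm i k * idm j k) = idm i j"
      using I that by (simp add: idm_def if_distrib[where f="\<lambda>x. x * _"] cong: if_cong)
    also have "(\<Sum>k\<in>I. cnj (x k) * idm j k) = cnj (x j)"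
      using I that by (simp add: idm_def if_distrib[where f="\<lambda>x. _ * x"] cong: if_cong)
    also have "(\<Sum>k\<in>I. x k * idm i k) = x i"
      using I that by (simp add: idm_def if_distrib[where f="\<lambda>x. _ * x"] cong: if_cong)
    finally show ?thesis by (cases "s = 0") (simp_all add: field_simps)
  qed
  have WW': "(\<Sum>k\<in>I. cnj (W k i) * W k j) = idm i j" if "i \<in> I" "j \<in> I" for i j
  proof -
    have "cnj s = s" by (simp add: s)
    then have "cnj (W k i) * W k j = W i k * cnj (W j k)" for k
      by (simp add: W_def idm_def algebra_simps)
    then show ?thesis using WW[OF that] by simp
  qed
  have "W i i0 = v i" if "i \<in> I" for i
  proof (cases "s = 0")
    case True
    then have "(\<Sum>i\<in>I. (cmod (x i))\<^sup>2) = 0"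
      unfolding s_def by (simp add: complex_norm_square[symmetric] del: of_real_power flip: of_real_sum)
    then have "x i = 0" using that I by (simp add: sum_nonneg_eq_0_iff)
    then show ?thesis using True by (simp add: W_def x_def vu)
  next
    case False
    have "cnj (x i0) = s / 2" by (simp add: s x_def idm_def ui0)
    then have "2 * x i * cnj (x i0) / s = x i"
      unfolding \<open>cnj (x i0) = s / 2\<close> using False by simp
    then have "W i i0 = al * (idm i i0 - x i)" by (simp add: W_def)
    then show ?thesis by (simp add: x_def vu)
  qed
  moreover have "unitary_on I W"
    unfolding unitary_on_def meq_def mm_def adj_def using WW WW' by simp
  ultimately show ?thesis by blast
qed

text \<open>Deflation. A unit eigenvector is completed to a unitary \<open>W\<close>; in the new
  basis its column, and by hermiticity its row, is zero off the diagonal, and the induction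
  hypothesis diagonalises the remaining block.\<close>

theorem spectral_on:
  fixes K :: "'i \<Rightarrow> 'i \<Rightarrow> complex"
  assumes "finite I" "hermitian_on I K"
  shows "\<exists>V (l :: 'i \<Rightarrow> real). unitary_on I V \<and>
    (\<forall>i\<in>I. \<forall>j\<in>I. K i j = (\<Sum>k\<in>I. of_real (l k) * V i k * cnj (V j k)))"
  using assms
proof (induction I arbitrary: K rule: finite_induct)
  case empty
  show ?case by (simp add: unitary_on_def meq_def)
next
  case (insert i0 J)
  define I where "I = insert i0 J"
  have I: "finite I" "i0 \<in> I" "J \<subseteq> I" using insert by (auto simp: I_def)
  have K: "cnj (K j i) = K i j" if "i \<in> I" "j \<in> I" for i j
    using insert.prems that unfolding hermitian_on_def meq_def adj_def I_def by blast
  obtain v0 l0 where v0: "\<exists>i\<in>I. v0 i \<noteq> 0" and ev0: "\<And>i. i \<in> I \<Longrightarrow> (\<Sum>j\<in>I. K i j * v0 j) = l0 * v0 i"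
    using eigenvector_exists[of I K] I by blast
  define c where "c = sqrt (\<Sum>i\<in>I. (cmod (v0 i))\<^sup>2)"
  have c2: "(\<Sum>i\<in>I. (cmod (v0 i))\<^sup>2) > 0"
  proof -
    from v0 obtain i where "i \<in> I" "v0 i \<noteq> 0" by blast
    then show ?thesis using I(1) by (intro sum_pos2[of I i]) auto
  qed
  then have c: "c > 0" "c\<^sup>2 = (\<Sum>i\<in>I. (cmod (v0 i))\<^sup>2)" by (auto simp: c_def)
  define v where "v = (\<lambda>i. v0 i / of_real c)"
  have v1: "(\<Sum>i\<in>I. v i * cnj (v i)) = 1"
  proof -
    have "v i * cnj (v i) = of_real ((cmod (v0 i))\<^sup>2 / c\<^sup>2)" for i
    proof -
      have "v i * cnj (v i) = v0 i * cnj (v0 i) / of_real (c * c)"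
        by (simp add: v_def)
      then show ?thesis
        by (simp only: complex_norm_square[symmetric] of_real_divide power2_eq_square[of c])
    qed
    then have "(\<Sum>i\<in>I. v i * cnj (v i)) = (\<Sum>i\<in>I. of_real ((cmod (v0 i))\<^sup>2 / c\<^sup>2))"
      by simp
    also have "\<dots> = of_real ((\<Sum>i\<in>I. (cmod (v0 i))\<^sup>2) / c\<^sup>2)"
      by (simp add: sum_divide_distrib)
    finally show ?thesis using c by (metis div_self of_real_1 power_eq_0_iff less_numeral_extra(3))
  qed
  have ev: "(\<Sum>j\<in>I. K i j * v j) = l0 * v i" if "i \<in> I" for i
    using ev0[OF that] by (simp add: v_def sum_divide_distrib[symmetric])
  obtain W where W: "unitary_on I W" "\<And>i. i \<in> I \<Longrightarrow> W i i0 = v i"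
    using unitary_with_column[OF I(1,2) v1] by blast
  define K' where "K' = mm I (adj W) (mm I K W)"
  have Kadj: "meq I I (adj K) K" using K by (simp add: meq_def adj_def)
  have hK': "meq I I (adj K') K'"
  proof -
    have "meq I I (mm I (mm I (adj W) (adj K)) W) (mm I (mm I (adj W) K) W)"
      by (intro mm_cong meq_refl Kadj)
    then show ?thesis by (simp add: K'_def adj_mm mm_assoc)
  qed
  have col: "K' i i0 = l0 * idm i i0" if "i \<in> I" for i
  proof -
    have "K' i i0 = (\<Sum>p\<in>I. cnj (W p i) * (\<Sum>q\<in>I. K p q * v q))"
      using W(2) unfolding K'_def mm_def adj_def by (intro sum.cong refl) simp
    also have "\<dots> = l0 * (\<Sum>p\<in>I. cnj (W p i) * W p i0)"
      using ev W(2) by (simp add: sum_distrib_left algebra_simps)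
    also have "(\<Sum>p\<in>I. cnj (W p i) * W p i0) = idm i i0"
      using unitary_onD(2)[OF W(1)] that I by (simp add: meq_def mm_def adj_def)
    finally show ?thesis .
  qed
  have row: "K' i0 i = cnj l0 * idm i i0" if "i \<in> I" for i
    using meqD[OF hK', of i0 i] that I col[OF that]
    by (cases "i = i0") (auto simp: adj_def idm_def)
  have l0: "cnj l0 = l0"
    using row[OF I(2)] col[OF I(2)] by (simp add: idm_def)
  have "hermitian_on J K'"
    using hK' I(3) by (auto simp: hermitian_on_def meq_def)
  from insert.IH[OF this] obtain V' l' where V': "unitary_on J V'"
    and K'J: "\<And>i j. i \<in> J \<Longrightarrow> j \<in> J \<Longrightarrow> K' i j = (\<Sum>k\<in>J. of_real (l' k :: real) * V' i k * cnj (V' j k))"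
    by blast
  \<comment> \<open>The block sum of the one-dimensional identity at \<open>i0\<close> and the
    unitary for the smaller index set.\<close>
  define V2 where "V2 = (\<lambda>i k. if i = i0 \<or> k = i0 then idm i k else V' i k)"
  define l where "l = (\<lambda>k. if k = i0 then Re l0 else l' k)"
  have l0r: "of_real (Re l0) = l0" using l0 by (simp add: complex_eq_iff)
  have i0J: "i0 \<notin> J" by fact
  have V2: "V2 i0 i0 = 1" "\<And>j. j \<in> J \<Longrightarrow> V2 i0 j = 0" "\<And>j. j \<in> J \<Longrightarrow> V2 j i0 = 0"
     "\<And>i j. i \<in> J \<Longrightarrow> j \<in> J \<Longrightarrow> V2 i j = V' i j"
    using i0J by (auto simp: V2_def idm_def)
  have sumI: "(\<Sum>k\<in>I. f k) = f i0 + (\<Sum>k\<in>J. f k)" for f :: "'i \<Rightarrow> complex"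
    using insert by (simp add: I_def)
  have V'D: "(\<Sum>k\<in>J. V' i k * cnj (V' j k)) = idm i j" "(\<Sum>k\<in>J. cnj (V' k i) * V' k j) = idm i j"
    if "i \<in> J" "j \<in> J" for i j
    using unitary_onD[OF V'] that by (auto simp: meq_def mm_def adj_def)
  have uV2: "unitary_on I V2"
    unfolding unitary_on_def meq_def mm_def adj_def sumI
    using V2 V'D i0J by (auto simp: I_def idm_def)
  have K'dec: "K' i j = (\<Sum>k\<in>I. of_real (l k) * V2 i k * cnj (V2 j k))" if "i \<in> I" "j \<in> I" for i j
  proof -
    have lJ: "(\<Sum>k\<in>J. of_real (l k) * V2 i k * cnj (V2 j k)) = (\<Sum>k\<in>J. of_real (l' k) * V2 i k * cnj (V2 j k))"
      using i0J by (intro sum.cong) (auto simp: l_def)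
    show ?thesis
      using that V2 K'J col row l0r unfolding sumI lJ
      by (auto simp: I_def l_def idm_def l0)
  qed
  define D where "D = (\<lambda>k j. of_real (l k) * cnj (V2 j k))"
  have K'D: "meq I I K' (mm I V2 D)"
    using K'dec by (simp add: meq_def mm_def D_def mult.assoc mult.left_commute)
  have "meq I I K (mm I W (mm I K' (adj W)))"
  proof -
    have "mm I W (mm I K' (adj W)) = mm I (mm I W (adj W)) (mm I K (mm I W (adj W)))"
      by (simp add: K'_def mm_assoc)
    moreover have "meq I I \<dots> (mm I idm (mm I K idm))"
      by (intro mm_cong meq_refl unitary_onD(1)[OF W(1)])
    moreover have "meq I I (mm I idm (mm I K idm)) K"
      using mm_idm_left[OF I(1)] mm_idm_right[OF I(1)] by (meson meq_trans)
    ultimately show ?thesis by (metis meq_sym meq_trans)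
  qed
  also have "meq I I (mm I W (mm I K' (adj W))) (mm I W (mm I (mm I V2 D) (adj W)))"
    by (intro mm_cong meq_refl K'D)
  also have "mm I W (mm I (mm I V2 D) (adj W)) = mm I (mm I W V2) (mm I D (adj W))"
    by (simp add: mm_assoc)
  also have "mm I D (adj W) = (\<lambda>k j. of_real (l k) * cnj (mm I W V2 j k))"
    by (auto simp: fun_eq_iff mm_def D_def adj_def sum_distrib_left algebra_simps)
  finally have fin: "meq I I K (mm I (mm I W V2) (\<lambda>k j. of_real (l k) * cnj (mm I W V2 j k)))" .
  have "unitary_on I (mm I W V2)" by (rule unitary_on_mm[OF I(1) W(1) uV2])
  moreover have "\<forall>i\<in>I. \<forall>j\<in>I. K i j = (\<Sum>k\<in>I. of_real (l k) * mm I W V2 i k * cnj (mm I W V2 j k))"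
  proof (intro ballI)
    fix i j assume "i \<in> I" "j \<in> I"
    from meqD[OF fin this] show "K i j = (\<Sum>k\<in>I. of_real (l k) * mm I W V2 i k * cnj (mm I W V2 j k))"
      unfolding mm_def[of I "mm I W V2"] by (simp add: mult.assoc mult.left_commute)
  qed
  ultimately show ?case unfolding I_def by blast
qed

section \<open>The commutant of the tensor powers\<close>

abbreviation perms :: "nat \<Rightarrow> (nat \<Rightarrow> nat) set" where
  "perms n \<equiv> {p. p permutes {..<n}}"

definition commute_on :: "'a set \<Rightarrow> ('a \<Rightarrow> 'a \<Rightarrow> complex) \<Rightarrow> ('a \<Rightarrow> 'a \<Rightarrow> complex) \<Rightarrow> bool" where
  "commute_on T A B \<longleftrightarrow> meq T T (mm T A B) (mm T B A)"

definition conj_on :: "'a set \<Rightarrow> ('a \<Rightarrow> 'a \<Rightarrow> complex) \<Rightarrow> ('a \<Rightarrow> 'a \<Rightarrow> complex) \<Rightarrow> 'a \<Rightarrow> 'a \<Rightarrow> complex" where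
  "conj_on T u X = mm T u (mm T X (adj u))"

lemma commute_on_cong:
  assumes "meq T T A A'" "meq T T B B'" "commute_on T A B"
  shows "commute_on T A' B'"
  using mm_cong[OF assms(1,2)] mm_cong[OF assms(2,1)] assms(3)
  unfolding commute_on_def by (meson meq_sym meq_trans)

lemma conj_on_mult:
  assumes T: "finite T" and u: "unitary_on T u"
  shows "meq T T (mm T (conj_on T u X) (conj_on T u Y)) (conj_on T u (mm T X Y))"
proof -
  have e: "mm T (conj_on T u X) (conj_on T u Y)
      = mm T u (mm T X (mm T (mm T (adj u) u) (mm T Y (adj u))))"
    by (simp add: conj_on_def mm_assoc)
  have "meq T T (mm T (mm T (adj u) u) (mm T Y (adj u))) (mm T Y (adj u))"
    by (rule meq_trans[OF mm_cong[OF unitary_onD(2)[OF u] meq_refl] mm_idm_left[OF T]])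
  then have "meq T T (mm T u (mm T X (mm T (mm T (adj u) u) (mm T Y (adj u))))) (mm T u (mm T X (mm T Y (adj u))))"
    by (intro mm_cong[OF meq_refl])
  then show ?thesis unfolding e by (simp add: conj_on_def mm_assoc)
qed

lemma conj_on_inverse:
  assumes T: "finite T" and u: "unitary_on T u"
  shows "meq T T (conj_on T u (conj_on T (adj u) X)) X"
proof -
  have e: "conj_on T u (conj_on T (adj u) X) = mm T (mm T u (adj u)) (mm T X (mm T u (adj u)))"
    by (simp add: conj_on_def mm_assoc)
  have "meq T T (mm T (mm T u (adj u)) (mm T X (mm T u (adj u)))) (mm T idm (mm T X idm))"
    by (rule mm_cong[OF unitary_onD(1)[OF u] mm_cong[OF meq_refl unitary_onD(1)[OF u]]])
  then show ?thesis
    unfolding e by (rule meq_trans[OF _ meq_trans[OF mm_idm_left[OF T] mm_idm_right[OF T]]])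
qed

lemma conj_on_cong: "meq T T X Y \<Longrightarrow> meq T T (conj_on T u X) (conj_on T u Y)"
  unfolding conj_on_def by (intro mm_cong meq_refl)

lemma commute_on_conj:
  assumes T: "finite T" and u: "unitary_on T u" and "commute_on T X Y"
  shows "commute_on T (conj_on T u X) (conj_on T u Y)"
  using conj_on_mult[OF T u, of X Y] conj_on_mult[OF T u, of Y X] conj_on_cong[of T "mm T X Y" "mm T Y X" u]
    assms(3) unfolding commute_on_def by (meson meq_sym meq_trans)

definition diagm :: "('a \<Rightarrow> complex) \<Rightarrow> 'a \<Rightarrow> 'a \<Rightarrow> complex" where
  "diagm d = (\<lambda>i j. if i = j then d i else 0)"

lemma mm_diagm_left: "finite R \<Longrightarrow> i \<in> R \<Longrightarrow> mm R (diagm d) X i j = d i * X i j"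
  by (simp add: mm_def diagm_def if_distrib[where f="\<lambda>x. x * _"] cong: if_cong)

lemma mm_diagm_right: "finite R \<Longrightarrow> j \<in> R \<Longrightarrow> mm R X (diagm d) i j = X i j * d j"
  by (simp add: mm_def diagm_def if_distrib[where f="\<lambda>x. _ * x"] cong: if_cong)

lemma tpow_diagm:
  "length xs = length ys \<Longrightarrow> tpow (diagm d) xs ys = diagm (\<lambda>xs. prod_list (map d xs)) xs ys"
proof (induction xs arbitrary: ys)
  case (Cons x xs)
  then show ?case by (cases ys) (auto simp: diagm_def)
qed (auto simp: diagm_def)

lemma unitary_on_diagm:
  assumes R: "finite R" and d: "\<And>c. c \<in> R \<Longrightarrow> d c * cnj (d c) = 1"
  shows "unitary_on R (diagm d)"
proof -
  have "adj (diagm d) = diagm (\<lambda>c. cnj (d c))"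
    by (auto simp: adj_def diagm_def fun_eq_iff)
  then show ?thesis
    unfolding unitary_on_def meq_def
    using d by (auto simp: mm_diagm_left[OF R]) (auto simp: mult.commute diagm_def idm_def)
qed

lemma tpow_conj_on:
  assumes "finite R"
  shows "meq (tup n R) (tup n R) (tpow (conj_on R V X)) (conj_on (tup n R) (tpow V) (tpow X))"
proof -
  have 1: "meq (tup n R) (tup n R) (tpow (conj_on R V X)) (mm (tup n R) (tpow V) (tpow (mm R X (adj V))))"
    unfolding conj_on_def by (rule meqI) (simp add: tpow_mm length_tup)
  have 2: "meq (tup n R) (tup n R) (tpow (mm R X (adj V))) (mm (tup n R) (tpow X) (tpow (adj V)))"
    by (rule meqI) (simp add: tpow_mm length_tup)
  have 3: "meq (tup n R) (tup n R) (tpow (adj V)) (adj (tpow V))"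
    by (rule meqI) (simp add: tpow_adj length_tup)
  have 4: "meq (tup n R) (tup n R) (mm (tup n R) (tpow X) (tpow (adj V))) (mm (tup n R) (tpow X) (adj (tpow V)))"
    by (intro mm_cong meq_refl 3)
  have "meq (tup n R) (tup n R) (tpow (conj_on R V X)) (mm (tup n R) (tpow V) (mm (tup n R) (tpow X) (adj (tpow V))))"
    by (rule meq_trans[OF 1], rule mm_cong[OF meq_refl meq_trans[OF 2 4]])
  then show ?thesis by (simp add: conj_on_def)
qed

text \<open>Letters are counted one at a time, by giving a nontrivial phase to \<open>c\<close>
  only. The angle \<open>1 / (n + 1)\<close> keeps the total angle of a tuple within
  \<open>[0, 1]\<close>, where the cosine is injective.\<close>

lemma diag_phases_separate:
  fixes b b' :: "'r list"
  assumes R: "b \<in> tup n R" "b' \<in> tup n R"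
    and eq: "\<And>d. (\<forall>c. d c * cnj (d c) = 1) \<Longrightarrow> prod_list (map d b) = prod_list (map d b')"
  shows "mset b = mset b'"
proof (rule multiset_eqI)
  fix c
  define d :: "'r \<Rightarrow> complex" where "d = (\<lambda>x. if x = c then cis (1 / (n + 1)) else 1)"
  have p: "prod_list (map d xs) = cis (real (count (mset xs) c) / (n + 1))" for xs
  proof -
    have "prod_list (map d xs) = cis (1 / (n + 1)) ^ count (mset xs) c"
      by (induction xs) (auto simp: d_def)
    then show ?thesis by (simp add: DeMoivre)
  qed
  have "d x * cnj (d x) = 1" for x by (simp add: d_def cis_cnj cis_mult)
  then have "prod_list (map d b) = prod_list (map d b')" by (intro eq allI)
  then have "Re (prod_list (map d b)) = Re (prod_list (map d b'))" by (rule arg_cong)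
  then have *: "cos (real (count (mset b) c) / (n + 1)) = cos (real (count (mset b') c) / (n + 1))"
    unfolding p cis.sel .
  have bd: "real (count (mset xs) c) / (n + 1) \<le> pi" if "xs \<in> tup n R" for xs
  proof -
    have "count (mset xs) c \<le> n"
      using that count_le_length[of xs c] by (simp add: length_tup count_mset)
    then have "real (count (mset xs) c) / (n + 1) \<le> 1" by (simp add: field_simps)
    then show ?thesis using pi_ge_two by linarith
  qed
  have "real (count (mset b) c) / (n + 1) = real (count (mset b') c) / (n + 1)"
    by (rule cos_inj_pi[OF _ bd[OF R(1)] _ bd[OF R(2)] *]) simp_all
  moreover have "real (n + 1) \<noteq> 0" by simp
  ultimately have "real (count (mset b) c) = real (count (mset b') c)"
    by (simp only: divide_cancel_right simp_thms)
  then show "count (mset b) c = count (mset b') c" by (rule of_nat_eq_iff[THEN iffD1])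
qed

text \<open>In an eigenbasis of \<open>H\<close> the operator \<open>y'\<close> commutes with the
  tensor powers of all diagonal phases, so it vanishes between tuples with different multisets of
  letters. The tensor power of the eigenvalues depends on a tuple through its multiset only and
  therefore commutes with \<open>y'\<close>.\<close>

lemma commute_on_tpow_hermitian:
  assumes R: "finite R"
    and y: "\<And>W. unitary_on R W \<Longrightarrow> commute_on (tup n R) (tpow W) y"
    and H: "hermitian_on R H"
  shows "commute_on (tup n R) (tpow H) y"
proof -
  let ?T = "tup n R"
  obtain V and l :: "_ \<Rightarrow> real" where V: "unitary_on R V"
    and HV: "\<And>i j. i \<in> R \<Longrightarrow> j \<in> R \<Longrightarrow> H i j = (\<Sum>k\<in>R. of_real (l k) * V i k * cnj (V j k))"
    using spectral_on[OF R H] by blast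
  let ?u = "tpow V"
  have T: "finite ?T" using R by simp
  have u: "unitary_on ?T ?u" by (rule unitary_on_tpow[OF R V])
  note u' = unitary_on_adj[OF u]
  define y' where "y' = conj_on ?T (adj ?u) y"
  have tp: "meq ?T ?T (tpow (conj_on R V (diagm d))) (conj_on ?T ?u (diagm (\<lambda>xs. prod_list (map d xs))))" for d
    by (rule meq_trans[OF tpow_conj_on[OF R]]) (intro conj_on_cong meqI tpow_diagm, simp add: length_tup)
  have y'0: "(prod_list (map d b) - prod_list (map d b')) * y' b b' = 0"
    if d: "\<forall>c. d c * cnj (d c) = 1" and b: "b \<in> ?T" "b' \<in> ?T" for d b b'
  proof -
    let ?D = "diagm (\<lambda>xs. prod_list (map d xs))"
    have "unitary_on R (conj_on R V (diagm d))"
      unfolding conj_on_def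
      by (intro unitary_on_mm R V unitary_on_diagm unitary_on_adj) (use d in auto)
    then have "commute_on ?T (tpow (conj_on R V (diagm d))) y" by (rule y)
    then have "commute_on ?T (conj_on ?T ?u ?D) y"
      using commute_on_cong[OF tp meq_refl] by blast
    then have "commute_on ?T (conj_on ?T (adj ?u) (conj_on ?T ?u ?D)) y'"
      unfolding y'_def by (rule commute_on_conj[OF T u'])
    then have "commute_on ?T ?D y'"
      using conj_on_inverse[OF T u', of ?D] by (simp add: commute_on_cong[OF _ meq_refl])
    then show ?thesis
      using b T by (simp add: commute_on_def meq_def mm_diagm_left mm_diagm_right algebra_simps)
  qed
  have y'mset: "y' b b' = 0" if b: "b \<in> ?T" "b' \<in> ?T" "mset b \<noteq> mset b'" for b b'
    using diag_phases_separate[OF b(1,2)] y'0[OF _ b(1,2)] b(3) by auto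
  let ?L = "diagm (\<lambda>xs. prod_list (map (\<lambda>k. of_real (l k)) xs)) :: _ \<Rightarrow> _ \<Rightarrow> complex"
  have "commute_on ?T ?L y'"
    unfolding commute_on_def
  proof (rule meqI)
    fix b b' assume b: "b \<in> ?T" "b' \<in> ?T"
    have "prod_list (map f b) = prod_list (map f b')" if "mset b = mset b'" for f :: "'a \<Rightarrow> complex"
      using that by (metis mset_map prod_mset_prod_list)
    then show "mm ?T ?L y' b b' = mm ?T y' ?L b b'"
      using y'mset[OF b] b T by (cases "mset b = mset b'") (auto simp: mm_diagm_left mm_diagm_right)
  qed
  then have "commute_on ?T (conj_on ?T ?u ?L) (conj_on ?T ?u y')"
    by (rule commute_on_conj[OF T u])
  moreover have "meq ?T ?T (conj_on ?T ?u y') y"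
    unfolding y'_def by (rule conj_on_inverse[OF T u])
  moreover have "meq ?T ?T (conj_on ?T ?u ?L) (tpow H)"
  proof -
    have "meq R R (conj_on R V (diagm (\<lambda>k. of_real (l k)))) H"
    proof (rule meqI)
      fix i j assume ij: "i \<in> R" "j \<in> R"
      have "conj_on R V (diagm (\<lambda>k. of_real (l k))) i j = (\<Sum>k\<in>R. V i k * mm R (diagm (\<lambda>k. of_real (l k))) (adj V) k j)"
        by (simp add: conj_on_def mm_def)
      also have "\<dots> = H i j"
        using R ij by (simp add: HV mm_diagm_left adj_def algebra_simps)
      finally show "conj_on R V (diagm (\<lambda>k. of_real (l k))) i j = H i j" .
    qed
    then show ?thesis using tp tpow_cong by (meson meq_sym meq_trans)
  qed
  ultimately show ?thesis using commute_on_cong by blast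
qed

text \<open>The unitarian trick: write \<open>A = H1 + \<i> * H2\<close> with hermitian parts. Each
  entry of the commutator with the tensor power of \<open>H1 + t * H2\<close> is a polynomial in
  \<open>t\<close>; it vanishes for all real \<open>t\<close>, hence also at
  \<open>t = \<i>\<close>.\<close>

lemma commute_on_tpow_any:
  assumes R: "finite R"
    and y: "\<And>W. unitary_on R W \<Longrightarrow> commute_on (tup n R) (tpow W) y"
  shows "commute_on (tup n R) (tpow A) y"
  unfolding commute_on_def
proof (rule meqI)
  let ?T = "tup n R"
  fix b b' assume b: "b \<in> ?T" "b' \<in> ?T"
  define H1 where "H1 = (\<lambda>i j. (A i j + cnj (A j i)) / 2)"
  define H2 where "H2 = (\<lambda>i j. - (\<i> * (A i j - cnj (A j i))) / 2)"
  define p where "p = (\<Sum>c\<in>?T. [:y c b':] * (\<Prod>k<n. [:H1 (b ! k) (c ! k), H2 (b ! k) (c ! k):]))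
     - (\<Sum>c\<in>?T. [:y b c:] * (\<Prod>k<n. [:H1 (c ! k) (b' ! k), H2 (c ! k) (b' ! k):]))"
  have p: "poly p t = mm ?T (tpow (\<lambda>i j. H1 i j + t * H2 i j)) y b b' - mm ?T y (tpow (\<lambda>i j. H1 i j + t * H2 i j)) b b'" for t
  proof -
    have "poly p t = (\<Sum>c\<in>?T. y c b' * (\<Prod>k<n. H1 (b ! k) (c ! k) + t * H2 (b ! k) (c ! k)))
       - (\<Sum>c\<in>?T. y b c * (\<Prod>k<n. H1 (c ! k) (b' ! k) + t * H2 (c ! k) (b' ! k)))"
      by (simp add: p_def poly_sum poly_prod)
    moreover have "mm ?T (tpow (\<lambda>i j. H1 i j + t * H2 i j)) y b b' = (\<Sum>c\<in>?T. y c b' * (\<Prod>k<n. H1 (b ! k) (c ! k) + t * H2 (b ! k) (c ! k)))"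
      unfolding mm_def tpow_def using b by (intro sum.cong refl) (simp add: length_tup)
    moreover have "mm ?T y (tpow (\<lambda>i j. H1 i j + t * H2 i j)) b b' = (\<Sum>c\<in>?T. y b c * (\<Prod>k<n. H1 (c ! k) (b' ! k) + t * H2 (c ! k) (b' ! k)))"
      unfolding mm_def tpow_def by (intro sum.cong refl) (simp add: length_tup)
    ultimately show ?thesis by simp
  qed
  have "poly p (of_real t) = 0" for t
  proof -
    have "hermitian_on R (\<lambda>i j. H1 i j + of_real t * H2 i j)"
    proof -
      have "cnj (H1 j i) = H1 i j" "cnj (H2 j i) = H2 i j" for i j
        by (simp_all add: H1_def H2_def add.commute minus_divide_left[symmetric] diff_divide_distrib right_diff_distrib)
      then show ?thesis by (simp add: hermitian_on_def meq_def adj_def)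
    qed
    from commute_on_tpow_hermitian[OF R y this] show ?thesis
      using b by (simp add: p commute_on_def meq_def)
  qed
  then have "range (of_real :: real \<Rightarrow> complex) \<subseteq> {t. poly p t = 0}" by auto
  moreover have "infinite (range (of_real :: real \<Rightarrow> complex))"
    using infinite_UNIV_char_0[where 'a=real] finite_imageD[of of_real UNIV] inj_of_real by blast
  ultimately have "p = 0" using poly_roots_finite finite_subset by blast
  then have "poly p \<i> = 0" by simp
  moreover have "(\<lambda>i j. H1 i j + \<i> * H2 i j) = A"
  proof (intro ext)
    fix i j
    have "\<i> * H2 i j = (A i j - cnj (A j i)) / 2"
    proof -
      have "\<i> * (- (\<i> * w) / 2) = w / 2" for w by (simp add: mult.assoc[symmetric])
      then show ?thesis unfolding H2_def .
    qed
    moreover have "(x + z) / 2 + (x - z) / 2 = x" for x z :: complex by (simp add: field_simps)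
    ultimately show "H1 i j + \<i> * H2 i j = A i j"
      by (simp only: H1_def)
  qed
  ultimately show "mm ?T (tpow A) y b b' = mm ?T y (tpow A) b b'" by (simp add: p)
qed

section \<open>Polarization: symmetrised matrix units as combinations of tensor powers\<close>

lemma alternating_sum_supersets:
  assumes "finite N" "F \<subseteq> N"
  shows "(\<Sum>S | F \<subseteq> S \<and> S \<subseteq> N. (-1 :: complex) ^ card S) = (if F = N then (-1) ^ card N else 0)"
proof (cases "F = N")
  case True
  then have "{S. F \<subseteq> S \<and> S \<subseteq> N} = {N}" by auto
  with True show ?thesis by simp
next
  case False
  have fin: "finite {S. F \<subseteq> S \<and> S \<subseteq> N}"
    using assms by (auto intro: finite_subset[of _ "Pow N"])
  have "(\<Sum>S | F \<subseteq> S \<and> S \<subseteq> N. (-1 :: complex) ^ card S) = 0"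
    using card_subsupersets_even_odd[of N F] False assms
    by (intro sum_alternating_cancels fin) (auto simp: conj_ac psubset_eq)
  with False show ?thesis by simp
qed

text \<open>Ryser's formula for the permanent.\<close>

lemma permanent_polarization:
  fixes a :: "nat \<Rightarrow> nat \<Rightarrow> complex"
  shows "(\<Sum>p\<in>perms n. \<Prod>k<n. a (p k) k) =
    (\<Sum>S\<in>Pow {..<n}. (-1) ^ n * (-1) ^ card S * (\<Prod>k<n. \<Sum>s\<in>S. a s k))"
proof -
  let ?N = "{..<n}"
  have sub: "tup n S = {fs \<in> tup n ?N. set fs \<subseteq> S}" if "S \<subseteq> ?N" for S
    using that by (auto simp: tup_def)
  have "(\<Sum>S\<in>Pow ?N. (-1) ^ n * (-1) ^ card S * (\<Prod>k<n. \<Sum>s\<in>S. a s k))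
      = (\<Sum>S\<in>Pow ?N. \<Sum>fs\<in>tup n ?N. if set fs \<subseteq> S then (-1) ^ n * (-1) ^ card S * (\<Prod>k<n. a (fs ! k) k) else 0)"
  proof (rule sum.cong[OF refl])
    fix S assume S: "S \<in> Pow ?N"
    have "(\<Prod>k<n. \<Sum>s\<in>S. a s k) = (\<Sum>fs\<in>tup n S. \<Prod>k<n. a (fs ! k) k)"
      by (rule sum_tup_prod[where f="\<lambda>k s. a s k", symmetric])
    also have "tup n S = {fs \<in> tup n ?N. set fs \<subseteq> S}"
      using S by (intro sub) auto
    also have "(\<Sum>fs\<in>{fs \<in> tup n ?N. set fs \<subseteq> S}. \<Prod>k<n. a (fs ! k) k)
        = (\<Sum>fs\<in>tup n ?N. if set fs \<subseteq> S then (\<Prod>k<n. a (fs ! k) k) else 0)"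
      by (rule sum.inter_filter) simp
    finally have e: "(\<Prod>k<n. \<Sum>s\<in>S. a s k) = (\<Sum>fs\<in>tup n ?N. if set fs \<subseteq> S then (\<Prod>k<n. a (fs ! k) k) else 0)" .
    show "(-1) ^ n * (-1) ^ card S * (\<Prod>k<n. \<Sum>s\<in>S. a s k) =
       (\<Sum>fs\<in>tup n ?N. if set fs \<subseteq> S then (-1) ^ n * (-1) ^ card S * (\<Prod>k<n. a (fs ! k) k) else 0)"
      unfolding e sum_distrib_left by (intro sum.cong refl) simp
  qed
  also have "\<dots> = (\<Sum>fs\<in>tup n ?N. \<Sum>S\<in>Pow ?N. if set fs \<subseteq> S then (-1) ^ n * (-1) ^ card S * (\<Prod>k<n. a (fs ! k) k) else 0)"
    by (rule sum.swap)
  \<comment> \<open>Summed over \<open>S\<close> first, the signs cancel unless the tuple takes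
    every value in \<open>{..<n}\<close>; such tuples are the permutations.\<close>
  also have "\<dots> = (\<Sum>fs\<in>tup n ?N. if set fs = ?N then (\<Prod>k<n. a (fs ! k) k) else 0)"
  proof (rule sum.cong[OF refl])
    fix fs assume fs: "fs \<in> tup n ?N"
    have "(\<Sum>S\<in>Pow ?N. if set fs \<subseteq> S then (-1) ^ n * (-1) ^ card S * (\<Prod>k<n. a (fs ! k) k) else 0)
        = (-1) ^ n * (\<Prod>k<n. a (fs ! k) k) * (\<Sum>S\<in>Pow ?N. if set fs \<subseteq> S then (-1) ^ card S else 0)"
      unfolding sum_distrib_left by (intro sum.cong refl) simp
    also have "(\<Sum>S\<in>Pow ?N. if set fs \<subseteq> S then (-1) ^ card S else 0) = (\<Sum>S\<in>{S \<in> Pow ?N. set fs \<subseteq> S}. (-1 :: complex) ^ card S)"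
      by (rule sum.inter_filter[symmetric]) simp
    also have "{S \<in> Pow ?N. set fs \<subseteq> S} = {S. set fs \<subseteq> S \<and> S \<subseteq> ?N}" by blast
    also have "(\<Sum>S | set fs \<subseteq> S \<and> S \<subseteq> ?N. (-1 :: complex) ^ card S) = (if set fs = ?N then (-1) ^ n else 0)"
      using fs by (subst alternating_sum_supersets) (auto simp: tup_def)
    finally have e: "(\<Sum>S\<in>Pow ?N. if set fs \<subseteq> S then (-1) ^ n * (-1) ^ card S * (\<Prod>k<n. a (fs ! k) k) else 0)
        = (-1) ^ n * (\<Prod>k<n. a (fs ! k) k) * (if set fs = ?N then (-1) ^ n else 0)" .
    show "(\<Sum>S\<in>Pow ?N. if set fs \<subseteq> S then (-1) ^ n * (-1) ^ card S * (\<Prod>k<n. a (fs ! k) k) else 0)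
        = (if set fs = ?N then (\<Prod>k<n. a (fs ! k) k) else 0)"
    proof -
      have "(-1 :: complex) ^ n * x * (-1) ^ n = x" for x
      proof -
        have "(-1 :: complex) ^ n * x * (-1) ^ n = ((-1) ^ n * (-1) ^ n) * x" by (simp only: mult_ac)
        also have "(-1 :: complex) ^ n * (-1) ^ n = 1" by (simp flip: power_mult_distrib)
        finally show ?thesis by simp
      qed
      then show ?thesis unfolding e by simp
    qed
  qed
  also have "\<dots> = (\<Sum>fs | length fs = n \<and> set fs = ?N. \<Prod>k<n. a (fs ! k) k)"
  proof -
    have "{fs \<in> tup n ?N. set fs = ?N} = {fs. length fs = n \<and> set fs = ?N}" by (auto simp: tup_def)
    then show ?thesis by (subst sum.inter_filter[symmetric]) simp_all
  qed
  also have "\<dots> = (\<Sum>p\<in>perms n. \<Prod>k<n. a (p k) k)"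
  proof (rule sum.reindex_bij_witness[where i="\<lambda>p. map p [0..<n]" and j="\<lambda>fs k. if k < n then fs ! k else k"])
    fix fs assume fs: "fs \<in> {fs. length fs = n \<and> set fs = ?N}"
    let ?p = "\<lambda>k. if k < n then fs ! k else k"
    from fs have len: "length fs = n" and set: "set fs = ?N" by auto
    show "map ?p [0..<n] = fs" by (rule nth_equalityI) (simp_all add: len)
    have "distinct fs" by (rule card_distinct) (simp add: len set)
    then have "inj_on ?p ?N" by (simp add: inj_on_def nth_eq_iff_index_eq len)
    moreover have "?p ` ?N \<subseteq> ?N"
    proof
      fix x assume "x \<in> ?p ` ?N"
      then obtain k where "k < n" "x = fs ! k" by auto
      then show "x \<in> ?N" using nth_mem[of k fs] by (simp add: len set)
    qed
    ultimately have "bij_betw ?p ?N ?N"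
      unfolding bij_betw_def using endo_inj_surj[OF finite_lessThan] by blast
    then have "?p permutes ?N" by (rule bij_imp_permutes) simp
    then show "?p \<in> perms n" by simp
    show "(\<Prod>k<n. a (?p k) k) = (\<Prod>k<n. a (fs ! k) k)" by simp
  next
    fix p assume p: "p \<in> perms n"
    then have p': "p permutes ?N" by simp
    show "(\<lambda>k. if k < n then map p [0..<n] ! k else k) = p"
      using permutes_not_in[OF p'] by (simp add: fun_eq_iff)
    show "map p [0..<n] \<in> {fs. length fs = n \<and> set fs = ?N}"
      using permutes_image[OF p'] by (simp add: lessThan_atLeast0)
  qed
  finally show ?thesis by simp
qed

text \<open>The matrix unit from \<open>j\<close> to \<open>i\<close> on tuples, summed over all
  simultaneous permutations of the tensor factors. These operators span everything that commutes
  with the permutations.\<close>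

definition sym_unit :: "nat \<Rightarrow> 'r list \<Rightarrow> 'r list \<Rightarrow> 'r list \<Rightarrow> 'r list \<Rightarrow> complex" where
  "sym_unit n i j = (\<lambda>b b'. \<Sum>p\<in>perms n. of_bool (b = permute_list p i \<and> b' = permute_list p j))"

text \<open>The entries of a symmetrised matrix unit are permanents of the one-factor units
  \<open>E s\<close>. Ryser's formula turns them into a combination of the tensor powers of the
  subset sums \<open>A S\<close>, each of which commutes with \<open>y\<close>.\<close>

theorem commute_on_sym_unit:
  assumes R: "finite R"
    and y: "\<And>W. unitary_on R W \<Longrightarrow> commute_on (tup n R) (tpow W) y"
    and i: "i \<in> tup n R" and j: "j \<in> tup n R"
  shows "commute_on (tup n R) (sym_unit n i j) y"
proof -
  let ?T = "tup n R"
  define E where "E = (\<lambda>s x z. of_bool (x = i ! s \<and> z = j ! s) :: complex)"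
  define A where "A = (\<lambda>S x z. \<Sum>s\<in>S. E s x z)"
  define c where "c = (\<lambda>S :: nat set. (-1 :: complex) ^ n * (-1) ^ card S)"
  have su: "sym_unit n i j b b' = (\<Sum>S\<in>Pow {..<n}. c S * tpow (A S) b b')"
    if b: "b \<in> ?T" "b' \<in> ?T" for b b'
  proof -
    have "of_bool (b = permute_list p i \<and> b' = permute_list p j) = (\<Prod>k<n. E (p k) (b ! k) (b' ! k))"
      if p: "p \<in> perms n" for p
    proof -
      have n: "length b = n" "length b' = n" "length i = n" "length j = n"
        using b i j by (auto simp: length_tup)
      have "b = permute_list p i \<longleftrightarrow> (\<forall>k<n. b ! k = i ! p k)"
        using n p by (auto simp: list_eq_iff_nth_eq permute_list_nth)
      moreover have "b' = permute_list p j \<longleftrightarrow> (\<forall>k<n. b' ! k = j ! p k)"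
        using n p by (auto simp: list_eq_iff_nth_eq permute_list_nth)
      ultimately show ?thesis by (auto simp: E_def)
    qed
    then have "sym_unit n i j b b' = (\<Sum>p\<in>perms n. \<Prod>k<n. E (p k) (b ! k) (b' ! k))"
      by (simp add: sym_unit_def)
    also have "\<dots> = (\<Sum>S\<in>Pow {..<n}. c S * tpow (A S) b b')"
      using b by (subst permanent_polarization) (simp add: c_def tpow_def A_def length_tup)
    finally show ?thesis .
  qed
  show ?thesis
    unfolding commute_on_def
  proof (rule meqI)
    fix b b' assume b: "b \<in> ?T" "b' \<in> ?T"
    have "mm ?T (sym_unit n i j) y b b' = (\<Sum>d\<in>?T. (\<Sum>S\<in>Pow {..<n}. c S * tpow (A S) b d) * y d b')"
      unfolding mm_def using b by (intro sum.cong) (auto simp: su)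
    also have "\<dots> = (\<Sum>S\<in>Pow {..<n}. c S * mm ?T (tpow (A S)) y b b')"
      by (simp add: mm_def sum_distrib_left sum_distrib_right mult.assoc) (rule sum.swap)
    also have "\<dots> = (\<Sum>S\<in>Pow {..<n}. c S * mm ?T y (tpow (A S)) b b')"
      using commute_on_tpow_any[OF R y] b by (simp add: commute_on_def meq_def)
    also have "\<dots> = (\<Sum>d\<in>?T. y b d * (\<Sum>S\<in>Pow {..<n}. c S * tpow (A S) d b'))"
      by (simp add: mm_def sum_distrib_left sum_distrib_right mult_ac) (rule sum.swap)
    also have "\<dots> = mm ?T y (sym_unit n i j) b b'"
      unfolding mm_def using b by (intro sum.cong) (auto simp: su)
    finally show "mm ?T (sym_unit n i j) y b b' = mm ?T y (sym_unit n i j) b b'" .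
  qed
qed

section \<open>Haar averages\<close>

text \<open>Lists instead of sets, so that repetitions count and a translated copy can be
  appended.\<close>

definition avg :: "('r \<Rightarrow> 'r \<Rightarrow> complex) list \<Rightarrow> (('r \<Rightarrow> 'r \<Rightarrow> complex) \<Rightarrow> complex) \<Rightarrow> complex" where
  "avg Vs f = (\<Sum>V\<leftarrow>Vs. f V) / of_nat (length Vs)"

definition unitaries :: "'r set \<Rightarrow> ('r \<Rightarrow> 'r \<Rightarrow> complex) list \<Rightarrow> bool" where
  "unitaries R Vs \<longleftrightarrow> Vs \<noteq> [] \<and> (\<forall>V\<in>set Vs. unitary_on R V)"

text \<open>Monomials of equal degree in the entries and in their conjugates are the only ones that
  a twirl produces.\<close>

definition mon :: "'r list \<Rightarrow> 'r list \<Rightarrow> 'r list \<Rightarrow> 'r list \<Rightarrow> ('r \<Rightarrow> 'r \<Rightarrow> complex) \<Rightarrow> complex" where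
  "mon b c b' c' V = tpow V b c * cnj (tpow V b' c')"

lemma sum_list_sum: "(\<Sum>V\<leftarrow>Vs. \<Sum>i\<in>I. f i V) = (\<Sum>i\<in>I. \<Sum>V\<leftarrow>Vs. f i V)"
  by (induction Vs) (auto simp: sum.distrib)

lemma avg_sum: "avg Vs (\<lambda>V. \<Sum>i\<in>I. f i V) = (\<Sum>i\<in>I. avg Vs (f i))"
  by (simp add: avg_def sum_list_sum sum_divide_distrib)

lemma avg_cmult: "avg Vs (\<lambda>V. c * f V) = c * avg Vs f"
  by (simp add: avg_def sum_list_const_mult)

lemma avg_multc: "avg Vs (\<lambda>V. f V * c) = avg Vs f * c"
  by (simp add: avg_def sum_list_mult_const)

lemma avg_const: "Vs \<noteq> [] \<Longrightarrow> avg Vs (\<lambda>V. c) = c"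
  by (simp add: avg_def sum_list_triv)

lemma avg_cong: "(\<And>V. V \<in> set Vs \<Longrightarrow> f V = g V) \<Longrightarrow> avg Vs f = avg Vs g"
  by (auto simp: avg_def cong: map_cong)

lemma avg_append_map: "Vs \<noteq> [] \<Longrightarrow> avg (Vs @ map h Vs) f = (avg Vs f + avg Vs (\<lambda>V. f (h V))) / 2"
  by (simp add: avg_def o_def field_simps)

lemma norm_avg_le:
  assumes "\<And>V. V \<in> set Vs \<Longrightarrow> cmod (f V) \<le> C" "Vs \<noteq> []"
  shows "cmod (avg Vs f) \<le> C"
proof -
  have "cmod (\<Sum>V\<leftarrow>Vs. f V) \<le> (\<Sum>V\<leftarrow>Vs. C)"
    using assms(1)
    by (induction Vs) (auto intro!: norm_triangle_le add_mono)
  also have "\<dots> = real (length Vs) * C" by (simp add: sum_list_triv)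
  finally show ?thesis using assms(2) by (simp add: avg_def norm_divide field_simps)
qed

lemma norm_unitary_entry_le:
  assumes R: "finite R" and V: "unitary_on R V" and ij: "i \<in> R" "j \<in> R"
  shows "cmod (V i j) \<le> 1"
proof -
  have "(\<Sum>k\<in>R. V i k * cnj (V i k)) = 1"
    using unitary_onD(1)[OF V] ij by (simp add: meq_def mm_def adj_def idm_def)
  then have "of_real (\<Sum>k\<in>R. (cmod (V i k))\<^sup>2) = (1 :: complex)"
    by (simp only: of_real_sum complex_norm_square)
  then have "(\<Sum>k\<in>R. (cmod (V i k))\<^sup>2) = 1" by (metis of_real_eq_1_iff)
  moreover have "(cmod (V i j))\<^sup>2 \<le> (\<Sum>k\<in>R. (cmod (V i k))\<^sup>2)"
    using R ij by (intro member_le_sum) auto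
  ultimately show ?thesis by (simp add: power_le_one_iff abs_square_le_1)
qed

lemma norm_mon_le:
  assumes R: "finite R" and V: "unitary_on R V"
    and "b \<in> tup n R" "c \<in> tup n R" "b' \<in> tup n R" "c' \<in> tup n R"
  shows "cmod (mon b c b' c' V) \<le> 1"
proof -
  note u = unitary_on_tpow[OF R V, of n]
  have "cmod (tpow V b c) \<le> 1" "cmod (tpow V b' c') \<le> 1"
    using norm_unitary_entry_le[OF _ u] R assms(3-) by auto
  then show ?thesis by (simp add: mon_def norm_mult mult_le_one)
qed

lemma mon_mm:
  assumes "length b = n" "length b' = n"
  shows "mon b c b' c' (mm R W V)
    = (\<Sum>d\<in>tup n R. \<Sum>d'\<in>tup n R. tpow W b d * cnj (tpow W b' d') * mon d c d' c' V)"
  unfolding mon_def tpow_mm[OF assms(1)] tpow_mm[OF assms(2)] mm_def[of "tup n R" "tpow W" "tpow V"]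
  by (simp add: sum_product mult_ac)

lemma isometry_norm:
  assumes R: "finite R" and V: "unitary_on R V"
  shows "(\<Sum>i\<in>R. (cmod (\<Sum>j\<in>R. V i j * x j))\<^sup>2) = (\<Sum>j\<in>R. (cmod (x j))\<^sup>2)"
proof -
  have "of_real (\<Sum>i\<in>R. (cmod (\<Sum>j\<in>R. V i j * x j))\<^sup>2) = (of_real (\<Sum>j\<in>R. (cmod (x j))\<^sup>2) :: complex)"
    unfolding of_real_sum complex_norm_square by (rule unitary_on_isometry[OF R V])
  then show ?thesis by (rule of_real_eq_iff[THEN iffD1])
qed

lemma unitary_on_cnj:
  assumes "unitary_on R V"
  shows "unitary_on R (\<lambda>i j. cnj (V i j))"
proof -
  have "mm R (\<lambda>i j. cnj (V i j)) (adj (\<lambda>i j. cnj (V i j))) i j = cnj (mm R V (adj V) i j)"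
    "mm R (adj (\<lambda>i j. cnj (V i j))) (\<lambda>i j. cnj (V i j)) i j = cnj (mm R (adj V) V i j)" for i j
    by (simp_all add: mm_def adj_def)
  then show ?thesis
    using assms by (simp add: unitary_on_def meq_def idm_def)
qed

lemma isometry_norm2:
  assumes R: "finite R" and V: "unitary_on R V"
  shows "(\<Sum>b\<in>R. \<Sum>b'\<in>R. (cmod (\<Sum>d\<in>R. \<Sum>d'\<in>R. V b d * cnj (V b' d') * x d d'))\<^sup>2)
    = (\<Sum>d\<in>R. \<Sum>d'\<in>R. (cmod (x d d'))\<^sup>2)"
proof -
  have "(\<Sum>b\<in>R. \<Sum>b'\<in>R. (cmod (\<Sum>d\<in>R. \<Sum>d'\<in>R. V b d * cnj (V b' d') * x d d'))\<^sup>2)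
      = (\<Sum>b\<in>R. \<Sum>b'\<in>R. (cmod (\<Sum>d'\<in>R. cnj (V b' d') * (\<Sum>d\<in>R. V b d * x d d')))\<^sup>2)"
  proof -
    have "(\<Sum>d\<in>R. \<Sum>d'\<in>R. V b d * cnj (V b' d') * x d d') = (\<Sum>d'\<in>R. cnj (V b' d') * (\<Sum>d\<in>R. V b d * x d d'))" for b b'
      by (subst sum.swap) (simp add: sum_distrib_left mult_ac)
    then show ?thesis by simp
  qed
  also have "\<dots> = (\<Sum>b\<in>R. \<Sum>d'\<in>R. (cmod (\<Sum>d\<in>R. V b d * x d d'))\<^sup>2)"
    by (intro sum.cong refl isometry_norm[OF R unitary_on_cnj[OF V]])
  also have "\<dots> = (\<Sum>d'\<in>R. \<Sum>b\<in>R. (cmod (\<Sum>d\<in>R. V b d * x d d'))\<^sup>2)"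
    by (rule sum.swap)
  also have "\<dots> = (\<Sum>d'\<in>R. \<Sum>d\<in>R. (cmod (x d d'))\<^sup>2)"
    by (intro sum.cong refl isometry_norm[OF R V])
  also have "\<dots> = (\<Sum>d\<in>R. \<Sum>d'\<in>R. (cmod (x d d'))\<^sup>2)" by (rule sum.swap)
  finally show ?thesis .
qed

text \<open>The squared Hilbert-Schmidt norm of the moment operators of all degrees up to
  \<open>N\<close> together.\<close>

definition mnorm :: "'r set \<Rightarrow> nat \<Rightarrow> ('r list \<Rightarrow> 'r list \<Rightarrow> 'r list \<Rightarrow> 'r list \<Rightarrow> complex) \<Rightarrow> real" where
  "mnorm R N f = (\<Sum>n\<le>N. \<Sum>c\<in>tup n R. \<Sum>c'\<in>tup n R. \<Sum>b\<in>tup n R. \<Sum>b'\<in>tup n R. (cmod (f b c b' c'))\<^sup>2)"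

lemma mnorm_nonneg: "0 \<le> mnorm R N f"
  unfolding mnorm_def by (intro sum_nonneg) simp

text \<open>Translation by \<open>W\<close> multiplies the moment operator of degree
  \<open>n\<close> by the unitary \<open>tpow W\<close> tensored with its conjugate.\<close>

lemma mnorm_translate:
  assumes R: "finite R" and W: "unitary_on R W"
  shows "mnorm R N (\<lambda>b c b' c'. avg Vs (\<lambda>V. mon b c b' c' (mm R W V))) = mnorm R N (\<lambda>b c b' c'. avg Vs (mon b c b' c'))"
  unfolding mnorm_def
proof (rule sum.cong[OF refl], rule sum.cong[OF refl], rule sum.cong[OF refl])
  fix n c c'
  have "avg Vs (\<lambda>V. mon b c b' c' (mm R W V))
      = (\<Sum>d\<in>tup n R. \<Sum>d'\<in>tup n R. tpow W b d * cnj (tpow W b' d') * avg Vs (mon d c d' c'))"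
    if "b \<in> tup n R" "b' \<in> tup n R" for b b'
    using that by (simp add: mon_mm[of b n] length_tup avg_sum avg_cmult)
  then show "(\<Sum>b\<in>tup n R. \<Sum>b'\<in>tup n R. (cmod (avg Vs (\<lambda>V. mon b c b' c' (mm R W V))))\<^sup>2)
     = (\<Sum>b\<in>tup n R. \<Sum>b'\<in>tup n R. (cmod (avg Vs (mon b c b' c')))\<^sup>2)"
    using isometry_norm2[OF _ unitary_on_tpow[OF R W, of n], of "\<lambda>d d'. avg Vs (mon d c d' c')"] R
    by simp
qed

lemma mnorm_parallelogram:
  "mnorm R N (\<lambda>b c b' c'. f b c b' c' - g b c b' c') =
    2 * mnorm R N f + 2 * mnorm R N g - 4 * mnorm R N (\<lambda>b c b' c'. (f b c b' c' + g b c b' c') / 2)"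
proof -
  have *: "(cmod (u - v))\<^sup>2 = 2 * (cmod u)\<^sup>2 + 2 * (cmod v)\<^sup>2 - 4 * (cmod ((u + v) / 2))\<^sup>2" for u v
    by (simp add: cmod_power2 power_divide norm_divide) (simp add: power2_eq_square algebra_simps)
  show ?thesis
    unfolding mnorm_def by (simp add: * sum.distrib sum_subtractf sum_distrib_left)
qed

lemma mnorm_ge:
  assumes R: "finite R" and n: "n \<le> N" and "b \<in> tup n R" "c \<in> tup n R" "b' \<in> tup n R" "c' \<in> tup n R"
  shows "(cmod (f b c b' c'))\<^sup>2 \<le> mnorm R N f"
proof -
  have fin: "finite (tup n R)" using R by simp
  have "(cmod (f b c b' c'))\<^sup>2 \<le> (\<Sum>b'\<in>tup n R. (cmod (f b c b' c'))\<^sup>2)"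
    using fin assms by (intro member_le_sum[where f="\<lambda>b'. (cmod (f b c b' c'))\<^sup>2"]) auto
  also have "\<dots> \<le> (\<Sum>b\<in>tup n R. \<Sum>b'\<in>tup n R. (cmod (f b c b' c'))\<^sup>2)"
    using fin assms by (intro member_le_sum[where f="\<lambda>b. \<Sum>b'\<in>tup n R. (cmod (f b c b' c'))\<^sup>2"]) (auto intro: sum_nonneg)
  also have "\<dots> \<le> (\<Sum>c'\<in>tup n R. \<Sum>b\<in>tup n R. \<Sum>b'\<in>tup n R. (cmod (f b c b' c'))\<^sup>2)"
    using fin assms by (intro member_le_sum[where f="\<lambda>c'. \<Sum>b\<in>tup n R. \<Sum>b'\<in>tup n R. (cmod (f b c b' c'))\<^sup>2"]) (auto intro!: sum_nonneg)
  also have "\<dots> \<le> (\<Sum>c\<in>tup n R. \<Sum>c'\<in>tup n R. \<Sum>b\<in>tup n R. \<Sum>b'\<in>tup n R. (cmod (f b c b' c'))\<^sup>2)"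
    using fin assms by (intro member_le_sum[where f="\<lambda>c. \<Sum>c'\<in>tup n R. \<Sum>b\<in>tup n R. \<Sum>b'\<in>tup n R. (cmod (f b c b' c'))\<^sup>2"]) (auto intro!: sum_nonneg)
  also have "\<dots> \<le> mnorm R N f"
    unfolding mnorm_def using n
    by (intro member_le_sum[where f="\<lambda>n. \<Sum>c\<in>tup n R. \<Sum>c'\<in>tup n R. \<Sum>b\<in>tup n R. \<Sum>b'\<in>tup n R. (cmod (f b c b' c'))\<^sup>2"])
       (auto intro!: sum_nonneg)
  finally show ?thesis .
qed

text \<open>A finite average of almost minimal Hilbert-Schmidt norm is almost invariant, by the
  parallelogram identity applied to it and its translate.\<close>

lemma almost_invariant_averages:
  assumes R: "finite R"
  shows "\<exists>Us :: nat \<Rightarrow> _. \<forall>t. unitaries R (Us t) \<and>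
    (\<forall>W. unitary_on R W \<longrightarrow> mnorm R N (\<lambda>b c b' c'. avg (Us t) (\<lambda>V. mon b c b' c' (mm R W V)) - avg (Us t) (mon b c b' c')) \<le> 4 / (real t + 1))"
proof -
  define F where "F = (\<lambda>Vs. mnorm R N (\<lambda>b c b' c'. avg Vs (mon b c b' c')))"
  define m where "m = Inf (F ` Collect (unitaries R))"
  have ne: "unitaries R [idm]" using unitary_on_idm[OF R] by (simp add: unitaries_def)
  have bdd: "bdd_below (F ` Collect (unitaries R))"
    by (rule bdd_belowI[of _ 0]) (auto simp: F_def mnorm_nonneg)
  have lower: "m \<le> F Vs" if "unitaries R Vs" for Vs
    unfolding m_def using that by (intro cInf_lower bdd) auto
  have "\<exists>Vs. unitaries R Vs \<and> F Vs < m + 1 / (real t + 1)" for t :: nat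
  proof -
    have "m < m + 1 / (real t + 1)" by simp
    then have "\<exists>x\<in>F ` Collect (unitaries R). x < m + 1 / (real t + 1)"
      unfolding m_def using ne by (intro cInf_lessD) auto
    then show ?thesis by auto
  qed
  then obtain Us where Us: "\<And>t::nat. unitaries R (Us t)" "\<And>t::nat. F (Us t) < m + 1 / (real t + 1)"
    by metis
  have "mnorm R N (\<lambda>b c b' c'. avg (Us t) (\<lambda>V. mon b c b' c' (mm R W V)) - avg (Us t) (mon b c b' c')) \<le> 4 / (real t + 1)"
    if W: "unitary_on R W" for t W
  proof -
    \<comment> \<open>Lists are closed under appending a translate, so the midpoint of an average
      and its translate competes in the infimum \<open>m\<close> as well.\<close>
    let ?Vs = "Us t @ map (mm R W) (Us t)"
    have "unitaries R ?Vs"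
      using Us(1)[of t] by (auto simp: unitaries_def intro!: unitary_on_mm[OF R W])
    moreover have "F ?Vs = mnorm R N (\<lambda>b c b' c'. (avg (Us t) (\<lambda>V. mon b c b' c' (mm R W V)) + avg (Us t) (mon b c b' c')) / 2)"
      using Us(1)[of t] by (simp add: F_def avg_append_map unitaries_def add.commute)
    ultimately have "m \<le> mnorm R N (\<lambda>b c b' c'. (avg (Us t) (\<lambda>V. mon b c b' c' (mm R W V)) + avg (Us t) (mon b c b' c')) / 2)"
      using lower by metis
    moreover have "mnorm R N (\<lambda>b c b' c'. avg (Us t) (\<lambda>V. mon b c b' c' (mm R W V))) = F (Us t)"
      unfolding F_def by (rule mnorm_translate[OF R W])
    ultimately show ?thesis
      using Us(2)[of t] unfolding mnorm_parallelogram F_def by simp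
  qed
  with Us(1) show ?thesis by blast
qed

text \<open>Bolzano-Weierstrass, through monotone subsequences of the real and then of the imaginary
  parts.\<close>

lemma bounded_complex_subseq:
  fixes f :: "nat \<Rightarrow> complex"
  assumes "\<And>n. cmod (f n) \<le> C"
  shows "\<exists>s. strict_mono s \<and> convergent (\<lambda>n. f (s n))"
proof -
  obtain s where s: "strict_mono s" "monoseq (\<lambda>n. Re (f (s n)))"
    using seq_monosub[of "\<lambda>n. Re (f n)"] by auto
  obtain s' where s': "strict_mono s'" "monoseq (\<lambda>n. Im (f (s (s' n))))"
    using seq_monosub[of "\<lambda>n. Im (f (s n))"] by auto
  have "Bseq (\<lambda>n. Re (f (s n)))" "Bseq (\<lambda>n. Im (f (s (s' n))))"
    using assms by (auto intro!: BseqI'[of _ C] order_trans[OF abs_Re_le_cmod] order_trans[OF abs_Im_le_cmod])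
  then have "convergent (\<lambda>n. Re (f (s n)))" and I: "convergent (\<lambda>n. Im (f (s (s' n))))"
    using s s' Bseq_monoseq_convergent by blast+
  then have "convergent (\<lambda>n. Re (f (s (s' n))))"
    using convergent_subseq_convergent[OF _ s'(1)] by (auto simp: o_def)
  with I obtain a b where "(\<lambda>n. Re (f (s (s' n)))) \<longlonglongrightarrow> a" "(\<lambda>n. Im (f (s (s' n)))) \<longlonglongrightarrow> b"
    by (auto simp: convergent_def)
  then have "(\<lambda>n. Complex (Re (f (s (s' n)))) (Im (f (s (s' n))))) \<longlonglongrightarrow> Complex a b"
    by (intro tendsto_Complex)
  then have "convergent (\<lambda>n. f ((s \<circ> s') n))" by (auto simp: convergent_def)
  moreover have "strict_mono (s \<circ> s')" using s(1) s'(1) by (rule strict_mono_o)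
  ultimately show ?thesis by blast
qed

lemma bounded_family_subseq:
  fixes f :: "'j \<Rightarrow> nat \<Rightarrow> complex"
  assumes "finite J" "\<And>j n. j \<in> J \<Longrightarrow> cmod (f j n) \<le> C"
  shows "\<exists>s. strict_mono s \<and> (\<forall>j\<in>J. convergent (\<lambda>n. f j (s n)))"
  using assms
proof (induction J rule: finite_induct)
  case empty
  show ?case using strict_mono_id by blast
next
  case (insert j J)
  then obtain s where s: "strict_mono s" "\<forall>j\<in>J. convergent (\<lambda>n. f j (s n))" by auto
  obtain s' where s': "strict_mono s'" "convergent (\<lambda>n. f j (s (s' n)))"
    using bounded_complex_subseq[of "\<lambda>n. f j (s n)" C] insert.prems by auto
  have "convergent (\<lambda>n. f i (s (s' n)))" if "i \<in> J" for i
    using convergent_subseq_convergent[OF _ s'(1), of "\<lambda>n. f i (s n)"] s(2) that by (auto simp: o_def)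
  then have "\<forall>i\<in>insert j J. convergent (\<lambda>n. f i ((s \<circ> s') n))" using s'(2) by auto
  moreover have "strict_mono (s \<circ> s')" using s(1) s'(1) by (rule strict_mono_o)
  ultimately show ?case by blast
qed

text \<open>A substitute for the Haar measure: only moments of bounded degree are ever averaged.\<close>

definition haar_seq :: "'r set \<Rightarrow> nat \<Rightarrow> (nat \<Rightarrow> ('r \<Rightarrow> 'r \<Rightarrow> complex) list) \<Rightarrow> bool" where
  "haar_seq R N Us \<longleftrightarrow> (\<forall>t. unitaries R (Us t)) \<and>
    (\<forall>n\<le>N. \<forall>b\<in>tup n R. \<forall>c\<in>tup n R. \<forall>b'\<in>tup n R. \<forall>c'\<in>tup n R.
       convergent (\<lambda>t. avg (Us t) (mon b c b' c')) \<and>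
       (\<forall>W. unitary_on R W \<longrightarrow>
          (\<lambda>t. avg (Us t) (\<lambda>V. mon b c b' c' (mm R W V)) - avg (Us t) (mon b c b' c')) \<longlonglongrightarrow> 0))"

text \<open>Entries of unitaries are bounded and there are finitely many moments of degree at most
  \<open>N\<close>, so all of them converge along one subsequence. The invariance defect tends to 0
  along the full sequence and hence along the subsequence.\<close>

theorem haar_seq_exists:
  assumes R: "finite R"
  shows "\<exists>Us. haar_seq R N Us"
proof -
  obtain Us :: "nat \<Rightarrow> _" where Us: "\<And>t. unitaries R (Us t)"
    and inv: "\<And>t W. unitary_on R W \<Longrightarrow>
      mnorm R N (\<lambda>b c b' c'. avg (Us t) (\<lambda>V. mon b c b' c' (mm R W V)) - avg (Us t) (mon b c b' c')) \<le> 4 / (real t + 1)"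
    using almost_invariant_averages[OF R] by blast
  define J where "J = (\<Union>n\<le>N. tup n R \<times> tup n R \<times> tup n R \<times> tup n R)"
  have finJ: "finite J" using R by (auto simp: J_def)
  obtain s where s: "strict_mono s"
    and conv: "\<And>b c b' c'. (b, c, b', c') \<in> J \<Longrightarrow> convergent (\<lambda>t. avg (Us (s t)) (mon b c b' c'))"
  proof -
    have "cmod (avg (Us t) (mon b c b' c')) \<le> 1" if "(b, c, b', c') \<in> J" for b c b' c' t
      using that Us[of t] unfolding J_def
      by (intro norm_avg_le) (auto simp: unitaries_def intro: norm_mon_le[OF R])
    then have "\<exists>s. strict_mono s \<and> (\<forall>j\<in>J. convergent (\<lambda>t. (\<lambda>(b, c, b', c') t. avg (Us t) (mon b c b' c')) j (s t)))"
      by (intro bounded_family_subseq[OF finJ, where C=1]) auto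
    then show ?thesis using that by fastforce
  qed
  have "haar_seq R N (\<lambda>t. Us (s t))"
    unfolding haar_seq_def
  proof (intro conjI allI impI ballI)
    show "unitaries R (Us (s t))" for t by (rule Us)
    fix n b c b' c' assume n: "n \<le> N" and bc: "b \<in> tup n R" "c \<in> tup n R" "b' \<in> tup n R" "c' \<in> tup n R"
    then show "convergent (\<lambda>t. avg (Us (s t)) (mon b c b' c'))"
      by (intro conv) (auto simp: J_def)
    fix W assume W: "unitary_on R W"
    let ?d = "\<lambda>t. avg (Us t) (\<lambda>V. mon b c b' c' (mm R W V)) - avg (Us t) (mon b c b' c')"
    have "(cmod (?d t))\<^sup>2 \<le> 4 / (real t + 1)" for t
      using mnorm_ge[OF R n bc, of "\<lambda>b c b' c'. avg (Us t) (\<lambda>V. mon b c b' c' (mm R W V)) - avg (Us t) (mon b c b' c')"]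
        inv[OF W, of t] by linarith
    then have "cmod (?d t) \<le> sqrt (4 / (real t + 1))" for t
      by (rule real_le_rsqrt)
    moreover have "(\<lambda>t. sqrt (4 / (real t + 1))) \<longlonglongrightarrow> sqrt 0"
    proof (intro tendsto_real_sqrt)
      have "(\<lambda>t. 4 * (1 / real (Suc t))) \<longlonglongrightarrow> 4 * 0"
        by (intro tendsto_mult tendsto_const LIMSEQ_Suc[OF lim_1_over_n])
      then show "(\<lambda>t. 4 / (real t + 1)) \<longlonglongrightarrow> 0" by (simp add: add.commute)
    qed
    ultimately have "?d \<longlonglongrightarrow> 0"
      by (intro tendsto_0_le[where f="\<lambda>t. sqrt (4 / (real t + 1))" and K=1 and g="?d"]) (auto intro!: always_eventually)
    then show "(\<lambda>t. ?d (s t)) \<longlonglongrightarrow> 0"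
      using LIMSEQ_subseq_LIMSEQ[OF _ s, of ?d 0] by (simp add: o_def)
  qed
  then show ?thesis by blast
qed

section \<open>Twirling\<close>

abbreviation "pl \<equiv> permute_list"
abbreviation "pinv \<equiv> Hilbert_Choice.inv"

lemma perms_fin [simp]: "finite (perms n)"
  by (simp add: finite_permutations)

lemma card_perms: "card (perms n) = fact n"
  by (simp add: card_permutations)

lemma pl_tup: "p \<in> perms n \<Longrightarrow> x \<in> tup n A \<Longrightarrow> pl p x \<in> tup n A"
  by (auto simp: tup_def)

lemma pl_comp: "p \<in> perms n \<Longrightarrow> q \<in> perms n \<Longrightarrow> x \<in> tup n A \<Longrightarrow> pl (p \<circ> q) x = pl q (pl p x)"
  by (auto simp: tup_def permute_list_compose)

lemma perms_comp: "p \<in> perms n \<Longrightarrow> q \<in> perms n \<Longrightarrow> p \<circ> q \<in> perms n"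
  by (auto intro: permutes_compose)

lemma perms_inv: "p \<in> perms n \<Longrightarrow> pinv p \<in> perms n"
  by (auto intro: permutes_inv)

lemma pl_inv1: "p \<in> perms n \<Longrightarrow> x \<in> tup n A \<Longrightarrow> pl p (pl (pinv p) x) = x"
  using pl_comp[OF perms_inv, of p n p x A] by (auto simp: permutes_inv_o)

lemma pl_inv2: "p \<in> perms n \<Longrightarrow> x \<in> tup n A \<Longrightarrow> pl (pinv p) (pl p x) = x"
  using pl_comp[OF _ perms_inv, of p n p x A] by (auto simp: permutes_inv_o)

lemma pl_eq_iff: "p \<in> perms n \<Longrightarrow> x \<in> tup n A \<Longrightarrow> y \<in> tup n B \<Longrightarrow> x = pl p y \<longleftrightarrow> y = pl (pinv p) x"
  by (metis pl_inv1 pl_inv2)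

lemma sum_pl: "p \<in> perms n \<Longrightarrow> (\<Sum>x\<in>tup n A. f (pl p x)) = (\<Sum>x\<in>tup n A. f x)"
proof -
  assume p: "p \<in> perms n"
  show ?thesis
    by (rule sum.reindex_bij_witness[where i="pl (pinv p)" and j="pl p"])
       (simp_all only: pl_inv1[OF p] pl_inv2[OF p] pl_tup[OF p] pl_tup[OF perms_inv[OF p]])
qed

lemma sum_perms_inv: "(\<Sum>p\<in>perms n. f (pinv p)) = (\<Sum>p\<in>perms n. f p)"
  using sum_permutations_inverse[of f "{..<n}"] by simp

lemma sum_perms_left: "q \<in> perms n \<Longrightarrow> (\<Sum>p\<in>perms n. f (q \<circ> p)) = (\<Sum>p\<in>perms n. f p)"
  using setum_permutations_compose_left[of q "{..<n}" f] by simp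

lemma sum_perms_right: "q \<in> perms n \<Longrightarrow> (\<Sum>p\<in>perms n. f (p \<circ> q)) = (\<Sum>p\<in>perms n. f p)"
  using sum_permutations_compose_right[of q "{..<n}" f] by simp

lemma sum_delta_pl:
  "p \<in> perms n \<Longrightarrow> finite A \<Longrightarrow> y \<in> tup n A \<Longrightarrow> (\<Sum>x\<in>tup n A. of_bool (y = pl p x) * f x) = (f (pl (pinv p) y) :: complex)"
proof -
  assume p: "p \<in> perms n" and A: "finite A" and y: "y \<in> tup n A"
  have "(\<Sum>x\<in>tup n A. of_bool (y = pl p x) * f x) = (\<Sum>x\<in>tup n A. if x = pl (pinv p) y then f x else 0)"
    using pl_eq_iff[OF p y] by (intro sum.cong) auto
  then show ?thesis using A pl_tup[OF perms_inv[OF p] y] by simp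
qed

lemma tpow_pl:
  assumes p: "p \<in> perms n" and x: "x \<in> tup n A" and y: "y \<in> tup n B"
  shows "tpow V (pl p x) (pl p y) = tpow V x y"
proof -
  have "tpow V (pl p x) (pl p y) = (\<Prod>k<n. V (x ! p k) (y ! p k))"
    using p x y unfolding tpow_def by (intro prod.cong) (auto simp: length_tup permute_list_nth)
  also have "\<dots> = (\<Prod>k\<in>p ` {..<n}. V (x ! k) (y ! k))"
    using p permutes_inj_on[of p "{..<n}"] by (subst prod.reindex) auto
  finally show ?thesis using p x by (simp add: permutes_image tpow_def length_tup)
qed

text \<open>The trace of the permutation operator of \<open>p\<close> on the \<open>n\<close>-fold
  tensor power of the space over \<open>R\<close>, which is \<open>card R\<close> to the number of
  cycles of \<open>p\<close>.\<close>

definition fixc :: "nat \<Rightarrow> 'r set \<Rightarrow> (nat \<Rightarrow> nat) \<Rightarrow> complex" where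
  "fixc n R p = (\<Sum>b\<in>tup n R. of_bool (b = pl p b))"

lemma fixc_inv: "p \<in> perms n \<Longrightarrow> fixc n R (pinv p) = fixc n R p"
  unfolding fixc_def by (intro sum.cong refl arg_cong[where f=of_bool] pl_eq_iff[symmetric])

text \<open>Each unit contributes a sum over permutations \<open>p\<close> and \<open>q\<close>, but
  only \<open>s = pinv p \<circ> q\<close> survives the sums over tuples, so the other permutation
  yields the factor \<open>fact n\<close>. The sum over \<open>j\<close> is \<open>fixc\<close> when
  \<open>g\<close> is the identity, and a partial trace when \<open>g\<close> is a twirl.\<close>

lemma sym_unit_sandwich:
  assumes R: "finite R" and b: "b \<in> tup n R" "b' \<in> tup n R"
  shows "(\<Sum>i\<in>tup n R. \<Sum>j\<in>tup n R. \<Sum>c\<in>tup n R. \<Sum>c'\<in>tup n R. sym_unit n i j b c * g c c' * sym_unit n i j b' c')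
    = fact n * (\<Sum>s\<in>perms n. of_bool (b' = pl s b) * (\<Sum>j\<in>tup n R. g j (pl s j)))"
proof -
  let ?T = "tup n R"
  have T: "finite ?T" using R by simp
  have A: "(\<Sum>c\<in>?T. \<Sum>c'\<in>?T. sym_unit n i j b c * g c c' * sym_unit n i j b' c')
      = (\<Sum>p\<in>perms n. \<Sum>q\<in>perms n. of_bool (b = pl p i) * of_bool (b' = pl q i) * g (pl p j) (pl q j))"
    if ij: "i \<in> ?T" "j \<in> ?T" for i j
  proof -
    have "(\<Sum>c\<in>?T. \<Sum>c'\<in>?T. sym_unit n i j b c * g c c' * sym_unit n i j b' c')
      = (\<Sum>c\<in>?T. \<Sum>c'\<in>?T. \<Sum>p\<in>perms n. \<Sum>q\<in>perms n. of_bool (b = pl p i) * of_bool (b' = pl q i) *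
           (of_bool (c = pl p j) * (of_bool (c' = pl q j) * g c c')))"
    proof (intro sum.cong refl)
      fix c c'
      have "sym_unit n i j b c * g c c' * sym_unit n i j b' c' = (\<Sum>p\<in>perms n. \<Sum>q\<in>perms n.
          of_bool (b = pl p i \<and> c = pl p j) * of_bool (b' = pl q i \<and> c' = pl q j)) * g c c'"
        unfolding sym_unit_def sum_product[symmetric] by (simp only: mult_ac)
      also have "\<dots> = (\<Sum>p\<in>perms n. \<Sum>q\<in>perms n. of_bool (b = pl p i) * of_bool (b' = pl q i) *
           (of_bool (c = pl p j) * (of_bool (c' = pl q j) * g c c')))"
        unfolding sum_distrib_right by (intro sum.cong refl) (simp only: of_bool_conj mult_ac)
      finally show "sym_unit n i j b c * g c c' * sym_unit n i j b' c' = (\<Sum>p\<in>perms n. \<Sum>q\<in>perms n. of_bool (b = pl p i) * of_bool (b' = pl q i) *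
           (of_bool (c = pl p j) * (of_bool (c' = pl q j) * g c c')))" .
    qed
    also have "\<dots> = (\<Sum>p\<in>perms n. \<Sum>q\<in>perms n. \<Sum>c\<in>?T. \<Sum>c'\<in>?T. of_bool (b = pl p i) * of_bool (b' = pl q i) *
           (of_bool (c = pl p j) * (of_bool (c' = pl q j) * g c c')))"
      by (simp only: sum.swap[of _ ?T "perms n"])
    also have "\<dots> = (\<Sum>p\<in>perms n. \<Sum>q\<in>perms n. of_bool (b = pl p i) * of_bool (b' = pl q i) *
        (\<Sum>c\<in>?T. of_bool (c = pl p j) * (\<Sum>c'\<in>?T. of_bool (c' = pl q j) * g c c')))"
      by (simp add: sum_distrib_left)
    also have "\<dots> = (\<Sum>p\<in>perms n. \<Sum>q\<in>perms n. of_bool (b = pl p i) * of_bool (b' = pl q i) * g (pl p j) (pl q j))"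
    proof (intro sum.cong refl)
      fix p q assume pq: "p \<in> perms n" "q \<in> perms n"
      have "(\<Sum>c\<in>?T. of_bool (c = pl p j) * (\<Sum>c'\<in>?T. of_bool (c' = pl q j) * g c c')) = g (pl p j) (pl q j)"
        using T pl_tup[OF pq(1) ij(2)] pl_tup[OF pq(2) ij(2)]
        by (simp add: of_bool_def if_distrib[where f="\<lambda>x. x * _"] cong: if_cong)
      then show "of_bool (b = pl p i) * of_bool (b' = pl q i) * (\<Sum>c\<in>?T. of_bool (c = pl p j) * (\<Sum>c'\<in>?T. of_bool (c' = pl q j) * g c c'))
         = of_bool (b = pl p i) * of_bool (b' = pl q i) * g (pl p j) (pl q j)" by simp
    qed
    finally show ?thesis .
  qed
  have "(\<Sum>i\<in>?T. \<Sum>j\<in>?T. \<Sum>c\<in>?T. \<Sum>c'\<in>?T. sym_unit n i j b c * g c c' * sym_unit n i j b' c')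
      = (\<Sum>i\<in>?T. \<Sum>j\<in>?T. \<Sum>p\<in>perms n. \<Sum>q\<in>perms n. of_bool (b = pl p i) * of_bool (b' = pl q i) * g (pl p j) (pl q j))"
    by (intro sum.cong refl A)
  also have "\<dots> = (\<Sum>p\<in>perms n. \<Sum>q\<in>perms n. \<Sum>i\<in>?T. \<Sum>j\<in>?T. of_bool (b = pl p i) * of_bool (b' = pl q i) * g (pl p j) (pl q j))"
    by (simp only: sum.swap[of _ ?T "perms n"])
  also have "\<dots> = (\<Sum>p\<in>perms n. \<Sum>q\<in>perms n. of_bool (b' = pl (pinv p \<circ> q) b) * (\<Sum>j\<in>?T. g j (pl (pinv p \<circ> q) j)))"
  proof (intro sum.cong refl)
    fix p q assume p: "p \<in> perms n" and q: "q \<in> perms n"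
    have c: "pl q x = pl (pinv p \<circ> q) (pl p x)" if "x \<in> ?T" for x
      using pl_comp[OF perms_inv[OF p] q pl_tup[OF p that]] pl_inv2[OF p that] by simp
    have "(\<Sum>i\<in>?T. \<Sum>j\<in>?T. of_bool (b = pl p i) * of_bool (b' = pl q i) * g (pl p j) (pl q j))
        = (\<Sum>i\<in>?T. of_bool (b = pl p i) * of_bool (b' = pl (pinv p \<circ> q) (pl p i))) * (\<Sum>j\<in>?T. g (pl p j) (pl (pinv p \<circ> q) (pl p j)))"
      unfolding sum_product by (intro sum.cong refl) (simp add: c)
    also have "(\<Sum>j\<in>?T. g (pl p j) (pl (pinv p \<circ> q) (pl p j))) = (\<Sum>j\<in>?T. g j (pl (pinv p \<circ> q) j))"
      by (rule sum_pl[OF p])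
    also have "(\<Sum>i\<in>?T. of_bool (b = pl p i) * of_bool (b' = pl (pinv p \<circ> q) (pl p i)))
        = (\<Sum>i\<in>?T. of_bool (b = i) * of_bool (b' = pl (pinv p \<circ> q) i) :: complex)"
      by (rule sum_pl[OF p])
    also have "\<dots> = of_bool (b' = pl (pinv p \<circ> q) b)"
      using T b by (simp add: of_bool_def if_distrib[where f="\<lambda>x. x * _"] cong: if_cong)
    finally show "(\<Sum>i\<in>?T. \<Sum>j\<in>?T. of_bool (b = pl p i) * of_bool (b' = pl q i) * g (pl p j) (pl q j))
        = of_bool (b' = pl (pinv p \<circ> q) b) * (\<Sum>j\<in>?T. g j (pl (pinv p \<circ> q) j))" .
  qed
  also have "\<dots> = (\<Sum>p\<in>perms n. \<Sum>s\<in>perms n. of_bool (b' = pl s b) * (\<Sum>j\<in>?T. g j (pl s j)))"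
    by (intro sum.cong refl sum_perms_left perms_inv)
  finally show ?thesis by (simp add: card_perms)
qed

section \<open>The twirl of a permutation-symmetric vector over the environment\<close>

definition app :: "nat \<Rightarrow> 'r set \<Rightarrow> ('r \<Rightarrow> 'r \<Rightarrow> complex) \<Rightarrow> ('m list \<Rightarrow> 'r list \<Rightarrow> complex) \<Rightarrow> 'm list \<Rightarrow> 'r list \<Rightarrow> complex" where
  "app n R V \<Psi> a b = (\<Sum>c\<in>tup n R. tpow V b c * \<Psi> a c)"

definition symm_on :: "nat \<Rightarrow> 'm set \<Rightarrow> 'r set \<Rightarrow> ('m list \<Rightarrow> 'r list \<Rightarrow> complex) \<Rightarrow> bool" where
  "symm_on n A R \<Psi> \<longleftrightarrow> (\<forall>p\<in>perms n. \<forall>a\<in>tup n A. \<forall>b\<in>tup n R. \<Psi> (pl p a) (pl p b) = \<Psi> a b)"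

lemma symm_on_app:
  assumes "symm_on n A R \<Psi>"
  shows "symm_on n A R (app n R V \<Psi>)"
  unfolding symm_on_def
proof (intro ballI)
  fix p a b assume p: "p \<in> perms n" and a: "a \<in> tup n A" and b: "b \<in> tup n R"
  have "app n R V \<Psi> (pl p a) (pl p b) = (\<Sum>c\<in>tup n R. tpow V (pl p b) (pl p c) * \<Psi> (pl p a) (pl p c))"
    unfolding app_def by (rule sum_pl[OF p, symmetric])
  also have "\<dots> = app n R V \<Psi> a b"
    unfolding app_def using assms p a b by (intro sum.cong refl) (simp add: tpow_pl symm_on_def)
  finally show "app n R V \<Psi> (pl p a) (pl p b) = app n R V \<Psi> a b" .
qed

text \<open>The reduced operator of the vector \<open>\<Psi>\<close> after tracing out the second
  register.\<close>

definition gram :: "nat \<Rightarrow> 'r set \<Rightarrow> ('m list \<Rightarrow> 'r list \<Rightarrow> complex) \<Rightarrow> 'm list \<Rightarrow> 'm list \<Rightarrow> complex" where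
  "gram n R \<Psi> a a' = (\<Sum>b\<in>tup n R. \<Psi> a b * cnj (\<Psi> a' b))"

lemma gram_app:
  assumes "finite R" "unitary_on R V"
  shows "gram n R (app n R V \<Psi>) a a' = gram n R \<Psi> a a'"
  unfolding gram_def app_def
  using unitary_on_isometry[OF _ unitary_on_tpow[OF assms], of n "\<Psi> a" "\<Psi> a'"] assms by simp

lemma gram_symm:
  assumes "symm_on n A R \<Psi>" "p \<in> perms n" "a \<in> tup n A" "a' \<in> tup n A"
  shows "gram n R \<Psi> (pl p a) (pl p a') = gram n R \<Psi> a a'"
proof -
  have "gram n R \<Psi> (pl p a) (pl p a') = (\<Sum>b\<in>tup n R. \<Psi> (pl p a) (pl p b) * cnj (\<Psi> (pl p a') (pl p b)))"
    unfolding gram_def by (rule sum_pl[OF assms(2), symmetric])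
  also have "\<dots> = gram n R \<Psi> a a'"
    unfolding gram_def using assms by (intro sum.cong refl) (simp add: symm_on_def)
  finally show ?thesis .
qed

text \<open>The projector onto \<open>\<Psi>\<close>, averaged over unitaries on the second
  register. The limit exists for sequences from \<open>haar_seq\<close> of sufficient degree, see
  \<open>twirl_lim\<close>.\<close>

definition twirl :: "nat \<Rightarrow> 'r set \<Rightarrow> (nat \<Rightarrow> ('r \<Rightarrow> 'r \<Rightarrow> complex) list) \<Rightarrow> ('m list \<Rightarrow> 'r list \<Rightarrow> complex) \<Rightarrow>
   'm list \<Rightarrow> 'r list \<Rightarrow> 'm list \<Rightarrow> 'r list \<Rightarrow> complex" where
  "twirl n R Us \<Psi> a b a' b' = lim (\<lambda>t. avg (Us t) (\<lambda>V. app n R V \<Psi> a b * cnj (app n R V \<Psi> a' b')))"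

lemma app_product_mon:
  "app n R V \<Psi> a b * cnj (app n R V \<Psi> a' b') =
     (\<Sum>c\<in>tup n R. \<Sum>c'\<in>tup n R. \<Psi> a c * cnj (\<Psi> a' c') * mon b c b' c' V)"
  by (simp add: app_def mon_def sum_product mult_ac)

context
  fixes R :: "'r set" and N n :: nat and Us and A :: "'m set" and \<Psi>
  assumes R: "finite R" and Us: "haar_seq R N Us" and n: "n \<le> N" and sy: "symm_on n A R \<Psi>"
begin

lemma twirl_lim:
  assumes b: "b \<in> tup n R" "b' \<in> tup n R"
  shows "(\<lambda>t. avg (Us t) (\<lambda>V. app n R V \<Psi> a b * cnj (app n R V \<Psi> a' b'))) \<longlonglongrightarrow> twirl n R Us \<Psi> a b a' b'"
proof -
  have "convergent (\<lambda>t. avg (Us t) (\<lambda>V. app n R V \<Psi> a b * cnj (app n R V \<Psi> a' b')))"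
    unfolding app_product_mon avg_sum avg_cmult
    using Us n b by (intro convergent_sum convergent_mult convergent_const) (auto simp: haar_seq_def)
  then show ?thesis unfolding twirl_def by (simp add: convergent_LIMSEQ_iff)
qed

lemma twirl_symm:
  assumes "p \<in> perms n" "a \<in> tup n A" "b \<in> tup n R" "a' \<in> tup n A" "b' \<in> tup n R"
  shows "twirl n R Us \<Psi> a b (pl p a') (pl p b') = twirl n R Us \<Psi> a b a' b'"
  unfolding twirl_def using symm_on_app[OF sy] assms by (simp add: symm_on_def)

text \<open>Unitaries on the register that is traced out leave the reduced operator unchanged, so
  already every finite average has this value.\<close>

lemma twirl_trace:
  "(\<Sum>b\<in>tup n R. twirl n R Us \<Psi> a b a' b) = gram n R \<Psi> a a'"
proof -
  have "(\<lambda>t. \<Sum>b\<in>tup n R. avg (Us t) (\<lambda>V. app n R V \<Psi> a b * cnj (app n R V \<Psi> a' b)))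
      \<longlonglongrightarrow> (\<Sum>b\<in>tup n R. twirl n R Us \<Psi> a b a' b)"
    by (intro tendsto_sum twirl_lim)
  moreover have "(\<Sum>b\<in>tup n R. avg (Us t) (\<lambda>V. app n R V \<Psi> a b * cnj (app n R V \<Psi> a' b))) = gram n R \<Psi> a a'" for t
  proof -
    have U: "Us t \<noteq> []" "\<And>V. V \<in> set (Us t) \<Longrightarrow> unitary_on R V"
      using Us by (auto simp: haar_seq_def unitaries_def)
    have "(\<Sum>b\<in>tup n R. avg (Us t) (\<lambda>V. app n R V \<Psi> a b * cnj (app n R V \<Psi> a' b)))
        = avg (Us t) (\<lambda>V. gram n R (app n R V \<Psi>) a a')"
      by (simp add: gram_def avg_sum)
    also have "\<dots> = avg (Us t) (\<lambda>V. gram n R \<Psi> a a')"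
      by (intro avg_cong gram_app R U)
    finally show ?thesis using U by (simp add: avg_const)
  qed
  ultimately show ?thesis by (simp add: LIMSEQ_const_iff)
qed

text \<open>Conjugating the twirl by \<open>tpow W\<close> amounts to translating the averaging
  sequence by \<open>W\<close>, and the limit does not see this translation.\<close>

lemma twirl_commute:
  assumes W: "unitary_on R W"
  shows "commute_on (tup n R) (tpow W) (\<lambda>b b'. twirl n R Us \<Psi> a b a' b')"
proof -
  let ?T = "tup n R" and ?y = "\<lambda>b b'. twirl n R Us \<Psi> a b a' b'"
  have T: "finite ?T" using R by simp
  have u: "unitary_on ?T (tpow W)" by (rule unitary_on_tpow[OF R W])
  have conj: "meq ?T ?T (conj_on ?T (tpow W) ?y) ?y"
  proof (rule meqI)
    fix b b' assume b: "b \<in> ?T" "b' \<in> ?T"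
    have "(\<lambda>t. \<Sum>d\<in>?T. \<Sum>d'\<in>?T. tpow W b d * cnj (tpow W b' d') * avg (Us t) (\<lambda>V. app n R V \<Psi> a d * cnj (app n R V \<Psi> a' d')))
        \<longlonglongrightarrow> (\<Sum>d\<in>?T. \<Sum>d'\<in>?T. tpow W b d * cnj (tpow W b' d') * ?y d d')"
      by (intro tendsto_sum tendsto_mult tendsto_const twirl_lim)
    moreover have "(\<Sum>d\<in>?T. \<Sum>d'\<in>?T. tpow W b d * cnj (tpow W b' d') * ?y d d') = conj_on ?T (tpow W) ?y b b'"
      by (simp add: conj_on_def mm_def adj_def sum_distrib_left mult_ac)
    \<comment> \<open>Conjugation translates every moment by \<open>W\<close>; the second summand
      collects the invariance defects, which tend to 0.\<close>
    moreover have "(\<Sum>d\<in>?T. \<Sum>d'\<in>?T. tpow W b d * cnj (tpow W b' d') * avg (Us t) (\<lambda>V. app n R V \<Psi> a d * cnj (app n R V \<Psi> a' d')))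
       = avg (Us t) (\<lambda>V. app n R V \<Psi> a b * cnj (app n R V \<Psi> a' b')) +
         (\<Sum>c\<in>?T. \<Sum>c'\<in>?T. \<Psi> a c * cnj (\<Psi> a' c') * (avg (Us t) (\<lambda>V. mon b c b' c' (mm R W V)) - avg (Us t) (mon b c b' c')))" for t
    proof -
      have "(\<Sum>d\<in>?T. \<Sum>d'\<in>?T. tpow W b d * cnj (tpow W b' d') * avg (Us t) (\<lambda>V. app n R V \<Psi> a d * cnj (app n R V \<Psi> a' d')))
        = (\<Sum>d\<in>?T. \<Sum>d'\<in>?T. \<Sum>c\<in>?T. \<Sum>c'\<in>?T. tpow W b d * cnj (tpow W b' d') * (\<Psi> a c * cnj (\<Psi> a' c') * avg (Us t) (mon d c d' c')))"
        unfolding app_product_mon avg_sum avg_cmult by (simp add: sum_distrib_left)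
      also have "\<dots> = (\<Sum>d\<in>?T. \<Sum>c\<in>?T. \<Sum>c'\<in>?T. \<Sum>d'\<in>?T. tpow W b d * cnj (tpow W b' d') * (\<Psi> a c * cnj (\<Psi> a' c') * avg (Us t) (mon d c d' c')))"
        by (rule sum.cong[OF refl], rule trans[OF sum.swap], rule sum.cong[OF refl], rule sum.swap)
      also have "\<dots> = (\<Sum>c\<in>?T. \<Sum>c'\<in>?T. \<Sum>d\<in>?T. \<Sum>d'\<in>?T. tpow W b d * cnj (tpow W b' d') * (\<Psi> a c * cnj (\<Psi> a' c') * avg (Us t) (mon d c d' c')))"
        by (rule trans[OF sum.swap], rule sum.cong[OF refl], rule sum.swap)
      also have "\<dots> = (\<Sum>c\<in>?T. \<Sum>c'\<in>?T. \<Psi> a c * cnj (\<Psi> a' c') * avg (Us t) (\<lambda>V. mon b c b' c' (mm R W V)))"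
        using b by (simp add: mon_mm[of b n] length_tup avg_sum avg_cmult sum_distrib_left mult_ac)
      finally show ?thesis
        unfolding app_product_mon avg_sum avg_cmult by (simp add: sum_subtractf right_diff_distrib)
    qed
    moreover have "(\<lambda>t. avg (Us t) (\<lambda>V. app n R V \<Psi> a b * cnj (app n R V \<Psi> a' b')) +
         (\<Sum>c\<in>?T. \<Sum>c'\<in>?T. \<Psi> a c * cnj (\<Psi> a' c') * (avg (Us t) (\<lambda>V. mon b c b' c' (mm R W V)) - avg (Us t) (mon b c b' c'))))
         \<longlonglongrightarrow> ?y b b' + (\<Sum>c\<in>?T. \<Sum>c'\<in>?T. \<Psi> a c * cnj (\<Psi> a' c') * 0)"
      using Us n b W by (intro tendsto_add tendsto_sum tendsto_mult tendsto_const twirl_lim) (auto simp: haar_seq_def)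
    ultimately show "conj_on ?T (tpow W) ?y b b' = ?y b b'"
      using LIMSEQ_unique by fastforce
  qed
  have "meq ?T ?T (mm ?T (conj_on ?T (tpow W) ?y) (tpow W)) (mm ?T (tpow W) ?y)"
  proof -
    have e: "mm ?T (conj_on ?T (tpow W) ?y) (tpow W) = mm ?T (tpow W) (mm ?T ?y (mm ?T (adj (tpow W)) (tpow W)))"
      by (simp add: conj_on_def mm_assoc)
    have "meq ?T ?T (mm ?T ?y (mm ?T (adj (tpow W)) (tpow W))) ?y"
      by (rule meq_trans[OF mm_cong[OF meq_refl unitary_onD(2)[OF u]] mm_idm_right[OF T]])
    then show ?thesis unfolding e by (rule mm_cong[OF meq_refl])
  qed
  moreover have "meq ?T ?T (mm ?T (conj_on ?T (tpow W) ?y) (tpow W)) (mm ?T ?y (tpow W))"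
    by (intro mm_cong meq_refl conj)
  ultimately show ?thesis unfolding commute_on_def by (meson meq_sym meq_trans)
qed

text \<open>Both sides are \<open>\<Sum>\<^sub>i\<^sub>j S\<^sub>i\<^sub>j y S\<^sub>i\<^sub>j\<^sup>* = y \<Sum>\<^sub>i\<^sub>j S\<^sub>i\<^sub>j S\<^sub>i\<^sub>j\<^sup>*\<close> with \<open>S\<^sub>i\<^sub>j\<close> the symmetrised matrix units.\<close>

lemma twirl_fixc:
  assumes a: "a \<in> tup n A" "a' \<in> tup n A" and b: "b \<in> tup n R" "b' \<in> tup n R"
  shows "(\<Sum>s\<in>perms n. fixc n R s * twirl n R Us \<Psi> a b (pl s a') b')
    = (\<Sum>s\<in>perms n. of_bool (b = pl s b') * gram n R \<Psi> a (pl s a'))"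
proof -
  let ?T = "tup n R" and ?y = "\<lambda>b b'. twirl n R Us \<Psi> a b a' b'" and ?S = "sym_unit n :: 'r list \<Rightarrow> _"
  have T: "finite ?T" using R by simp
  have comm: "mm ?T (?S i j) ?y b c' = mm ?T ?y (?S i j) b c'" if "i \<in> ?T" "j \<in> ?T" "c' \<in> ?T" for i j c'
    using commute_on_sym_unit[OF R twirl_commute that(1,2)] that b by (simp add: commute_on_def meq_def)
  have "(\<Sum>i\<in>?T. \<Sum>j\<in>?T. \<Sum>c\<in>?T. \<Sum>c'\<in>?T. ?S i j b c * ?y c c' * ?S i j b' c')
      = (\<Sum>i\<in>?T. \<Sum>j\<in>?T. \<Sum>c'\<in>?T. mm ?T (?S i j) ?y b c' * ?S i j b' c')"
    unfolding mm_def sum_distrib_right by (rule sum.cong[OF refl], rule sum.cong[OF refl], rule sum.swap)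
  also have "\<dots> = (\<Sum>i\<in>?T. \<Sum>j\<in>?T. \<Sum>c'\<in>?T. mm ?T ?y (?S i j) b c' * ?S i j b' c')"
    by (intro sum.cong refl) (simp add: comm)
  also have "\<dots> = (\<Sum>i\<in>?T. \<Sum>j\<in>?T. \<Sum>d\<in>?T. ?y b d * (\<Sum>c\<in>?T. \<Sum>c'\<in>?T. ?S i j d c * idm c c' * ?S i j b' c'))"
  proof (rule sum.cong[OF refl], rule sum.cong[OF refl])
    fix i j
    have "(\<Sum>c'\<in>?T. mm ?T ?y (?S i j) b c' * ?S i j b' c') = (\<Sum>d\<in>?T. ?y b d * (\<Sum>c'\<in>?T. ?S i j d c' * ?S i j b' c'))"
      unfolding mm_def sum_distrib_right sum_distrib_left mult.assoc by (rule sum.swap)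
    also have "\<dots> = (\<Sum>d\<in>?T. ?y b d * (\<Sum>c\<in>?T. \<Sum>c'\<in>?T. ?S i j d c * idm c c' * ?S i j b' c'))"
      using T by (simp add: idm_def if_distrib[where f="\<lambda>x. x * _"] if_distrib[where f="\<lambda>x. _ * x"] cong: if_cong)
    finally show "(\<Sum>c'\<in>?T. mm ?T ?y (?S i j) b c' * ?S i j b' c') = (\<Sum>d\<in>?T. ?y b d * (\<Sum>c\<in>?T. \<Sum>c'\<in>?T. ?S i j d c * idm c c' * ?S i j b' c'))" .
  qed
  also have "\<dots> = (\<Sum>d\<in>?T. ?y b d * (\<Sum>i\<in>?T. \<Sum>j\<in>?T. \<Sum>c\<in>?T. \<Sum>c'\<in>?T. ?S i j d c * idm c c' * ?S i j b' c'))"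
  proof -
    have "(\<Sum>i\<in>?T. \<Sum>j\<in>?T. \<Sum>d\<in>?T. g i j d) = (\<Sum>d\<in>?T. \<Sum>i\<in>?T. \<Sum>j\<in>?T. g i j d)" for g :: "_ \<Rightarrow> _ \<Rightarrow> _ \<Rightarrow> complex"
    proof -
      have "(\<Sum>i\<in>?T. \<Sum>j\<in>?T. \<Sum>d\<in>?T. g i j d) = (\<Sum>i\<in>?T. \<Sum>d\<in>?T. \<Sum>j\<in>?T. g i j d)"
        by (rule sum.cong[OF refl], rule sum.swap)
      also have "\<dots> = (\<Sum>d\<in>?T. \<Sum>i\<in>?T. \<Sum>j\<in>?T. g i j d)" by (rule sum.swap)
      finally show ?thesis .
    qed
    then show ?thesis by (simp add: sum_distrib_left)
  qed
  also have "\<dots> = (\<Sum>d\<in>?T. ?y b d * (fact n * (\<Sum>s\<in>perms n. of_bool (b' = pl s d) * fixc n R s)))"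
    using b by (intro sum.cong refl) (simp add: sym_unit_sandwich[OF R] fixc_def idm_def of_bool_def)
  also have "\<dots> = fact n * (\<Sum>s\<in>perms n. fixc n R s * (\<Sum>d\<in>?T. of_bool (b' = pl s d) * ?y b d))"
    unfolding sum_distrib_left
    by (rule trans[OF sum.swap], rule sum.cong[OF refl], rule sum.cong[OF refl], simp only: mult_ac)
  also have "\<dots> = fact n * (\<Sum>s\<in>perms n. fixc n R s * ?y b (pl (pinv s) b'))"
    using b by (intro arg_cong[where f="\<lambda>x. fact n * x"] sum.cong refl) (simp add: sum_delta_pl[OF _ R])
  also have "\<dots> = fact n * (\<Sum>s\<in>perms n. fixc n R s * twirl n R Us \<Psi> a b (pl s a') b')"
  proof -
    \<comment> \<open>By the symmetry of \<open>\<Psi>\<close> a permutation of the environment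
      tuple can be moved to the input tuple.\<close>
    have "?y b (pl (pinv s) b') = twirl n R Us \<Psi> a b (pl s a') b'" if s: "s \<in> perms n" for s
      using twirl_symm[OF s a(1) b(1) a(2) pl_tup[OF perms_inv[OF s] b(2)]] pl_inv1[OF s b(2)] by simp
    then show ?thesis by simp
  qed
  finally have 1: "(\<Sum>i\<in>?T. \<Sum>j\<in>?T. \<Sum>c\<in>?T. \<Sum>c'\<in>?T. ?S i j b c * ?y c c' * ?S i j b' c')
      = fact n * (\<Sum>s\<in>perms n. fixc n R s * twirl n R Us \<Psi> a b (pl s a') b')" .
  \<comment> \<open>The second evaluation of the same sum: here the sum over \<open>j\<close> is the
    trace over the environment, in which the unitaries cancel.\<close>
  have "(\<Sum>i\<in>?T. \<Sum>j\<in>?T. \<Sum>c\<in>?T. \<Sum>c'\<in>?T. ?S i j b c * ?y c c' * ?S i j b' c')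
      = fact n * (\<Sum>s\<in>perms n. of_bool (b' = pl s b) * gram n R \<Psi> a (pl (pinv s) a'))"
  proof -
    have "(\<Sum>j\<in>?T. ?y j (pl s j)) = gram n R \<Psi> a (pl (pinv s) a')" if s: "s \<in> perms n" for s
    proof -
      have "?y j (pl s j) = twirl n R Us \<Psi> a j (pl (pinv s) a') j" if j: "j \<in> ?T" for j
        using twirl_symm[OF s a(1) j pl_tup[OF perms_inv[OF s] a(2)] j] pl_inv1[OF s a(2)] by simp
      then show ?thesis by (simp add: twirl_trace[symmetric])
    qed
    then show ?thesis using b by (simp add: sym_unit_sandwich[OF R])
  qed
  also have "(\<Sum>s\<in>perms n. of_bool (b' = pl s b) * gram n R \<Psi> a (pl (pinv s) a'))
      = (\<Sum>s\<in>perms n. of_bool (b = pl (pinv s) b') * gram n R \<Psi> a (pl (pinv s) a'))"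
    using b by (intro sum.cong refl) (simp add: pl_eq_iff[of _ n b' R b R])
  also have "\<dots> = (\<Sum>s\<in>perms n. of_bool (b = pl s b') * gram n R \<Psi> a (pl s a'))"
    by (rule sum_perms_inv)
  finally show ?thesis using 1 by simp
qed

end

section \<open>Inverse square roots of positive semidefinite operators\<close>

definition psd_on :: "'a set \<Rightarrow> ('a \<Rightarrow> 'a \<Rightarrow> complex) \<Rightarrow> bool" where
  "psd_on I B \<longleftrightarrow> (\<forall>v. 0 \<le> (\<Sum>i\<in>I. \<Sum>j\<in>I. cnj (v i) * B i j * v j))"

text \<open>\<open>Z\<close> is the inverse square root of \<open>K\<close> on its support and vanishes on its kernel.\<close>

definition is_inv_root :: "'a set \<Rightarrow> ('a \<Rightarrow> 'a \<Rightarrow> complex) \<Rightarrow> ('a \<Rightarrow> 'a \<Rightarrow> complex) \<Rightarrow> bool" where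
  "is_inv_root I K Z \<longleftrightarrow> hermitian_on I Z \<and> (\<forall>B. commute_on I K B \<longrightarrow> commute_on I Z B) \<and>
    (\<forall>x. (\<forall>v. (\<forall>i\<in>I. (\<Sum>j\<in>I. K i j * v j) = 0) \<longrightarrow> (\<Sum>j\<in>I. x j * v j) = 0) \<longrightarrow>
       (\<forall>j\<in>I. (\<Sum>i\<in>I. x i * mm I K (mm I Z Z) i j) = x j)) \<and>
    (\<forall>B. psd_on I B \<and> commute_on I K B \<longrightarrow> psd_on I (\<lambda>i j. B i j - mm I Z (mm I (mm I B K) Z) i j))"

lemma psd_on_cong:
  assumes "meq I I A B" "psd_on I A"
  shows "psd_on I B"
proof -
  have "(\<Sum>i\<in>I. \<Sum>j\<in>I. cnj (v i) * B i j * v j) = (\<Sum>i\<in>I. \<Sum>j\<in>I. cnj (v i) * A i j * v j)" for v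
    using assms(1) by (intro sum.cong refl) (simp add: meq_def)
  then show ?thesis using assms(2) by (simp add: psd_on_def)
qed

lemma form_conj_on:
  "(\<Sum>i\<in>I. \<Sum>j\<in>I. cnj (v i) * conj_on I u X i j * v j)
    = (\<Sum>k\<in>I. \<Sum>l\<in>I. cnj (\<Sum>i\<in>I. cnj (u i k) * v i) * X k l * (\<Sum>j\<in>I. cnj (u j l) * v j))"
proof -
  have "(\<Sum>i\<in>I. \<Sum>j\<in>I. cnj (v i) * conj_on I u X i j * v j)
      = (\<Sum>i\<in>I. \<Sum>j\<in>I. \<Sum>k\<in>I. \<Sum>l\<in>I. cnj (v i) * u i k * X k l * (cnj (u j l) * v j))"
    unfolding conj_on_def mm_def adj_def sum_distrib_left sum_distrib_right
    by (intro sum.cong refl) (simp only: mult_ac)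
  also have "\<dots> = (\<Sum>i\<in>I. \<Sum>k\<in>I. \<Sum>l\<in>I. \<Sum>j\<in>I. cnj (v i) * u i k * X k l * (cnj (u j l) * v j))"
    by (rule sum.cong[OF refl], rule trans[OF sum.swap], rule sum.cong[OF refl], rule sum.swap)
  also have "\<dots> = (\<Sum>k\<in>I. \<Sum>l\<in>I. \<Sum>i\<in>I. \<Sum>j\<in>I. cnj (v i) * u i k * X k l * (cnj (u j l) * v j))"
    by (rule trans[OF sum.swap], rule sum.cong[OF refl], rule sum.swap)
  also have "\<dots> = (\<Sum>k\<in>I. \<Sum>l\<in>I. cnj (\<Sum>i\<in>I. cnj (u i k) * v i) * X k l * (\<Sum>j\<in>I. cnj (u j l) * v j))"
    unfolding cnj_sum complex_cnj_mult complex_cnj_cnj sum_distrib_left sum_distrib_right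
    by (rule sum.cong[OF refl], rule sum.cong[OF refl], rule trans[OF sum.swap],
        rule sum.cong[OF refl], rule sum.cong[OF refl], simp only: mult_ac)
  finally show ?thesis .
qed

lemma psd_on_conj: "psd_on I X \<Longrightarrow> psd_on I (conj_on I u X)"
  unfolding psd_on_def form_conj_on by (rule allI) (erule allE)

lemma mm_diagm_diagm: "finite I \<Longrightarrow> meq I I (mm I (diagm d) (diagm e)) (diagm (\<lambda>i. d i * e i))"
  by (rule meqI) (simp add: mm_diagm_left, simp add: diagm_def)

text \<open>All clauses are verified in an eigenbasis of \<open>K\<close>, where \<open>Z\<close> is
  diagonal with a function of the eigenvalue as entries.\<close>

lemma inv_root_exists:
  assumes I: "finite I" and K: "hermitian_on I K" and psd: "psd_on I K"
  shows "\<exists>Z. is_inv_root I K Z"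
proof -
  obtain V and l :: "_ \<Rightarrow> real" where V: "unitary_on I V"
    and KV: "\<And>i j. i \<in> I \<Longrightarrow> j \<in> I \<Longrightarrow> K i j = (\<Sum>k\<in>I. of_real (l k) * V i k * cnj (V j k))"
    using spectral_on[OF I K] by blast
  note V' = unitary_on_adj[OF V]
  have VV: "(\<Sum>i\<in>I. cnj (V i k) * V i l) = idm k l" "(\<Sum>i\<in>I. V k i * cnj (V l i)) = idm k l" if "k \<in> I" "l \<in> I" for k l
    using unitary_onD[OF V] that by (simp_all add: meq_def mm_def adj_def)
  define L where "L = (diagm (\<lambda>k. of_real (l k)) :: _ \<Rightarrow> _ \<Rightarrow> complex)"
  have KL: "meq I I (conj_on I V L) K"
  proof (rule meqI)
    fix i j assume ij: "i \<in> I" "j \<in> I"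
    have "conj_on I V L i j = (\<Sum>k\<in>I. V i k * mm I L (adj V) k j)"
      by (simp add: conj_on_def mm_def)
    also have "\<dots> = K i j"
      unfolding KV[OF ij] using I by (intro sum.cong refl) (simp add: L_def mm_diagm_left adj_def)
    finally show "conj_on I V L i j = K i j" .
  qed
  have ev: "(\<Sum>j\<in>I. K i j * V j k) = of_real (l k) * V i k" if "i \<in> I" "k \<in> I" for i k
  proof -
    have "(\<Sum>j\<in>I. K i j * V j k) = (\<Sum>j\<in>I. \<Sum>m\<in>I. of_real (l m) * V i m * (cnj (V j m) * V j k))"
      using that by (intro sum.cong refl) (simp add: KV sum_distrib_right mult.assoc)
    also have "\<dots> = (\<Sum>m\<in>I. of_real (l m) * V i m * idm m k)"
      using that VV(1) by (subst sum.swap) (simp add: sum_distrib_left[symmetric])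
    also have "\<dots> = of_real (l k) * V i k"
      using I that by (simp add: idm_def if_distrib[where f="\<lambda>x. _ * x"] cong: if_cong)
    finally show ?thesis .
  qed
  have lpos: "l k \<ge> 0" if k: "k \<in> I" for k
  proof -
    have "0 \<le> (\<Sum>i\<in>I. \<Sum>j\<in>I. cnj (V i k) * K i j * V j k)"
      using psd by (simp add: psd_on_def)
    also have "\<dots> = (\<Sum>i\<in>I. cnj (V i k) * (of_real (l k) * V i k))"
      using ev k by (simp add: sum_distrib_left[symmetric] mult.assoc)
    also have "\<dots> = of_real (l k) * (\<Sum>i\<in>I. cnj (V i k) * V i k)"
      by (simp add: sum_distrib_left mult_ac)
    also have "\<dots> = of_real (l k)" using VV(1)[OF k k] by (simp add: idm_def)
    finally show ?thesis by (simp add: less_eq_complex_def)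
  qed
  \<comment> \<open>Since \<open>1 / sqrt 0\<close> is 0, \<open>Z\<close> vanishes on the kernel
    without a case distinction.\<close>
  define f where "f = (\<lambda>k. 1 / sqrt (l k))"
  have lf: "l k * (f k * f k) = (if l k = 0 then 0 else 1)" if "k \<in> I" for k
    using lpos[OF that] by (simp add: f_def)
  define F where "F = (diagm (\<lambda>k. of_real (f k)) :: _ \<Rightarrow> _ \<Rightarrow> complex)"
  define Z where "Z = conj_on I V F"
  have herm: "hermitian_on I Z"
  proof -
    have "adj F = F" by (auto simp: F_def adj_def diagm_def fun_eq_iff)
    then have "adj Z = Z" by (simp add: Z_def conj_on_def adj_mm mm_assoc)
    then show ?thesis by (simp add: hermitian_on_def)
  qed
  have comm: "commute_on I L (conj_on I (adj V) B)" if "commute_on I K B" for B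
  proof -
    have "commute_on I (conj_on I (adj V) K) (conj_on I (adj V) B)"
      by (rule commute_on_conj[OF I V' that])
    moreover have "meq I I (conj_on I (adj V) K) L"
      by (rule meq_trans[OF conj_on_cong[OF meq_sym[OF KL]]])
         (use conj_on_inverse[OF I V', of L] in simp)
    ultimately show ?thesis using commute_on_cong[OF _ meq_refl] by blast
  qed
  \<comment> \<open>An operator that commutes with \<open>K\<close> connects only equal eigenvalues,
    on which functions of the eigenvalue agree.\<close>
  have supp: "conj_on I (adj V) B i j = 0 \<or> l i = l j" if "commute_on I K B" "i \<in> I" "j \<in> I" for B i j
  proof -
    have "of_real (l i) * conj_on I (adj V) B i j = conj_on I (adj V) B i j * of_real (l j)"
      using comm[OF that(1)] that I by (simp add: commute_on_def meq_def L_def mm_diagm_left mm_diagm_right)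
    then show ?thesis by (auto simp: mult.commute)
  qed
  have reconj: "meq I I (conj_on I V (conj_on I (adj V) B)) B" for B
    by (rule conj_on_inverse[OF I V])
  have 2: "commute_on I Z B" if B: "commute_on I K B" for B
  proof -
    have "commute_on I F (conj_on I (adj V) B)"
      unfolding commute_on_def
    proof (rule meqI)
      fix i j assume ij: "i \<in> I" "j \<in> I"
      show "mm I F (conj_on I (adj V) B) i j = mm I (conj_on I (adj V) B) F i j"
        using supp[OF B ij] ij I by (auto simp: F_def mm_diagm_left mm_diagm_right f_def)
    qed
    then have "commute_on I Z (conj_on I V (conj_on I (adj V) B))"
      unfolding Z_def by (rule commute_on_conj[OF I V])
    then show ?thesis by (rule commute_on_cong[OF meq_refl reconj])
  qed
  have KZZ: "meq I I (mm I K (mm I Z Z)) (conj_on I V (diagm (\<lambda>k. of_real (l k * (f k * f k)))))"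
  proof -
    have "meq I I (mm I Z Z) (conj_on I V (mm I F F))"
      unfolding Z_def by (rule conj_on_mult[OF I V])
    then have "meq I I (mm I K (mm I Z Z)) (mm I (conj_on I V L) (conj_on I V (mm I F F)))"
      by (rule mm_cong[OF meq_sym[OF KL]])
    then have 1: "meq I I (mm I K (mm I Z Z)) (conj_on I V (mm I L (mm I F F)))"
      using conj_on_mult[OF I V] by (rule meq_trans)
    have "meq I I (mm I L (mm I F F)) (mm I L (diagm (\<lambda>k. of_real (f k) * of_real (f k))))"
      unfolding F_def by (rule mm_cong[OF meq_refl mm_diagm_diagm[OF I]])
    then have "meq I I (mm I L (mm I F F)) (diagm (\<lambda>k. of_real (l k) * (of_real (f k) * of_real (f k))))"
      unfolding L_def using mm_diagm_diagm[OF I] by (rule meq_trans)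
    then show ?thesis using meq_trans[OF 1 conj_on_cong] by simp
  qed
  have 3: "(\<Sum>i\<in>I. x i * mm I K (mm I Z Z) i j) = x j"
    if x: "\<forall>v. (\<forall>i\<in>I. (\<Sum>j\<in>I. K i j * v j) = 0) \<longrightarrow> (\<Sum>j\<in>I. x j * v j) = 0" and j: "j \<in> I" for x j
  proof -
    define x' where "x' = (\<lambda>k. \<Sum>i\<in>I. x i * V i k)"
    \<comment> \<open>Eigenvectors of eigenvalue 0 lie in the kernel, so \<open>x\<close> has no
      component along them.\<close>
    have x'0: "x' k = 0" if "k \<in> I" "l k = 0" for k
      using x[rule_format, of "\<lambda>j. V j k"] ev that by (simp add: x'_def)
    have "(\<Sum>i\<in>I. x i * mm I K (mm I Z Z) i j)
        = (\<Sum>i\<in>I. x i * (\<Sum>k\<in>I. V i k * (of_real (l k * (f k * f k)) * cnj (V j k))))"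
    proof (rule sum.cong[OF refl])
      fix i assume i: "i \<in> I"
      have "mm I K (mm I Z Z) i j = conj_on I V (diagm (\<lambda>k. of_real (l k * (f k * f k)))) i j"
        by (rule meqD[OF KZZ i j])
      also have "\<dots> = (\<Sum>k\<in>I. V i k * mm I (diagm (\<lambda>k. of_real (l k * (f k * f k)))) (adj V) k j)"
        by (simp add: conj_on_def mm_def)
      also have "\<dots> = (\<Sum>k\<in>I. V i k * (of_real (l k * (f k * f k)) * cnj (V j k)))"
        using I by (intro sum.cong refl) (simp add: mm_diagm_left adj_def)
      finally show "x i * mm I K (mm I Z Z) i j = x i * (\<Sum>k\<in>I. V i k * (of_real (l k * (f k * f k)) * cnj (V j k)))"
        by simp
    qed
    also have "\<dots> = (\<Sum>k\<in>I. x' k * (of_real (l k * (f k * f k)) * cnj (V j k)))"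
      unfolding x'_def sum_distrib_left sum_distrib_right mult.assoc by (rule sum.swap)
    also have "\<dots> = (\<Sum>k\<in>I. x' k * cnj (V j k))"
    proof (rule sum.cong[OF refl])
      fix k assume "k \<in> I"
      then show "x' k * (of_real (l k * (f k * f k)) * cnj (V j k)) = x' k * cnj (V j k)"
        using x'0[of k] by (cases "l k = 0") (simp_all only: lf, simp_all)
    qed
    also have "\<dots> = (\<Sum>i\<in>I. x i * idm i j)"
      unfolding x'_def sum_distrib_left sum_distrib_right mult.assoc
      using VV(2) j by (subst sum.swap) (simp add: sum_distrib_left[symmetric])
    also have "\<dots> = x j"
      using I j by (simp add: idm_def if_distrib[where f="\<lambda>x. _ * x"] cong: if_cong)
    finally show ?thesis .
  qed
  have 4: "psd_on I (\<lambda>i j. B i j - mm I Z (mm I (mm I B K) Z) i j)" if B: "psd_on I B" "commute_on I K B" for B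
  proof -
    define B' where "B' = conj_on I (adj V) B"
    have pB': "psd_on I B'" unfolding B'_def by (rule psd_on_conj[OF B(1)])
    \<comment> \<open>The compression of \<open>B\<close> to the kernel of \<open>K\<close>: this is
      exactly what \<open>Z B K Z\<close> loses, and it inherits positivity from
      \<open>B\<close>.\<close>
    define C where "C = (\<lambda>i j. if l i = 0 \<and> l j = 0 then B' i j else 0)"
    have psdC: "psd_on I C"
      unfolding psd_on_def
    proof
      fix v
      have "(\<Sum>i\<in>I. \<Sum>j\<in>I. cnj (v i) * C i j * v j)
         = (\<Sum>i\<in>I. \<Sum>j\<in>I. cnj (if l i = 0 then v i else 0) * B' i j * (if l j = 0 then v j else 0))"
        by (intro sum.cong refl) (simp add: C_def)
      then show "0 \<le> (\<Sum>i\<in>I. \<Sum>j\<in>I. cnj (v i) * C i j * v j)"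
        using pB' unfolding psd_on_def by simp
    qed
    have ZBKZ: "meq I I (mm I Z (mm I (mm I B K) Z)) (conj_on I V (mm I F (mm I (mm I B' L) F)))"
    proof -
      have "meq I I (mm I B K) (conj_on I V (mm I B' L))"
        by (rule meq_trans[OF mm_cong[OF meq_sym[OF reconj] meq_sym[OF KL]]])
           (unfold B'_def, rule conj_on_mult[OF I V])
      then have "meq I I (mm I (mm I B K) Z) (conj_on I V (mm I (mm I B' L) F))"
        unfolding Z_def by (rule meq_trans[OF mm_cong[OF _ meq_refl] conj_on_mult[OF I V]])
      then show ?thesis
        unfolding Z_def by (rule meq_trans[OF mm_cong[OF meq_refl] conj_on_mult[OF I V]])
    qed
    have ent: "mm I F (mm I (mm I B' L) F) i j = B' i j - C i j" if ij: "i \<in> I" "j \<in> I" for i j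
    proof -
      have "mm I F (mm I (mm I B' L) F) i j = of_real (f i) * (B' i j * of_real (l j) * of_real (f j))"
        using ij I by (simp add: F_def L_def mm_diagm_left mm_diagm_right)
      also have "\<dots> = B' i j - C i j"
      proof (cases "B' i j = 0")
        case False
        then have lij: "l i = l j" using supp[OF B(2) ij] by (simp add: B'_def)
        then have "f i = f j" by (simp add: f_def)
        then have "of_real (f i) * (B' i j * of_real (l j) * of_real (f j)) = B' i j * of_real (l j * (f j * f j))"
          by simp
        also have "\<dots> = B' i j * of_real (if l j = 0 then 0 else 1)" by (simp only: lf[OF ij(2)])
        also have "\<dots> = B' i j - C i j" using lij by (simp add: C_def)
        finally show ?thesis .
      qed (simp add: C_def)
      finally show ?thesis .
    qed
    have "psd_on I (conj_on I V C)" by (rule psd_on_conj[OF psdC])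
    moreover have "meq I I (conj_on I V C) (\<lambda>i j. B i j - mm I Z (mm I (mm I B K) Z) i j)"
    proof (rule meqI)
      fix i j assume ij: "i \<in> I" "j \<in> I"
      have "meq I I C (\<lambda>i j. B' i j - mm I F (mm I (mm I B' L) F) i j)"
        using ent by (simp add: meq_def)
      then have "conj_on I V C i j = conj_on I V (\<lambda>i j. B' i j - mm I F (mm I (mm I B' L) F) i j) i j"
        by (rule meqD[OF conj_on_cong ij])
      also have "\<dots> = conj_on I V B' i j - conj_on I V (mm I F (mm I (mm I B' L) F)) i j"
        unfolding conj_on_def mm_def[of I V] mm_def[of I _ "adj V"]
        by (simp add: left_diff_distrib right_diff_distrib sum_subtractf)
      also have "\<dots> = B i j - mm I Z (mm I (mm I B K) Z) i j"
        using meqD[OF reconj ij, of B] meqD[OF ZBKZ ij] by (simp add: B'_def)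
      finally show "conj_on I V C i j = B i j - mm I Z (mm I (mm I B K) Z) i j" .
    qed
    ultimately show ?thesis using psd_on_cong by blast
  qed
  show ?thesis
    unfolding is_inv_root_def using herm 2 3 4 by blast
qed

text \<open>A central element of the group algebra. On the isotypic component of an irreducible
  representation of the symmetric group it is the scalar given by the multiplicity of that
  representation over \<open>R\<close>, divided by its dimension; its kernel collects the components
  that do not occur over \<open>R\<close>.\<close>

definition kop :: "nat \<Rightarrow> 'r set \<Rightarrow> 'm list \<Rightarrow> 'm list \<Rightarrow> complex" where
  "kop n R a a' = (\<Sum>s\<in>perms n. of_bool (a = pl s a') * fixc n R s) / fact n"

lemma cnj_of_bool [simp]: "cnj (of_bool P) = of_bool P"
  by simp

lemma cnj_fixc [simp]: "cnj (fixc n R s) = fixc n R s"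
  by (simp add: fixc_def)

lemma kop_sym:
  assumes "a \<in> tup n A" "a' \<in> tup n A"
  shows "kop n R a' a = kop n R a a'"
proof -
  have "(\<Sum>s\<in>perms n. of_bool (a' = pl s a) * fixc n R s) = (\<Sum>s\<in>perms n. of_bool (a = pl (pinv s) a') * fixc n R (pinv s))"
  proof (rule sum.cong[OF refl])
    fix s assume s: "s \<in> perms n"
    then show "of_bool (a' = pl s a) * fixc n R s = of_bool (a = pl (pinv s) a') * fixc n R (pinv s)"
      using pl_eq_iff[OF s assms(2,1)] by (simp add: fixc_inv[OF s])
  qed
  also have "\<dots> = (\<Sum>s\<in>perms n. of_bool (a = pl s a') * fixc n R s)"
    by (rule sum_perms_inv)
  finally show ?thesis by (simp add: kop_def)
qed

lemma hermitian_on_kop: "hermitian_on (tup n A) (kop n R)"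
proof -
  have "cnj (kop n R a a') = kop n R a a'" for a a' by (simp add: kop_def)
  then show ?thesis unfolding hermitian_on_def adj_def by (intro meqI) (simp add: kop_sym[of _ n A])
qed

lemma sum_kop:
  assumes A: "finite A" and a': "a' \<in> tup n A"
  shows "(\<Sum>a\<in>tup n A. f a * kop n R a a') = (\<Sum>s\<in>perms n. fixc n R s * f (pl s a')) / fact n"
proof -
  have "(\<Sum>a\<in>tup n A. f a * kop n R a a') = (\<Sum>a\<in>tup n A. \<Sum>s\<in>perms n. of_bool (a = pl s a') * (f a * fixc n R s)) / fact n"
    unfolding kop_def sum_divide_distrib sum_distrib_left times_divide_eq_right
    by (intro sum.cong refl) (simp only: mult_ac)
  also have "(\<Sum>a\<in>tup n A. \<Sum>s\<in>perms n. of_bool (a = pl s a') * (f a * fixc n R s))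
      = (\<Sum>s\<in>perms n. \<Sum>a\<in>tup n A. of_bool (a = pl s a') * (f a * fixc n R s))" by (rule sum.swap)
  also have "\<dots> = (\<Sum>s\<in>perms n. fixc n R s * f (pl s a'))"
  proof (rule sum.cong[OF refl])
    fix s assume "s \<in> perms n"
    then have "pl s a' \<in> tup n A" using a' by (rule pl_tup)
    then show "(\<Sum>a\<in>tup n A. of_bool (a = pl s a') * (f a * fixc n R s)) = fixc n R s * f (pl s a')"
      using A by (simp add: of_bool_def if_distrib[where f="\<lambda>x. x * _"] cong: if_cong)
  qed
  finally show ?thesis .
qed

text \<open>Up to the factor \<open>fact n\<close> the projection of \<open>v\<close> tensored with
  the basis vector \<open>b0\<close> onto the symmetric vectors.\<close>

definition pert :: "nat \<Rightarrow> ('m list \<Rightarrow> complex) \<Rightarrow> 'r list \<Rightarrow> 'm list \<Rightarrow> 'r list \<Rightarrow> complex" where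
  "pert n v b0 a b = (\<Sum>s\<in>perms n. v (pl s a) * of_bool (b0 = pl s b))"

text \<open>A sum of squares for the quadratic form of \<open>kop\<close>. It yields positivity, and
  it identifies the kernel as the vectors whose symmetrisations with all \<open>b0\<close>
  vanish.\<close>

lemma pert_norm:
  assumes A: "finite A" and R: "finite R"
  shows "(\<Sum>b0\<in>tup n R. \<Sum>a\<in>tup n A. \<Sum>b\<in>tup n R. pert n v b0 a b * cnj (pert n v b0 a b))
    = fact n * fact n * (\<Sum>a\<in>tup n A. \<Sum>a'\<in>tup n A. cnj (v a) * kop n R a a' * v a')"
proof -
  have one: "(\<Sum>a\<in>tup n A. \<Sum>b\<in>tup n R. pert n v b0 a b * cnj (pert n v b0 a b))
      = fact n * (\<Sum>s\<in>perms n. of_bool (b0 = pl s b0) * (\<Sum>a\<in>tup n A. v a * cnj (v (pl s a))))"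
    if b0: "b0 \<in> tup n R" for b0
  proof -
    have "(\<Sum>a\<in>tup n A. \<Sum>b\<in>tup n R. pert n v b0 a b * cnj (pert n v b0 a b))
      = (\<Sum>a\<in>tup n A. \<Sum>b\<in>tup n R. \<Sum>p\<in>perms n. \<Sum>q\<in>perms n. (v (pl p a) * cnj (v (pl q a))) * (of_bool (b0 = pl p b) * of_bool (b0 = pl q b)))"
      unfolding pert_def cnj_sum sum_product
      by (intro sum.cong refl) (simp only: complex_cnj_mult cnj_of_bool mult_ac)
    also have "\<dots> = (\<Sum>p\<in>perms n. \<Sum>q\<in>perms n. \<Sum>a\<in>tup n A. \<Sum>b\<in>tup n R. (v (pl p a) * cnj (v (pl q a))) * (of_bool (b0 = pl p b) * of_bool (b0 = pl q b)))"
      by (simp only: sum.swap[of _ "tup n A" "perms n"] sum.swap[of _ "tup n R" "perms n"])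
    also have "\<dots> = (\<Sum>p\<in>perms n. \<Sum>q\<in>perms n. of_bool (b0 = pl (pinv p \<circ> q) b0) * (\<Sum>a\<in>tup n A. v a * cnj (v (pl (pinv p \<circ> q) a))))"
    proof (rule sum.cong[OF refl], rule sum.cong[OF refl])
      fix p q assume p: "p \<in> perms n" and q: "q \<in> perms n"
      have cA: "pl q x = pl (pinv p \<circ> q) (pl p x)" if "x \<in> tup n A" for x
        using pl_comp[OF perms_inv[OF p] q pl_tup[OF p that]] pl_inv2[OF p that] by simp
      have cR: "pl q x = pl (pinv p \<circ> q) (pl p x)" if "x \<in> tup n R" for x
        using pl_comp[OF perms_inv[OF p] q pl_tup[OF p that]] pl_inv2[OF p that] by simp
      have "(\<Sum>a\<in>tup n A. \<Sum>b\<in>tup n R. (v (pl p a) * cnj (v (pl q a))) * (of_bool (b0 = pl p b) * of_bool (b0 = pl q b)))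
         = (\<Sum>a\<in>tup n A. v (pl p a) * cnj (v (pl (pinv p \<circ> q) (pl p a)))) * (\<Sum>b\<in>tup n R. of_bool (b0 = pl p b) * of_bool (b0 = pl (pinv p \<circ> q) (pl p b)))"
        unfolding sum_product by (intro sum.cong refl) (simp only: cA cR)
      also have "(\<Sum>a\<in>tup n A. v (pl p a) * cnj (v (pl (pinv p \<circ> q) (pl p a)))) = (\<Sum>a\<in>tup n A. v a * cnj (v (pl (pinv p \<circ> q) a)))"
        by (rule sum_pl[OF p])
      also have "(\<Sum>b\<in>tup n R. of_bool (b0 = pl p b) * of_bool (b0 = pl (pinv p \<circ> q) (pl p b)) :: complex)
          = (\<Sum>b\<in>tup n R. of_bool (b0 = b) * of_bool (b0 = pl (pinv p \<circ> q) b))"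
        by (rule sum_pl[OF p])
      also have "\<dots> = of_bool (b0 = pl (pinv p \<circ> q) b0)"
        using R b0 by (simp add: of_bool_def if_distrib[where f="\<lambda>x. x * _"] cong: if_cong)
      finally show "(\<Sum>a\<in>tup n A. \<Sum>b\<in>tup n R. (v (pl p a) * cnj (v (pl q a))) * (of_bool (b0 = pl p b) * of_bool (b0 = pl q b)))
         = of_bool (b0 = pl (pinv p \<circ> q) b0) * (\<Sum>a\<in>tup n A. v a * cnj (v (pl (pinv p \<circ> q) a)))"
        by (simp only: mult.commute)
    qed
    also have "\<dots> = (\<Sum>p\<in>perms n. \<Sum>s\<in>perms n. of_bool (b0 = pl s b0) * (\<Sum>a\<in>tup n A. v a * cnj (v (pl s a))))"
      by (intro sum.cong refl sum_perms_left perms_inv)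
    finally show ?thesis by (simp add: card_perms)
  qed
  have "(\<Sum>b0\<in>tup n R. \<Sum>a\<in>tup n A. \<Sum>b\<in>tup n R. pert n v b0 a b * cnj (pert n v b0 a b))
      = fact n * (\<Sum>s\<in>perms n. fixc n R s * (\<Sum>a\<in>tup n A. v a * cnj (v (pl s a))))"
  proof -
    have "(\<Sum>b0\<in>tup n R. \<Sum>a\<in>tup n A. \<Sum>b\<in>tup n R. pert n v b0 a b * cnj (pert n v b0 a b))
      = (\<Sum>b0\<in>tup n R. fact n * (\<Sum>s\<in>perms n. of_bool (b0 = pl s b0) * (\<Sum>a\<in>tup n A. v a * cnj (v (pl s a)))))"
      by (intro sum.cong refl one)
    also have "\<dots> = fact n * (\<Sum>s\<in>perms n. fixc n R s * (\<Sum>a\<in>tup n A. v a * cnj (v (pl s a))))"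
      unfolding fixc_def sum_distrib_left[symmetric] sum_distrib_right
      by (rule arg_cong[where f="\<lambda>x. fact n * x"], rule sum.swap)
    finally show ?thesis .
  qed
  also have "(\<Sum>s\<in>perms n. fixc n R s * (\<Sum>a\<in>tup n A. v a * cnj (v (pl s a))))
      = (\<Sum>a'\<in>tup n A. v a' * (\<Sum>s\<in>perms n. fixc n R s * cnj (v (pl s a'))))"
    unfolding sum_distrib_left by (rule trans[OF sum.swap], rule sum.cong[OF refl], rule sum.cong[OF refl], simp only: mult_ac)
  also have "\<dots> = (\<Sum>a'\<in>tup n A. v a' * (fact n * (\<Sum>a\<in>tup n A. cnj (v a) * kop n R a a')))"
    by (intro sum.cong refl) (simp add: sum_kop[OF A])
  also have "fact n * \<dots> = fact n * fact n * (\<Sum>a\<in>tup n A. \<Sum>a'\<in>tup n A. cnj (v a) * kop n R a a' * v a')"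
  proof -
    have "(\<Sum>a'\<in>tup n A. v a' * (fact n * (\<Sum>a\<in>tup n A. cnj (v a) * kop n R a a')))
        = fact n * (\<Sum>a'\<in>tup n A. \<Sum>a\<in>tup n A. cnj (v a) * kop n R a a' * v a')"
      unfolding sum_distrib_left by (intro sum.cong refl) (simp only: mult_ac)
    also have "(\<Sum>a'\<in>tup n A. \<Sum>a\<in>tup n A. cnj (v a) * kop n R a a' * v a') = (\<Sum>a\<in>tup n A. \<Sum>a'\<in>tup n A. cnj (v a) * kop n R a a' * v a')"
      by (rule sum.swap)
    finally show ?thesis by (simp only: mult.assoc)
  qed
  finally show ?thesis .
qed

lemma psd_on_kop:
  assumes A: "finite A" and R: "finite R"
  shows "psd_on (tup n A) (kop n R)"
  unfolding psd_on_def
proof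
  fix v
  have "0 \<le> (\<Sum>b0\<in>tup n R. \<Sum>a\<in>tup n A. \<Sum>b\<in>tup n R. pert n v b0 a b * cnj (pert n v b0 a b))"
    by (intro sum_nonneg) (simp add: less_eq_complex_def)
  then have "0 \<le> complex_of_real (fact n * fact n) * (\<Sum>a\<in>tup n A. \<Sum>a'\<in>tup n A. cnj (v a) * kop n R a a' * v a')"
    unfolding pert_norm[OF A R] by simp
  moreover have "0 \<le> w" if "0 \<le> complex_of_real (fact n * fact n) * w" for w
  proof -
    have "0 < (fact n * fact n :: real)" by simp
    then show ?thesis using that by (auto simp: less_eq_complex_def zero_le_mult_iff simp del: fact_gt_zero)
  qed
  ultimately show "0 \<le> (\<Sum>a\<in>tup n A. \<Sum>a'\<in>tup n A. cnj (v a) * kop n R a a' * v a')"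
    by blast
qed

text \<open>A symmetric \<open>\<Psi>\<close> pairs with \<open>v\<close> tensored with
  \<open>b0\<close> in the same way as with its symmetrisation, which is 0 for \<open>v\<close> in
  the kernel. So rows of symmetric vectors satisfy the support condition in
  \<open>is_inv_root\<close>.\<close>

lemma kop_kernel:
  assumes A: "finite A" and R: "finite R"
    and v: "\<And>a. a \<in> tup n A \<Longrightarrow> (\<Sum>a'\<in>tup n A. kop n R a a' * v a') = 0"
    and sy: "symm_on n A R \<Psi>" and b0: "b0 \<in> tup n R"
  shows "(\<Sum>a\<in>tup n A. \<Psi> a b0 * v a) = 0"
proof -
  have "(\<Sum>a\<in>tup n A. \<Sum>a'\<in>tup n A. cnj (v a) * kop n R a a' * v a') = 0"
    using v by (simp add: mult.assoc sum_distrib_left[symmetric])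
  then have z: "(\<Sum>b0\<in>tup n R. \<Sum>a\<in>tup n A. \<Sum>b\<in>tup n R. pert n v b0 a b * cnj (pert n v b0 a b)) = 0"
    by (simp add: pert_norm[OF A R])
  have "of_real (\<Sum>b0\<in>tup n R. \<Sum>a\<in>tup n A. \<Sum>b\<in>tup n R. (cmod (pert n v b0 a b))\<^sup>2) = (0 :: complex)"
    unfolding of_real_sum complex_norm_square by (rule z)
  then have "(\<Sum>b0\<in>tup n R. \<Sum>a\<in>tup n A. \<Sum>b\<in>tup n R. (cmod (pert n v b0 a b))\<^sup>2) = 0"
    by (rule of_real_eq_0_iff[THEN iffD1])
  then have w: "pert n v b0 a b = 0" if "a \<in> tup n A" "b \<in> tup n R" for a b
    using that b0 A R by (simp add: sum_nonneg_eq_0_iff sum_nonneg)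
  have "0 = (\<Sum>a\<in>tup n A. \<Sum>b\<in>tup n R. \<Psi> a b * pert n v b0 a b)" by (simp add: w)
  also have "\<dots> = (\<Sum>a\<in>tup n A. \<Sum>b\<in>tup n R. \<Sum>s\<in>perms n. \<Psi> a b * v (pl s a) * of_bool (b0 = pl s b))"
    unfolding pert_def sum_distrib_left by (simp only: mult.assoc)
  also have "\<dots> = (\<Sum>s\<in>perms n. \<Sum>a\<in>tup n A. \<Sum>b\<in>tup n R. \<Psi> a b * v (pl s a) * of_bool (b0 = pl s b))"
    by (simp only: sum.swap[of _ "tup n A" "perms n"] sum.swap[of _ "tup n R" "perms n"])
  also have "\<dots> = (\<Sum>s\<in>perms n. \<Sum>a\<in>tup n A. \<Psi> a b0 * v a)"
  proof (rule sum.cong[OF refl])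
    fix s assume s: "s \<in> perms n"
    have "(\<Sum>a\<in>tup n A. \<Sum>b\<in>tup n R. \<Psi> a b * v (pl s a) * of_bool (b0 = pl s b))
       = (\<Sum>a\<in>tup n A. \<Sum>b\<in>tup n R. \<Psi> (pl s a) (pl s b) * v (pl s a) * of_bool (b0 = pl s b))"
      using sy s by (intro sum.cong refl) (simp add: symm_on_def)
    also have "\<dots> = (\<Sum>a\<in>tup n A. \<Sum>b\<in>tup n R. \<Psi> (pl s a) b * v (pl s a) * of_bool (b0 = b))"
      by (rule sum.cong[OF refl], rule sum_pl[OF s])
    also have "\<dots> = (\<Sum>a\<in>tup n A. \<Sum>b\<in>tup n R. \<Psi> a b * v a * of_bool (b0 = b))"
      by (rule sum_pl[OF s])
    also have "\<dots> = (\<Sum>a\<in>tup n A. \<Psi> a b0 * v a)"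
      using R b0 by (simp add: of_bool_def if_distrib[where f="\<lambda>x. _ * x"] cong: if_cong)
    finally show "(\<Sum>a\<in>tup n A. \<Sum>b\<in>tup n R. \<Psi> a b * v (pl s a) * of_bool (b0 = pl s b)) = (\<Sum>a\<in>tup n A. \<Psi> a b0 * v a)" .
  qed
  finally show ?thesis by (simp add: card_perms)
qed

definition perm_mat :: "(nat \<Rightarrow> nat) \<Rightarrow> 'm list \<Rightarrow> 'm list \<Rightarrow> complex" where
  "perm_mat s = (\<lambda>a a'. of_bool (a = pl s a'))"

lemma mm_perm_mat_left:
  assumes A: "finite A" and s: "s \<in> perms n" and a: "a \<in> tup n A"
  shows "mm (tup n A) (perm_mat s) B a a' = B (pl (pinv s) a) a'"
  using sum_delta_pl[OF s A a, of "\<lambda>x. B x a'"] by (simp add: mm_def perm_mat_def)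

lemma mm_perm_mat_right:
  assumes A: "finite A" and s: "s \<in> perms n" and a': "a' \<in> tup n A"
  shows "mm (tup n A) B (perm_mat s) a a' = B a (pl s a')"
  using A pl_tup[OF s a']
  by (simp add: mm_def perm_mat_def of_bool_def if_distrib[where f="\<lambda>x. _ * x"] cong: if_cong)

lemma commute_on_perm_mat:
  assumes A: "finite A" and s: "s \<in> perms n"
  shows "commute_on (tup n A) B (perm_mat s) \<longleftrightarrow> (\<forall>a\<in>tup n A. \<forall>a'\<in>tup n A. B (pl s a) (pl s a') = B a a')"
proof
  assume L: "commute_on (tup n A) B (perm_mat s)"
  show "\<forall>a\<in>tup n A. \<forall>a'\<in>tup n A. B (pl s a) (pl s a') = B a a'"
  proof (intro ballI)
    fix a a' assume a: "a \<in> tup n A" "a' \<in> tup n A"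
    have "mm (tup n A) B (perm_mat s) (pl s a) a' = mm (tup n A) (perm_mat s) B (pl s a) a'"
      using L a pl_tup[OF s a(1)] by (auto simp: commute_on_def meq_def)
    then show "B (pl s a) (pl s a') = B a a'"
      using mm_perm_mat_left[OF A s pl_tup[OF s a(1)], of B a'] mm_perm_mat_right[OF A s a(2), of B "pl s a"] pl_inv2[OF s a(1)]
      by simp
  qed
next
  assume Rr: "\<forall>a\<in>tup n A. \<forall>a'\<in>tup n A. B (pl s a) (pl s a') = B a a'"
  show "commute_on (tup n A) B (perm_mat s)"
    unfolding commute_on_def
  proof (rule meqI)
    fix a a' assume a: "a \<in> tup n A" "a' \<in> tup n A"
    have "B a (pl s a') = B (pl (pinv s) a) a'"
      using Rr[rule_format, of "pl (pinv s) a" a'] a pl_tup[OF perms_inv[OF s] a(1)] pl_inv1[OF s a(1)] by simp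
    then show "mm (tup n A) B (perm_mat s) a a' = mm (tup n A) (perm_mat s) B a a'"
      using mm_perm_mat_left[OF A s a(1), of B a'] mm_perm_mat_right[OF A s a(2), of B a] by simp
  qed
qed

lemma commute_on_kop:
  assumes A: "finite A"
    and B: "\<And>s a a'. s \<in> perms n \<Longrightarrow> a \<in> tup n A \<Longrightarrow> a' \<in> tup n A \<Longrightarrow> B (pl s a) (pl s a') = B a a'"
  shows "commute_on (tup n A) (kop n R) B"
  unfolding commute_on_def
proof (rule meqI)
  fix a a' assume a: "a \<in> tup n A" "a' \<in> tup n A"
  have "mm (tup n A) (kop n R) B a a' = (\<Sum>x\<in>tup n A. B x a' * kop n R x a)"
    unfolding mm_def using a by (intro sum.cong refl) (simp add: kop_sym[of _ n A] mult.commute)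
  also have "\<dots> = (\<Sum>s\<in>perms n. fixc n R s * B (pl s a) a') / fact n" by (rule sum_kop[OF A a(1)])
  also have "(\<Sum>s\<in>perms n. fixc n R s * B (pl s a) a') = (\<Sum>s\<in>perms n. fixc n R (pinv s) * B a (pl (pinv s) a'))"
  proof (rule sum.cong[OF refl])
    fix s assume s: "s \<in> perms n"
    show "fixc n R s * B (pl s a) a' = fixc n R (pinv s) * B a (pl (pinv s) a')"
      using B[OF s a(1) pl_tup[OF perms_inv[OF s] a(2)]] pl_inv1[OF s a(2)] by (simp add: fixc_inv[OF s])
  qed
  also have "\<dots> = (\<Sum>s\<in>perms n. fixc n R s * B a (pl s a'))" by (rule sum_perms_inv)
  also have "\<dots> / fact n = (\<Sum>x\<in>tup n A. B a x * kop n R x a')" by (rule sum_kop[OF A a(2), symmetric])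
  finally show "mm (tup n A) (kop n R) B a a' = mm (tup n A) B (kop n R) a a'" by (simp add: mm_def)
qed

text \<open>Because \<open>fixc\<close> is invariant under conjugation, \<open>s\<close> only
  relabels the sum over permutations.\<close>

lemma kop_perm:
  assumes s: "s \<in> perms n" and a: "a \<in> tup n A" "a' \<in> tup n A"
  shows "kop n R (pl s a) (pl s a') = kop n R a a'"
proof -
  have fx: "fixc n R (s \<circ> t \<circ> pinv s) = fixc n R t" if t: "t \<in> perms n" for t
  proof -
    have "fixc n R (s \<circ> t \<circ> pinv s) = (\<Sum>b\<in>tup n R. of_bool (pl s b = pl s b \<and> b = pl (s \<circ> t \<circ> pinv s) b))"
      by (simp add: fixc_def)
    also have "\<dots> = (\<Sum>b\<in>tup n R. of_bool (pl s b = pl t (pl s b)))"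
    proof (intro sum.cong refl arg_cong[where f=of_bool])
      fix b assume b: "b \<in> tup n R"
      have "pl (s \<circ> t \<circ> pinv s) b = pl (pinv s) (pl t (pl s b))"
        using pl_comp[OF perms_comp[OF s t] perms_inv[OF s] b] pl_comp[OF s t b] by simp
      then show "(pl s b = pl s b \<and> b = pl (s \<circ> t \<circ> pinv s) b) = (pl s b = pl t (pl s b))"
        using pl_eq_iff[OF s pl_tup[OF t pl_tup[OF s b]] b] by auto
    qed
    also have "\<dots> = fixc n R t" unfolding fixc_def by (rule sum_pl[OF s])
    finally show ?thesis .
  qed
  have "(\<Sum>t\<in>perms n. of_bool (pl s a = pl t (pl s a')) * fixc n R t)
      = (\<Sum>t\<in>perms n. of_bool (a = pl (s \<circ> t \<circ> pinv s) a') * fixc n R (s \<circ> t \<circ> pinv s))"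
  proof (rule sum.cong[OF refl])
    fix t assume t: "t \<in> perms n"
    have "pl (s \<circ> t \<circ> pinv s) a' = pl (pinv s) (pl t (pl s a'))"
      using pl_comp[OF perms_comp[OF s t] perms_inv[OF s] a(2)] pl_comp[OF s t a(2)] by simp
    then show "of_bool (pl s a = pl t (pl s a')) * fixc n R t = of_bool (a = pl (s \<circ> t \<circ> pinv s) a') * fixc n R (s \<circ> t \<circ> pinv s)"
      using pl_eq_iff[OF s pl_tup[OF t pl_tup[OF s a(2)]] a(1)] fx[OF t] by auto
  qed
  also have "\<dots> = (\<Sum>t\<in>perms n. of_bool (a = pl (s \<circ> t) a') * fixc n R (s \<circ> t))"
    using sum_perms_right[OF perms_inv[OF s], of "\<lambda>t. of_bool (a = pl (s \<circ> t) a') * fixc n R (s \<circ> t)"]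
    by (simp add: comp_assoc)
  also have "\<dots> = (\<Sum>t\<in>perms n. of_bool (a = pl t a') * fixc n R t)"
    by (rule sum_perms_left[OF s])
  finally show ?thesis by (simp add: kop_def)
qed

lemma kop_inv_root_exists:
  "finite A \<Longrightarrow> finite R \<Longrightarrow> \<exists>Z. is_inv_root (tup n A) (kop n R) Z"
  by (intro inv_root_exists hermitian_on_kop psd_on_kop) simp_all

definition zxz :: "'a set \<Rightarrow> ('a \<Rightarrow> 'a \<Rightarrow> complex) \<Rightarrow> ('a \<Rightarrow> 'a \<Rightarrow> complex) \<Rightarrow> 'a \<Rightarrow> 'a \<Rightarrow> complex" where
  "zxz I Z X = mm I Z (mm I X Z)"

text \<open>The identity \<open>twirl_fixc\<close> determines the twirl \<open>Y\<close> only
  multiplied by \<open>K\<close> on the input side. Multiplying by \<open>Z Z\<close> recovers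
  \<open>Y\<close>, as its rows annihilate the kernel of \<open>K\<close>. On the other side
  \<open>X Z Z = Z X Z\<close>, since \<open>Z\<close> commutes with the permutation-invariant
  reduced operator \<open>X\<close>.\<close>

theorem twirl_eq:
  assumes R: "finite R" and A: "finite A" and Us: "haar_seq R N Us" and n: "n \<le> N" and sy: "symm_on n A R \<Psi>"
    and Z: "is_inv_root (tup n A) (kop n R) Z"
    and a: "a \<in> tup n A" "a' \<in> tup n A" and b: "b \<in> tup n R" "b' \<in> tup n R"
  shows "twirl n R Us \<Psi> a b a' b'
    = (\<Sum>s\<in>perms n. of_bool (b = pl s b') * zxz (tup n A) Z (gram n R \<Psi>) a (pl s a')) / fact n"
proof -
  let ?T = "tup n A" and ?K = "kop n R :: 'b list \<Rightarrow> _" and ?Y = "twirl n R Us \<Psi>" and ?X = "gram n R \<Psi>"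
  have T: "finite ?T" using A by simp
  have YK: "(\<Sum>x\<in>?T. ?Y a b x b' * ?K x y) = (\<Sum>s\<in>perms n. of_bool (b = pl s b') * ?X a (pl s y)) / fact n"
    if y: "y \<in> ?T" for y
    using sum_kop[OF A y, of "\<lambda>x. ?Y a b x b'" R] twirl_fixc[OF R Us n sy a(1) y b] by simp
  have "(\<Sum>x\<in>?T. ?Y a b x b' * mm ?T ?K (mm ?T Z Z) x a') = ?Y a b a' b'"
  proof -
    have "(\<Sum>x\<in>?T. ?Y a b x b' * v x) = 0" if v: "\<forall>x\<in>?T. (\<Sum>y\<in>?T. ?K x y * v y) = 0" for v
    proof -
      have sy': "symm_on n A R (\<lambda>a b. cnj (app n R V \<Psi> a b))" for V
        using symm_on_app[OF sy, of V] by (simp add: symm_on_def)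
      have "(\<lambda>t. \<Sum>x\<in>?T. avg (Us t) (\<lambda>V. app n R V \<Psi> a b * cnj (app n R V \<Psi> x b')) * v x)
         \<longlonglongrightarrow> (\<Sum>x\<in>?T. ?Y a b x b' * v x)"
        by (intro tendsto_sum tendsto_mult tendsto_const twirl_lim[OF R Us n sy] b)
      moreover have "(\<Sum>x\<in>?T. avg (Us t) (\<lambda>V. app n R V \<Psi> a b * cnj (app n R V \<Psi> x b')) * v x) = 0" for t
      proof -
        have "(\<Sum>x\<in>?T. avg (Us t) (\<lambda>V. app n R V \<Psi> a b * cnj (app n R V \<Psi> x b')) * v x)
            = avg (Us t) (\<lambda>V. app n R V \<Psi> a b * (\<Sum>x\<in>?T. cnj (app n R V \<Psi> x b') * v x))"
          by (simp only: avg_multc[symmetric] avg_sum[symmetric] sum_distrib_left mult.assoc)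
        also have "(\<lambda>V. app n R V \<Psi> a b * (\<Sum>x\<in>?T. cnj (app n R V \<Psi> x b') * v x)) = (\<lambda>V. 0)"
          using kop_kernel[OF A R _ sy' b(2), of v] v by simp
        also have "avg (Us t) (\<lambda>V. 0) = 0" by (simp add: avg_def)
        finally show ?thesis .
      qed
      ultimately show ?thesis by (simp add: LIMSEQ_const_iff)
    qed
    then show ?thesis using Z a(2) by (auto simp: is_inv_root_def)
  qed
  moreover have "(\<Sum>x\<in>?T. ?Y a b x b' * mm ?T ?K (mm ?T Z Z) x a')
      = (\<Sum>y\<in>?T. (\<Sum>x\<in>?T. ?Y a b x b' * ?K x y) * mm ?T Z Z y a')"
    unfolding mm_def[of ?T ?K] sum_distrib_left sum_distrib_right mult.assoc by (rule sum.swap)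
  moreover have "\<dots> = (\<Sum>y\<in>?T. (\<Sum>s\<in>perms n. of_bool (b = pl s b') * ?X a (pl s y)) / fact n * mm ?T Z Z y a')"
    by (intro sum.cong refl) (simp add: YK)
  moreover have "\<dots> = (\<Sum>s\<in>perms n. of_bool (b = pl s b') * (\<Sum>y\<in>?T. ?X a (pl s y) * mm ?T Z Z y a')) / fact n"
    unfolding sum_divide_distrib sum_distrib_left sum_distrib_right
    by (rule trans[OF sum.swap], rule sum.cong[OF refl], rule sum.cong[OF refl]) simp
  moreover have "(\<Sum>y\<in>?T. ?X a (pl s y) * mm ?T Z Z y a') = zxz ?T Z ?X a (pl s a')" if s: "s \<in> perms n" for s
  proof -
    have cZ: "commute_on ?T ?K B \<Longrightarrow> commute_on ?T Z B" for B using Z by (simp add: is_inv_root_def)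
    have "commute_on ?T ?K (perm_mat s)"
      unfolding commute_on_perm_mat[OF A s] by (simp add: kop_perm[OF s])
    then have "commute_on ?T Z (perm_mat s)" by (rule cZ)
    then have Zs: "Z (pl s x) (pl s y) = Z x y" if "x \<in> ?T" "y \<in> ?T" for x y
      using commute_on_perm_mat[OF A s] that by blast
    have "commute_on ?T ?K ?X"
      by (rule commute_on_kop[OF A]) (rule gram_symm[OF sy])
    then have ZX: "commute_on ?T Z ?X" by (rule cZ)
    have ZZs: "mm ?T Z Z y a' = mm ?T Z Z (pl s y) (pl s a')" if y: "y \<in> ?T" for y
    proof -
      have "mm ?T Z Z (pl s y) (pl s a') = (\<Sum>k\<in>?T. Z (pl s y) (pl s k) * Z (pl s k) (pl s a'))"
        unfolding mm_def by (rule sum_pl[OF s, symmetric])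
      also have "\<dots> = mm ?T Z Z y a'"
        unfolding mm_def using y a by (intro sum.cong refl) (simp add: Zs)
      finally show ?thesis by simp
    qed
    have "(\<Sum>y\<in>?T. ?X a (pl s y) * mm ?T Z Z y a') = (\<Sum>y\<in>?T. ?X a (pl s y) * mm ?T Z Z (pl s y) (pl s a'))"
      by (intro sum.cong refl) (simp add: ZZs)
    also have "\<dots> = mm ?T ?X (mm ?T Z Z) a (pl s a')"
      unfolding mm_def[of ?T ?X] by (rule sum_pl[OF s])
    also have "\<dots> = mm ?T (mm ?T ?X Z) Z a (pl s a')" by (simp add: mm_assoc)
    also have "\<dots> = mm ?T (mm ?T Z ?X) Z a (pl s a')"
      by (rule meqD[OF mm_cong[OF _ meq_refl] a(1) pl_tup[OF s a(2)]])
         (use ZX in \<open>simp add: commute_on_def meq_def\<close>)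
    finally show ?thesis by (simp add: zxz_def mm_assoc)
  qed
  ultimately show ?thesis by simp
qed

section \<open>Moments of a uniformly random unit vector\<close>

lemma sum_tup_snoc: "(\<Sum>xs\<in>tup (Suc n) A. f xs) = (\<Sum>xs\<in>tup n A. \<Sum>x\<in>A. f (xs @ [x]))"
proof -
  have "(\<Sum>xs\<in>tup (Suc n) A. f xs) = (\<Sum>p\<in>tup n A \<times> A. f (fst p @ [snd p]))"
  proof (rule sum.reindex_bij_witness[where i="\<lambda>p. fst p @ [snd p]" and j="\<lambda>xs. (butlast xs, last xs)"])
    fix xs assume xs: "xs \<in> tup (Suc n) A"
    then have ne: "xs \<noteq> []" by (auto simp: tup_def)
    show e: "fst (butlast xs, last xs) @ [snd (butlast xs, last xs)] = xs" using ne by simp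
    show "(butlast xs, last xs) \<in> tup n A \<times> A"
      using xs ne last_in_set[OF ne] by (auto simp: tup_def dest: in_set_butlastD)
    show "f (fst (butlast xs, last xs) @ [snd (butlast xs, last xs)]) = f xs" using e by simp
  next
    fix p assume p: "p \<in> tup n A \<times> A"
    show "(butlast (fst p @ [snd p]), last (fst p @ [snd p])) = p" by simp
    show "fst p @ [snd p] \<in> tup (Suc n) A" using p by (auto simp: tup_def)
  qed
  then show ?thesis by (simp add: sum.cartesian_product case_prod_unfold)
qed

lemma eq_pl_iff: "p permutes {..<length x} \<Longrightarrow> x = pl p x \<longleftrightarrow> (\<forall>k<length x. x ! k = x ! p k)"
  by (auto simp: list_eq_iff_nth_eq permute_list_nth)

text \<open>Either \<open>n\<close> is a new cycle of its own, which adds a free letter, or the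
  transposition inserts it into the cycle of \<open>b\<close>, which forces its letter.\<close>

lemma fixc_insert:
  assumes R: "finite R" and q: "q \<in> perms n" and b: "b < Suc n"
  shows "fixc (Suc n) R (transpose n b \<circ> q) = (if b = n then of_nat (card R) * fixc n R q else fixc n R q)"
proof -
  have q': "q permutes {..<Suc n}" using q by (auto intro: permutes_subset)
  have qn: "q n = n" using q by (auto simp: permutes_def)
  have qk: "q k < n" if "k < n" for k using q that permutes_in_image[of q "{..<n}" k] by auto
  have tq: "(transpose n b \<circ> q) permutes {..<Suc n}"
    using b by (intro permutes_compose[OF q'] permutes_swap_id) auto
  have key: "y @ [r] = pl (transpose n b \<circ> q) (y @ [r]) \<longleftrightarrow> y = pl q y \<and> (b = n \<or> r = y ! b)"
    if y: "y \<in> tup n R" for y r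
  proof -
    have ly: "length y = n" using y by (simp add: tup_def)
    have "y @ [r] = pl (transpose n b \<circ> q) (y @ [r]) \<longleftrightarrow> (\<forall>k<Suc n. (y @ [r]) ! k = (y @ [r]) ! transpose n b (q k))"
      using eq_pl_iff[of "transpose n b \<circ> q" "y @ [r]"] tq ly by simp
    also have "\<dots> \<longleftrightarrow> (\<forall>k<n. y ! k = (y @ [r]) ! transpose n b (q k)) \<and> r = (y @ [r]) ! transpose n b n"
    proof -
      have "(\<forall>k<Suc n. P k) \<longleftrightarrow> (\<forall>k<n. P k) \<and> P n" for P :: "nat \<Rightarrow> bool"
        by (auto simp: less_Suc_eq)
      moreover have "(y @ [r]) ! k = y ! k" if "k < n" for k using ly that by (simp add: nth_append)
      moreover have "(y @ [r]) ! n = r" using ly by (simp add: nth_append)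
      ultimately show ?thesis by (simp add: qn)
    qed
    also have "\<dots> \<longleftrightarrow> (\<forall>k<n. y ! k = y ! q k) \<and> (b = n \<or> r = y ! b)"
    proof (cases "b = n")
      case True
      then show ?thesis using ly qk by (simp add: nth_append)
    next
      case False
      then have bn: "b < n" using b by simp
      have e: "(y @ [r]) ! transpose n b (q k) = (if q k = b then r else y ! q k)" if "k < n" for k
        using ly qk[OF that] bn by (auto simp: nth_append transpose_def)
      have "(y @ [r]) ! transpose n b n = y ! b" using ly bn by (simp add: nth_append)
      then show ?thesis using False e by auto
    qed
    also have "(\<forall>k<n. y ! k = y ! q k) \<longleftrightarrow> y = pl q y"
      using eq_pl_iff[of q y] q ly by simp
    finally show ?thesis .
  qed
  have "fixc (Suc n) R (transpose n b \<circ> q) = (\<Sum>y\<in>tup n R. \<Sum>r\<in>R. of_bool (y = pl q y) * of_bool (b = n \<or> r = y ! b))"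
    unfolding fixc_def sum_tup_snoc by (intro sum.cong refl) (simp add: key of_bool_conj)
  also have "\<dots> = (\<Sum>y\<in>tup n R. of_bool (y = pl q y) * (\<Sum>r\<in>R. of_bool (b = n \<or> r = y ! b)))"
    by (simp only: sum_distrib_left)
  also have "\<dots> = (\<Sum>y\<in>tup n R. of_bool (y = pl q y) * (if b = n then of_nat (card R) else 1))"
  proof (rule sum.cong[OF refl])
    fix y assume y: "y \<in> tup n R"
    have "(\<Sum>r\<in>R. of_bool (b = n \<or> r = y ! b)) = (if b = n then of_nat (card R) else 1 :: complex)"
    proof (cases "b = n")
      case False
      then have "y ! b \<in> R" using nth_tup[OF y] b by simp
      then show ?thesis using R False by (simp add: of_bool_def)
    qed simp
    then show "of_bool (y = pl q y) * (\<Sum>r\<in>R. of_bool (b = n \<or> r = y ! b)) =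
       of_bool (y = pl q y) * (if b = n then of_nat (card R) else 1 :: complex)" by simp
  qed
  also have "\<dots> = fixc n R q * (if b = n then of_nat (card R) else 1)"
    unfolding fixc_def by (rule sum_distrib_right[symmetric])
  finally show ?thesis by simp
qed

text \<open>Adding a point multiplies the sum by \<open>card R + n\<close>, the factor by which the
  rising factorial grows.\<close>

lemma sum_fixc:
  assumes R: "finite R"
  shows "(\<Sum>s\<in>perms n. fixc n R s) = pochhammer (of_nat (card R)) n"
proof (induction n)
  case 0
  show ?case by (simp add: fixc_def)
next
  case (Suc n)
  have "(\<Sum>s\<in>perms (Suc n). fixc (Suc n) R s) = (\<Sum>b\<in>insert n {..<n}. \<Sum>q\<in>perms n. fixc (Suc n) R (transpose n b \<circ> q))"
    using sum_over_permutations_insert[of "{..<n}" n "fixc (Suc n) R"] by (simp add: lessThan_Suc)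
  also have "\<dots> = (\<Sum>b\<in>insert n {..<n}. \<Sum>q\<in>perms n. if b = n then of_nat (card R) * fixc n R q else fixc n R q)"
    by (intro sum.cong refl fixc_insert[OF R]) auto
  also have "\<dots> = of_nat (card R) * (\<Sum>q\<in>perms n. fixc n R q) + of_nat n * (\<Sum>q\<in>perms n. fixc n R q)"
    by (simp add: sum_distrib_left)
  finally show ?case by (simp add: Suc.IH pochhammer_Suc algebra_simps)
qed

definition cinner :: "'r set \<Rightarrow> ('r \<Rightarrow> complex) \<Rightarrow> ('r \<Rightarrow> complex) \<Rightarrow> complex" where
  "cinner R u v = (\<Sum>r\<in>R. cnj (u r) * v r)"

lemma cinner_power:
  "cinner R u v ^ n = (\<Sum>b\<in>tup n R. (\<Prod>k<n. cnj (u (b ! k))) * (\<Prod>k<n. v (b ! k)))"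
proof -
  have "cinner R u v ^ n = (\<Prod>k<n. \<Sum>r\<in>R. cnj (u r) * v r)" by (simp add: cinner_def)
  also have "\<dots> = (\<Sum>b\<in>tup n R. \<Prod>k<n. cnj (u (b ! k)) * v (b ! k))"
    by (rule sum_tup_prod[symmetric])
  finally show ?thesis by (simp add: prod.distrib)
qed

text \<open>The moments of the uniform distribution on the unit sphere of \<open>C\<^sup>D\<close>, \<open>D = card R\<close>.\<close>

lemma haar_moment:
  fixes R :: "'r set"
  assumes R: "finite R" and Us: "haar_seq R N Us" and n: "n \<le> N" and c0: "c0 \<in> R" and eta: "\<eta> > 0"
  shows "\<exists>t0. \<forall>t\<ge>t0. \<forall>\<psi>. (\<Sum>r\<in>R. (cmod (\<psi> r))\<^sup>2) = 1 \<longrightarrow>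
    cmod (avg (Us t) (\<lambda>V. of_real (cmod (cinner R (\<lambda>r. V r c0) \<psi>) ^ (2 * n))) - fact n / pochhammer (of_nat (card R)) n) \<le> \<eta>"
proof -
  \<comment> \<open>With a one-point input register, \<open>\<Psi>\<close> is the product vector
    with all factors at \<open>c0\<close>. Permutations act trivially on the input, so
    \<open>twirl_fixc\<close> becomes a scalar equation, solvable by
    \<open>sum_fixc\<close>.\<close>
  define \<Psi> :: "unit list \<Rightarrow> 'r list \<Rightarrow> complex" where "\<Psi> = (\<lambda>a b. of_bool (b = replicate n c0))"
  define u where "u = replicate n ()"
  have U: "tup n {()} = {u}" by (auto simp: tup_def u_def replicate_eqI subset_singleton_iff)
  have rep: "replicate n c0 \<in> tup n R" using c0 by (auto simp: tup_def)
  have plrep: "pl p (replicate n x) = replicate n x" if "p \<in> perms n" for p and x :: 'z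
    using that permutes_in_image[of p "{..<n}"] by (auto simp: list_eq_iff_nth_eq permute_list_nth)
  have sy: "symm_on n {()} R \<Psi>"
    unfolding symm_on_def
  proof (intro ballI)
    fix p a b assume p: "p \<in> perms n" and b: "b \<in> tup n R"
    have "pl p b = replicate n c0 \<longleftrightarrow> b = replicate n c0"
      using pl_eq_iff[OF p rep b] plrep[OF perms_inv[OF p], of c0] by auto
    then show "\<Psi> (pl p a) (pl p b) = \<Psi> a b" by (simp add: \<Psi>_def)
  qed
  have ap: "app n R V \<Psi> u b = (\<Prod>k<n. V (b ! k) c0)" if "b \<in> tup n R" for V b
  proof -
    have "app n R V \<Psi> u b = tpow V b (replicate n c0)"
      using R rep by (simp add: app_def \<Psi>_def of_bool_def if_distrib[where f="\<lambda>x. _ * x"] cong: if_cong)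
    then show ?thesis using that by (simp add: tpow_def length_tup)
  qed
  define Y where "Y = twirl n R Us \<Psi> u"
  let ?poch = "pochhammer (of_nat (card R)) n :: complex"
  have poch0: "?poch \<noteq> 0"
  proof -
    have "card R > 0" using c0 R by (auto simp: card_gt_0_iff)
    then have "pochhammer (real (card R)) n > 0" by (intro pochhammer_pos) simp
    then have "complex_of_real (pochhammer (real (card R)) n) \<noteq> 0" by simp
    then show ?thesis by (simp add: pochhammer_of_real[symmetric])
  qed
  have Yeq: "Y b u b' = (\<Sum>s\<in>perms n. of_bool (b = pl s b')) / ?poch" if b: "b \<in> tup n R" "b' \<in> tup n R" for b b'
  proof -
    have gr: "gram n R \<Psi> u a = 1" for a
    proof -
      have "gram n R \<Psi> u a = (\<Sum>b\<in>tup n R. if b = replicate n c0 then 1 else 0)"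
        unfolding gram_def \<Psi>_def by (intro sum.cong refl) simp
      then show ?thesis using R rep by simp
    qed
    have "(\<Sum>s\<in>perms n. fixc n R s * Y b u b') = (\<Sum>s\<in>perms n. of_bool (b = pl s b'))"
      using twirl_fixc[OF R Us n sy _ _ b, of u u] gr
      by (simp add: Y_def U u_def plrep)
    then have "?poch * Y b u b' = (\<Sum>s\<in>perms n. of_bool (b = pl s b'))"
      by (simp only: sum_distrib_right[symmetric] sum_fixc[OF R])
    then show ?thesis using poch0 by (simp add: field_simps)
  qed
  define y where "y = (\<lambda>t b b'. avg (Us t) (\<lambda>V. (\<Prod>k<n. V (b ! k) c0) * cnj (\<Prod>k<n. V (b' ! k) c0)))"
  have ylim: "(\<lambda>t. y t b b') \<longlonglongrightarrow> Y b u b'" if b: "b \<in> tup n R" "b' \<in> tup n R" for b b'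
    using twirl_lim[OF R Us n sy b, of u u] unfolding y_def Y_def by (simp only: ap[OF b(1)] ap[OF b(2)])
  \<comment> \<open>Closeness of all moment entries at once gives a \<open>t0\<close> that serves
    every \<open>\<psi>\<close>, because the weights \<open>w\<close> are bounded by 1. Uniformity
    matters since \<open>\<psi>\<close> will depend on the unknown channel.\<close>
  have "(\<lambda>t. \<Sum>b\<in>tup n R. \<Sum>b'\<in>tup n R. cmod (y t b b' - Y b u b')) \<longlonglongrightarrow> (\<Sum>b\<in>tup n R. \<Sum>b'\<in>tup n R. 0)"
    by (intro tendsto_sum tendsto_norm_zero) (simp add: LIM_zero ylim)
  then have "(\<lambda>t. \<Sum>b\<in>tup n R. \<Sum>b'\<in>tup n R. cmod (y t b b' - Y b u b')) \<longlonglongrightarrow> 0" by simp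
  then have "eventually (\<lambda>t. (\<Sum>b\<in>tup n R. \<Sum>b'\<in>tup n R. cmod (y t b b' - Y b u b')) < \<eta>) sequentially"
    using eta by (rule order_tendstoD)
  then obtain t0 where t0: "\<And>t. t \<ge> t0 \<Longrightarrow> (\<Sum>b\<in>tup n R. \<Sum>b'\<in>tup n R. cmod (y t b b' - Y b u b')) < \<eta>"
    by (auto simp: eventually_sequentially)
  have "cmod (avg (Us t) (\<lambda>V. of_real (cmod (cinner R (\<lambda>r. V r c0) \<psi>) ^ (2 * n))) - fact n / ?poch) \<le> \<eta>"
    if t: "t \<ge> t0" and psi: "(\<Sum>r\<in>R. (cmod (\<psi> r))\<^sup>2) = 1" for t \<psi>
  proof -
    define w where "w = (\<lambda>b :: 'r list. \<Prod>k<n. \<psi> (b ! k))"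
    have w1: "cmod (w b) \<le> 1" if "b \<in> tup n R" for b
    proof -
      have "cmod (\<psi> r) \<le> 1" if "r \<in> R" for r
      proof -
        have "(cmod (\<psi> r))\<^sup>2 \<le> (\<Sum>r\<in>R. (cmod (\<psi> r))\<^sup>2)"
          using R that by (intro member_le_sum) auto
        then show ?thesis using psi by (simp add: abs_square_le_1)
      qed
      then show ?thesis unfolding w_def prod_norm[symmetric] using nth_tup[OF that] by (intro prod_le_1) auto
    qed
    have e: "of_real (cmod (cinner R (\<lambda>r. V r c0) \<psi>) ^ (2 * n))
        = (\<Sum>b\<in>tup n R. \<Sum>b'\<in>tup n R. cnj (w b) * w b' * ((\<Prod>k<n. V (b ! k) c0) * cnj (\<Prod>k<n. V (b' ! k) c0)))" for V
    proof -
      let ?z = "cinner R (\<lambda>r. V r c0) \<psi>"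
      have "of_real (cmod ?z ^ (2 * n)) = (complex_of_real ((cmod ?z)\<^sup>2)) ^ n"
        by (simp add: power_mult)
      also have "\<dots> = cnj (?z ^ n) * ?z ^ n"
        unfolding complex_norm_square by (simp add: power_mult_distrib mult.commute)
      also have "\<dots> = (\<Sum>b\<in>tup n R. \<Sum>b'\<in>tup n R. cnj (w b) * w b' * ((\<Prod>k<n. V (b ! k) c0) * cnj (\<Prod>k<n. V (b' ! k) c0)))"
        unfolding cinner_power cnj_sum sum_product w_def
        by (intro sum.cong refl) (simp add: mult_ac)
      finally show ?thesis .
    qed
    have "avg (Us t) (\<lambda>V. of_real (cmod (cinner R (\<lambda>r. V r c0) \<psi>) ^ (2 * n)))
        = (\<Sum>b\<in>tup n R. \<Sum>b'\<in>tup n R. cnj (w b) * w b' * y t b b')"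
      unfolding e avg_sum avg_cmult y_def ..
    moreover have "(\<Sum>b\<in>tup n R. \<Sum>b'\<in>tup n R. cnj (w b) * w b' * Y b u b') = fact n / ?poch"
    proof -
      have "(\<Sum>b\<in>tup n R. \<Sum>b'\<in>tup n R. cnj (w b) * w b' * Y b u b')
          = (\<Sum>b\<in>tup n R. \<Sum>b'\<in>tup n R. \<Sum>s\<in>perms n. cnj (w b) * w b' * of_bool (b = pl s b')) / ?poch"
        unfolding sum_divide_distrib
        by (intro sum.cong refl) (simp only: Yeq times_divide_eq_right sum_distrib_left sum_divide_distrib)
      also have "(\<Sum>b\<in>tup n R. \<Sum>b'\<in>tup n R. \<Sum>s\<in>perms n. cnj (w b) * w b' * of_bool (b = pl s b'))
          = (\<Sum>s\<in>perms n. \<Sum>b'\<in>tup n R. \<Sum>b\<in>tup n R. cnj (w b) * w b' * of_bool (b = pl s b'))"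
        by (subst sum.swap) (simp only: sum.swap[of _ "tup n R" "perms n"])
      also have "\<dots> = (\<Sum>s\<in>perms n. \<Sum>b'\<in>tup n R. cnj (w b') * w b')"
      proof (rule sum.cong[OF refl], rule sum.cong[OF refl])
        fix s b' assume s: "s \<in> perms n" and b': "b' \<in> tup n R"
        have "w (pl s b') = w b'"
        proof -
          have "w (pl s b') = (\<Prod>k<n. \<psi> (b' ! s k))"
            unfolding w_def using s b' by (intro prod.cong refl) (auto simp: permute_list_nth length_tup)
          also have "\<dots> = (\<Prod>k\<in>s ` {..<n}. \<psi> (b' ! k))"
            using s permutes_inj_on[of s "{..<n}"] by (subst prod.reindex) auto
          finally show ?thesis using s by (simp add: permutes_image w_def)
        qed
        then show "(\<Sum>b\<in>tup n R. cnj (w b) * w b' * of_bool (b = pl s b')) = cnj (w b') * w b'"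
          using R pl_tup[OF s b'] by (simp add: of_bool_def if_distrib[where f="\<lambda>x. _ * x"] cong: if_cong)
      qed
      also have "(\<Sum>b'\<in>tup n R. cnj (w b') * w b') = cinner R \<psi> \<psi> ^ n"
        by (simp add: cinner_power w_def)
      also have "cinner R \<psi> \<psi> = 1"
      proof -
        have "cinner R \<psi> \<psi> = of_real (\<Sum>r\<in>R. (cmod (\<psi> r))\<^sup>2)"
          unfolding cinner_def of_real_sum complex_norm_square by (simp only: mult.commute)
        then show ?thesis by (simp add: psi)
      qed
      finally show ?thesis by (simp add: card_perms)
    qed
    ultimately have "avg (Us t) (\<lambda>V. of_real (cmod (cinner R (\<lambda>r. V r c0) \<psi>) ^ (2 * n))) - fact n / ?poch
        = (\<Sum>b\<in>tup n R. \<Sum>b'\<in>tup n R. cnj (w b) * w b' * (y t b b' - Y b u b'))"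
      by (simp add: sum_subtractf right_diff_distrib)
    also have "cmod \<dots> \<le> (\<Sum>b\<in>tup n R. \<Sum>b'\<in>tup n R. cmod (y t b b' - Y b u b'))"
    proof (intro sum_norm_le)
      fix b b' assume b: "b \<in> tup n R" "b' \<in> tup n R"
      have "cmod (w b) * cmod (w b') \<le> 1" using w1 b by (intro mult_le_one) auto
      then show "cmod (cnj (w b) * w b' * (y t b b' - Y b u b')) \<le> cmod (y t b b' - Y b u b')"
        by (simp add: norm_mult mult_left_le_one_le)
    qed
    finally show ?thesis using t0[OF t] by linarith
  qed
  then show ?thesis by blast
qed

section \<open>Jacobi polynomials\<close>

text \<open>\<open>sph D m\<close> is the \<open>m\<close>-th moment of \<open>x = |\<psi> 0|\<^sup>2\<close> for a uniformly random unit vector \<open>\<psi>\<close> of \<open>C\<^sup>D\<close>,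
  and \<open>ell D L p\<close> the expectation of \<open>x^L * p x\<close>.\<close>

definition sph :: "nat \<Rightarrow> nat \<Rightarrow> real" where
  "sph D m = fact m / pochhammer (of_nat D) m"

definition ell :: "nat \<Rightarrow> nat \<Rightarrow> real poly \<Rightarrow> real" where
  "ell D L p = (\<Sum>i\<le>degree p. coeff p i * sph D (L + i))"

lemma ell_le: "degree p \<le> N \<Longrightarrow> ell D L p = (\<Sum>i\<le>N. coeff p i * sph D (L + i))"
  unfolding ell_def by (rule sum.mono_neutral_left) (auto simp: coeff_eq_0)

lemma ell_0 [simp]: "ell D L 0 = 0"
  by (simp add: ell_def)

lemma ell_add: "ell D L (p + q) = ell D L p + ell D L q"
proof -
  let ?N = "max (degree p) (degree q)"
  have "degree (p + q) \<le> ?N" by (rule degree_add_le_max)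
  then show ?thesis by (simp add: ell_le[where N="?N"] sum.distrib distrib_right)
qed

lemma ell_smult: "ell D L (Polynomial.smult c p) = c * ell D L p"
  using degree_smult_le[of c p] by (simp add: ell_le[where N="degree p"] sum_distrib_left mult.assoc)

lemma ell_minus: "ell D L (- p) = - ell D L p"
  using ell_smult[of D L "-1" p] by simp

lemma ell_diff: "ell D L (p - q) = ell D L p - ell D L q"
  using ell_add[of D L p "-q"] by (simp add: ell_minus)

lemma ell_sum: "ell D L (\<Sum>i\<in>I. f i) = (\<Sum>i\<in>I. ell D L (f i))"
  by (induction I rule: infinite_finite_induct) (auto simp: ell_add)

lemma ell_monom_mult: "ell D L (monom 1 m * p) = (\<Sum>i\<le>degree p. coeff p i * sph D (L + m + i))"
proof -
  have p: "monom 1 m * p = (\<Sum>i\<le>degree p. Polynomial.smult (coeff p i) (monom 1 (m + i)))"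
    by (subst (1) poly_as_sum_of_monoms[symmetric]) (simp add: sum_distrib_left mult_monom smult_monom)
  have "ell D L (monom 1 (m + i)) = sph D (L + m + i)" for i
    by (simp add: ell_le[where N="m + i"] degree_monom_le if_distrib[where f="\<lambda>x. x * _"] add.assoc cong: if_cong)
  then show ?thesis unfolding p by (simp add: ell_sum ell_smult)
qed

text \<open>By Pascal's rule one difference step replaces \<open>p x\<close> by
  \<open>p x - p (x + 1)\<close>, which lowers the degree.\<close>

lemma finite_difference_zero:
  fixes p :: "real poly"
  assumes "degree p < j"
  shows "(\<Sum>i\<le>j. (-1) ^ i * real (j choose i) * poly p (real i)) = 0"
  using assms
proof (induction j arbitrary: p)
  case (Suc j)
  define q where "q = p - pcompose p [:1, 1:]"
  have q: "poly q x = poly p x - poly p (x + 1)" for x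
    by (simp add: q_def poly_pcompose add.commute)
  have "(\<Sum>i\<le>Suc j. (-1) ^ i * real (Suc j choose i) * poly p (real i)) = (\<Sum>i\<le>j. (-1) ^ i * real (j choose i) * poly q (real i))"
  proof -
    have "(\<Sum>i\<le>Suc j. (-1) ^ i * real (Suc j choose i) * poly p (real i))
        = poly p 0 + (\<Sum>i\<le>j. (-1) ^ Suc i * real ((j choose Suc i) + (j choose i)) * poly p (real (Suc i)))"
      by (subst sum.atMost_Suc_shift) (simp add: add.commute)
    also have "\<dots> = poly p 0 + (\<Sum>i\<le>j. (-1) ^ Suc i * real (j choose Suc i) * poly p (real (Suc i)))
        - (\<Sum>i\<le>j. (-1) ^ i * real (j choose i) * poly p (real i + 1))"
      by (simp add: sum.distrib algebra_simps sum_subtractf sum_negf)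
    also have "poly p 0 + (\<Sum>i\<le>j. (-1) ^ Suc i * real (j choose Suc i) * poly p (real (Suc i)))
        = (\<Sum>i\<le>Suc j. (-1) ^ i * real (j choose i) * poly p (real i))"
      by (subst sum.atMost_Suc_shift) simp
    also have "\<dots> = (\<Sum>i\<le>j. (-1) ^ i * real (j choose i) * poly p (real i))" by simp
    finally show ?thesis by (simp add: q sum_subtractf right_diff_distrib)
  qed
  also have "\<dots> = 0"
  proof (cases "degree p = 0")
    case True
    then obtain a where "p = [:a:]" by (rule degree_eq_zeroE)
    then have "q = 0" by (simp add: q_def)
    then show ?thesis by simp
  next
    case False
    have "degree q < degree p"
    proof -
      have d: "degree (pcompose p [:1, 1:]) = degree p" by (simp add: degree_pcompose)
      have "degree q \<le> degree p" unfolding q_def using degree_diff_le_max[of p "pcompose p [:1, 1:]"] d by simp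
      moreover have "coeff q (degree p) = 0"
      proof -
        have "lead_coeff (pcompose p [:1, 1:]) = lead_coeff p"
          by (subst lead_coeff_comp) simp_all
        then show ?thesis by (simp add: q_def d)
      qed
      ultimately show ?thesis using False by (metis le_neq_implies_less leading_coeff_0_iff degree_0)
    qed
    then show ?thesis using Suc.prems by (intro Suc.IH) simp
  qed
  finally show ?case .
qed simp

context
  fixes D L :: nat
  assumes D: "D \<ge> 2" and L: "L \<ge> 1"
begin

text \<open>The Jacobi polynomials of the weight \<open>x^L * (1 - x)^(D - 2)\<close>.\<close>

definition jc :: "nat \<Rightarrow> nat \<Rightarrow> real" where
  "jc j i = (-1) ^ i * real (j choose i) * pochhammer (real j + real L + real D - 1) i / pochhammer (real L + 1) i"

definition jac :: "nat \<Rightarrow> real poly" where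
  "jac j = (\<Sum>i\<le>j. monom (jc j i) i)"

lemma coeff_jac: "coeff (jac j) i = jc j i"
  by (simp add: jac_def coeff_sum jc_def binomial_eq_0)

lemma degree_jac: "degree (jac j) \<le> j"
  by (rule degree_le) (simp add: coeff_jac jc_def binomial_eq_0)

lemma sph_pos: "sph D m > 0"
  using D by (simp add: sph_def pochhammer_pos)

lemma sph_Suc: "sph D (Suc m) = sph D m * (m + 1) / (D + m)"
  using D by (simp add: sph_def pochhammer_Suc divide_simps)

lemma sph_shift: "sph D (L + m) = sph D L * pochhammer (real L + 1) m / pochhammer (real L + real D) m"
proof (induction m)
  case (Suc m)
  have "sph D (L + Suc m) = sph D (L + m) * (L + m + 1) / (D + (L + m))"
    using sph_Suc[of "L + m"] by simp
  then show ?case unfolding Suc.IH by (simp add: pochhammer_Suc algebra_simps)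
qed simp

text \<open>Coefficients and moments are quotients of Pochhammer symbols. In their product these
  combine, up to a constant, to the polynomial \<open>P\<close> in \<open>i\<close> of degree below
  \<open>j\<close>, so the expectation is a vanishing \<open>j\<close>-th finite difference.\<close>

lemma ell_monom_jac:
  assumes m: "m < j"
  shows "ell D L (monom 1 m * jac j) = 0"
proof -
  define c where "c = real L + real D - 1"
  have c0: "c > 0" using D L by (simp add: c_def)
  define P where "P = (\<Prod>t<m. [:real L + 1 + real t, 1:]) * (\<Prod>t<j - 1 - m. [:c + 1 + real m + real t, 1:])"
  have P: "poly P x = pochhammer (real L + 1 + x) m * pochhammer (c + 1 + real m + x) (j - 1 - m)" for x
    by (simp add: P_def poly_prod pochhammer_prod add_ac atLeast0LessThan)
  have dp: "degree (\<Prod>t<n. [:a t, 1:] :: real poly) \<le> n" for a n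
    using degree_prod_sum_le[of "{..<n}" "\<lambda>t. [:a t, 1:] :: real poly"] by simp
  have "degree P \<le> m + (j - 1 - m)"
    unfolding P_def
    by (rule order.trans[OF degree_mult_le add_mono[OF dp[of "\<lambda>t. real L + 1 + real t"] dp[of "\<lambda>t. c + 1 + real m + real t"]]])
  then have dP: "degree P < j" using m by simp
  have e: "jc j i * sph D (L + m + i) = sph D L / pochhammer (c + 1) (j - 1) * ((-1) ^ i * real (j choose i) * poly P (real i))"
    for i
  proof -
    have 1: "sph D (L + m + i) = sph D L * pochhammer (real L + 1) (i + m) / pochhammer (c + 1) (i + m)"
      using sph_shift[of "m + i"] by (simp add: c_def add_ac)
    have 2: "pochhammer (real L + 1) (i + m) = pochhammer (real L + 1) i * pochhammer (real L + 1 + real i) m"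
      by (rule pochhammer_product')
    have 3: "pochhammer (c + 1) (j - 1) * pochhammer (real j + c) i = pochhammer (c + 1) (i + m) * pochhammer (c + 1 + real m + real i) (j - 1 - m)"
    proof -
      have a: "c + 1 + real (j - 1) = real j + c" using m by simp
      have b: "j - 1 + i = i + m + (j - 1 - m)" using m by simp
      have "pochhammer (c + 1) (j - 1) * pochhammer (real j + c) i = pochhammer (c + 1) (j - 1 + i)"
        using pochhammer_product'[of "c + 1" "j - 1" i] unfolding a by simp
      also have "\<dots> = pochhammer (c + 1) (i + m) * pochhammer (c + 1 + real (i + m)) (j - 1 - m)"
        unfolding b by (rule pochhammer_product')
      also have "c + 1 + real (i + m) = c + 1 + real m + real i" by simp
      finally show ?thesis .
    qed
    have nz: "pochhammer (c + 1) k \<noteq> 0" "pochhammer (real L + 1) k \<noteq> 0" for k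
      using c0 by (auto intro!: pochhammer_pos less_imp_neq[THEN not_sym])
    have jc: "jc j i = (-1) ^ i * real (j choose i) * pochhammer (real j + c) i / pochhammer (real L + 1) i"
    proof -
      have "real j + real L + real D - 1 = real j + c" by (simp add: c_def)
      then show ?thesis by (simp only: jc_def)
    qed
    have 4: "pochhammer (real j + c) i = pochhammer (c + 1) (i + m) * pochhammer (c + 1 + real m + real i) (j - 1 - m) / pochhammer (c + 1) (j - 1)"
      using 3 nz(1)[of "j - 1"] by (simp add: eq_divide_eq mult.commute)
    have "(s * b * (Z * Y / Pc) / Q) * (S * (Q * X) / Z) = S / Pc * (s * b * (X * Y))"
      if "Q \<noteq> 0" "Z \<noteq> 0" for s b Z Y Pc Q S X :: real
      using that by simp
    from this[OF nz(2) nz(1)] show ?thesis unfolding jc 1 2 P 4 .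
  qed
  have "ell D L (monom 1 m * jac j) = (\<Sum>i\<le>degree (jac j). jc j i * sph D (L + m + i))"
    by (simp add: ell_monom_mult coeff_jac)
  also have "\<dots> = (\<Sum>i\<le>j. jc j i * sph D (L + m + i))"
    using degree_jac[of j] by (intro sum.mono_neutral_left) (auto simp: coeff_jac[symmetric] coeff_eq_0)
  also have "\<dots> = sph D L / pochhammer (c + 1) (j - 1) * (\<Sum>i\<le>j. (-1) ^ i * real (j choose i) * poly P (real i))"
    by (simp add: e sum_distrib_left)
  also have "\<dots> = 0" by (simp add: finite_difference_zero[OF dP])
  finally show ?thesis .
qed

lemma ell_mult_jac: "degree p < j \<Longrightarrow> ell D L (p * jac j) = 0"
proof -
  assume p: "degree p < j"
  have "p * jac j = (\<Sum>m\<le>degree p. Polynomial.smult (coeff p m) (monom 1 m * jac j))"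
    by (subst (1) poly_as_sum_of_monoms[symmetric])
       (simp add: sum_distrib_right smult_monom flip: mult_smult_left)
  then show ?thesis using p by (simp add: ell_sum ell_smult ell_monom_jac)
qed

lemma ell_jac_jac: "i \<noteq> j \<Longrightarrow> ell D L (jac i * jac j) = 0"
  using ell_mult_jac[of "jac i" j] ell_mult_jac[of "jac j" i] degree_jac[of i] degree_jac[of j]
  by (cases "i < j") (auto simp: mult.commute)

section \<open>The three-term recurrence\<close>

definition jp :: "nat \<Rightarrow> real" where
  "jp j = real j + real L + real D - 1"

text \<open>All \<open>jac j\<close> take the value 1 at 0, so the coefficients of the recurrence
  for \<open>x * jac j\<close> sum to 0 and the two numbers \<open>ja j\<close> and
  \<open>jb j\<close> determine them.\<close>

definition ja :: "nat \<Rightarrow> real" where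
  "ja j = jp j * (real j + L + 1) / ((j + jp j) * (j + jp j + 1))"

definition jb :: "nat \<Rightarrow> real" where
  "jb j = real j * (jp j - L - 1) / ((j + jp j - 1) * (j + jp j))"

text \<open>What remains of the recurrence when the common hypergeometric factor is removed;
  \<open>i\<close> stands for the index of the compared coefficient and \<open>p\<close> for
  \<open>jp j\<close>.\<close>

lemma jac_identity:
  fixes i j l p :: real
  assumes "j + p - 1 \<noteq> 0" "j + p \<noteq> 0" "j + p + 1 \<noteq> 0"
  shows "i * (l + i) = (j + l + 1) * (j + 1) * (p + i - 1) * (p + i) / ((j + p) * (j + p + 1))
     - (p * (j + l + 1) / ((j + p) * (j + p + 1)) + j * (p - l - 1) / ((j + p - 1) * (j + p)))
        * ((j - i + 1) * (p + i - 1))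
     + (p - l - 1) * (j - i + 1) * (j - i) * (p - 1) / ((j + p - 1) * (j + p))"
proof -
  have comb: "z = X / (b * c) - (Y / (b * c) + W / (a * b)) * U + V / (a * b)"
    if "a \<noteq> 0" "b \<noteq> 0" "c \<noteq> 0" "z * (a * b * c) = a * X - (a * Y + c * W) * U + c * V" for a b c X Y W U V z :: real
  proof -
    have "X / (b * c) - (Y / (b * c) + W / (a * b)) * U + V / (a * b) = (a * X - (a * Y + c * W) * U + c * V) / (a * b * c)"
      using that(1-3) by (simp add: field_simps)
    then show ?thesis using that by (simp add: field_simps)
  qed
  show ?thesis
    by (rule comb[OF assms]) (simp add: algebra_simps)
qed

lemma jp_pos: "jp j > 1"
  using D L by (simp add: jp_def)

lemma jc_alt: "jc j i = (-1) ^ i * real (j choose i) * pochhammer (jp j) i / pochhammer (real L + 1) i"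
  by (simp add: jc_def jp_def)

text \<open>The four coefficients involved are rational multiples of one factor \<open>C\<close>,
  which reduces the claim to \<open>jac_identity\<close>.\<close>

lemma jc_recurrence:
  "jc j i = - ja j * jc (Suc j) (Suc i) + (ja j + jb j) * jc j (Suc i) - jb j * jc (j - 1) (Suc i)"
proof -
  define T where "T = pochhammer (jp j) i"
  define W where "W = real (j choose i)"
  define P where "P = pochhammer (real L + 1) i"
  define r where "r = real i + 1"
  define X where "X = jp j + r - 1"
  define C where "C = (-1) ^ i * W * T / (r * P * (real L + r))"
  have r0: "r > 0" "real L + r > 0" by (auto simp: r_def)
  have P0: "P > 0" unfolding P_def by (rule pochhammer_pos) simp
  have p0: "jp j > 1" by (rule jp_pos)
  have PS: "pochhammer (real L + 1) (Suc i) = P * (real L + r)"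
    by (simp add: pochhammer_Suc P_def r_def add_ac)
  have b1: "real (j choose Suc i) * r = W * (real j - r + 1)"
  proof -
    have "real (Suc i) * real (j choose Suc i) = real (j - i) * real (j choose i)"
      by (metis binomial_absorb_comp binomial_absorption of_nat_mult mult.commute Suc_times_binomial_eq binomial_fact_lemma)
    moreover have "real (j - i) * real (j choose i) = (real j - real i) * real (j choose i)"
      by (cases "i \<le> j") (auto simp: binomial_eq_0 of_nat_diff)
    ultimately show ?thesis by (simp add: r_def W_def algebra_simps)
  qed
  have b2: "real (Suc j choose Suc i) * r = W * (real j + 1)"
    using b1 by (simp add: distrib_right) (simp add: W_def[symmetric] algebra_simps)
  have b3: "real j * real (j - 1 choose Suc i) = real (j choose Suc i) * (real j - r)"
  proof (cases j)
    case (Suc k)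
    have "real (Suc k choose Suc i) * (real k - real i) = real (Suc k) * real (k choose Suc i)"
    proof (cases "i \<le> k")
      case True
      have "(Suc k - Suc i) * (Suc k choose Suc i) = Suc k * (k choose Suc i)"
        using binomial_absorb_comp[of "Suc k" "Suc i"] by simp
      then have "real (k - i) * real (Suc k choose Suc i) = real (Suc k) * real (k choose Suc i)"
        by (metis diff_Suc_Suc of_nat_mult)
      then show ?thesis using True by (simp add: of_nat_diff mult.commute)
    next
      case False
      then show ?thesis by (simp add: binomial_eq_0)
    qed
    then show ?thesis using Suc by (simp add: r_def)
  qed simp
  have t1: "pochhammer (jp j) (Suc i) = T * X"
    by (simp add: pochhammer_Suc T_def X_def r_def)
  have t2: "jp j * pochhammer (jp (Suc j)) (Suc i) = T * X * (X + 1)"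
  proof -
    have "jp (Suc j) = jp j + 1" by (simp add: jp_def)
    then have "jp j * pochhammer (jp (Suc j)) (Suc i) = pochhammer (jp j) (Suc (Suc i))"
      by (simp only: pochhammer_rec)
    also have "\<dots> = pochhammer (jp j) (Suc i) * (jp j + real (Suc i))" by (rule pochhammer_Suc)
    also have "\<dots> = T * X * (X + 1)" unfolding t1 by (simp add: X_def r_def)
    finally show ?thesis .
  qed
  have t3: "real j * pochhammer (jp (j - 1)) (Suc i) = real j * ((jp j - 1) * T)"
  proof (cases j)
    case (Suc k)
    have "jp (j - 1) = jp j - 1" by (simp add: jp_def Suc)
    then show ?thesis by (simp only: pochhammer_rec T_def) simp
  qed simp
  have e0: "jc j i = C * (r * (real L + r))"
    using r0 P0 by (simp add: jc_alt C_def W_def T_def P_def)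
  have e1: "jc j (Suc i) = - C * ((real j - r + 1) * X)"
  proof -
    have "jc j (Suc i) = - ((-1) ^ i * (real (j choose Suc i) * r) * (T * X) / (r * (P * (real L + r))))"
      using r0 by (simp add: jc_alt t1 PS)
    then show ?thesis unfolding b1 by (simp add: C_def mult_ac)
  qed
  have e2: "jp j * jc (Suc j) (Suc i) = - C * ((real j + 1) * X * (X + 1))"
  proof -
    have "jp j * jc (Suc j) (Suc i) = - ((-1) ^ i * (real (Suc j choose Suc i) * r) * (jp j * pochhammer (jp (Suc j)) (Suc i)) / (r * (P * (real L + r))))"
      using r0 by (simp add: jc_alt PS del: binomial_Suc_Suc)
    then show ?thesis unfolding b2 t2 by (simp add: C_def mult_ac)
  qed
  have e3: "real j * jc (j - 1) (Suc i) = - C * ((real j - r + 1) * (real j - r) * (jp j - 1))"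
  proof -
    have "real j * (real j * jc (j - 1) (Suc i)) = - ((-1) ^ i * (real j * real (j - 1 choose Suc i)) * (real j * pochhammer (jp (j - 1)) (Suc i)) / (P * (real L + r)))"
      by (simp add: jc_alt PS)
    also have "\<dots> = real j * (- ((-1) ^ i * ((real (j choose Suc i) * r) * (real j - r)) * ((jp j - 1) * T) / (r * (P * (real L + r)))))"
      unfolding b3 t3 using r0 by simp
    also have "\<dots> = real j * (- C * ((real j - r + 1) * (real j - r) * (jp j - 1)))"
      unfolding b1 by (simp add: C_def mult_ac)
    finally have fin: "real j * (real j * jc (j - 1) (Suc i)) = real j * (- C * ((real j - r + 1) * (real j - r) * (jp j - 1)))" .
    \<comment> \<open>For \<open>j = 0\<close> the factor \<open>real j\<close> cannot be cancelled.
      Then the right side is 0 by itself: \<open>C\<close> contains \<open>0 choose i\<close>, and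
      \<open>1 - r\<close> vanishes at \<open>i = 0\<close>.\<close>
    then show ?thesis
    proof (cases "j = 0")
      case True
      have "(1 - r) * r * C = 0"
      proof (cases i)
        case (Suc i')
        then show ?thesis using True by (simp add: C_def W_def)
      qed (simp add: r_def)
      then show ?thesis using True by (auto simp: algebra_simps)
    next
      case False
      then have "real j \<noteq> 0" by simp
      then show ?thesis using fin by (rule mult_left_cancel[THEN iffD1])
    qed
  qed
  have "ja j * jc (Suc j) (Suc i) = - C * ((real j + L + 1) * (real j + 1) * X * (X + 1) / ((j + jp j) * (j + jp j + 1)))"
  proof -
    have "ja j * jc (Suc j) (Suc i) = (jp j * jc (Suc j) (Suc i)) * ((real j + L + 1) / ((j + jp j) * (j + jp j + 1)))"
      by (simp add: ja_def)
    then show ?thesis unfolding e2 by (simp add: mult_ac)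
  qed
  moreover have "(ja j + jb j) * jc j (Suc i) = - C * ((jp j * (real j + L + 1) / ((j + jp j) * (j + jp j + 1)) + j * (jp j - L - 1) / ((j + jp j - 1) * (j + jp j))) * ((real j - r + 1) * X))"
    unfolding e1 ja_def jb_def by simp
  moreover have "jb j * jc (j - 1) (Suc i) = - C * ((jp j - L - 1) * (real j - r + 1) * (real j - r) * (jp j - 1) / ((j + jp j - 1) * (j + jp j)))"
  proof -
    have "jb j * jc (j - 1) (Suc i) = (real j * jc (j - 1) (Suc i)) * ((jp j - L - 1) / ((j + jp j - 1) * (j + jp j)))"
      by (simp add: jb_def)
    then show ?thesis unfolding e3 by (simp add: mult_ac)
  qed
  moreover have "r * (real L + r) = (real j + L + 1) * (real j + 1) * X * (X + 1) / ((j + jp j) * (j + jp j + 1))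
     - (jp j * (real j + L + 1) / ((j + jp j) * (j + jp j + 1)) + j * (jp j - L - 1) / ((j + jp j - 1) * (j + jp j)))
        * ((real j - r + 1) * X)
     + (jp j - L - 1) * (real j - r + 1) * (real j - r) * (jp j - 1) / ((j + jp j - 1) * (j + jp j))"
    using jac_identity[of "real j" "jp j" r "real L"] p0 by (simp add: X_def)
  ultimately show ?thesis
    unfolding e0 by (simp only: minus_mult_minus mult_minus_left) (simp add: algebra_simps)
qed

lemma jac_recurrence:
  "[:0, 1:] * jac j = - Polynomial.smult (ja j) (jac (Suc j)) + Polynomial.smult (ja j + jb j) (jac j) - Polynomial.smult (jb j) (jac (j - 1))"
proof (rule poly_eqI)
  fix i
  show "coeff ([:0, 1:] * jac j) i = coeff (- Polynomial.smult (ja j) (jac (Suc j)) + Polynomial.smult (ja j + jb j) (jac j) - Polynomial.smult (jb j) (jac (j - 1))) i"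
  proof (cases i)
    case 0
    then show ?thesis by (simp add: coeff_jac jc_def)
  next
    case (Suc i')
    then show ?thesis using jc_recurrence[of j i'] by (simp add: coeff_jac)
  qed
qed

section \<open>Multiplication by \<open>x\<close> and by \<open>1 - x\<close> in the Jacobi
  basis\<close>

definition jh :: "nat \<Rightarrow> real" where
  "jh j = ell D L (jac j * jac j)"

lemma ell_x_jac:
  "ell D L ([:0, 1:] * jac i * jac j) = - ja i * ell D L (jac (Suc i) * jac j) + (ja i + jb i) * ell D L (jac i * jac j)
     - jb i * ell D L (jac (i - 1) * jac j)"
  unfolding jac_recurrence by (simp add: algebra_simps ell_add ell_diff ell_minus ell_smult)

lemma ell_x_jac_Suc: "ell D L ([:0, 1:] * jac j * jac (Suc j)) = - ja j * jh (Suc j)"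
  using ell_jac_jac[of j "Suc j"] ell_jac_jac[of "j - 1" "Suc j"] by (simp add: ell_x_jac jh_def del: mult_pCons_left)

lemma ell_x_jac_Suc': "ell D L ([:0, 1:] * jac (Suc j) * jac j) = - jb (Suc j) * jh j"
  using ell_jac_jac[of "Suc j" j] ell_jac_jac[of "Suc (Suc j)" j] by (simp add: ell_x_jac jh_def del: mult_pCons_left)

lemma ell_x_jac_same: "ell D L ([:0, 1:] * jac j * jac j) = (ja j + jb j) * jh j"
proof (cases j)
  case 0
  then show ?thesis using ell_jac_jac[of "Suc 0" 0] by (simp add: ell_x_jac jh_def jb_def del: mult_pCons_left)
next
  case (Suc k)
  then show ?thesis using ell_jac_jac[of "Suc j" j] ell_jac_jac[of k j] by (simp add: ell_x_jac jh_def del: mult_pCons_left)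
qed

lemma ell_x_jac_far: "i \<noteq> j \<Longrightarrow> i \<noteq> Suc j \<Longrightarrow> j \<noteq> Suc i \<Longrightarrow> ell D L ([:0, 1:] * jac i * jac j) = 0"
  using ell_jac_jac[of "Suc i" j] ell_jac_jac[of i j] ell_jac_jac[of "i - 1" j]
  by (cases i) (auto simp: ell_x_jac jb_def simp del: mult_pCons_left)

lemma ja_pos: "ja j > 0"
  using jp_pos[of j] by (simp add: ja_def)

lemma jb_pos: "jb (Suc j) > 0"
proof -
  have "jp (Suc j) - L - 1 > 0" using D by (simp add: jp_def)
  then show ?thesis using jp_pos[of "Suc j"] by (simp add: jb_def)
qed

text \<open>The pairing of \<open>x * jac j\<close> with \<open>jac (Suc j)\<close> is computed by
  applying the recurrence to either factor.\<close>

lemma jh_Suc: "jh (Suc j) = jh j * jb (Suc j) / ja j"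
proof -
  have e: "[:0, 1:] * jac j * jac (Suc j) = [:0, 1:] * jac (Suc j) * jac j"
    by (simp only: mult_ac)
  have "- ja j * jh (Suc j) = - jb (Suc j) * jh j"
    by (rule trans[OF ell_x_jac_Suc[of j, symmetric, unfolded e] ell_x_jac_Suc'[of j]])
  then show ?thesis using ja_pos[of j] by (simp add: field_simps)
qed

lemma jh_pos: "jh j > 0"
proof (induction j)
  case 0
  have "jac 0 = 1" by (rule poly_eqI) (auto simp: coeff_jac jc_def binomial_eq_0 not_less split: nat.splits)
  then show ?case using sph_pos[of L] by (simp add: jh_def ell_def)
next
  case (Suc j)
  then show ?case using jb_pos[of j] ja_pos[of j] by (simp add: jh_Suc)
qed

text \<open>With \<open>jC\<close> the data of a Cholesky factorisation of multiplication by
  \<open>1 - x\<close> into bidiagonal factors: \<open>jA_jC_sum\<close> matches the diagonal and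
  \<open>jA_jC_prod\<close> the squares of the off-diagonal entries.\<close>

definition jA :: "nat \<Rightarrow> real" where
  "jA j = jp j * (real j + D - 1) / ((j + jp j) * (j + jp j + 1))"

definition jC :: "nat \<Rightarrow> real" where
  "jC j = real j * (real j + L) / ((j + jp j - 1) * (j + jp j))"

lemma jA_jC_sum: "1 - ja j - jb j = jA j + jC j"
proof -
  have p: "jp j > 1" by (rule jp_pos)
  have e: "real j + D - 1 = jp j - L" by (simp add: jp_def)
  have *: "1 - p * (l + j + 1) / ((j + p) * (j + p + 1)) - j * (p - l - 1) / ((j + p - 1) * (j + p))
      = p * (p - l) / ((j + p) * (j + p + 1)) + j * (j + l) / ((j + p - 1) * (j + p))"
    if "j \<ge> 0" "p > 1" for j p l :: real
  proof -
    have "j + p - 1 \<noteq> 0" "j + p \<noteq> 0" "j + p + 1 \<noteq> 0" using that by auto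
    then show ?thesis by (simp add: divide_simps) (simp add: algebra_simps)
  qed
  show ?thesis unfolding ja_def jb_def jA_def jC_def e using *[of "real j" "jp j" "real L"] p
    by (simp add: add.commute)
qed

lemma jA_jC_prod: "jA j * jC (Suc j) = ja j * jb (Suc j)"
proof -
  have e: "jp (Suc j) = jp j + 1" "real j + D - 1 = jp j - L" by (simp_all add: jp_def)
  have 1: "jA j = jp j * (jp j - L) / ((j + jp j) * (j + jp j + 1))" by (simp add: jA_def e(2))
  have 2: "jC (Suc j) = (j + 1) * (real j + L + 1) / ((j + jp j + 1) * (j + jp j + 2))"
    by (simp add: jC_def e(1) add_ac)
  have 3: "jb (Suc j) = (j + 1) * (jp j - L) / ((j + jp j + 1) * (j + jp j + 2))"
    by (simp add: jb_def e(1) add_ac)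
  show ?thesis unfolding 1 2 3 ja_def by (simp only: times_divide_times_eq mult_ac)
qed

lemma jA_pos: "jA j > 0"
  using jp_pos[of j] D by (simp add: jA_def)

lemma jC_nonneg: "jC j \<ge> 0"
  using jp_pos[of j] by (simp add: jC_def)

text \<open>Both summands are nonnegative and easy to bound. The closeness of \<open>jA j\<close>
  and \<open>jC (Suc j)\<close> is what makes the squares in \<open>jacobi_form\<close> small for
  slowly varying \<open>w\<close>.\<close>

lemma jA_jC_diff: "jA j - jC (Suc j) = (real D - 2) / (2 * real j + L + D - 1)
    + 2 * (real j + 1) * (real j + 1 + real L) / ((2 * real j + L + D - 1) * (2 * real j + L + D) * (2 * real j + L + D + 1))"
proof -
  define N where "N = 2 * real j + L + D"
  have N: "N > 2" using D L by (simp add: N_def)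
  define J where "J = real j + 1"
  have l: "real L = N - 2 * real j - D" by (simp add: N_def)
  have e: "real j + D - 1 = J + (real D - 2)" "real j + jp j = N - 1" "jp j = N - J"
    by (simp_all add: jp_def N_def J_def)
  have e': "real (Suc j) = J" "J + real L = N - J - (real D - 2)" "J + jp (Suc j) = N + 1"
    by (simp_all add: jp_def N_def J_def)
  have "jA j = (N - J) * (J + (real D - 2)) / ((N - 1) * N)"
    unfolding jA_def e(1,2) unfolding e(3) by simp
  moreover have "jC (Suc j) = J * (N - J - (real D - 2)) / (N * (N + 1))"
    unfolding jC_def e'(1) unfolding e'(2,3) by simp
  moreover have "(N - J) * (J + a) / ((N - 1) * N) - J * (N - J - a) / (N * (N + 1))
     = a / (N - 1) + 2 * J * (N - J - a) / ((N - 1) * N * (N + 1))" for a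
  proof -
    have "N - 1 \<noteq> 0" "N \<noteq> 0" "N + 1 \<noteq> 0" using N by auto
    then show ?thesis by (simp add: divide_simps) (simp add: algebra_simps)
  qed
  ultimately have "jA j - jC (Suc j) = (real D - 2) / (N - 1) + 2 * J * (J + real L) / ((N - 1) * N * (N + 1))"
    unfolding e'(2) by simp
  then show ?thesis by (simp add: N_def J_def)
qed

lemma sum_tridiagonal:
  fixes M :: "nat \<Rightarrow> nat \<Rightarrow> real"
  assumes "\<And>i j. i \<noteq> j \<Longrightarrow> i \<noteq> Suc j \<Longrightarrow> j \<noteq> Suc i \<Longrightarrow> M i j = 0"
  shows "(\<Sum>i\<le>n. \<Sum>j\<le>n. M i j) = (\<Sum>i\<le>n. M i i) + (\<Sum>i<n. M i (Suc i) + M (Suc i) i)"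
proof (induction n)
  case (Suc n)
  have 1: "(\<Sum>i\<le>n. M i (Suc n)) = M n (Suc n)"
    using assms by (subst sum.remove[of _ n]) (auto intro!: sum.neutral)
  have 2: "(\<Sum>j\<le>n. M (Suc n) j) = M (Suc n) n"
    using assms by (subst sum.remove[of _ n]) (auto intro!: sum.neutral)
  have "(\<Sum>i\<le>Suc n. \<Sum>j\<le>Suc n. M i j) = (\<Sum>i\<le>n. \<Sum>j\<le>n. M i j) + (\<Sum>i\<le>n. M i (Suc n)) + (\<Sum>j\<le>n. M (Suc n) j) + M (Suc n) (Suc n)"
    by (simp add: sum.distrib)
  then show ?case by (simp add: Suc.IH 1 2)
qed simp

text \<open>In the orthonormal basis the form \<open>q \<mapsto> ell ((1 - x) q\<^sup>2)\<close> is a Jacobi matrix, and a sum of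
  squares \<open>(\<surd>A\<^sub>j w\<^sub>j - \<surd>C\<^sub>j\<^sub>+\<^sub>1 w\<^sub>j\<^sub>+\<^sub>1)\<^sup>2\<close> after alternating the signs of the coefficients.\<close>

lemma jacobi_form:
  fixes w :: "nat \<Rightarrow> real"
  assumes w0: "w n = 0"
  shows "\<exists>q. degree q \<le> n \<and> ell D L (q * q) = (\<Sum>j\<le>n. (w j)\<^sup>2) \<and>
    ell D L ([:1, -1:] * (q * q)) = (\<Sum>j<n. (sqrt (jA j) * w j - sqrt (jC (Suc j)) * w (Suc j))\<^sup>2)"
proof -
  define c where "c = (\<lambda>j. (-1) ^ j * w j / sqrt (jh j))"
  define q where "q = (\<Sum>j\<le>n. Polynomial.smult (c j) (jac j))"
  have ch: "c j * c j * jh j = (w j)\<^sup>2" for j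
  proof -
    have "c j * c j * jh j = ((-1) ^ j * (-1) ^ j) * (w j * w j) * (jh j / (sqrt (jh j) * sqrt (jh j)))"
      by (simp add: c_def)
    also have "jh j / (sqrt (jh j) * sqrt (jh j)) = 1" using jh_pos[of j] by simp
    also have "(-1) ^ j * (-1) ^ j = (1 :: real)" by (simp flip: power_mult_distrib)
    finally show ?thesis by (simp add: power2_eq_square)
  qed
  have dq: "degree q \<le> n"
    unfolding q_def
    by (intro degree_sum_le) (auto intro!: order.trans[OF degree_smult_le] order.trans[OF degree_jac])
  have expand: "ell D L (p * (q * q)) = (\<Sum>i\<le>n. \<Sum>j\<le>n. c i * c j * ell D L (p * jac i * jac j))" for p
  proof -
    have "q * q = (\<Sum>i\<le>n. \<Sum>j\<le>n. Polynomial.smult (c i * c j) (jac i * jac j))"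
      unfolding q_def sum_product by (intro sum.cong refl) (simp add: mult.commute)
    then have "p * (q * q) = (\<Sum>i\<le>n. \<Sum>j\<le>n. Polynomial.smult (c i * c j) (p * jac i * jac j))"
      by (simp add: sum_distrib_left mult.assoc)
    then show ?thesis by (simp add: ell_sum ell_smult)
  qed
  have 1: "ell D L (q * q) = (\<Sum>j\<le>n. (w j)\<^sup>2)"
  proof -
    have "(\<Sum>j\<le>n. c i * c j * ell D L (jac i * jac j)) = (w i)\<^sup>2" if "i \<le> n" for i
    proof -
      have "c i * c j * ell D L (jac i * jac j) = (if j = i then (w i)\<^sup>2 else 0)" for j
        by (auto simp: ell_jac_jac ch[symmetric] jh_def)
      then show ?thesis using that by simp
    qed
    then show ?thesis using expand[of 1] by simp
  qed
  have off: "c j * c (Suc j) * ell D L ([:0, 1:] * jac j * jac (Suc j)) = w j * w (Suc j) * sqrt (jA j * jC (Suc j))"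
    "c (Suc j) * c j * ell D L ([:0, 1:] * jac (Suc j) * jac j) = w j * w (Suc j) * sqrt (jA j * jC (Suc j))" for j
  proof -
    have r: "jb (Suc j) * jh j = ja j * jh (Suc j)"
      using jh_Suc[of j] ja_pos[of j] by (simp add: field_simps)
    have s: "sqrt (ja j * jb (Suc j)) = ja j * jh (Suc j) / (sqrt (jh j) * sqrt (jh (Suc j)))"
    proof -
      have "(ja j * jh (Suc j) / (sqrt (jh j) * sqrt (jh (Suc j))))\<^sup>2 = ja j * jb (Suc j)"
        using jh_pos[of j] jh_pos[of "Suc j"] r by (simp add: power_divide power_mult_distrib) (simp add: power2_eq_square field_simps)
      moreover have "ja j * jh (Suc j) / (sqrt (jh j) * sqrt (jh (Suc j))) \<ge> 0"
        using jh_pos[of j] jh_pos[of "Suc j"] ja_pos[of j] by simp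
      ultimately show ?thesis by (metis real_sqrt_unique)
    qed
    have "c j * c (Suc j) * (- ja j * jh (Suc j)) = ((-1) ^ j * (-1) ^ j) * (w j * w (Suc j)) * (ja j * jh (Suc j) / (sqrt (jh j) * sqrt (jh (Suc j))))"
      by (simp add: c_def)
    also have "(-1) ^ j * (-1) ^ j = (1 :: real)" by (simp flip: power_mult_distrib)
    finally have k: "c j * c (Suc j) * (- ja j * jh (Suc j)) = w j * w (Suc j) * sqrt (jA j * jC (Suc j))"
      by (simp add: s jA_jC_prod)
    show "c j * c (Suc j) * ell D L ([:0, 1:] * jac j * jac (Suc j)) = w j * w (Suc j) * sqrt (jA j * jC (Suc j))"
      unfolding ell_x_jac_Suc by (rule k)
    have "- jb (Suc j) * jh j = - ja j * jh (Suc j)" using r by simp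
    then show "c (Suc j) * c j * ell D L ([:0, 1:] * jac (Suc j) * jac j) = w j * w (Suc j) * sqrt (jA j * jC (Suc j))"
      unfolding ell_x_jac_Suc' using k by (simp only: mult.commute[of "c (Suc j)"])
  qed
  have 2: "ell D L ([:0, 1:] * (q * q)) = (\<Sum>j\<le>n. (ja j + jb j) * (w j)\<^sup>2) + (\<Sum>j<n. 2 * (w j * w (Suc j) * sqrt (jA j * jC (Suc j))))"
  proof -
    have "ell D L ([:0, 1:] * (q * q)) = (\<Sum>i\<le>n. c i * c i * ell D L ([:0, 1:] * jac i * jac i))
       + (\<Sum>i<n. c i * c (Suc i) * ell D L ([:0, 1:] * jac i * jac (Suc i)) + c (Suc i) * c i * ell D L ([:0, 1:] * jac (Suc i) * jac i))"
      unfolding expand by (rule sum_tridiagonal) (simp add: ell_x_jac_far del: mult_pCons_left)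
    also have "(\<Sum>i\<le>n. c i * c i * ell D L ([:0, 1:] * jac i * jac i)) = (\<Sum>j\<le>n. (ja j + jb j) * (w j)\<^sup>2)"
      unfolding ell_x_jac_same ch[symmetric] by (intro sum.cong refl) (simp only: mult_ac)
    finally show ?thesis unfolding off by (simp add: mult.assoc)
  qed
  have "ell D L ([:1, -1:] * (q * q)) = ell D L (q * q) - ell D L ([:0, 1:] * (q * q))"
  proof -
    have "[:1, -1:] * (q * q) = q * q - [:0, 1:] * (q * q)" by (simp add: algebra_simps)
    then show ?thesis by (simp only: ell_diff)
  qed
  also have "\<dots> = (\<Sum>j\<le>n. (jA j + jC j) * (w j)\<^sup>2) - (\<Sum>j<n. 2 * (w j * w (Suc j) * sqrt (jA j * jC (Suc j))))"
    unfolding 1 2 jA_jC_sum[symmetric] by (simp add: sum_subtractf[symmetric] algebra_simps)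
  \<comment> \<open>The sums are aligned by \<open>w n = 0\<close> at the upper end and
    \<open>jC 0 = 0\<close> at the lower end.\<close>
  also have "(\<Sum>j\<le>n. (jA j + jC j) * (w j)\<^sup>2) = (\<Sum>j<n. jA j * (w j)\<^sup>2) + (\<Sum>j<n. jC (Suc j) * (w (Suc j))\<^sup>2)"
  proof -
    have "(\<Sum>j\<le>n. jA j * (w j)\<^sup>2) = (\<Sum>j<n. jA j * (w j)\<^sup>2)"
      unfolding lessThan_Suc_atMost[symmetric] using w0 by simp
    moreover have "(\<Sum>j\<le>n. jC j * (w j)\<^sup>2) = (\<Sum>j<n. jC (Suc j) * (w (Suc j))\<^sup>2)"
      unfolding lessThan_Suc_atMost[symmetric] sum.lessThan_Suc_shift by (simp add: jC_def)
    ultimately show ?thesis by (simp add: distrib_right sum.distrib)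
  qed
  also have "(\<Sum>j<n. jA j * (w j)\<^sup>2) + (\<Sum>j<n. jC (Suc j) * (w (Suc j))\<^sup>2) - (\<Sum>j<n. 2 * (w j * w (Suc j) * sqrt (jA j * jC (Suc j))))
      = (\<Sum>j<n. (sqrt (jA j) * w j - sqrt (jC (Suc j)) * w (Suc j))\<^sup>2)"
    unfolding sum.distrib[symmetric] sum_subtractf[symmetric]
  proof (rule sum.cong[OF refl])
    fix j
    have "(sqrt (jA j))\<^sup>2 = jA j" "(sqrt (jC (Suc j)))\<^sup>2 = jC (Suc j)"
      using jA_pos[of j] jC_nonneg[of "Suc j"] by simp_all
    then show "jA j * (w j)\<^sup>2 + jC (Suc j) * (w (Suc j))\<^sup>2 - 2 * (w j * w (Suc j) * sqrt (jA j * jC (Suc j)))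
      = (sqrt (jA j) * w j - sqrt (jC (Suc j)) * w (Suc j))\<^sup>2"
      by (simp add: power2_diff power_mult_distrib real_sqrt_mult)
  qed
  finally show ?thesis using 1 dq by blast
qed

end

lemma sum_squares_ge: "real k ^ 3 / 3 \<le> (\<Sum>j\<le>k. (real j)\<^sup>2)"
proof (induction k)
  case (Suc k)
  have "real (Suc k) ^ 3 / 3 \<le> real k ^ 3 / 3 + (real (Suc k))\<^sup>2"
    by (simp add: power3_eq_cube power2_eq_square field_simps)
  then show ?case using Suc.IH by simp
qed simp

text \<open>The trial vector \<open>w\<close> is a tent of height \<open>k\<close> on
  \<open>{0..2 * k}\<close>. Its squared norm is at least \<open>k^3 / 3\<close>, while each of the
  \<open>2 * k\<close> squares in \<open>jacobi_form\<close> is of order \<open>D\<close>; the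
  quotient is of order \<open>D / k^2\<close>.\<close>

theorem jacobi_trial:
  fixes D k :: nat
  assumes D: "D \<ge> 2" and k: "k \<ge> 1"
  shows "\<exists>q. degree q \<le> 2 * k \<and> ell D (D * k) (q * q) = 1 \<and>
    ell D (D * k) ([:1, -1:] * (q * q)) \<le> 400 * real D / (real k)\<^sup>2"
proof -
  define L where "L = D * k"
  have L: "L \<ge> 1" using D k by (simp add: L_def)
  define w where "w = (\<lambda>j. real (min j (2 * k - j)))"
  define S where "S = (\<Sum>j\<le>2 * k. (w j)\<^sup>2)"
  have S: "S \<ge> real k ^ 3 / 3"
  proof -
    have "(\<Sum>j\<le>k. (real j)\<^sup>2) = (\<Sum>j\<le>k. (w j)\<^sup>2)" by (intro sum.cong refl) (simp add: w_def min_def)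
    also have "\<dots> \<le> S" unfolding S_def by (intro sum_mono2) auto
    finally show ?thesis using sum_squares_ge[of k] by linarith
  qed
  have S0: "S > 0" proof -
    have "real k ^ 3 / 3 > 0" using k by simp
    then show ?thesis using S by linarith
  qed
  have bnd: "(sqrt (jA D L j) * w j - sqrt (jC D L (Suc j)) * w (Suc j))\<^sup>2 \<le> 64 * real D + 2"
    if j: "j < 2 * k" for j
  proof -
    let ?A = "jA D L j" and ?C = "jC D L (Suc j)"
    define N where "N = 2 * real j + L + D"
    have A0: "?A > 0" by (rule jA_pos[OF D L])
    have C0: "?C \<ge> 0" by (rule jC_nonneg[OF D L])
    have rk: "real k \<ge> 1" and rD: "real D \<ge> 2" using k D by auto
    have rL: "real L = real D * real k" by (simp add: L_def)
    have Dk: "real D * real k \<ge> 2 * real k" "real D * real k \<ge> real D"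
      using rk rD by (auto intro: mult_right_mono mult_left_mono simp: mult_le_cancel_left1)
    have N1: "N - 1 \<ge> real D * real k" using rD by (simp add: N_def rL)
    have N4: "N \<le> 4 * (real D * real k)" using j Dk unfolding N_def rL by linarith
    have J: "real j + 1 \<le> 2 * real k" using j by linarith
    have pos: "N - 1 > 0" "N > 0" "N + 1 > 0" using N1 Dk rk by linarith+
    \<comment> \<open>The choice \<open>L = D * k\<close> enters through
      \<open>N - 1 \<ge> D * k\<close>, which bounds each of the two summands by
      \<open>1 / k\<close>.\<close>
    have diff: "\<bar>?A - ?C\<bar> \<le> 2 / k"
    proof -
      have e: "?A - ?C = (real D - 2) / (N - 1) + 2 * (real j + 1) * (real j + 1 + L) / ((N - 1) * N * (N + 1))"
        unfolding jA_jC_diff[OF D L] N_def by simp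
      have "(real D - 2) / (N - 1) \<le> real D / (real D * real k)"
        using pos N1 rD rk by (intro frac_le) auto
      also have "\<dots> = 1 / k" using rD by simp
      finally have 1: "(real D - 2) / (N - 1) \<le> 1 / k" .
      have "2 * (real j + 1) * (real j + 1 + L) / ((N - 1) * N * (N + 1)) = (2 * (real j + 1) / ((N - 1) * (N + 1))) * ((real j + 1 + L) / N)"
        using pos by (simp add: field_simps)
      also have "\<dots> \<le> (2 * (real j + 1) / ((N - 1) * (N + 1))) * 1"
        using pos rD by (intro mult_left_mono) (auto simp: N_def)
      also have "2 * (real j + 1) / ((N - 1) * (N + 1)) \<le> 4 * real k / ((2 * real k) * (2 * real k))"
      proof (rule frac_le)
        show "2 * real k * (2 * real k) \<le> (N - 1) * (N + 1)"
          using pos N1 Dk rk by (intro mult_mono) linarith+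
      qed (use J rk in auto)
      also have "\<dots> = 1 / k" using rk by (simp add: field_simps)
      finally have 2: "2 * (real j + 1) * (real j + 1 + L) / ((N - 1) * N * (N + 1)) \<le> 1 / k" by simp
      have "?A - ?C \<ge> 0" unfolding e using pos rD by (intro add_nonneg_nonneg divide_nonneg_nonneg mult_nonneg_nonneg) auto
      moreover have "2 / real k = 1 / k + 1 / k" by simp
      moreover have "?A - ?C \<le> 1 / k + 1 / k" unfolding e using 1 2 by (rule add_mono)
      ultimately show ?thesis by linarith
    qed
    \<comment> \<open>A lower bound growing linearly in \<open>j\<close>, as the tent does near 0;
      it makes up for the division by \<open>sqrt ?A\<close> in the difference of square
      roots.\<close>
    have Alow: "?A \<ge> (real j + 1) / (8 * (real D * real k))"
    proof -
      have "(real j + 1) / (8 * (real D * real k)) \<le> (real j + 1) / (2 * N)"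
        using pos N4 by (intro divide_left_mono) (auto intro: mult_pos_pos)
      also have "\<dots> = (N - 1) / 2 * (real j + 1) / ((N - 1) * N)" using pos by (simp add: field_simps)
      also have "\<dots> \<le> jp D L j * (real j + D - 1) / ((N - 1) * N)"
      proof (intro divide_right_mono mult_mono)
        show "(N - 1) / 2 \<le> jp D L j" using rD by (simp add: N_def jp_def[OF D L])
        show "0 \<le> jp D L j" using jp_pos[OF D L, of j] by simp
      qed (use pos rD in auto)
      also have "\<dots> = ?A" by (simp add: jA_def[OF D L] jp_def[OF D L] N_def algebra_simps)
      finally show ?thesis .
    qed
    have Cup: "?C \<le> 1"
    proof -
      have "?C = ((real j + 1) / N) * ((real j + 1 + L) / (N + 1))"
        by (simp add: jC_def[OF D L] jp_def[OF D L] N_def algebra_simps)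
      also have "\<dots> \<le> 1 * 1" using pos rD by (intro mult_mono) (auto simp: N_def)
      finally show ?thesis by simp
    qed
    have wj: "w j \<ge> 0" "w j \<le> real k" "w j \<le> real j + 1" by (auto simp: w_def min_def)
    have wd: "(w j - w (Suc j))\<^sup>2 \<le> 1"
    proof -
      have "\<bar>w j - w (Suc j)\<bar> \<le> 1" by (auto simp: w_def min_def of_nat_diff)
      then show ?thesis by (simp add: abs_square_le_1)
    qed
    have "(sqrt ?A - sqrt ?C)\<^sup>2 * ?A \<le> (sqrt ?A - sqrt ?C)\<^sup>2 * (sqrt ?A + sqrt ?C)\<^sup>2"
    proof (intro mult_left_mono)
      have "?A = (sqrt ?A)\<^sup>2" using A0 by simp
      also have "\<dots> \<le> (sqrt ?A + sqrt ?C)\<^sup>2" using A0 C0 by (intro power_mono) auto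
      finally show "?A \<le> (sqrt ?A + sqrt ?C)\<^sup>2" .
    qed simp
    also have "\<dots> = (?A - ?C)\<^sup>2"
    proof -
      have "(sqrt ?A - sqrt ?C) * (sqrt ?A + sqrt ?C) = ?A - ?C"
        using A0 C0 by (simp add: algebra_simps)
      then show ?thesis by (metis power_mult_distrib)
    qed
    also have "\<dots> \<le> (2 / k)\<^sup>2" using diff rk by (simp add: abs_le_square_iff[symmetric])
    finally have sA: "(sqrt ?A - sqrt ?C)\<^sup>2 * ?A \<le> 4 / (real k)\<^sup>2" by (simp add: power_divide)
    \<comment> \<open>One factor of \<open>(w j)^2\<close> is bounded by the height
      \<open>k\<close>, the other by \<open>j + 1\<close>, which \<open>Alow\<close> converts into
      \<open>?A\<close>; together with \<open>sA\<close> the powers of \<open>k\<close>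
      cancel.\<close>
    have sw: "(sqrt ?A - sqrt ?C)\<^sup>2 * (w j)\<^sup>2 \<le> 32 * real D"
    proof -
      have "(w j)\<^sup>2 \<le> real k * (real j + 1)"
        unfolding power2_eq_square using wj by (intro mult_mono) auto
      also have "\<dots> \<le> real k * (8 * (real D * real k) * ?A)"
        using Alow rk rD by (intro mult_left_mono) (auto simp: field_simps)
      finally have "(sqrt ?A - sqrt ?C)\<^sup>2 * (w j)\<^sup>2 \<le> (sqrt ?A - sqrt ?C)\<^sup>2 * (real k * (8 * (real D * real k) * ?A))"
        by (intro mult_left_mono) auto
      also have "\<dots> = 8 * real D * (real k)\<^sup>2 * ((sqrt ?A - sqrt ?C)\<^sup>2 * ?A)" by (simp add: power2_eq_square)
      also have "\<dots> \<le> 8 * real D * (real k)\<^sup>2 * (4 / (real k)\<^sup>2)"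
        using sA by (intro mult_left_mono) auto
      also have "\<dots> = 32 * real D" using rk by simp
      finally show ?thesis .
    qed
    have "sqrt ?A * w j - sqrt ?C * w (Suc j) = (sqrt ?A - sqrt ?C) * w j + sqrt ?C * (w j - w (Suc j))"
      by (simp add: algebra_simps)
    moreover have "(x + y)\<^sup>2 \<le> 2 * x\<^sup>2 + 2 * y\<^sup>2" for x y :: real
      using zero_le_power2[of "x - y"] by (simp add: power2_sum power2_diff)
    ultimately have "(sqrt ?A * w j - sqrt ?C * w (Suc j))\<^sup>2 \<le> 2 * ((sqrt ?A - sqrt ?C) * w j)\<^sup>2 + 2 * (sqrt ?C * (w j - w (Suc j)))\<^sup>2"
      by metis
    also have "\<dots> = 2 * ((sqrt ?A - sqrt ?C)\<^sup>2 * (w j)\<^sup>2) + 2 * (?C * (w j - w (Suc j))\<^sup>2)"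
      using C0 by (simp add: power_mult_distrib)
    also have "\<dots> \<le> 2 * (32 * real D) + 2 * (1 * 1)"
    proof (rule add_mono)
      show "2 * ((sqrt ?A - sqrt ?C)\<^sup>2 * (w j)\<^sup>2) \<le> 2 * (32 * real D)"
        using sw by (rule mult_left_mono) simp
      have "?C * (w j - w (Suc j))\<^sup>2 \<le> 1 * 1" using wd Cup C0 by (intro mult_mono) auto
      then show "2 * (?C * (w j - w (Suc j))\<^sup>2) \<le> 2 * (1 * 1)" by simp
    qed
    finally show ?thesis by simp
  qed
  obtain q where q: "degree q \<le> 2 * k" "ell D L (q * q) = S"
    "ell D L ([:1, -1:] * (q * q)) = (\<Sum>j<2 * k. (sqrt (jA D L j) * w j - sqrt (jC D L (Suc j)) * w (Suc j))\<^sup>2)"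
    using jacobi_form[OF D L, of w "2 * k"] by (auto simp: w_def S_def)
  have "ell D L ([:1, -1:] * (q * q)) \<le> (\<Sum>j<2 * k. 64 * real D + 2)"
    unfolding q(3) by (intro sum_mono bnd) auto
  also have "\<dots> = real k * (128 * real D + 4)" by (simp add: algebra_simps)
  also have "\<dots> \<le> real k * (130 * real D)" using D by (intro mult_left_mono) auto
  also have "\<dots> = 130 * real D * real k" by (simp only: mult_ac)
  finally have b: "ell D L ([:1, -1:] * (q * q)) \<le> 130 * real D * real k" .
  define q' where "q' = Polynomial.smult (1 / sqrt S) q"
  have qq: "q' * q' = Polynomial.smult (1 / S) (q * q)"
    using S0 by (simp add: q'_def)
  have "degree q' \<le> 2 * k" using q(1) by (simp add: q'_def)
  moreover have "ell D L (q' * q') = 1" using S0 by (simp add: qq ell_smult q(2))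
  moreover have "ell D L ([:1, -1:] * (q' * q')) \<le> 400 * real D / (real k)\<^sup>2"
  proof -
    have "ell D L ([:1, -1:] * (q' * q')) = ell D L ([:1, -1:] * (q * q)) / S"
      unfolding qq mult_smult_right ell_smult by simp
    also have "\<dots> \<le> 130 * real D * real k / S" using b S0 by (intro divide_right_mono) auto
    also have "\<dots> \<le> 130 * real D * real k / (real k ^ 3 / 3)"
      using S k by (intro divide_left_mono) (auto intro!: mult_pos_pos S0)
    also have "\<dots> = 390 * real D / (real k)\<^sup>2" using k by (simp add: power3_eq_cube power2_eq_square field_simps)
    also have "\<dots> \<le> 400 * real D / (real k)\<^sup>2" by (intro divide_right_mono) auto
    finally show ?thesis .
  qed
  ultimately show ?thesis unfolding L_def by blast
qed

text \<open>With \<open>q = 1\<close> one recovers the error of measuring \<open>L\<close> copies of a pure state.\<close>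

lemma ell_one:
  assumes "D \<ge> 1"
  shows "ell D L ([:1, -1:] * 1) = sph D L * (real D - 1) / (D + L)" "ell D L 1 = sph D L"
proof -
  have "ell D L ([:1, -1:] * 1) = sph D L - sph D (Suc L)"
    by (simp add: ell_def)
  also have "sph D (Suc L) = sph D L * (L + 1) / (D + L)"
    using assms by (simp add: sph_def pochhammer_Suc divide_simps)
  finally show "ell D L ([:1, -1:] * 1) = sph D L * (real D - 1) / (D + L)"
    using assms by (simp add: field_simps)
  show "ell D L 1 = sph D L" by (simp add: ell_def)
qed

section \<open>The amplitude\<close>

text \<open>Linear in the tensor power of \<open>U\<close> and free of conjugates: the form in which
  an amplitude is available from \<open>n\<close> uses of \<open>U\<close>.\<close>

definition hom_poly :: "nat \<Rightarrow> nat \<Rightarrow> ((nat \<Rightarrow> nat \<Rightarrow> complex) \<Rightarrow> complex) \<Rightarrow> bool" where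
  "hom_poly D n f \<longleftrightarrow> (\<exists>c. \<forall>U. f U = (\<Sum>a\<in>tup n {..<D}. \<Sum>b\<in>tup n {..<D}. c a b * tpow U b a))"

lemma hom_poly_const: "hom_poly D 0 (\<lambda>U. k)"
  unfolding hom_poly_def by (rule exI[of _ "\<lambda>a b. k"]) simp

lemma hom_poly_add:
  assumes "hom_poly D n f" "hom_poly D n g"
  shows "hom_poly D n (\<lambda>U. f U + g U)"
proof -
  obtain c d where "\<And>U. f U = (\<Sum>a\<in>tup n {..<D}. \<Sum>b\<in>tup n {..<D}. c a b * tpow U b a)"
    "\<And>U. g U = (\<Sum>a\<in>tup n {..<D}. \<Sum>b\<in>tup n {..<D}. d a b * tpow U b a)"
    using assms by (auto simp: hom_poly_def)
  then show ?thesis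
    unfolding hom_poly_def by (intro exI[of _ "\<lambda>a b. c a b + d a b"]) (simp add: sum.distrib distrib_right)
qed

lemma hom_poly_cmult:
  assumes "hom_poly D n f"
  shows "hom_poly D n (\<lambda>U. k * f U)"
proof -
  obtain c where "\<And>U. f U = (\<Sum>a\<in>tup n {..<D}. \<Sum>b\<in>tup n {..<D}. c a b * tpow U b a)"
    using assms by (auto simp: hom_poly_def)
  then show ?thesis
    unfolding hom_poly_def by (intro exI[of _ "\<lambda>a b. k * c a b"]) (simp add: sum_distrib_left mult.assoc)
qed

lemma hom_poly_sum:
  assumes "finite I" "\<And>i. i \<in> I \<Longrightarrow> hom_poly D n (f i)"
  shows "hom_poly D n (\<lambda>U. \<Sum>i\<in>I. f i U)"
  using assms
proof (induction I rule: finite_induct)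
  case empty
  show ?case unfolding hom_poly_def by (rule exI[of _ "\<lambda>a b. 0"]) simp
next
  case (insert i I)
  then show ?case by (simp add: hom_poly_add)
qed

lemma hom_poly_coord:
  assumes f: "hom_poly D n f" and ij: "i < D" "j < D"
  shows "hom_poly D (Suc n) (\<lambda>U. U i j * f U)"
proof -
  obtain c where c: "\<And>U. f U = (\<Sum>a\<in>tup n {..<D}. \<Sum>b\<in>tup n {..<D}. c a b * tpow U b a)"
    using f by (auto simp: hom_poly_def)
  define c' where "c' = (\<lambda>a b. if hd a = j then if hd b = i then c (tl a) (tl b) else 0 else 0)"
  have "U i j * f U = (\<Sum>a\<in>tup (Suc n) {..<D}. \<Sum>b\<in>tup (Suc n) {..<D}. c' a b * tpow U b a)" for U
  proof -
    have "(\<Sum>a\<in>tup (Suc n) {..<D}. \<Sum>b\<in>tup (Suc n) {..<D}. c' a b * tpow U b a)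
        = (\<Sum>x<D. \<Sum>a\<in>tup n {..<D}. \<Sum>y<D. \<Sum>b\<in>tup n {..<D}. c' (x # a) (y # b) * (U y x * tpow U b a))"
      by (simp add: sum_tup_Suc)
    also have "\<dots> = (\<Sum>x<D. if x = j then (\<Sum>a\<in>tup n {..<D}. \<Sum>b\<in>tup n {..<D}. c a b * (U i j * tpow U b a)) else 0)"
    proof (rule sum.cong[OF refl])
      fix x assume "x \<in> {..<D}"
      show "(\<Sum>a\<in>tup n {..<D}. \<Sum>y<D. \<Sum>b\<in>tup n {..<D}. c' (x # a) (y # b) * (U y x * tpow U b a))
          = (if x = j then (\<Sum>a\<in>tup n {..<D}. \<Sum>b\<in>tup n {..<D}. c a b * (U i j * tpow U b a)) else 0)"
      proof (cases "x = j")
        case True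
        have "(\<Sum>y<D. \<Sum>b\<in>tup n {..<D}. c' (x # a) (y # b) * (U y x * tpow U b a))
           = (\<Sum>y<D. if y = i then (\<Sum>b\<in>tup n {..<D}. c a b * (U i j * tpow U b a)) else 0)" for a
          by (rule sum.cong[OF refl]) (auto simp: c'_def True)
        then show ?thesis using True ij by simp
      next
        case False
        then show ?thesis by (simp add: c'_def)
      qed
    qed
    also have "\<dots> = U i j * f U"
      using ij by (simp add: c sum_distrib_left mult_ac)
    finally show ?thesis by simp
  qed
  then show ?thesis unfolding hom_poly_def by blast
qed

lemma hom_poly_coords:
  assumes f: "hom_poly D n f" and "\<And>t. t < m \<Longrightarrow> i t < D \<and> j t < D"
  shows "hom_poly D (n + m) (\<lambda>U. (\<Prod>t<m. U (i t) (j t)) * f U)"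
  using assms(2)
proof (induction m)
  case 0
  show ?case using f by simp
next
  case (Suc m)
  have "hom_poly D (n + m) (\<lambda>U. (\<Prod>t<m. U (i t) (j t)) * f U)" using Suc by simp
  then have "hom_poly D (Suc (n + m)) (\<lambda>U. U (i m) (j m) * ((\<Prod>t<m. U (i t) (j t)) * f U))"
    using Suc.prems[of m] by (intro hom_poly_coord) auto
  then show ?case by (simp add: mult_ac)
qed

definition umat :: "nat \<Rightarrow> (nat \<Rightarrow> nat \<Rightarrow> complex) \<Rightarrow> complex mat" where
  "umat D U = mat D D (\<lambda>(i, j). U i j)"

lemma hom_poly_det:
  assumes f: "hom_poly D n f"
  shows "hom_poly D (n + D) (\<lambda>U. det (umat D U) * f U)"
proof -
  have "det (umat D U) * f U = (\<Sum>p | p permutes {0..<D}. of_int (sign p) * ((\<Prod>i<D. U i (p i)) * f U))" for U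
  proof -
    have "det (umat D U) = (\<Sum>p | p permutes {0..<D}. of_int (sign p) * (\<Prod>i<D. U i (p i)))"
      unfolding det_def'[OF mat_carrier[of D D "\<lambda>(i, j). U i j", folded umat_def]]
    proof (rule sum.cong[OF refl])
      fix p assume "p \<in> {p. p permutes {0..<D}}"
      then have "i < D \<Longrightarrow> p i < D" for i using permutes_in_image[of p "{0..<D}" i] by auto
      then show "of_int (sign p) * (\<Prod>i = 0..<D. umat D U $$ (i, p i)) = of_int (sign p) * (\<Prod>i<D. U i (p i))"
        by (simp add: umat_def atLeast0LessThan)
    qed
    then show ?thesis by (simp add: sum_distrib_right mult.assoc)
  qed
  moreover have "hom_poly D (n + D) (\<lambda>U. \<Sum>p | p permutes {0..<D}. of_int (sign p) * ((\<Prod>i<D. U i (p i)) * f U))"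
  proof (intro hom_poly_sum hom_poly_cmult hom_poly_coords f)
    fix p t assume "p \<in> {p. p permutes {0..<D}}" "t < D"
    then show "t < D \<and> p t < D" using permutes_in_image[of p "{0..<D}" t] by auto
  qed (simp add: finite_permutations)
  ultimately show ?thesis by simp
qed

lemma hom_poly_cofactor:
  assumes f: "hom_poly (Suc D) n f"
  shows "hom_poly (Suc D) (n + D) (\<lambda>U. cofactor (umat (Suc D) U) 0 0 * f U)"
proof -
  have "cofactor (umat (Suc D) U) 0 0 * f U = (\<Sum>p | p permutes {0..<D}. of_int (sign p) * ((\<Prod>i<D. U (Suc i) (Suc (p i))) * f U))" for U
  proof -
    have c: "mat_delete (umat (Suc D) U) 0 0 \<in> carrier_mat D D" by (auto simp: umat_def mat_delete_def)
    have "cofactor (umat (Suc D) U) 0 0 = (\<Sum>p | p permutes {0..<D}. of_int (sign p) * (\<Prod>i<D. U (Suc i) (Suc (p i))))"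
      unfolding cofactor_def det_def'[OF c]
    proof (simp, rule sum.cong[OF refl])
      fix p assume "p \<in> {p. p permutes {0..<D}}"
      then have "i < D \<Longrightarrow> p i < D" for i using permutes_in_image[of p "{0..<D}" i] by auto
      then show "of_int (sign p) * (\<Prod>i = 0..<D. mat_delete (umat (Suc D) U) 0 0 $$ (i, p i)) = of_int (sign p) * (\<Prod>i<D. U (Suc i) (Suc (p i)))"
        by (simp add: umat_def mat_delete_def atLeast0LessThan)
    qed
    then show ?thesis by (simp add: sum_distrib_right mult.assoc)
  qed
  moreover have "hom_poly (Suc D) (n + D) (\<lambda>U. \<Sum>p | p permutes {0..<D}. of_int (sign p) * ((\<Prod>i<D. U (Suc i) (Suc (p i))) * f U))"
  proof (intro hom_poly_sum hom_poly_cmult hom_poly_coords f)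
    fix p t assume "p \<in> {p. p permutes {0..<D}}" "t < D"
    then show "Suc t < Suc D \<and> Suc (p t) < Suc D" using permutes_in_image[of p "{0..<D}" t] by auto
  qed (simp add: finite_permutations)
  ultimately show ?thesis by simp
qed

lemma hom_poly_power:
  assumes g: "\<And>n f. hom_poly D n f \<Longrightarrow> hom_poly D (n + e) (\<lambda>U. g U * f U)" and f: "hom_poly D n f"
  shows "hom_poly D (n + m * e) (\<lambda>U. g U ^ m * f U)"
proof (induction m)
  case (Suc m)
  from g[OF Suc.IH] show ?case by (simp add: mult_ac add_ac)
qed (use f in simp)

text \<open>For unitary \<open>U\<close> the cofactor is \<open>det U * cnj (U 0 0)\<close>, so this homogeneous polynomial in the
  entries of \<open>U\<close> equals \<open>(det U)^k * (U 0 0)^L * q (|U 0 0|\<^sup>2)\<close>.\<close>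

definition amp :: "nat \<Rightarrow> nat \<Rightarrow> nat \<Rightarrow> real poly \<Rightarrow> (nat \<Rightarrow> nat \<Rightarrow> complex) \<Rightarrow> complex" where
  "amp D L k q U = (\<Sum>m\<le>k. of_real (coeff q m) *
     (U 0 0 ^ (L + m) * (cofactor (umat D U) 0 0 ^ m * det (umat D U) ^ (k - m))))"

text \<open>The powers of the determinant equalise the degrees: each summand has degree
  \<open>(L + m) + m * (D - 1) + (k - m) * D = L + D * k\<close>.\<close>

lemma hom_poly_amp:
  assumes D: "D \<ge> 1"
  shows "hom_poly D (L + D * k) (amp D L k q)"
proof -
  obtain d where d: "D = Suc d" using D by (cases D) auto
  have "hom_poly D (L + D * k) (\<lambda>U. of_real (coeff q m) * (U 0 0 ^ (L + m) * (cofactor (umat D U) 0 0 ^ m * det (umat D U) ^ (k - m))))"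
    if m: "m \<in> {..k}" for m
  proof -
    have "hom_poly D (0 + (k - m) * D) (\<lambda>U. det (umat D U) ^ (k - m) * 1)"
      by (rule hom_poly_power[OF hom_poly_det hom_poly_const])
    then have "hom_poly D (0 + (k - m) * D + m * d) (\<lambda>U. cofactor (umat D U) 0 0 ^ m * (det (umat D U) ^ (k - m) * 1))"
      unfolding d by (rule hom_poly_power[where g = "\<lambda>U. cofactor (umat (Suc d) U) 0 0", rotated])
        (rule hom_poly_cofactor)
    then have "hom_poly D (0 + (k - m) * D + m * d + (L + m) * 1) (\<lambda>U. U 0 0 ^ (L + m) * (cofactor (umat D U) 0 0 ^ m * (det (umat D U) ^ (k - m) * 1)))"
      by (rule hom_poly_power[rotated]) (use D in \<open>simp add: hom_poly_coord\<close>)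
    then have "hom_poly D (0 + (k - m) * D + m * d + (L + m) * 1) (\<lambda>U. of_real (coeff q m) * (U 0 0 ^ (L + m) * (cofactor (umat D U) 0 0 ^ m * (det (umat D U) ^ (k - m) * 1))))"
      by (rule hom_poly_cmult)
    moreover have "0 + (k - m) * D + m * d + (L + m) * 1 = L + D * k"
    proof -
      have "(k - m) * D + m * D = k * D" using m by (simp add: add_mult_distrib[symmetric])
      then show ?thesis by (simp add: d algebra_simps)
    qed
    ultimately show ?thesis by (simp only: mult_1_right)
  qed
  then show ?thesis unfolding amp_def by (intro hom_poly_sum) auto
qed

text \<open>The adjugate of a unitary matrix is its determinant times its adjoint, and the
  determinant is a phase.\<close>

lemma
  assumes D: "D \<ge> 1" and U: "unitary_on {..<D} U"
  shows cofactor_unitary: "cofactor (umat D U) 0 0 = det (umat D U) * cnj (U 0 0)"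
    and det_unitary: "cmod (det (umat D U)) = 1"
proof -
  define M where "M = umat D U"
  define N where "N = mat D D (\<lambda>(i, j). cnj (U j i))"
  have M: "M \<in> carrier_mat D D" and N: "N \<in> carrier_mat D D" by (simp_all add: M_def umat_def N_def)
  have NM: "N * M = 1\<^sub>m D"
  proof (rule eq_matI)
    fix i j assume "i < dim_row (1\<^sub>m D :: complex mat)" "j < dim_col (1\<^sub>m D :: complex mat)"
    then have ij: "i < D" "j < D" by auto
    have "(N * M) $$ (i, j) = (\<Sum>k<D. cnj (U k i) * U k j)"
      using ij by (simp add: M_def N_def umat_def scalar_prod_def atLeast0LessThan)
    also have "\<dots> = 1\<^sub>m D $$ (i, j)"
      using unitary_onD(2)[OF U] ij by (simp add: meq_def mm_def adj_def idm_def)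
    finally show "(N * M) $$ (i, j) = 1\<^sub>m D $$ (i, j)" .
  qed (use M N in auto)
  have "N * (M * adj_mat M) = N * (det M \<cdot>\<^sub>m 1\<^sub>m D)" using adj_mat(2)[OF M] by simp
  moreover have "N * (M * adj_mat M) = adj_mat M"
    using assoc_mult_mat[OF N M adj_mat(1)[OF M]] NM adj_mat(1)[OF M] by simp
  moreover have "N * (det M \<cdot>\<^sub>m 1\<^sub>m D) = det M \<cdot>\<^sub>m N" using N by (simp add: mult_smult_distrib[OF N one_carrier_mat])
  ultimately have "adj_mat M $$ (0, 0) = (det M \<cdot>\<^sub>m N) $$ (0, 0)" by simp
  then show "cofactor (umat D U) 0 0 = det (umat D U) * cnj (U 0 0)"
    using D M N by (simp add: adj_mat_def M_def N_def umat_def)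
  interpret cnj_hom: comm_ring_hom cnj by (unfold_locales) auto
  have "N = transpose_mat (map_mat cnj M)"
    by (rule eq_matI) (auto simp: N_def M_def umat_def)
  then have "det N = cnj (det M)"
    using M det_transpose[of "map_mat cnj M" D] by (simp add: cnj_hom.hom_det)
  moreover have "det N * det M = 1" using det_mult[OF N M] NM by simp
  ultimately have "cnj (det M) * det M = 1" by simp
  then have "of_real ((cmod (det M))\<^sup>2) = (1 :: complex)"
    by (simp only: complex_norm_square mult.commute)
  then have "(cmod (det M))\<^sup>2 = 1" by (simp only: of_real_eq_1_iff)
  then show "cmod (det (umat D U)) = 1" unfolding M_def using power2_eq_1_iff norm_ge_zero by (smt (verit))
qed

lemma amp_unitary:
  assumes D: "D \<ge> 1" and U: "unitary_on {..<D} U" and q: "degree q \<le> k"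
  shows "(cmod (amp D L k q U))\<^sup>2 = ((cmod (U 0 0))\<^sup>2) ^ L * (poly q ((cmod (U 0 0))\<^sup>2))\<^sup>2"
proof -
  let ?z = "U 0 0" and ?d = "det (umat D U)"
  have "amp D L k q U = (\<Sum>m\<le>k. (?z ^ L * ?d ^ k) * of_real (coeff q m * ((cmod ?z)\<^sup>2) ^ m))"
    unfolding amp_def
  proof (rule sum.cong[OF refl])
    fix m assume m: "m \<in> {..k}"
    have "?d ^ k = ?d ^ m * ?d ^ (k - m)" using m by (simp add: power_add[symmetric])
    moreover have "of_real (((cmod ?z)\<^sup>2) ^ m) = ?z ^ m * cnj ?z ^ m"
      unfolding of_real_power[of _ m] complex_norm_square power_mult_distrib ..
    ultimately show "of_real (coeff q m) * (?z ^ (L + m) * (cofactor (umat D U) 0 0 ^ m * ?d ^ (k - m)))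
       = (?z ^ L * ?d ^ k) * of_real (coeff q m * ((cmod ?z)\<^sup>2) ^ m)"
      unfolding cofactor_unitary[OF D U] of_real_mult power_add power_mult_distrib by (simp only: mult_ac)
  qed
  also have "\<dots> = (?z ^ L * ?d ^ k) * of_real (poly q ((cmod ?z)\<^sup>2))"
  proof -
    have "poly q x = (\<Sum>m\<le>k. coeff q m * x ^ m)" for x
      unfolding poly_altdef by (rule sum.mono_neutral_left) (use q in \<open>auto simp: coeff_eq_0\<close>)
    then show ?thesis by (simp add: sum_distrib_left)
  qed
  finally have "cmod (amp D L k q U) = cmod ?z ^ L * \<bar>poly q ((cmod ?z)\<^sup>2)\<bar>"
    by (simp add: norm_mult norm_power det_unitary[OF D U])
  then show ?thesis by (simp add: power_mult_distrib power_mult[symmetric] mult.commute)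
qed

lemma amplitude_exists:
  assumes D: "D \<ge> 1" and q: "degree q \<le> k" and n: "n = L + D * k"
  shows "\<exists>F. symm_on n {..<D} {..<D} F \<and>
    (\<forall>U. unitary_on {..<D} U \<longrightarrow>
      (cmod (\<Sum>a\<in>tup n {..<D}. \<Sum>b\<in>tup n {..<D}. cnj (F a b) * tpow U b a))\<^sup>2
        = ((cmod (U 0 0))\<^sup>2) ^ L * (poly q ((cmod (U 0 0))\<^sup>2))\<^sup>2)"
proof -
  let ?T = "tup n {..<D}"
  obtain c where c: "\<And>U. amp D L k q U = (\<Sum>a\<in>?T. \<Sum>b\<in>?T. c a b * tpow U b a)"
    using hom_poly_amp[OF D, of L k q] n by (auto simp: hom_poly_def)
  \<comment> \<open>Symmetrising the coefficients does not change the polynomial, because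
    \<open>tpow U\<close> is invariant under simultaneous permutations. The conjugate makes the
    amplitude an inner product with the vector \<open>F\<close>.\<close>
  define F where "F = (\<lambda>a b. cnj ((\<Sum>p\<in>perms n. c (pl p a) (pl p b)) / fact n))"
  have "symm_on n {..<D} {..<D} F"
    unfolding symm_on_def
  proof (intro ballI)
    fix s a b assume s: "s \<in> perms n" and ab: "a \<in> ?T" "b \<in> ?T"
    have "(\<Sum>p\<in>perms n. c (pl p (pl s a)) (pl p (pl s b))) = (\<Sum>p\<in>perms n. c (pl (s \<circ> p) a) (pl (s \<circ> p) b))"
      using pl_comp[OF s _ ab(1)] pl_comp[OF s _ ab(2)] by simp
    also have "\<dots> = (\<Sum>p\<in>perms n. c (pl p a) (pl p b))" by (rule sum_perms_left[OF s])
    finally show "F (pl s a) (pl s b) = F a b" unfolding F_def by (rule arg_cong)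
  qed
  moreover have "(\<Sum>a\<in>?T. \<Sum>b\<in>?T. cnj (F a b) * tpow U b a) = amp D L k q U" for U
  proof -
    have "(\<Sum>a\<in>?T. \<Sum>b\<in>?T. cnj (F a b) * tpow U b a)
        = (\<Sum>a\<in>?T. \<Sum>b\<in>?T. \<Sum>p\<in>perms n. c (pl p a) (pl p b) * tpow U b a / fact n)"
      unfolding F_def complex_cnj_cnj sum_divide_distrib sum_distrib_right by (simp only: times_divide_eq_left)
    also have "\<dots> = (\<Sum>p\<in>perms n. \<Sum>a\<in>?T. \<Sum>b\<in>?T. c (pl p a) (pl p b) * tpow U b a / fact n)"
      by (simp only: sum.swap[of _ ?T "perms n"])
    also have "\<dots> = (\<Sum>p\<in>perms n. amp D L k q U / fact n)"
    proof (rule sum.cong[OF refl])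
      fix p assume p: "p \<in> perms n"
      have "(\<Sum>a\<in>?T. \<Sum>b\<in>?T. c (pl p a) (pl p b) * tpow U b a / fact n)
          = (\<Sum>a\<in>?T. \<Sum>b\<in>?T. c (pl p a) (pl p b) * tpow U (pl p b) (pl p a) / fact n)"
        by (intro sum.cong refl) (simp only: tpow_pl[OF p])
      also have "\<dots> = (\<Sum>a\<in>?T. \<Sum>b\<in>?T. c (pl p a) b * tpow U b (pl p a) / fact n)"
        by (rule sum.cong[OF refl], rule sum_pl[OF p])
      also have "\<dots> = (\<Sum>a\<in>?T. \<Sum>b\<in>?T. c a b * tpow U b a / fact n)"
        by (rule sum_pl[OF p])
      also have "\<dots> = amp D L k q U / fact n" unfolding c sum_divide_distrib ..
      finally show "(\<Sum>a\<in>?T. \<Sum>b\<in>?T. c (pl p a) (pl p b) * tpow U b a / fact n) = amp D L k q U / fact n" .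
    qed
    also have "\<dots> = amp D L k q U" by (simp add: card_perms)
    finally show ?thesis .
  qed
  ultimately show ?thesis using amp_unitary[OF D _ q] by (intro exI[of _ F]) simp
qed

section \<open>Dilation of channels\<close>

lemma pair_index_less:
  fixes a b m k :: nat
  assumes "a < m" "b < k"
  shows "a * k + b < m * k"
proof -
  have "a * k + b < Suc a * k" using assms(2) by simp
  also have "\<dots> \<le> m * k" using assms(1) by (intro mult_right_mono) auto
  finally show ?thesis .
qed

lemma sum_pair_index:
  fixes f :: "nat \<Rightarrow> 'a::comm_monoid_add"
  shows "(\<Sum>c<m * k. f c) = (\<Sum>a<m. \<Sum>b<k. f (a * k + b))"
proof -
  have "(\<Sum>c = a * k..<a * k + k. f c) = (\<Sum>b<k. f (a * k + b))" for a
    by (rule sum.reindex_bij_witness[of _ "\<lambda>b. a * k + b" "\<lambda>c. c - a * k"]) auto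
  then show ?thesis by (simp add: sum.nat_group[symmetric])
qed

lemma mult_mat_entry:
  "A \<in> carrier_mat n m \<Longrightarrow> B \<in> carrier_mat m k \<Longrightarrow> i < n \<Longrightarrow> j < k
    \<Longrightarrow> (A * B) $$ (i, j) = (\<Sum>l<m. A $$ (i, l) * B $$ (l, j))"
  by (simp add: scalar_prod_def atLeast0LessThan)

lemma unitary_spectral_mult:
  assumes I: "finite I" and V: "unitary_on I V"
  shows "(\<Sum>m\<in>I. (\<Sum>k\<in>I. a k * V i k * cnj (V m k)) * (\<Sum>h\<in>I. b h * V m h * cnj (V j h)))
    = (\<Sum>k\<in>I. a k * b k * V i k * cnj (V j k))"
proof -
  have "(\<Sum>m\<in>I. (\<Sum>k\<in>I. a k * V i k * cnj (V m k)) * (\<Sum>h\<in>I. b h * V m h * cnj (V j h)))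
      = (\<Sum>m\<in>I. \<Sum>k\<in>I. \<Sum>h\<in>I. (a k * V i k * (b h * cnj (V j h))) * (cnj (V m k) * V m h))"
    unfolding sum_product by (intro sum.cong refl) (simp only: mult_ac)
  also have "\<dots> = (\<Sum>k\<in>I. \<Sum>h\<in>I. \<Sum>m\<in>I. (a k * V i k * (b h * cnj (V j h))) * (cnj (V m k) * V m h))"
    by (rule trans[OF sum.swap], rule sum.cong[OF refl], rule sum.swap)
  also have "\<dots> = (\<Sum>k\<in>I. \<Sum>h\<in>I. (a k * V i k * (b h * cnj (V j h))) * idm k h)"
  proof (intro sum.cong refl)
    fix k h assume "k \<in> I" "h \<in> I"
    then have "(\<Sum>m\<in>I. cnj (V m k) * V m h) = idm k h"
      using unitary_onD(2)[OF V] by (simp add: meq_def mm_def adj_def)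
    then show "(\<Sum>m\<in>I. (a k * V i k * (b h * cnj (V j h))) * (cnj (V m k) * V m h))
      = (a k * V i k * (b h * cnj (V j h))) * idm k h"
      by (simp only: sum_distrib_left[symmetric])
  qed
  also have "\<dots> = (\<Sum>k\<in>I. a k * b k * V i k * cnj (V j k))"
    using I by (simp add: idm_def if_distrib[where f="\<lambda>x. _ * x"] mult_ac cong: if_cong)
  finally show ?thesis .
qed

lemma form_two_point:
  fixes B :: "'i \<Rightarrow> 'i \<Rightarrow> complex"
  assumes I: "finite I" "i \<in> I" "j \<in> I"
  shows "(\<Sum>k\<in>I. \<Sum>l\<in>I. cnj (a * idm k i + b * idm k j) * B k l * (a * idm l i + b * idm l j))
    = cnj a * a * B i i + cnj a * b * B i j + cnj b * a * B j i + cnj b * b * B j j"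
proof -
  have d: "(\<Sum>k\<in>I. f k * idm k m) = f m" if "m \<in> I" for f :: "'i \<Rightarrow> complex" and m
    using that I by (simp add: idm_def if_distrib[where f="\<lambda>x. _ * x"] cong: if_cong)
  have "(\<Sum>k\<in>I. \<Sum>l\<in>I. cnj (a * idm k i + b * idm k j) * B k l * (a * idm l i + b * idm l j))
      = (\<Sum>k\<in>I. \<Sum>l\<in>I. cnj (a * idm k i + b * idm k j) * B k l * a * idm l i
          + cnj (a * idm k i + b * idm k j) * B k l * b * idm l j)"
    by (simp add: algebra_simps)
  also have "\<dots> = (\<Sum>k\<in>I. cnj (a * idm k i + b * idm k j) * B k i * a + cnj (a * idm k i + b * idm k j) * B k j * b)"
    unfolding sum.distrib using I by (simp only: d)
  also have "\<dots> = (\<Sum>k\<in>I. (cnj a * (B k i * a + B k j * b)) * idm k i + (cnj b * (B k i * a + B k j * b)) * idm k j)"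
  proof (rule sum.cong[OF refl])
    fix k
    have "cnj (idm k i) = idm k i" "cnj (idm k j) = idm k j" by (simp_all add: idm_def)
    then show "cnj (a * idm k i + b * idm k j) * B k i * a + cnj (a * idm k i + b * idm k j) * B k j * b
      = (cnj a * (B k i * a + B k j * b)) * idm k i + (cnj b * (B k i * a + B k j * b)) * idm k j"
      by (simp add: algebra_simps)
  qed
  also have "\<dots> = cnj a * (B i i * a + B i j * b) + cnj b * (B j i * a + B j j * b)"
    unfolding sum.distrib using I by (simp only: d)
  finally show ?thesis by (simp add: algebra_simps)
qed

text \<open>Real values of the form on the basis vectors at \<open>i\<close> and \<open>j\<close>,
  on their sum, and on their combination with coefficients 1 and \<open>\<i>\<close> determine the
  conjugate entry.\<close>

lemma psd_on_hermitian:
  assumes I: "finite I" and B: "psd_on I B"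
  shows "hermitian_on I B"
  unfolding hermitian_on_def
proof (rule meqI)
  fix j i assume ij: "j \<in> I" "i \<in> I"
  have *: "Im (cnj a * a * B i i + cnj a * b * B i j + cnj b * a * B j i + cnj b * b * B j j) = 0" for a b
    using B[unfolded psd_on_def, rule_format, of "\<lambda>k. a * idm k i + b * idm k j"]
    unfolding form_two_point[OF I ij(2,1)] by (simp add: less_eq_complex_def)
  have "Im (B i i) = 0" using *[of 1 0] by simp
  moreover have "Im (B j j) = 0" using *[of 0 1] by simp
  ultimately have "Im (B i j) + Im (B j i) = 0" "Re (B i j) - Re (B j i) = 0"
    using *[of 1 1] *[of 1 \<i>] by simp_all
  then show "adj B j i = B j i" by (simp add: adj_def complex_eq_iff)
qed

lemma psd_spectral_on:
  fixes K :: "'i \<Rightarrow> 'i \<Rightarrow> complex"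
  assumes I: "finite I" and psd: "psd_on I K"
  obtains V and l :: "'i \<Rightarrow> real" where "unitary_on I V" "\<And>k. k \<in> I \<Longrightarrow> l k \<ge> 0"
    "\<And>i j. i \<in> I \<Longrightarrow> j \<in> I \<Longrightarrow> K i j = (\<Sum>k\<in>I. of_real (l k) * V i k * cnj (V j k))"
proof -
  obtain V and l :: "'i \<Rightarrow> real" where V: "unitary_on I V"
    and KV: "\<And>i j. i \<in> I \<Longrightarrow> j \<in> I \<Longrightarrow> K i j = (\<Sum>k\<in>I. of_real (l k) * V i k * cnj (V j k))"
    using spectral_on[OF I psd_on_hermitian[OF I psd]] by blast
  have VV: "(\<Sum>i\<in>I. cnj (V i k) * V i l) = idm k l" if "k \<in> I" "l \<in> I" for k l
    using unitary_onD[OF V] that by (simp_all add: meq_def mm_def adj_def)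
  have ev: "(\<Sum>j\<in>I. K i j * V j k) = of_real (l k) * V i k" if "i \<in> I" "k \<in> I" for i k
  proof -
    have "(\<Sum>j\<in>I. K i j * V j k) = (\<Sum>j\<in>I. \<Sum>m\<in>I. of_real (l m) * V i m * (cnj (V j m) * V j k))"
      using that by (intro sum.cong refl) (simp add: KV sum_distrib_right mult.assoc)
    also have "\<dots> = (\<Sum>m\<in>I. of_real (l m) * V i m * idm m k)"
      using that VV(1) by (subst sum.swap) (simp add: sum_distrib_left[symmetric])
    also have "\<dots> = of_real (l k) * V i k"
      using I that by (simp add: idm_def if_distrib[where f="\<lambda>x. _ * x"] cong: if_cong)
    finally show ?thesis .
  qed
  have "l k \<ge> 0" if k: "k \<in> I" for k
  proof -
    have "0 \<le> (\<Sum>i\<in>I. \<Sum>j\<in>I. cnj (V i k) * K i j * V j k)"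
      using psd by (simp add: psd_on_def)
    also have "\<dots> = (\<Sum>i\<in>I. cnj (V i k) * (of_real (l k) * V i k))"
      using ev k by (simp add: sum_distrib_left[symmetric] mult.assoc)
    also have "\<dots> = of_real (l k) * (\<Sum>i\<in>I. cnj (V i k) * V i k)"
      by (simp add: sum_distrib_left mult_ac)
    also have "\<dots> = of_real (l k)" using VV(1)[OF k k] by (simp add: idm_def)
    finally show ?thesis by (simp add: less_eq_complex_def)
  qed
  then show ?thesis using that V KV by blast
qed

lemma psd_iff:
  assumes "A \<in> carrier_mat N N"
  shows "psd N A \<longleftrightarrow> psd_on {..<N} (\<lambda>i j. A $$ (i, j))"
proof -
  have *: "(A *\<^sub>v v) \<bullet>c v = (\<Sum>i<N. \<Sum>j<N. cnj (v $ i) * A $$ (i, j) * v $ j)" if "v \<in> carrier_vec N" for v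
  proof -
    have "(A *\<^sub>v v) \<bullet>c v = (\<Sum>i<N. (\<Sum>j<N. A $$ (i, j) * v $ j) * cnj (v $ i))"
      using assms that by (simp add: scalar_prod_def atLeast0LessThan)
    then show ?thesis by (simp add: sum_distrib_left sum_distrib_right mult_ac)
  qed
  have 1: "(\<Sum>i<N. \<Sum>j<N. cnj (w i) * A $$ (i, j) * w j) = (A *\<^sub>v vec N w) \<bullet>c vec N w" for w
    by (subst *) simp_all
  show ?thesis
  proof
    assume "psd N A"
    then show "psd_on {..<N} (\<lambda>i j. A $$ (i, j))" unfolding psd_def psd_on_def 1 by simp
  next
    assume "psd_on {..<N} (\<lambda>i j. A $$ (i, j))"
    then show "psd N A" unfolding psd_def psd_on_def using assms by (auto simp only: *)
  qed
qed

lemma (in vec_space) rank_sum_le: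
  assumes "finite S" "\<And>k. k \<in> S \<Longrightarrow> A k \<in> carrier_mat n nc" "\<And>k. k \<in> S \<Longrightarrow> rank (A k) \<le> 1"
  shows "rank (mat n nc (\<lambda>ij. \<Sum>k\<in>S. A k $$ ij)) \<le> card S"
  using assms
proof (induction S rule: finite_induct)
  case empty
  have "mat n nc (\<lambda>ij. \<Sum>k\<in>{}. A k $$ ij) = 0\<^sub>m n nc" by (rule eq_matI) auto
  then show ?case using rank_0I by simp
next
  case (insert x S)
  have "mat n nc (\<lambda>ij. \<Sum>k\<in>insert x S. A k $$ ij) = A x + mat n nc (\<lambda>ij. \<Sum>k\<in>S. A k $$ ij)"
    using insert.hyps insert.prems(1)[of x] by (intro eq_matI) auto
  moreover have "rank (A x + mat n nc (\<lambda>ij. \<Sum>k\<in>S. A k $$ ij)) \<le> rank (A x) + rank (mat n nc (\<lambda>ij. \<Sum>k\<in>S. A k $$ ij))"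
    using insert.prems(1) by (intro rank_subadditive) auto
  moreover have "rank (mat n nc (\<lambda>ij. \<Sum>k\<in>S. A k $$ ij)) \<le> card S"
    using insert by auto
  ultimately show ?case using insert.hyps insert.prems(2)[of x] by simp
qed

text \<open>Adding the projections onto the kernel makes the operator invertible.\<close>

lemma card_nonzero_eigenvalues_le_rank:
  fixes C :: "complex mat" and l :: "nat \<Rightarrow> real"
  assumes C: "C \<in> carrier_mat N N" and V: "unitary_on {..<N} V"
    and CV: "\<And>i j. i < N \<Longrightarrow> j < N \<Longrightarrow> C $$ (i, j) = (\<Sum>k<N. of_real (l k) * V i k * cnj (V j k))"
  shows "card {k. k < N \<and> l k \<noteq> 0} \<le> vec_space.rank N C"
proof -
  interpret vec_space "TYPE(complex)" N .
  define S where "S = {k. k < N \<and> l k = 0}"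
  define A where "A = (\<lambda>k. mat N N (\<lambda>(i, j). V i k * cnj (V j k)))"
  define B where "B = mat N N (\<lambda>ij. \<Sum>k\<in>S. A k $$ ij)"
  define l' where "l' = (\<lambda>k. if l k = 0 then 1 else l k)"
  define J where "J = mat N N (\<lambda>(i, j). \<Sum>k<N. of_real (1 / l' k) * V i k * cnj (V j k))"
  have CB: "(C + B) $$ (i, j) = (\<Sum>k<N. of_real (l' k) * V i k * cnj (V j k))" if ij: "i < N" "j < N" for i j
  proof -
    have "B $$ (i, j) = (\<Sum>k\<in>S. V i k * cnj (V j k))" using ij by (simp add: B_def A_def)
    also have "\<dots> = (\<Sum>k<N. of_real (if l k = 0 then 1 else 0) * V i k * cnj (V j k))"
      unfolding S_def by (rule sum.mono_neutral_cong_left) auto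
    finally have "(C + B) $$ (i, j) = (\<Sum>k<N. of_real (l k) * V i k * cnj (V j k) + of_real (if l k = 0 then 1 else 0) * V i k * cnj (V j k))"
      using ij C by (simp add: CV sum.distrib B_def)
    also have "\<dots> = (\<Sum>k<N. of_real (l' k) * V i k * cnj (V j k))"
      by (rule sum.cong[OF refl]) (simp add: l'_def)
    finally show ?thesis .
  qed
  have CBc: "C + B \<in> carrier_mat N N" using C by (simp add: B_def)
  have Jc: "J \<in> carrier_mat N N" by (simp add: J_def)
  have "(C + B) * J = 1\<^sub>m N"
  proof (rule eq_matI)
    fix i j assume "i < dim_row (1\<^sub>m N :: complex mat)" "j < dim_col (1\<^sub>m N :: complex mat)"
    then have ij: "i < N" "j < N" by auto
    have "((C + B) * J) $$ (i, j) = (\<Sum>m<N. (C + B) $$ (i, m) * J $$ (m, j))"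
      by (rule mult_mat_entry[OF CBc Jc ij])
    also have "\<dots> = (\<Sum>m<N. (\<Sum>k<N. of_real (l' k) * V i k * cnj (V m k)) * (\<Sum>h<N. of_real (1 / l' h) * V m h * cnj (V j h)))"
      using ij by (intro sum.cong refl) (simp add: CB[OF ij(1)] J_def del: index_add_mat)
    also have "\<dots> = (\<Sum>k<N. of_real (l' k) * of_real (1 / l' k) * V i k * cnj (V j k))"
      by (rule unitary_spectral_mult[OF finite_lessThan V])
    also have "\<dots> = (\<Sum>k<N. V i k * cnj (V j k))"
    proof (rule sum.cong[OF refl])
      fix k
      have "of_real (l' k) * of_real (1 / l' k) = (1 :: complex)"
        by (simp add: l'_def)
      then show "of_real (l' k) * of_real (1 / l' k) * V i k * cnj (V j k) = V i k * cnj (V j k)"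
        by simp
    qed
    also have "\<dots> = 1\<^sub>m N $$ (i, j)"
      using unitary_onD(1)[OF V] ij by (simp add: meq_def mm_def adj_def idm_def)
    finally show "((C + B) * J) $$ (i, j) = 1\<^sub>m N $$ (i, j)" .
  qed (use CBc Jc in auto)
  then have "det (C + B) * det J = 1" using det_mult[OF CBc Jc] by simp
  then have "rank (C + B) = N" using det_rank_iff[OF CBc] by auto
  moreover have "rank (C + B) \<le> rank C + rank B"
    using C by (intro rank_subadditive) (auto simp: B_def)
  moreover have "rank B \<le> card S"
    unfolding B_def
  proof (rule rank_sum_le)
    fix k show "rank (A k) \<le> 1"
      by (rule rank_le_1_product_entries[of _ N "\<lambda>i. V i k" "\<lambda>j. cnj (V j k)"]) (auto simp: A_def)
  qed (auto simp: S_def A_def)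
  moreover have "card S + card {k. k < N \<and> l k \<noteq> 0} = N"
  proof -
    have "card (S \<union> {k. k < N \<and> l k \<noteq> 0}) = card S + card {k. k < N \<and> l k \<noteq> 0}"
      by (rule card_Un_disjoint) (auto simp: S_def)
    moreover have "S \<union> {k. k < N \<and> l k \<noteq> 0} = {..<N}" by (auto simp: S_def)
    ultimately show ?thesis by simp
  qed
  ultimately show ?thesis by linarith
qed

text \<open>Eigenvectors scaled by the roots of the nonzero eigenvalues, padded with zero vectors to
  exactly \<open>r\<close>. For a Choi operator these are the Kraus operators.\<close>

lemma psd_low_rank_factor:
  fixes C :: "complex mat"
  assumes C: "psd N C" and r: "vec_space.rank N C \<le> r"
  obtains w where "\<And>i j. i < N \<Longrightarrow> j < N \<Longrightarrow> C $$ (i, j) = (\<Sum>\<rho><r. w \<rho> i * cnj (w \<rho> j))"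
proof -
  have Cc: "C \<in> carrier_mat N N" using C by (simp add: psd_def)
  obtain V and l :: "nat \<Rightarrow> real" where V: "unitary_on {..<N} V" and l: "\<And>k. k \<in> {..<N} \<Longrightarrow> l k \<ge> 0"
    and CV: "\<And>i j. i \<in> {..<N} \<Longrightarrow> j \<in> {..<N} \<Longrightarrow> C $$ (i, j) = (\<Sum>k<N. of_real (l k) * V i k * cnj (V j k))"
    using psd_spectral_on[of "{..<N}" "\<lambda>i j. C $$ (i, j)"] C psd_iff[OF Cc] by auto
  define P where "P = {k. k < N \<and> l k \<noteq> 0}"
  have fP: "finite P" by (simp add: P_def)
  have "card P \<le> r"
    using card_nonzero_eigenvalues_le_rank[OF Cc V] CV r unfolding P_def by fastforce
  obtain e where e: "bij_betw e {..<card P} P"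
    using ex_bij_betw_nat_finite[OF fP] by (auto simp: atLeast0LessThan)
  define w where "w = (\<lambda>\<rho> i. if \<rho> < card P then of_real (sqrt (l (e \<rho>))) * V i (e \<rho>) else 0)"
  have "C $$ (i, j) = (\<Sum>\<rho><r. w \<rho> i * cnj (w \<rho> j))" if ij: "i < N" "j < N" for i j
  proof -
    have "C $$ (i, j) = (\<Sum>k<N. of_real (l k) * V i k * cnj (V j k))" using CV ij by simp
    also have "\<dots> = (\<Sum>k\<in>P. of_real (l k) * V i k * cnj (V j k))"
      by (rule sum.mono_neutral_right) (auto simp: P_def)
    also have "\<dots> = (\<Sum>\<rho><card P. of_real (l (e \<rho>)) * V i (e \<rho>) * cnj (V j (e \<rho>)))"
      by (rule sum.reindex_bij_betw[OF e, symmetric])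
    also have "\<dots> = (\<Sum>\<rho><card P. w \<rho> i * cnj (w \<rho> j))"
    proof (rule sum.cong[OF refl])
      fix \<rho> assume \<rho>: "\<rho> \<in> {..<card P}"
      then have "e \<rho> \<in> P" using e by (auto simp: bij_betw_def)
      then have "sqrt (l (e \<rho>)) * sqrt (l (e \<rho>)) = l (e \<rho>)" using l by (simp add: P_def)
      then have *: "of_real (sqrt (l (e \<rho>))) * of_real (sqrt (l (e \<rho>))) = (of_real (l (e \<rho>)) :: complex)"
        unfolding of_real_mult[symmetric] by simp
      have "w \<rho> i * cnj (w \<rho> j) = (of_real (sqrt (l (e \<rho>))) * of_real (sqrt (l (e \<rho>)))) * V i (e \<rho>) * cnj (V j (e \<rho>))"
        using \<rho> by (simp add: w_def)
      then show "of_real (l (e \<rho>)) * V i (e \<rho>) * cnj (V j (e \<rho>)) = w \<rho> i * cnj (w \<rho> j)"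
        unfolding * by simp
    qed
    also have "\<dots> = (\<Sum>\<rho><r. w \<rho> i * cnj (w \<rho> j))"
      by (rule sum.mono_neutral_left) (use \<open>card P \<le> r\<close> in \<open>auto simp: w_def\<close>)
    finally show ?thesis .
  qed
  then show ?thesis by (rule that)
qed

lemma psd_outer_prod: "v \<in> carrier_vec N \<Longrightarrow> psd N (outer_prod v v)"
proof -
  assume v: "v \<in> carrier_vec N"
  have c: "outer_prod v v \<in> carrier_mat N N" using v by (simp add: outer_prod_def)
  have "(\<Sum>i<N. \<Sum>j<N. cnj (w i) * outer_prod v v $$ (i, j) * w j)
      = (\<Sum>i<N. cnj (w i) * v $ i) * cnj (\<Sum>i<N. cnj (w i) * v $ i)" for w
    unfolding cnj_sum sum_product
    by (intro sum.cong refl) (use v in \<open>simp add: outer_prod_def mult_ac\<close>)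
  moreover have "0 \<le> z * cnj z" for z by (simp add: complex_mult_cnj less_eq_complex_def)
  ultimately show ?thesis
    unfolding psd_iff[OF c] psd_on_def by (simp only:) simp
qed

lemma choi_entry:
  assumes "p < d2 * d1" "q < d2 * d1"
  shows "choi d1 d2 E $$ (p, q)
    = E (outer_prod (unit_vec d1 (p mod d1)) (unit_vec d1 (q mod d1))) $$ (p div d1, q div d1)"
proof -
  have "tensor_block d1 d1 (outer_prod (max_entangled d1) (max_entangled d1)) i j
      = outer_prod (unit_vec d1 i) (unit_vec d1 j)" if "i < d1" "j < d1" for i j
  proof (rule eq_matI)
    fix a b assume "a < dim_row (outer_prod (unit_vec d1 i) (unit_vec d1 j))"
      "b < dim_col (outer_prod (unit_vec d1 i) (unit_vec d1 j))"
    then have ab: "a < d1" "b < d1" by (auto simp: outer_prod_def)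
    have "a * d1 + i < d1 * d1" "b * d1 + j < d1 * d1"
      using ab that by (auto intro: pair_index_less)
    then show "tensor_block d1 d1 (outer_prod (max_entangled d1) (max_entangled d1)) i j $$ (a, b)
        = outer_prod (unit_vec d1 i) (unit_vec d1 j) $$ (a, b)"
      using ab that by (simp add: tensor_block_def outer_prod_def max_entangled_def unit_vec_def)
  qed (auto simp: tensor_block_def outer_prod_def)
  moreover have "d1 > 0" using assms by (cases d1) auto
  ultimately show ?thesis using assms by (simp add: choi_def ampliation_def)
qed

text \<open>Since \<open>r * d2 = d1\<close>, the Stinespring isometry is a unitary; its row \<open>b * r + \<rho>\<close> belongs to
  the output \<open>b\<close> and the environment state \<open>\<rho>\<close>.\<close>

lemma dilation:
  assumes E: "E \<in> QChan d1 d2 r" and rd: "r * d2 = d1" and d1: "d1 > 0"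
  obtains U where "unitary_on {..<d1} U"
    "\<And>p q. p < d2 * d1 \<Longrightarrow> q < d2 * d1 \<Longrightarrow> choi d1 d2 E $$ (p, q)
       = (\<Sum>\<rho><r. U (p div d1 * r + \<rho>) (p mod d1) * cnj (U (q div d1 * r + \<rho>) (q mod d1)))"
proof -
  have lin: "linear_map d1 d2 E" and cp: "completely_positive d1 d2 E" and tp: "trace_preserving d1 E"
    using E by (auto simp: QChan_def quantum_channel_def)
  have "psd (d1 * d1) (outer_prod (max_entangled d1) (max_entangled d1))"
    by (rule psd_outer_prod) (simp add: max_entangled_def)
  then have psd: "psd (d2 * d1) (choi d1 d2 E)" using cp by (simp add: completely_positive_def choi_def)
  obtain w where w: "\<And>i j. i < d2 * d1 \<Longrightarrow> j < d2 * d1 \<Longrightarrow> choi d1 d2 E $$ (i, j) = (\<Sum>\<rho><r. w \<rho> i * cnj (w \<rho> j))"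
    using psd_low_rank_factor[OF psd, of r] E by (auto simp: QChan_def kraus_rank_def)
  \<comment> \<open>The row index \<open>c\<close> is split into output \<open>c div r\<close> and
    environment state \<open>c mod r\<close>; the column \<open>a\<close> is the input, which is the
    low digit of a Choi index.\<close>
  define U where "U = (\<lambda>c a. w (c mod r) (c div r * d1 + a))"
  have r: "r > 0" and d2: "d2 > 0" using rd d1 by (auto intro!: gr0I)
  have bnd: "b * d1 + a < d2 * d1" if "b < d2" "a < d1" for a b
    using that by (rule pair_index_less)
  have choi: "choi d1 d2 E $$ (p, q) = (\<Sum>\<rho><r. U (p div d1 * r + \<rho>) (p mod d1) * cnj (U (q div d1 * r + \<rho>) (q mod d1)))"
    if "p < d2 * d1" "q < d2 * d1" for p q
    using that r by (simp add: w U_def)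
  \<comment> \<open>Trace preservation on the matrix units says that the columns of \<open>U\<close>
    are orthonormal.\<close>
  have iso: "(\<Sum>c<d1. U c a * cnj (U c a')) = of_bool (a = a')" if a: "a < d1" "a' < d1" for a a'
  proof -
    have "(\<Sum>c<d1. U c a * cnj (U c a')) = (\<Sum>b<d2. \<Sum>\<rho><r. U (b * r + \<rho>) a * cnj (U (b * r + \<rho>) a'))"
      unfolding rd[symmetric] mult.commute[of r d2] by (rule sum_pair_index)
    also have "\<dots> = (\<Sum>b<d2. choi d1 d2 E $$ (b * d1 + a, b * d1 + a'))"
      using a bnd by (intro sum.cong refl) (simp add: choi)
    also have "\<dots> = (\<Sum>b<d2. E (outer_prod (unit_vec d1 a) (unit_vec d1 a')) $$ (b, b))"
      using a bnd by (intro sum.cong refl) (simp add: choi_entry)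
    also have "\<dots> = mtrace (E (outer_prod (unit_vec d1 a) (unit_vec d1 a')))"
    proof -
      have "outer_prod (unit_vec d1 a) (unit_vec d1 a') \<in> carrier_mat d1 d1" by (simp add: outer_prod_def)
      then have "E (outer_prod (unit_vec d1 a) (unit_vec d1 a')) \<in> carrier_mat d2 d2"
        using lin by (simp add: linear_map_def)
      then show ?thesis by (simp add: mtrace_def)
    qed
    also have "\<dots> = mtrace (outer_prod (unit_vec d1 a) (unit_vec d1 a'))"
      using tp by (simp add: trace_preserving_def outer_prod_def)
    also have "\<dots> = (\<Sum>c<d1. (if c = a then if a = a' then 1 else 0 else 0))"
      unfolding mtrace_def using a by (intro sum.cong) (auto simp: outer_prod_def unit_vec_def)
    also have "\<dots> = of_bool (a = a')" using a by simp
    finally show ?thesis .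
  qed
  define M where "M = mat d1 d1 (\<lambda>(i, j). U i j)"
  define N where "N = mat d1 d1 (\<lambda>(i, j). cnj (U j i))"
  have M: "M \<in> carrier_mat d1 d1" and N: "N \<in> carrier_mat d1 d1" by (simp_all add: M_def N_def)
  have "N * M = 1\<^sub>m d1"
  proof (rule eq_matI)
    fix i j assume "i < dim_row (1\<^sub>m d1 :: complex mat)" "j < dim_col (1\<^sub>m d1 :: complex mat)"
    then have ij: "i < d1" "j < d1" by auto
    have "(N * M) $$ (i, j) = (\<Sum>k<d1. U k j * cnj (U k i))"
      unfolding mult_mat_entry[OF N M ij] using ij
      by (intro sum.cong refl) (simp add: M_def N_def)
    also have "\<dots> = 1\<^sub>m d1 $$ (i, j)" using iso[OF ij(2,1)] ij by auto
    finally show "(N * M) $$ (i, j) = 1\<^sub>m d1 $$ (i, j)" .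
  qed (use M N in auto)
  then have MN: "M * N = 1\<^sub>m d1" by (rule mat_mult_left_right_inverse[OF N M])
  have "unitary_on {..<d1} U"
    unfolding unitary_on_def
  proof (intro conjI meqI)
    fix i j assume ij: "i \<in> {..<d1}" "j \<in> {..<d1}"
    have "mm {..<d1} U (adj U) i j = (M * N) $$ (i, j)"
      unfolding mm_def adj_def using ij
      by (subst mult_mat_entry[OF M N]) (auto simp: M_def N_def intro!: sum.cong)
    then show "mm {..<d1} U (adj U) i j = idm i j" using MN ij by (simp add: idm_def)
    have "mm {..<d1} (adj U) U i j = (\<Sum>c<d1. U c j * cnj (U c i))"
      by (simp add: mm_def adj_def mult.commute)
    then show "mm {..<d1} (adj U) U i j = idm i j"
      using iso[of j i] ij by (auto simp: idm_def)
  qed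
  then show ?thesis using choi by (rule that)
qed

section \<open>The trace norm of reduced states\<close>

lemma order_prod_linear:
  fixes a :: "'k \<Rightarrow> complex"
  assumes "finite S"
  shows "Polynomial.order x (\<Prod>k\<in>S. [:- a k, 1:]) = card {k \<in> S. a k = x}"
  using assms
proof (induction S rule: finite_induct)
  case empty
  show ?case by (simp add: order_0I)
next
  case (insert k S)
  have nz: "(\<Prod>k\<in>S. [:- a k, 1:]) \<noteq> 0" using insert.hyps by simp
  have o: "Polynomial.order x [:- a k, 1:] = (if a k = x then 1 else 0)"
    using order_power_n_n[of "a k" 1] by (auto intro: order_0I)
  have "{i \<in> insert k S. a i = x} = (if a k = x then insert k {i \<in> S. a i = x} else {i \<in> S. a i = x})"
    by auto
  then have "card {i \<in> insert k S. a i = x} = (if a k = x then 1 else 0) + card {i \<in> S. a i = x}"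
    using insert.hyps by simp
  moreover have "Polynomial.order x ([:- a k, 1:] * (\<Prod>k\<in>S. [:- a k, 1:]))
      = Polynomial.order x [:- a k, 1:] + Polynomial.order x (\<Prod>k\<in>S. [:- a k, 1:])"
    by (intro order_mult no_zero_divisors nz) simp
  ultimately show ?case using insert o by (simp del: mult_pCons_left)
qed

text \<open>In the eigenbasis of \<open>A\<close> the operator \<open>mat_adjoint A * A\<close> is
  diagonal with entries \<open>(l k)^2\<close>. Its characteristic polynomial splits accordingly,
  and grouping equal entries reproduces the multiplicities in \<open>trace_norm\<close>.\<close>

lemma trace_norm_spectral:
  fixes l :: "nat \<Rightarrow> real"
  assumes A: "A \<in> carrier_mat N N" and V: "unitary_on {..<N} V"
    and AV: "\<And>i j. i < N \<Longrightarrow> j < N \<Longrightarrow> A $$ (i, j) = (\<Sum>k<N. of_real (l k) * V i k * cnj (V j k))"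
  shows "trace_norm A = (\<Sum>k<N. \<bar>l k\<bar>)"
proof -
  define H where "H = mat_adjoint A * A"
  define a where "a = (\<lambda>k. complex_of_real (l k) * of_real (l k))"
  define P where "P = mat N N (\<lambda>(i, j). V i j)"
  define Q where "Q = mat N N (\<lambda>(i, j). cnj (V j i))"
  define Dg where "Dg = mat N N (\<lambda>(i, j). if i = j then a i else 0)"
  have P: "P \<in> carrier_mat N N" and Q: "Q \<in> carrier_mat N N" and Dg: "Dg \<in> carrier_mat N N"
    by (simp_all add: P_def Q_def Dg_def)
  have Aa: "mat_adjoint A \<in> carrier_mat N N"
    using A unfolding mat_adjoint_def by auto
  have H: "H \<in> carrier_mat N N" using A Aa by (simp add: H_def)
  have adj: "mat_adjoint A $$ (i, j) = cnj (A $$ (j, i))" if "i < N" "j < N" for i j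
    using that A by (simp add: mat_adjoint_def mat_of_rows_def)
  have PQ: "P * Q = 1\<^sub>m N"
  proof (rule eq_matI)
    fix i j assume "i < dim_row (1\<^sub>m N :: complex mat)" "j < dim_col (1\<^sub>m N :: complex mat)"
    then have ij: "i < N" "j < N" by auto
    have "(P * Q) $$ (i, j) = (\<Sum>k<N. V i k * cnj (V j k))"
      unfolding mult_mat_entry[OF P Q ij] using ij by (intro sum.cong refl) (simp add: P_def Q_def)
    then show "(P * Q) $$ (i, j) = 1\<^sub>m N $$ (i, j)"
      using unitary_onD(1)[OF V] ij by (simp add: meq_def mm_def adj_def idm_def)
  qed (use P Q in auto)
  have HPDQ: "H = P * Dg * Q"
  proof (rule eq_matI)
    fix i j assume "i < dim_row (P * Dg * Q)" "j < dim_col (P * Dg * Q)"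
    then have ij: "i < N" "j < N" using P Q by auto
    have PD: "(P * Dg) $$ (i, k) = V i k * a k" if "k < N" for k
    proof -
      have "(P * Dg) $$ (i, k) = (\<Sum>m<N. if m = k then V i k * a k else 0)"
        unfolding mult_mat_entry[OF P Dg ij(1) that] using ij that
        by (intro sum.cong refl) (simp add: P_def Dg_def)
      then show ?thesis using that by simp
    qed
    have "H $$ (i, j) = (\<Sum>m<N. cnj (A $$ (m, i)) * A $$ (m, j))"
      unfolding H_def mult_mat_entry[OF Aa A ij] using ij by (intro sum.cong refl) (simp add: adj)
    also have "\<dots> = (\<Sum>m<N. (\<Sum>k<N. of_real (l k) * V i k * cnj (V m k)) * (\<Sum>h<N. of_real (l h) * V m h * cnj (V j h)))"
      using ij by (intro sum.cong refl) (simp add: AV mult_ac)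
    also have "\<dots> = (\<Sum>k<N. a k * V i k * cnj (V j k))"
      unfolding a_def by (rule unitary_spectral_mult[OF finite_lessThan V])
    also have "\<dots> = (P * Dg * Q) $$ (i, j)"
      unfolding mult_mat_entry[OF mult_carrier_mat[OF P Dg] Q ij] using ij
      by (intro sum.cong refl) (simp add: PD Q_def mult_ac del: index_mult_mat)
    finally show "H $$ (i, j) = (P * Dg * Q) $$ (i, j)" .
  qed (use H P Q in auto)
  have "similar_mat_wit H Dg P Q"
    unfolding similar_mat_wit_def Let_def using H P Q Dg PQ HPDQ mat_mult_left_right_inverse[OF P Q PQ] by auto
  then have "char_poly H = char_poly Dg" by (intro char_poly_similar) (auto simp: similar_mat_def)
  also have "\<dots> = (\<Prod>k<N. [:- a k, 1:])"
  proof -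
    have "upper_triangular Dg" by (auto simp: upper_triangular_def Dg_def)
    then have "char_poly Dg = (\<Prod>x\<leftarrow>diag_mat Dg. [:- x, 1:])" by (rule char_poly_upper_triangular[OF Dg])
    also have "diag_mat Dg = map a [0..<N]" by (auto simp: diag_mat_def Dg_def)
    also have "(\<Prod>x\<leftarrow>map a [0..<N]. [:- x, 1:]) = (\<Prod>k<N. [:- a k, 1:])"
      by (simp add: prod.distinct_set_conv_list[symmetric] atLeast0LessThan o_def)
    finally show ?thesis .
  qed
  finally have cp: "char_poly H = (\<Prod>k<N. [:- a k, 1:])" .
  have "spectrum H = a ` {..<N}"
    unfolding spectrum_root_char_poly[OF H] cp by (auto simp: poly_prod)
  then have "trace_norm A = (\<Sum>x\<in>a ` {..<N}. real (card {k \<in> {..<N}. a k = x}) * sqrt (Re x))"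
    unfolding trace_norm_def Let_def H_def[symmetric] cp by (simp add: order_prod_linear)
  also have "\<dots> = (\<Sum>x\<in>a ` {..<N}. \<Sum>k\<in>{k \<in> {..<N}. a k = x}. sqrt (Re (a k)))"
    by (intro sum.cong refl) simp
  also have "\<dots> = (\<Sum>k<N. sqrt (Re (a k)))"
    by (rule sum.image_gen[symmetric]) simp
  also have "\<dots> = (\<Sum>k<N. \<bar>l k\<bar>)"
    by (simp add: a_def real_sqrt_mult_self)
  finally show ?thesis .
qed

text \<open>Lagrange's identity.\<close>

lemma sum_cauchy_schwarz:
  fixes f g :: "'i \<Rightarrow> real"
  shows "(\<Sum>i\<in>I. f i * g i)\<^sup>2 \<le> (\<Sum>i\<in>I. (f i)\<^sup>2) * (\<Sum>i\<in>I. (g i)\<^sup>2)"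
proof -
  have "0 \<le> (\<Sum>i\<in>I. \<Sum>j\<in>I. (f i * g j - f j * g i)\<^sup>2)" by (intro sum_nonneg) auto
  also have "\<dots> = (\<Sum>i\<in>I. \<Sum>j\<in>I. (f i)\<^sup>2 * (g j)\<^sup>2 + (g i)\<^sup>2 * (f j)\<^sup>2 - 2 * ((f i * g i) * (f j * g j)))"
    by (intro sum.cong refl) (simp add: power2_eq_square algebra_simps)
  also have "\<dots> = 2 * ((\<Sum>i\<in>I. (f i)\<^sup>2) * (\<Sum>i\<in>I. (g i)\<^sup>2)) - 2 * (\<Sum>i\<in>I. f i * g i)\<^sup>2"
  proof -
    have "(\<Sum>i\<in>I. \<Sum>j\<in>I. (f i)\<^sup>2 * (g j)\<^sup>2) = (\<Sum>i\<in>I. (f i)\<^sup>2) * (\<Sum>i\<in>I. (g i)\<^sup>2)"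
      by (simp only: sum_product)
    moreover have "(\<Sum>i\<in>I. \<Sum>j\<in>I. (g i)\<^sup>2 * (f j)\<^sup>2) = (\<Sum>i\<in>I. (g i)\<^sup>2) * (\<Sum>i\<in>I. (f i)\<^sup>2)"
      by (simp only: sum_product)
    moreover have "(\<Sum>i\<in>I. \<Sum>j\<in>I. 2 * ((f i * g i) * (f j * g j))) = 2 * (\<Sum>i\<in>I. f i * g i)\<^sup>2"
      by (simp only: sum_product power2_eq_square sum_distrib_left[symmetric])
    ultimately show ?thesis unfolding sum_subtractf sum.distrib by simp
  qed
  finally show ?thesis by simp
qed

text \<open>Each term is the real part of \<open>(u - v) * cnj (u + v)\<close>. By Cauchy-Schwarz
  the sum is bounded through the squared norms of \<open>x - y\<close> and \<open>x + y\<close>,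
  which are \<open>2 - 2 * R\<close> and \<open>2 + 2 * R\<close> with \<open>R\<close> the real
  part of the overlap.\<close>

lemma cmod_cross_sum:
  fixes x y :: "'i \<Rightarrow> complex"
  assumes I: "finite I" and x: "(\<Sum>i\<in>I. (cmod (x i))\<^sup>2) = 1" and y: "(\<Sum>i\<in>I. (cmod (y i))\<^sup>2) = 1"
  shows "(\<Sum>i\<in>I. \<bar>(cmod (x i))\<^sup>2 - (cmod (y i))\<^sup>2\<bar>)\<^sup>2 \<le> 4 * (1 - (Re (\<Sum>i\<in>I. cnj (y i) * x i))\<^sup>2)"
proof -
  have e: "(cmod (u - v))\<^sup>2 = (cmod u)\<^sup>2 + (cmod v)\<^sup>2 - 2 * Re (cnj v * u)"
    "(cmod (u + v))\<^sup>2 = (cmod u)\<^sup>2 + (cmod v)\<^sup>2 + 2 * Re (cnj v * u)" for u v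
    unfolding cmod_power2 by (simp_all add: power2_eq_square algebra_simps)
  let ?R = "Re (\<Sum>i\<in>I. cnj (y i) * x i)"
  have "\<bar>(cmod u)\<^sup>2 - (cmod v)\<^sup>2\<bar> \<le> cmod (u - v) * cmod (u + v)" for u v
  proof -
    have "(cmod u)\<^sup>2 - (cmod v)\<^sup>2 = Re ((u - v) * cnj (u + v))"
      unfolding cmod_power2 by (simp add: power2_eq_square algebra_simps)
    then show ?thesis using abs_Re_le_cmod[of "(u - v) * cnj (u + v)"]
      by (simp only: norm_mult complex_mod_cnj)
  qed
  then have "(\<Sum>i\<in>I. \<bar>(cmod (x i))\<^sup>2 - (cmod (y i))\<^sup>2\<bar>) \<le> (\<Sum>i\<in>I. cmod (x i - y i) * cmod (x i + y i))"
    by (intro sum_mono)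
  then have "(\<Sum>i\<in>I. \<bar>(cmod (x i))\<^sup>2 - (cmod (y i))\<^sup>2\<bar>)\<^sup>2 \<le> (\<Sum>i\<in>I. cmod (x i - y i) * cmod (x i + y i))\<^sup>2"
    by (intro power_mono sum_nonneg) auto
  also have "\<dots> \<le> (\<Sum>i\<in>I. (cmod (x i - y i))\<^sup>2) * (\<Sum>i\<in>I. (cmod (x i + y i))\<^sup>2)"
    by (rule sum_cauchy_schwarz)
  also have "(\<Sum>i\<in>I. (cmod (x i - y i))\<^sup>2) = 2 - 2 * ?R"
    unfolding e sum.distrib sum_subtractf sum_distrib_left[symmetric] Re_sum x y by simp
  also have "(\<Sum>i\<in>I. (cmod (x i + y i))\<^sup>2) = 2 + 2 * ?R"
    unfolding e sum.distrib sum_distrib_left[symmetric] Re_sum x y by simp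
  finally show ?thesis by (simp add: power2_eq_square algebra_simps)
qed

text \<open>In an eigenbasis of the difference both marginals are diagonal up to terms that cancel, which
  reduces the trace norm to an \<open>\<ell>\<^sub>1\<close> distance.\<close>

lemma trace_norm_ptrace_le:
  fixes \<psi> \<phi> :: "nat \<Rightarrow> nat \<Rightarrow> complex"
  assumes \<psi>: "(\<Sum>b<d. \<Sum>\<rho><r. (cmod (\<psi> b \<rho>))\<^sup>2) = 1" and \<phi>: "(\<Sum>b<d. \<Sum>\<rho><r. (cmod (\<phi> b \<rho>))\<^sup>2) = 1"
    and A: "A \<in> carrier_mat d d"
    and AE: "\<And>b c. b < d \<Longrightarrow> c < d \<Longrightarrow> A $$ (b, c) = (\<Sum>\<rho><r. \<psi> b \<rho> * cnj (\<psi> c \<rho>)) - (\<Sum>\<rho><r. \<phi> b \<rho> * cnj (\<phi> c \<rho>))"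
  shows "(trace_norm A)\<^sup>2 \<le> 4 * (1 - (cmod (\<Sum>b<d. \<Sum>\<rho><r. cnj (\<phi> b \<rho>) * \<psi> b \<rho>))\<^sup>2)"
proof -
  let ?z = "\<Sum>b<d. \<Sum>\<rho><r. cnj (\<phi> b \<rho>) * \<psi> b \<rho>"
  \<comment> \<open>A phase that makes the overlap real and nonnegative, since
    \<open>cmod_cross_sum\<close> sees only its real part. The reduced operator of
    \<open>\<phi>\<close> does not depend on it.\<close>
  define c where "c = (if ?z = 0 then 1 else ?z / of_real (cmod ?z))"
  have c1: "cmod c = 1" by (simp add: c_def norm_divide)
  then have cc: "c * cnj c = 1" by (simp add: complex_norm_square[symmetric])
  have cz: "cnj c * ?z = of_real (cmod ?z)"
  proof (cases "?z = 0")
    case False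
    have "cnj ?z * ?z = of_real (cmod ?z) * of_real (cmod ?z)"
      using complex_norm_square[of ?z] by (simp add: power2_eq_square mult.commute)
    then show ?thesis using False by (simp add: c_def field_simps)
  qed (simp add: c_def)
  have "hermitian_on {..<d} (\<lambda>b c. A $$ (b, c))"
    unfolding hermitian_on_def by (rule meqI) (simp add: adj_def AE mult.commute)
  then obtain V and l :: "nat \<Rightarrow> real" where V: "unitary_on {..<d} V"
    and AV: "\<And>i j. i \<in> {..<d} \<Longrightarrow> j \<in> {..<d} \<Longrightarrow> A $$ (i, j) = (\<Sum>k<d. of_real (l k) * V i k * cnj (V j k))"
    using spectral_on[of "{..<d}" "\<lambda>b c. A $$ (b, c)"] by auto
  have VV: "(\<Sum>i<d. cnj (V i k) * V i l) = idm k l" "(\<Sum>i<d. V k i * cnj (V l i)) = idm k l" if "k < d" "l < d" for k l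
    using unitary_onD[OF V] that by (simp_all add: meq_def mm_def adj_def)
  define T where "T = (\<lambda>(\<xi> :: nat \<Rightarrow> nat \<Rightarrow> complex) (p :: nat \<times> nat). \<Sum>b<d. adj V (fst p) b * \<xi> b (snd p))"
  let ?I = "{..<d} \<times> {..<r}"
  have inner: "(\<Sum>p\<in>?I. T \<xi> p * cnj (T \<eta> p)) = (\<Sum>b<d. \<Sum>\<rho><r. \<xi> b \<rho> * cnj (\<eta> b \<rho>))" for \<xi> \<eta>
  proof -
    have "(\<Sum>p\<in>?I. T \<xi> p * cnj (T \<eta> p)) = (\<Sum>k<d. \<Sum>\<rho><r. (\<Sum>b<d. adj V k b * \<xi> b \<rho>) * cnj (\<Sum>b<d. adj V k b * \<eta> b \<rho>))"
      unfolding T_def by (simp add: sum.cartesian_product case_prod_unfold)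
    also have "\<dots> = (\<Sum>\<rho><r. \<Sum>k<d. (\<Sum>b<d. adj V k b * \<xi> b \<rho>) * cnj (\<Sum>b<d. adj V k b * \<eta> b \<rho>))"
      by (rule sum.swap)
    also have "\<dots> = (\<Sum>\<rho><r. \<Sum>b<d. \<xi> b \<rho> * cnj (\<eta> b \<rho>))"
      by (intro sum.cong refl unitary_on_isometry unitary_on_adj V) simp
    also have "\<dots> = (\<Sum>b<d. \<Sum>\<rho><r. \<xi> b \<rho> * cnj (\<eta> b \<rho>))" by (rule sum.swap)
    finally show ?thesis .
  qed
  have sq: "(\<Sum>p\<in>?I. (cmod (T \<xi> p))\<^sup>2) = (\<Sum>b<d. \<Sum>\<rho><r. (cmod (\<xi> b \<rho>))\<^sup>2)" for \<xi>
  proof -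
    have "complex_of_real (\<Sum>p\<in>?I. (cmod (T \<xi> p))\<^sup>2) = of_real (\<Sum>b<d. \<Sum>\<rho><r. (cmod (\<xi> b \<rho>))\<^sup>2)"
      unfolding of_real_sum complex_norm_square by (rule inner)
    then show ?thesis by (simp only: of_real_eq_iff)
  qed
  define \<phi>' where "\<phi>' = (\<lambda>b \<rho>. c * \<phi> b \<rho>)"
  \<comment> \<open>In the eigenbasis each eigenvalue is the difference of the probabilities that
    the two vectors give to the basis state \<open>k\<close>.\<close>
  have lk: "l k = (\<Sum>\<rho><r. (cmod (T \<psi> (k, \<rho>)))\<^sup>2 - (cmod (T \<phi>' (k, \<rho>)))\<^sup>2)" if k: "k < d" for k
  proof -
    have sel: "(\<Sum>m<d. f m * idm m k) = f k" for f :: "nat \<Rightarrow> complex"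
      using k by (simp add: idm_def if_distrib[where f="\<lambda>x. _ * x"] cong: if_cong)
    have "(\<Sum>i<d. \<Sum>j<d. cnj (V i k) * A $$ (i, j) * V j k)
        = (\<Sum>i<d. cnj (V i k) * (\<Sum>j<d. \<Sum>m<d. of_real (l m) * V i m * (cnj (V j m) * V j k)))"
      unfolding sum_distrib_left by (intro sum.cong refl) (simp add: AV sum_distrib_left sum_distrib_right mult_ac)
    also have "\<dots> = (\<Sum>i<d. cnj (V i k) * (\<Sum>m<d. of_real (l m) * V i m * idm m k))"
      using k by (subst sum.swap) (simp add: sum_distrib_left[symmetric] VV)
    also have "\<dots> = of_real (l k) * (\<Sum>i<d. cnj (V i k) * V i k)"
      unfolding sel sum_distrib_left by (simp add: mult_ac)
    also have "\<dots> = of_real (l k)" using k by (simp add: VV idm_def)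
    finally have 1: "of_real (l k) = (\<Sum>i<d. \<Sum>j<d. cnj (V i k) * A $$ (i, j) * V j k)" ..
    have 2: "(\<Sum>i<d. \<Sum>j<d. cnj (V i k) * (\<Sum>\<rho><r. \<xi> i \<rho> * cnj (\<xi> j \<rho>)) * V j k)
        = of_real (\<Sum>\<rho><r. (cmod (T \<xi> (k, \<rho>)))\<^sup>2)" for \<xi>
    proof -
      have "of_real (\<Sum>\<rho><r. (cmod (T \<xi> (k, \<rho>)))\<^sup>2)
          = (\<Sum>\<rho><r. \<Sum>i<d. \<Sum>j<d. (cnj (V i k) * \<xi> i \<rho>) * (V j k * cnj (\<xi> j \<rho>)))"
        unfolding of_real_sum complex_norm_square T_def cnj_sum sum_product
        by (simp add: adj_def)
      also have "\<dots> = (\<Sum>i<d. \<Sum>j<d. \<Sum>\<rho><r. (cnj (V i k) * \<xi> i \<rho>) * (V j k * cnj (\<xi> j \<rho>)))"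
        by (rule trans[OF sum.swap], rule sum.cong[OF refl], rule sum.swap)
      also have "\<dots> = (\<Sum>i<d. \<Sum>j<d. cnj (V i k) * (\<Sum>\<rho><r. \<xi> i \<rho> * cnj (\<xi> j \<rho>)) * V j k)"
        unfolding sum_distrib_left sum_distrib_right by (intro sum.cong refl) (simp only: mult_ac)
      finally show ?thesis ..
    qed
    have AE': "A $$ (i, j) = (\<Sum>\<rho><r. \<psi> i \<rho> * cnj (\<psi> j \<rho>)) - (\<Sum>\<rho><r. \<phi>' i \<rho> * cnj (\<phi>' j \<rho>))" if "i < d" "j < d" for i j
    proof -
      have "\<phi>' i \<rho> * cnj (\<phi>' j \<rho>) = (c * cnj c) * (\<phi> i \<rho> * cnj (\<phi> j \<rho>))" for \<rho>
        by (simp add: \<phi>'_def mult_ac)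
      then show ?thesis using that by (simp add: AE cc)
    qed
    have "of_real (l k) = (\<Sum>i<d. \<Sum>j<d. cnj (V i k) * (\<Sum>\<rho><r. \<psi> i \<rho> * cnj (\<psi> j \<rho>)) * V j k
        - cnj (V i k) * (\<Sum>\<rho><r. \<phi>' i \<rho> * cnj (\<phi>' j \<rho>)) * V j k)"
      unfolding 1 by (intro sum.cong refl) (simp only: lessThan_iff AE' left_diff_distrib right_diff_distrib)
    then have "of_real (l k) = (\<Sum>i<d. \<Sum>j<d. cnj (V i k) * (\<Sum>\<rho><r. \<psi> i \<rho> * cnj (\<psi> j \<rho>)) * V j k)
        - (\<Sum>i<d. \<Sum>j<d. cnj (V i k) * (\<Sum>\<rho><r. \<phi>' i \<rho> * cnj (\<phi>' j \<rho>)) * V j k)"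
      by (simp only: sum_subtractf)
    then have "complex_of_real (l k) = of_real ((\<Sum>\<rho><r. (cmod (T \<psi> (k, \<rho>)))\<^sup>2) - (\<Sum>\<rho><r. (cmod (T \<phi>' (k, \<rho>)))\<^sup>2))"
      unfolding 2 of_real_diff .
    then show ?thesis unfolding sum_subtractf by (simp only: of_real_eq_iff)
  qed
  have "trace_norm A = (\<Sum>k<d. \<bar>l k\<bar>)"
    by (rule trace_norm_spectral[OF A V AV]) auto
  then have tn: "trace_norm A \<le> (\<Sum>p\<in>?I. \<bar>(cmod (T \<psi> p))\<^sup>2 - (cmod (T \<phi>' p))\<^sup>2\<bar>)"
    unfolding sum.cartesian_product[symmetric, of "\<lambda>k \<rho>. \<bar>(cmod (T \<psi> (k, \<rho>)))\<^sup>2 - (cmod (T \<phi>' (k, \<rho>)))\<^sup>2\<bar>", simplified]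
    by (auto simp: lk intro!: sum_mono sum_abs)
  have tn0: "0 \<le> trace_norm A" using \<open>trace_norm A = _\<close> by (simp add: sum_nonneg)
  have s: "(\<Sum>p\<in>?I. (cmod (T \<psi> p))\<^sup>2) = 1" unfolding sq by (rule \<psi>)
  have s': "(\<Sum>p\<in>?I. (cmod (T \<phi>' p))\<^sup>2) = 1" unfolding sq by (simp add: \<phi>'_def norm_mult c1 \<phi>)
  have ov: "(\<Sum>p\<in>?I. cnj (T \<phi>' p) * T \<psi> p) = of_real (cmod ?z)"
  proof -
    have "(\<Sum>p\<in>?I. cnj (T \<phi>' p) * T \<psi> p) = (\<Sum>b<d. \<Sum>\<rho><r. \<psi> b \<rho> * cnj (\<phi>' b \<rho>))"
      unfolding inner[symmetric] by (simp only: mult.commute)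
    also have "\<dots> = cnj c * ?z"
      unfolding \<phi>'_def sum_distrib_left by (intro sum.cong refl) (simp add: mult_ac)
    finally show ?thesis unfolding cz .
  qed
  have "(trace_norm A)\<^sup>2 \<le> (\<Sum>p\<in>?I. \<bar>(cmod (T \<psi> p))\<^sup>2 - (cmod (T \<phi>' p))\<^sup>2\<bar>)\<^sup>2"
    using tn tn0 by (intro power_mono)
  also have "\<dots> \<le> 4 * (1 - (Re (\<Sum>p\<in>?I. cnj (T \<phi>' p) * T \<psi> p))\<^sup>2)"
    by (rule cmod_cross_sum[OF _ s s']) simp
  also have "\<dots> = 4 * (1 - (cmod ?z)\<^sup>2)" unfolding ov by simp
  finally show ?thesis .
qed

section \<open>The tester\<close>

lemma psd_on_sum:
  assumes "\<And>k. k \<in> K \<Longrightarrow> psd_on I (B k)"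
  shows "psd_on I (\<lambda>i j. \<Sum>k\<in>K. B k i j)"
  unfolding psd_on_def
proof
  fix v
  have "(\<Sum>i\<in>I. \<Sum>j\<in>I. cnj (v i) * (\<Sum>k\<in>K. B k i j) * v j)
      = (\<Sum>i\<in>I. \<Sum>j\<in>I. \<Sum>k\<in>K. cnj (v i) * B k i j * v j)"
    by (simp only: sum_distrib_left sum_distrib_right)
  also have "\<dots> = (\<Sum>i\<in>I. \<Sum>k\<in>K. \<Sum>j\<in>I. cnj (v i) * B k i j * v j)"
    by (rule sum.cong[OF refl], rule sum.swap)
  also have "\<dots> = (\<Sum>k\<in>K. \<Sum>i\<in>I. \<Sum>j\<in>I. cnj (v i) * B k i j * v j)" by (rule sum.swap)
  finally have e: "(\<Sum>i\<in>I. \<Sum>j\<in>I. cnj (v i) * (\<Sum>k\<in>K. B k i j) * v j)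
    = (\<Sum>k\<in>K. \<Sum>i\<in>I. \<Sum>j\<in>I. cnj (v i) * B k i j * v j)" .
  define g where "g = (\<lambda>k. \<Sum>i\<in>I. \<Sum>j\<in>I. cnj (v i) * B k i j * v j)"
  have "0 \<le> g k" if "k \<in> K" for k
    using assms[OF that] unfolding psd_on_def g_def by blast
  then have "0 \<le> sum g K" by (auto simp: less_eq_complex_def intro!: sum_nonneg)
  then show "0 \<le> (\<Sum>i\<in>I. \<Sum>j\<in>I. cnj (v i) * (\<Sum>k\<in>K. B k i j) * v j)"
    unfolding e g_def .
qed

lemma psd_on_add: "psd_on I A \<Longrightarrow> psd_on I B \<Longrightarrow> psd_on I (\<lambda>i j. A i j + B i j)"
  using psd_on_sum[of "{True, False}" I "\<lambda>k. if k then A else B"] by simp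

lemma psd_on_scale:
  assumes "c \<ge> 0" "psd_on I B"
  shows "psd_on I (\<lambda>i j. of_real c * B i j)"
  unfolding psd_on_def
proof
  fix v
  have "(\<Sum>i\<in>I. \<Sum>j\<in>I. cnj (v i) * (of_real c * B i j) * v j)
      = of_real c * (\<Sum>i\<in>I. \<Sum>j\<in>I. cnj (v i) * B i j * v j)"
    unfolding sum_distrib_left by (intro sum.cong refl) (simp only: mult_ac)
  then show "0 \<le> (\<Sum>i\<in>I. \<Sum>j\<in>I. cnj (v i) * (of_real c * B i j) * v j)"
    using assms unfolding psd_on_def less_eq_complex_def by simp
qed

lemma psd_on_transpose:
  assumes "psd_on I B"
  shows "psd_on I (\<lambda>i j. B j i)"
  unfolding psd_on_def
proof
  fix v
  have "(\<Sum>i\<in>I. \<Sum>j\<in>I. cnj (v i) * B j i * v j) = (\<Sum>j\<in>I. \<Sum>i\<in>I. cnj (v i) * B j i * v j)" by (rule sum.swap)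
  also have "\<dots> = (\<Sum>j\<in>I. \<Sum>i\<in>I. cnj (cnj (v j)) * B j i * cnj (v i))" by (simp add: mult_ac)
  finally show "0 \<le> (\<Sum>i\<in>I. \<Sum>j\<in>I. cnj (v i) * B j i * v j)"
    using assms[unfolded psd_on_def, rule_format, of "\<lambda>i. cnj (v i)"] by simp
qed

text \<open>One statement for relabelled indices, for rank-one operators (with a one-point
  \<open>J\<close>), and for block-diagonal extensions (with indicator functions as
  \<open>h\<close>).\<close>

lemma psd_on_pullback:
  assumes I: "finite I" and J: "finite J" and f: "\<And>i. i \<in> I \<Longrightarrow> f i \<in> J" and S: "psd_on J S"
  shows "psd_on I (\<lambda>i j. h i * S (f i) (f j) * cnj (h j))"
  unfolding psd_on_def
proof
  fix v :: "'a \<Rightarrow> complex"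
  define w where "w = (\<lambda>y. \<Sum>j\<in>I. of_bool (f j = y) * (cnj (h j) * v j))"
  have 1: "(\<Sum>y\<in>J. S x y * w y) = (\<Sum>j\<in>I. S x (f j) * (cnj (h j) * v j))" for x
  proof -
    have "(\<Sum>y\<in>J. S x y * w y) = (\<Sum>j\<in>I. \<Sum>y\<in>J. S x y * (of_bool (f j = y) * (cnj (h j) * v j)))"
      unfolding w_def sum_distrib_left by (rule sum.swap)
    also have "\<dots> = (\<Sum>j\<in>I. \<Sum>y\<in>J. if f j = y then S x y * (cnj (h j) * v j) else 0)"
      by (intro sum.cong refl) auto
    also have "\<dots> = (\<Sum>j\<in>I. S x (f j) * (cnj (h j) * v j))"
      using J f by (intro sum.cong refl) simp
    finally show ?thesis .
  qed
  have 2: "(\<Sum>x\<in>J. cnj (w x) * g x) = (\<Sum>i\<in>I. cnj (v i) * h i * g (f i))" for g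
  proof -
    have "(\<Sum>x\<in>J. cnj (w x) * g x) = (\<Sum>i\<in>I. \<Sum>x\<in>J. of_bool (f i = x) * (cnj (v i) * h i) * g x)"
      unfolding w_def cnj_sum sum_distrib_right by (rule trans[OF sum.swap]) (simp add: mult_ac)
    also have "\<dots> = (\<Sum>i\<in>I. \<Sum>x\<in>J. if f i = x then cnj (v i) * h i * g x else 0)"
      by (intro sum.cong refl) auto
    also have "\<dots> = (\<Sum>i\<in>I. cnj (v i) * h i * g (f i))"
      using J f by (intro sum.cong refl) simp
    finally show ?thesis .
  qed
  have "(\<Sum>x\<in>J. \<Sum>y\<in>J. cnj (w x) * S x y * w y) = (\<Sum>x\<in>J. cnj (w x) * (\<Sum>y\<in>J. S x y * w y))"
    by (simp only: sum_distrib_left mult.assoc)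
  also have "\<dots> = (\<Sum>i\<in>I. cnj (v i) * h i * (\<Sum>y\<in>J. S (f i) y * w y))" by (rule 2)
  also have "\<dots> = (\<Sum>i\<in>I. \<Sum>j\<in>I. cnj (v i) * (h i * S (f i) (f j) * cnj (h j)) * v j)"
    unfolding 1 sum_distrib_left by (simp only: mult.assoc)
  finally show "0 \<le> (\<Sum>i\<in>I. \<Sum>j\<in>I. cnj (v i) * (h i * S (f i) (f j) * cnj (h j)) * v j)"
    using S[unfolded psd_on_def, rule_format, of w] by simp
qed

lemma psd_on_rank_one: "finite I \<Longrightarrow> psd_on I (\<lambda>i j. u i * cnj (u j))"
proof -
  assume I: "finite I"
  have "psd_on {()} (\<lambda>_ _. 1)" by (simp add: psd_on_def complex_mult_cnj less_eq_complex_def)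
  then have "psd_on I (\<lambda>i j. u i * 1 * cnj (u j))"
    by (rule psd_on_pullback[OF I _ _, where f = "\<lambda>_. ()", rotated 2]) auto
  then show ?thesis by simp
qed

lemma psd_on_idm:
  assumes I: "finite I"
  shows "psd_on I idm"
proof (rule psd_on_cong)
  show "psd_on I (\<lambda>i j. \<Sum>k\<in>I. idm i k * cnj (idm j k))"
    by (intro psd_on_sum psd_on_rank_one I)
  show "meq I I (\<lambda>i j. \<Sum>k\<in>I. idm i k * cnj (idm j k)) idm"
  proof (rule meqI)
    fix i j assume "i \<in> I" "j \<in> I"
    have "(\<Sum>k\<in>I. idm i k * cnj (idm j k)) = (\<Sum>k\<in>I. if i = k then idm i j else 0)"
      by (intro sum.cong refl) (auto simp: idm_def)
    then show "(\<Sum>k\<in>I. idm i k * cnj (idm j k)) = idm i j" using I \<open>i \<in> I\<close> by simp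
  qed
qed

lemma psd_on_gram: "finite I \<Longrightarrow> psd_on I (gram n R \<Psi>)"
  unfolding gram_def by (intro psd_on_sum psd_on_rank_one)

lemma zxz_conj_on: "hermitian_on I Z \<Longrightarrow> meq I I (zxz I Z X) (conj_on I Z X)"
  unfolding zxz_def conj_on_def
  by (intro mm_cong meq_refl) (auto simp: hermitian_on_def intro: meq_sym)

lemma psd_on_zxz: "hermitian_on I Z \<Longrightarrow> psd_on I X \<Longrightarrow> psd_on I (zxz I Z X)"
  by (rule psd_on_cong[OF meq_sym[OF zxz_conj_on] psd_on_conj])

text \<open>Permutation operators commute with \<open>kop\<close>, hence with
  \<open>Z\<close>.\<close>

lemma inv_root_perm:
  assumes A: "finite A" and Z: "is_inv_root (tup n A) (kop n R) Z" and s: "s \<in> perms n"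
    and x: "x \<in> tup n A" "y \<in> tup n A"
  shows "Z (pl s x) (pl s y) = Z x y"
proof -
  have cZ: "commute_on (tup n A) (kop n R) B \<Longrightarrow> commute_on (tup n A) Z B" for B
    using Z by (simp add: is_inv_root_def)
  have "commute_on (tup n A) (kop n R) (perm_mat s)"
    unfolding commute_on_perm_mat[OF A s] by (simp add: kop_perm[OF s])
  then have "commute_on (tup n A) Z (perm_mat s)" by (rule cZ)
  then show ?thesis using commute_on_perm_mat[OF A s] x by blast
qed

lemma mm_perm:
  assumes s: "s \<in> perms n" and x: "x \<in> tup n A" "y \<in> tup n A"
    and B: "\<And>x y. x \<in> tup n A \<Longrightarrow> y \<in> tup n A \<Longrightarrow> B (pl s x) (pl s y) = B x y"
    and C: "\<And>x y. x \<in> tup n A \<Longrightarrow> y \<in> tup n A \<Longrightarrow> C (pl s x) (pl s y) = C x y"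
  shows "mm (tup n A) B C (pl s x) (pl s y) = mm (tup n A) B C x y"
proof -
  have "mm (tup n A) B C (pl s x) (pl s y) = (\<Sum>k\<in>tup n A. B (pl s x) (pl s k) * C (pl s k) (pl s y))"
    unfolding mm_def by (rule sum_pl[OF s, symmetric])
  also have "\<dots> = mm (tup n A) B C x y"
    unfolding mm_def by (intro sum.cong refl) (simp add: B C x)
  finally show ?thesis .
qed

lemma zxz_perm:
  assumes A: "finite A" and Z: "is_inv_root (tup n A) (kop n R) Z" and s: "s \<in> perms n"
    and x: "x \<in> tup n A" "y \<in> tup n A"
    and X: "\<And>x y. x \<in> tup n A \<Longrightarrow> y \<in> tup n A \<Longrightarrow> X (pl s x) (pl s y) = X x y"
  shows "zxz (tup n A) Z X (pl s x) (pl s y) = zxz (tup n A) Z X x y"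
  unfolding zxz_def
proof (rule mm_perm[OF s x])
  fix x y assume xy: "x \<in> tup n A" "y \<in> tup n A"
  show "Z (pl s x) (pl s y) = Z x y" by (rule inv_root_perm[OF A Z s xy])
  show "mm (tup n A) X Z (pl s x) (pl s y) = mm (tup n A) X Z x y"
    by (rule mm_perm[OF s xy]) (rule X inv_root_perm[OF A Z s]; assumption)+
qed

text \<open>The operator \<open>zxz Z (gram \<Psi>)\<close> reproduces the average of the outcome probabilities over the
  unknown unitary on \<open>R\<close>.\<close>

lemma born_limit:
  assumes R: "finite R" and A: "finite A" and Us: "haar_seq R N Us" and n: "n \<le> N" and sy: "symm_on n A R \<Psi>"
    and Z: "is_inv_root (tup n A) (kop n R) Z" and \<Phi>: "symm_on n A R \<Phi>"
  shows "(\<lambda>t. avg (Us t) (\<lambda>V. of_real ((cmod (\<Sum>a\<in>tup n A. \<Sum>b\<in>tup n R. cnj (app n R V \<Psi> a b) * \<Phi> a b))\<^sup>2)))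
    \<longlonglongrightarrow> (\<Sum>a'\<in>tup n A. \<Sum>a\<in>tup n A. zxz (tup n A) Z (gram n R \<Psi>) a' a * (\<Sum>b\<in>tup n R. \<Phi> a b * cnj (\<Phi> a' b)))"
proof -
  let ?TA = "tup n A" and ?TR = "tup n R" and ?Q = "zxz (tup n A) Z (gram n R \<Psi>)"
  have sq: "of_real ((cmod (\<Sum>a\<in>?TA. \<Sum>b\<in>?TR. cnj (app n R V \<Psi> a b) * \<Phi> a b))\<^sup>2)
    = (\<Sum>a\<in>?TA. \<Sum>a'\<in>?TA. \<Sum>b\<in>?TR. \<Sum>b'\<in>?TR. app n R V \<Psi> a' b' * cnj (app n R V \<Psi> a b) * (\<Phi> a b * cnj (\<Phi> a' b')))" for V
    unfolding complex_norm_square cnj_sum sum_product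
    by (intro sum.cong refl) (simp only: complex_cnj_mult complex_cnj_cnj mult_ac)
  have "(\<lambda>t. \<Sum>a\<in>?TA. \<Sum>a'\<in>?TA. \<Sum>b\<in>?TR. \<Sum>b'\<in>?TR.
        avg (Us t) (\<lambda>V. app n R V \<Psi> a' b' * cnj (app n R V \<Psi> a b)) * (\<Phi> a b * cnj (\<Phi> a' b')))
     \<longlonglongrightarrow> (\<Sum>a\<in>?TA. \<Sum>a'\<in>?TA. \<Sum>b\<in>?TR. \<Sum>b'\<in>?TR. twirl n R Us \<Psi> a' b' a b * (\<Phi> a b * cnj (\<Phi> a' b')))"
    by (intro tendsto_sum tendsto_mult tendsto_const twirl_lim[OF R Us n sy])
  moreover have "(\<Sum>a\<in>?TA. \<Sum>a'\<in>?TA. \<Sum>b\<in>?TR. \<Sum>b'\<in>?TR. twirl n R Us \<Psi> a' b' a b * (\<Phi> a b * cnj (\<Phi> a' b')))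
     = (\<Sum>a'\<in>?TA. \<Sum>a\<in>?TA. ?Q a' a * (\<Sum>b\<in>?TR. \<Phi> a b * cnj (\<Phi> a' b)))"
  proof -
    have inner: "(\<Sum>b\<in>?TR. \<Sum>b'\<in>?TR. twirl n R Us \<Psi> a' b' a b * (\<Phi> a b * cnj (\<Phi> a' b')))
      = (\<Sum>s\<in>perms n. \<Sum>b\<in>?TR. ?Q a' (pl s a) * (\<Phi> a b * cnj (\<Phi> a' (pl s b)))) / fact n"
      if a: "a \<in> ?TA" "a' \<in> ?TA" for a a'
    proof -
      have "(\<Sum>b\<in>?TR. \<Sum>b'\<in>?TR. twirl n R Us \<Psi> a' b' a b * (\<Phi> a b * cnj (\<Phi> a' b')))
         = (\<Sum>b\<in>?TR. \<Sum>b'\<in>?TR. \<Sum>s\<in>perms n. of_bool (b' = pl s b) * (?Q a' (pl s a) * (\<Phi> a b * cnj (\<Phi> a' b')) / fact n))"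
        by (intro sum.cong refl) (simp only: twirl_eq[OF R A Us n sy Z a(2,1)] sum_divide_distrib sum_distrib_right
            times_divide_eq_left times_divide_eq_right mult.assoc)
      also have "\<dots> = (\<Sum>b\<in>?TR. \<Sum>s\<in>perms n. \<Sum>b'\<in>?TR. of_bool (b' = pl s b) * (?Q a' (pl s a) * (\<Phi> a b * cnj (\<Phi> a' b')) / fact n))"
        by (rule sum.cong[OF refl], rule sum.swap)
      also have "\<dots> = (\<Sum>b\<in>?TR. \<Sum>s\<in>perms n. ?Q a' (pl s a) * (\<Phi> a b * cnj (\<Phi> a' (pl s b))) / fact n)"
      proof (rule sum.cong[OF refl], rule sum.cong[OF refl])
        fix b s assume b: "b \<in> ?TR" and s: "s \<in> perms n"
        have "(\<Sum>b'\<in>?TR. of_bool (b' = pl s b) * (?Q a' (pl s a) * (\<Phi> a b * cnj (\<Phi> a' b')) / fact n))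
           = (\<Sum>b'\<in>?TR. if b' = pl s b then ?Q a' (pl s a) * (\<Phi> a b * cnj (\<Phi> a' b')) / fact n else 0)"
          by (rule sum.cong[OF refl]) simp
        then show "(\<Sum>b'\<in>?TR. of_bool (b' = pl s b) * (?Q a' (pl s a) * (\<Phi> a b * cnj (\<Phi> a' b')) / fact n))
           = ?Q a' (pl s a) * (\<Phi> a b * cnj (\<Phi> a' (pl s b))) / fact n"
          using R pl_tup[OF s b] by simp
      qed
      also have "\<dots> = (\<Sum>s\<in>perms n. \<Sum>b\<in>?TR. ?Q a' (pl s a) * (\<Phi> a b * cnj (\<Phi> a' (pl s b))) / fact n)" by (rule sum.swap)
      finally show ?thesis by (simp only: sum_divide_distrib)
    qed
    have "(\<Sum>a\<in>?TA. \<Sum>a'\<in>?TA. \<Sum>b\<in>?TR. \<Sum>b'\<in>?TR. twirl n R Us \<Psi> a' b' a b * (\<Phi> a b * cnj (\<Phi> a' b')))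
      = (\<Sum>a'\<in>?TA. \<Sum>a\<in>?TA. \<Sum>b\<in>?TR. \<Sum>b'\<in>?TR. twirl n R Us \<Psi> a' b' a b * (\<Phi> a b * cnj (\<Phi> a' b')))"
      by (rule sum.swap)
    also have "\<dots> = (\<Sum>a'\<in>?TA. \<Sum>a\<in>?TA. (\<Sum>s\<in>perms n. \<Sum>b\<in>?TR. ?Q a' (pl s a) * (\<Phi> a b * cnj (\<Phi> a' (pl s b)))) / fact n)"
      by (rule sum.cong[OF refl], rule sum.cong[OF refl], rule inner)
    also have "\<dots> = (\<Sum>a'\<in>?TA. (\<Sum>s\<in>perms n. \<Sum>a\<in>?TA. \<Sum>b\<in>?TR. ?Q a' (pl s a) * (\<Phi> a b * cnj (\<Phi> a' (pl s b)))) / fact n)"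
      unfolding sum_divide_distrib[symmetric] by (rule arg_cong[where f = "\<lambda>x. x / fact n"], rule sum.cong[OF refl], rule sum.swap)
    \<comment> \<open>The symmetry of \<open>\<Phi>\<close> absorbs the permutation left by
      \<open>twirl_eq\<close>, so all \<open>fact n\<close> terms coincide.\<close>
    also have "\<dots> = (\<Sum>a'\<in>?TA. (\<Sum>s\<in>perms n. \<Sum>a\<in>?TA. ?Q a' a * (\<Sum>b\<in>?TR. \<Phi> a b * cnj (\<Phi> a' b))) / fact n)"
    proof (rule sum.cong[OF refl], rule arg_cong[where f = "\<lambda>x. x / fact n"], rule sum.cong[OF refl])
      fix a' s assume a': "a' \<in> ?TA" and s: "s \<in> perms n"
      have "(\<Sum>a\<in>?TA. \<Sum>b\<in>?TR. ?Q a' (pl s a) * (\<Phi> a b * cnj (\<Phi> a' (pl s b))))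
         = (\<Sum>a\<in>?TA. \<Sum>b\<in>?TR. ?Q a' (pl s a) * (\<Phi> (pl s a) (pl s b) * cnj (\<Phi> a' (pl s b))))"
        using \<Phi> s by (intro sum.cong refl) (simp add: symm_on_def)
      also have "\<dots> = (\<Sum>a\<in>?TA. \<Sum>b\<in>?TR. ?Q a' (pl s a) * (\<Phi> (pl s a) b * cnj (\<Phi> a' b)))"
        by (rule sum.cong[OF refl], rule sum_pl[OF s])
      also have "\<dots> = (\<Sum>a\<in>?TA. \<Sum>b\<in>?TR. ?Q a' a * (\<Phi> a b * cnj (\<Phi> a' b)))"
        by (rule sum_pl[OF s])
      finally show "(\<Sum>a\<in>?TA. \<Sum>b\<in>?TR. ?Q a' (pl s a) * (\<Phi> a b * cnj (\<Phi> a' (pl s b))))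
         = (\<Sum>a\<in>?TA. ?Q a' a * (\<Sum>b\<in>?TR. \<Phi> a b * cnj (\<Phi> a' b)))"
        by (simp only: sum_distrib_left)
    qed
    finally show ?thesis by (simp add: card_perms)
  qed
  ultimately show ?thesis unfolding sq avg_sum avg_multc by simp
qed

text \<open>Moves a unitary from the outcome vector to the unknown vector as its adjoint.\<close>

lemma app_pairing:
  "(\<Sum>a\<in>tup n A. \<Sum>b\<in>tup n R. cnj (app n R V \<Psi> a b) * \<Phi> a b)
    = (\<Sum>a\<in>tup n A. \<Sum>c\<in>tup n R. cnj (\<Psi> a c) * app n R (adj V) \<Phi> a c)"
proof (rule sum.cong[OF refl])
  fix a
  have "(\<Sum>b\<in>tup n R. cnj (app n R V \<Psi> a b) * \<Phi> a b)
      = (\<Sum>b\<in>tup n R. \<Sum>c\<in>tup n R. cnj (\<Psi> a c) * (cnj (tpow V b c) * \<Phi> a b))"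
    unfolding app_def cnj_sum sum_distrib_right
    by (intro sum.cong refl) (simp only: complex_cnj_mult mult_ac)
  also have "\<dots> = (\<Sum>c\<in>tup n R. \<Sum>b\<in>tup n R. cnj (\<Psi> a c) * (cnj (tpow V b c) * \<Phi> a b))" by (rule sum.swap)
  also have "\<dots> = (\<Sum>c\<in>tup n R. cnj (\<Psi> a c) * app n R (adj V) \<Phi> a c)"
    unfolding app_def sum_distrib_left
  proof (rule sum.cong[OF refl], rule sum.cong[OF refl])
    fix c b assume "c \<in> tup n R" "b \<in> tup n R"
    then show "cnj (\<Psi> a c) * (cnj (tpow V b c) * \<Phi> a b) = cnj (\<Psi> a c) * (tpow (adj V) c b * \<Phi> a b)"
      using tpow_adj[of c b V] by (simp add: length_tup adj_def)
  qed
  finally show "(\<Sum>b\<in>tup n R. cnj (app n R V \<Psi> a b) * \<Phi> a b) = (\<Sum>c\<in>tup n R. cnj (\<Psi> a c) * app n R (adj V) \<Phi> a c)" .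
qed

lemma app_tpow: "c \<in> tup n R \<Longrightarrow> app n R W (\<lambda>a b. tpow U b a) a c = tpow (mm R W U) c a"
  by (simp add: app_def tpow_mm[OF length_tup] mm_def[of "tup n R"])

section \<open>Splitting the rows of the dilation into channel output and environment\<close>

definition comb :: "nat \<Rightarrow> nat list \<Rightarrow> nat list \<Rightarrow> nat list" where
  "comb r = map2 (\<lambda>b \<rho>. b * r + \<rho>)"

text \<open>Column \<open>(b, a)\<close> of \<open>env r U\<close> is the environment state accompanying the output \<open>b\<close> on input \<open>a\<close>.\<close>

definition env :: "nat \<Rightarrow> (nat \<Rightarrow> nat \<Rightarrow> complex) \<Rightarrow> nat \<Rightarrow> nat \<times> nat \<Rightarrow> complex" where
  "env r U \<rho> p = U (fst p * r + \<rho>) (snd p)"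

text \<open>The tensor \<open>F\<close> is regarded as a vector on two registers: the pairs (output,
  input), which the tester acts on, and the environment, which it cannot access.\<close>

definition lift :: "nat \<Rightarrow> (nat list \<Rightarrow> nat list \<Rightarrow> complex) \<Rightarrow> (nat \<times> nat) list \<Rightarrow> nat list \<Rightarrow> complex" where
  "lift r F p \<rho> = F (map snd p) (comb r (map fst p) \<rho>)"

text \<open>The operator \<open>I \<otimes> W\<close> acting on the environment.\<close>

definition blk :: "nat \<Rightarrow> (nat \<Rightarrow> nat \<Rightarrow> complex) \<Rightarrow> nat \<Rightarrow> nat \<Rightarrow> complex" where
  "blk r W c e = (if c div r = e div r then W (c mod r) (e mod r) else 0)"

lemma tpow_comb:
  "length p = length \<rho> \<Longrightarrow> tpow U (comb r (map fst p) \<rho>) (map snd p) = tpow (env r U) \<rho> p"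
  by (induction p \<rho> rule: list_induct2) (simp_all add: comb_def env_def)

lemma comb_tup:
  assumes "p \<in> tup n {..<d}" "\<rho> \<in> tup n {..<r}"
  shows "comb r p \<rho> \<in> tup n {..<d * r}"
proof -
  have l: "length p = n" "length \<rho> = n" using assms by (auto simp: tup_def)
  have "x < d * r" if x: "x \<in> set (comb r p \<rho>)" for x
  proof -
    obtain k where "k < length (comb r p \<rho>)" "x = comb r p \<rho> ! k"
      using x unfolding in_set_conv_nth by blast
    then have k: "k < n" "x = p ! k * r + \<rho> ! k" using l by (simp_all add: comb_def)
    then show ?thesis using nth_tup[OF assms(1) k(1)] nth_tup[OF assms(2) k(1)] by (simp add: pair_index_less)
  qed
  then show ?thesis using l by (auto simp: tup_def comb_def)
qed

lemma comb_eq_iff: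
  assumes "p \<in> tup n {..<d}" "\<rho> \<in> tup n {..<r}" "p' \<in> tup n {..<d}" "\<rho>' \<in> tup n {..<r}"
  shows "comb r p \<rho> = comb r p' \<rho>' \<longleftrightarrow> p = p' \<and> \<rho> = \<rho>'"
proof -
  have dm: "map (\<lambda>c. c div r) (comb r p \<rho>) = p \<and> map (\<lambda>c. c mod r) (comb r p \<rho>) = \<rho>"
    if "p \<in> tup n {..<d}" "\<rho> \<in> tup n {..<r}" for p \<rho>
  proof -
    have l: "length p = n" "length \<rho> = n" using that by (auto simp: tup_def)
    have dm: "(b * r + x) div r = b \<and> (b * r + x) mod r = x" if "x < r" for b x
      using that by (cases "r = 0") auto
    have "\<rho> ! k < r" if "k < n" for k using nth_tup[OF \<open>\<rho> \<in> tup n {..<r}\<close> that] by simp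
    then show ?thesis using l by (auto simp: dm comb_def list_eq_iff_nth_eq)
  qed
  show ?thesis using dm[OF assms(1,2)] dm[OF assms(3,4)] by metis
qed

lemma tup_map: "p \<in> tup n A \<Longrightarrow> (\<And>x. x \<in> A \<Longrightarrow> f x \<in> B) \<Longrightarrow> map f p \<in> tup n B"
  by (auto simp: tup_def)

lemma pl_comb:
  assumes s: "s \<in> perms n" and p: "length p = n" "length \<rho> = n"
  shows "comb r (pl s p) (pl s \<rho>) = pl s (comb r p \<rho>)"
proof -
  have "s permutes {..<length (zip p \<rho>)}" using s p by simp
  moreover have "zip (pl s p) (pl s \<rho>) = pl s (zip p \<rho>)"
    using s p by (intro permute_list_zip[symmetric]) auto
  ultimately show ?thesis by (simp only: comb_def permute_list_map)
qed

lemma pl_map: "s \<in> perms n \<Longrightarrow> length p = n \<Longrightarrow> map f (pl s p) = pl s (map f p)"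
  using permute_list_map[of s p f] by simp

lemma symm_on_lift:
  assumes F: "symm_on n {..<D} {..<d * r} F"
  shows "symm_on n ({..<d} \<times> {..<D}) {..<r} (lift r F)"
  unfolding symm_on_def
proof (intro ballI)
  fix s p \<rho> assume s: "s \<in> perms n" and p: "p \<in> tup n ({..<d} \<times> {..<D})" and \<rho>: "\<rho> \<in> tup n {..<r}"
  have l: "length p = n" "length \<rho> = n" using p \<rho> by (auto simp: tup_def)
  have "map snd p \<in> tup n {..<D}" "map fst p \<in> tup n {..<d}" by (rule tup_map[OF p], auto)+
  then show "lift r F (pl s p) (pl s \<rho>) = lift r F p \<rho>"
    using F s l comb_tup[OF _ \<rho>] by (simp add: lift_def pl_map pl_comb symm_on_def)
qed

lemma symm_on_tpow: "symm_on n A R (\<lambda>a b. tpow U b a)"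
  by (simp add: symm_on_def tpow_pl)

text \<open>Digit by digit, division with remainder by \<open>r\<close> is a bijection between row
  indices and pairs of output and environment digits.\<close>

lemma sum_comb:
  fixes f :: "nat list \<Rightarrow> nat list \<Rightarrow> 'a :: comm_monoid_add"
  shows "(\<Sum>p\<in>tup n ({..<d} \<times> {..<D}). \<Sum>\<rho>\<in>tup n {..<r}. f (map snd p) (comb r (map fst p) \<rho>))
    = (\<Sum>a\<in>tup n {..<D}. \<Sum>c\<in>tup n {..<d * r}. f a c)"
proof (induction n arbitrary: f)
  case 0
  show ?case by (simp add: comb_def)
next
  case (Suc n)
  let ?P = "tup n ({..<d} \<times> {..<D})" and ?R = "tup n {..<r}"
  have pair: "(\<Sum>b<d. \<Sum>a<D. g b a) = (\<Sum>x\<in>{..<d} \<times> {..<D}. g (fst x) (snd x))" for g :: "nat \<Rightarrow> nat \<Rightarrow> 'a"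
    by (simp add: sum.cartesian_product case_prod_unfold)
  have "(\<Sum>p\<in>tup (Suc n) ({..<d} \<times> {..<D}). \<Sum>\<rho>\<in>tup (Suc n) {..<r}. f (map snd p) (comb r (map fst p) \<rho>))
      = (\<Sum>x\<in>{..<d} \<times> {..<D}. \<Sum>p\<in>?P. \<Sum>y<r. \<Sum>\<rho>\<in>?R. f (snd x # map snd p) ((fst x * r + y) # comb r (map fst p) \<rho>))"
    by (simp add: sum_tup_Suc comb_def)
  also have "\<dots> = (\<Sum>x\<in>{..<d} \<times> {..<D}. \<Sum>y<r. \<Sum>p\<in>?P. \<Sum>\<rho>\<in>?R. f (snd x # map snd p) ((fst x * r + y) # comb r (map fst p) \<rho>))"
    by (rule sum.cong[OF refl], rule sum.swap)
  also have "\<dots> = (\<Sum>x\<in>{..<d} \<times> {..<D}. \<Sum>y<r. \<Sum>a\<in>tup n {..<D}. \<Sum>c\<in>tup n {..<d * r}. f (snd x # a) ((fst x * r + y) # c))"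
    by (rule sum.cong[OF refl], rule sum.cong[OF refl], rule Suc.IH)
  also have "\<dots> = (\<Sum>b<d. \<Sum>a0<D. \<Sum>y<r. \<Sum>a\<in>tup n {..<D}. \<Sum>c\<in>tup n {..<d * r}. f (a0 # a) ((b * r + y) # c))"
    by (rule sym, rule pair)
  also have "\<dots> = (\<Sum>a0<D. \<Sum>b<d. \<Sum>y<r. \<Sum>a\<in>tup n {..<D}. \<Sum>c\<in>tup n {..<d * r}. f (a0 # a) ((b * r + y) # c))"
    by (rule sum.swap)
  also have "\<dots> = (\<Sum>a0<D. \<Sum>z<d * r. \<Sum>a\<in>tup n {..<D}. \<Sum>c\<in>tup n {..<d * r}. f (a0 # a) (z # c))"
    unfolding sum_pair_index ..
  also have "\<dots> = (\<Sum>a0<D. \<Sum>a\<in>tup n {..<D}. \<Sum>z<d * r. \<Sum>c\<in>tup n {..<d * r}. f (a0 # a) (z # c))"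
    by (rule sum.cong[OF refl], rule sum.swap)
  finally show ?case by (simp only: sum_tup_Suc)
qed

lemma mm_blk:
  assumes "r > 0"
  shows "meq {..<d * r} UNIV (mm {..<d * r} (blk r W) (blk r W')) (blk r (mm {..<r} W W'))"
proof (rule meqI)
  fix c e assume c: "c \<in> {..<d * r}"
  have cd: "c div r < d" using c by (simp add: less_mult_imp_div_less)
  have "mm {..<d * r} (blk r W) (blk r W') c e = (\<Sum>b<d. \<Sum>\<rho><r. blk r W c (b * r + \<rho>) * blk r W' (b * r + \<rho>) e)"
    unfolding mm_def by (rule sum_pair_index)
  also have "\<dots> = (\<Sum>b<d. if c div r = b then blk r (mm {..<r} W W') c e else 0)"
    using assms by (intro sum.cong refl) (auto simp: blk_def mm_def)
  also have "\<dots> = blk r (mm {..<r} W W') c e" using cd by simp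
  finally show "mm {..<d * r} (blk r W) (blk r W') c e = blk r (mm {..<r} W W') c e" .
qed

lemma adj_blk: "adj (blk r W) = blk r (adj W)"
  by (auto simp: adj_def blk_def fun_eq_iff)

lemma unitary_on_blk:
  assumes r: "r > 0" and W: "unitary_on {..<r} W"
  shows "unitary_on {..<d * r} (blk r W)"
proof -
  have "blk r X c e = idm c e" if X: "meq {..<r} {..<r} X idm" for X c e
  proof -
    have "X (c mod r) (e mod r) = idm (c mod r) (e mod r)" using X r by (simp add: meq_def)
    moreover have "c div r = e div r \<Longrightarrow> c mod r = e mod r \<Longrightarrow> c = e" by (metis div_mult_mod_eq)
    ultimately show ?thesis by (auto simp: blk_def idm_def)
  qed
  then show ?thesis
    using mm_blk[OF r, of d W "adj W"] mm_blk[OF r, of d "adj W" W] unitary_onD[OF W]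
    unfolding unitary_on_def adj_blk meq_def by simp
qed

lemma mm_env:
  assumes r: "r > 0" and s: "\<sigma> < r" and p: "fst p < d"
  shows "mm {..<r} W (env r U) \<sigma> p = env r (mm {..<d * r} (blk r W) U) \<sigma> p"
proof -
  have "env r (mm {..<d * r} (blk r W) U) \<sigma> p
      = (\<Sum>b<d. \<Sum>\<rho><r. blk r W (fst p * r + \<sigma>) (b * r + \<rho>) * U (b * r + \<rho>) (snd p))"
    unfolding env_def mm_def by (rule sum_pair_index)
  also have "\<dots> = (\<Sum>b<d. if fst p = b then mm {..<r} W (env r U) \<sigma> p else 0)"
    using r s by (intro sum.cong refl) (auto simp: blk_def mm_def env_def)
  also have "\<dots> = mm {..<r} W (env r U) \<sigma> p" using p by simp
  finally show ?thesis ..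
qed

text \<open>Moving \<open>V\<close> and \<open>g\<close> to the other side turns the amplitude into
  that of the unitary \<open>U\<close>, first hit by the adjoint of \<open>V\<close> on the
  environment and then by the adjoint of \<open>g\<close>. This is why only averages over
  \<open>V\<close> are accessible.\<close>

lemma lift_pairing:
  assumes r: "r > 0"
  shows "(\<Sum>p\<in>tup n ({..<d} \<times> {..<D}). \<Sum>\<rho>\<in>tup n {..<r}.
        cnj (app n {..<r} V (lift r (app n {..<d * r} g F)) p \<rho>) * tpow (env r U) \<rho> p)
    = (\<Sum>a\<in>tup n {..<D}. \<Sum>c\<in>tup n {..<d * r}.
        cnj (F a c) * tpow (mm {..<d * r} (adj g) (mm {..<d * r} (blk r (adj V)) U)) c a)"
proof -
  let ?U = "mm {..<d * r} (blk r (adj V)) U"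
  have "(\<Sum>p\<in>tup n ({..<d} \<times> {..<D}). \<Sum>\<rho>\<in>tup n {..<r}.
        cnj (app n {..<r} V (lift r (app n {..<d * r} g F)) p \<rho>) * tpow (env r U) \<rho> p)
    = (\<Sum>p\<in>tup n ({..<d} \<times> {..<D}). \<Sum>\<sigma>\<in>tup n {..<r}. cnj (lift r (app n {..<d * r} g F) p \<sigma>)
         * app n {..<r} (adj V) (\<lambda>p \<rho>. tpow (env r U) \<rho> p) p \<sigma>)"
    by (rule app_pairing)
  also have "\<dots> = (\<Sum>p\<in>tup n ({..<d} \<times> {..<D}). \<Sum>\<sigma>\<in>tup n {..<r}.
      cnj (app n {..<d * r} g F (map snd p) (comb r (map fst p) \<sigma>)) * tpow ?U (comb r (map fst p) \<sigma>) (map snd p))"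
  proof (rule sum.cong[OF refl], rule sum.cong[OF refl])
    fix p \<sigma> assume p: "p \<in> tup n ({..<d} \<times> {..<D})" and \<sigma>: "\<sigma> \<in> tup n {..<r}"
    have l: "length p = n" "length \<sigma> = n" using p \<sigma> by (auto simp: tup_def)
    have "tpow (mm {..<r} (adj V) (env r U)) \<sigma> p = tpow (env r ?U) \<sigma> p"
      unfolding tpow_def
    proof (rule prod.cong[OF refl])
      fix k assume "k \<in> {..<length \<sigma>}"
      then show "mm {..<r} (adj V) (env r U) (\<sigma> ! k) (p ! k) = env r ?U (\<sigma> ! k) (p ! k)"
        using nth_tup[OF p, of k] nth_tup[OF \<sigma>, of k] l by (intro mm_env[OF r]) (auto simp: mem_Times_iff)
    qed
    then have "app n {..<r} (adj V) (\<lambda>p \<rho>. tpow (env r U) \<rho> p) p \<sigma> = tpow ?U (comb r (map fst p) \<sigma>) (map snd p)"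
      using app_tpow[OF \<sigma>] tpow_comb[of p \<sigma>] l by metis
    then show "cnj (lift r (app n {..<d * r} g F) p \<sigma>) * app n {..<r} (adj V) (\<lambda>p \<rho>. tpow (env r U) \<rho> p) p \<sigma>
      = cnj (app n {..<d * r} g F (map snd p) (comb r (map fst p) \<sigma>)) * tpow ?U (comb r (map fst p) \<sigma>) (map snd p)"
      by (simp only: lift_def)
  qed
  also have "\<dots> = (\<Sum>a\<in>tup n {..<D}. \<Sum>c\<in>tup n {..<d * r}. cnj (app n {..<d * r} g F a c) * tpow ?U c a)"
    by (rule sum_comb)
  also have "\<dots> = (\<Sum>a\<in>tup n {..<D}. \<Sum>c\<in>tup n {..<d * r}. cnj (F a c) * app n {..<d * r} (adj g) (\<lambda>a c. tpow ?U c a) a c)"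
    by (rule app_pairing)
  also have "\<dots> = (\<Sum>a\<in>tup n {..<D}. \<Sum>c\<in>tup n {..<d * r}. cnj (F a c) * tpow (mm {..<d * r} (adj g) ?U) c a)"
    by (rule sum.cong[OF refl], rule sum.cong[OF refl]) (simp only: app_tpow)
  finally show ?thesis .
qed

text \<open>Here \<open>twirl_eq\<close> is applied with the whole range \<open>{..<d * r}\<close>
  of \<open>U\<close> as the randomised space. Summing over the environment digits turns the
  condition \<open>\<rho> = pl s \<rho>\<close> into \<open>fixc n {..<r} s\<close>. Hence the
  factor \<open>kop n {..<r}\<close> next to an operator that is the identity on the
  outputs.\<close>

lemma avg_gram_lift_limit:
  assumes r: "r > 0" and Us: "haar_seq {..<d * r} N Us" and n: "n \<le> N" and F: "symm_on n {..<D} {..<d * r} F"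
    and Z: "is_inv_root (tup n {..<D}) (kop n {..<d * r}) Z"
    and p: "p \<in> tup n ({..<d} \<times> {..<D})" "p' \<in> tup n ({..<d} \<times> {..<D})"
  shows "(\<lambda>t. avg (Us t) (\<lambda>g. gram n {..<r} (lift r (app n {..<d * r} g F)) p p'))
    \<longlonglongrightarrow> mm (tup n ({..<d} \<times> {..<D})) (\<lambda>p p'. of_bool (map fst p = map fst p') *
        zxz (tup n {..<D}) Z (gram n {..<d * r} F) (map snd p) (map snd p')) (kop n {..<r}) p p'"
proof -
  let ?R = "tup n {..<r}" and ?Q = "zxz (tup n {..<D}) Z (gram n {..<d * r} F)" and ?T = "tup n ({..<d} \<times> {..<D})"
  let ?Y = "\<lambda>\<rho>. twirl n {..<d * r} Us F (map snd p) (comb r (map fst p) \<rho>) (map snd p') (comb r (map fst p') \<rho>)"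
  let ?Qh = "\<lambda>p p'. of_bool (map fst p = map fst p') * ?Q (map snd p) (map snd p')"
  have l: "length p = n" "length p' = n" using p by (auto simp: tup_def)
  have sn: "map snd p \<in> tup n {..<D}" "map snd p' \<in> tup n {..<D}"
    by (rule tup_map[OF p(1)], auto) (rule tup_map[OF p(2)], auto)
  have fs: "map fst p \<in> tup n {..<d}" "map fst p' \<in> tup n {..<d}"
    by (rule tup_map[OF p(1)], auto) (rule tup_map[OF p(2)], auto)
  have "(\<lambda>t. \<Sum>\<rho>\<in>?R. avg (Us t) (\<lambda>g. app n {..<d * r} g F (map snd p) (comb r (map fst p) \<rho>)
      * cnj (app n {..<d * r} g F (map snd p') (comb r (map fst p') \<rho>)))) \<longlonglongrightarrow> (\<Sum>\<rho>\<in>?R. ?Y \<rho>)"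
    by (intro tendsto_sum twirl_lim[OF _ Us n F] comb_tup fs) auto
  moreover have "(\<Sum>\<rho>\<in>?R. ?Y \<rho>) = mm ?T ?Qh (kop n {..<r}) p p'"
  proof -
    have "(\<Sum>\<rho>\<in>?R. ?Y \<rho>) = (\<Sum>\<rho>\<in>?R. (\<Sum>s\<in>perms n. of_bool (\<rho> = pl s \<rho>) * ?Qh p (pl s p')) / fact n)"
    proof (rule sum.cong[OF refl])
      fix \<rho> assume \<rho>: "\<rho> \<in> ?R"
      have "?Y \<rho> = (\<Sum>s\<in>perms n. of_bool (comb r (map fst p) \<rho> = pl s (comb r (map fst p') \<rho>)) * ?Q (map snd p) (pl s (map snd p'))) / fact n"
        by (rule twirl_eq[OF _ _ Us n F Z sn comb_tup[OF fs(1) \<rho>] comb_tup[OF fs(2) \<rho>]]) auto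
      also have "(\<Sum>s\<in>perms n. of_bool (comb r (map fst p) \<rho> = pl s (comb r (map fst p') \<rho>)) * ?Q (map snd p) (pl s (map snd p')))
          = (\<Sum>s\<in>perms n. of_bool (\<rho> = pl s \<rho>) * ?Qh p (pl s p'))"
      proof (rule sum.cong[OF refl])
        fix s assume s: "s \<in> perms n"
        have iff: "comb r (map fst p) \<rho> = pl s (comb r (map fst p') \<rho>) \<longleftrightarrow> map fst p = pl s (map fst p') \<and> \<rho> = pl s \<rho>"
          using comb_eq_iff[OF fs(1) \<rho> pl_tup[OF s fs(2)] pl_tup[OF s \<rho>]] pl_comb[OF s, of "map fst p'" \<rho> r] l length_tup[OF \<rho>]
          by simp
        show "of_bool (comb r (map fst p) \<rho> = pl s (comb r (map fst p') \<rho>)) * ?Q (map snd p) (pl s (map snd p'))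
          = of_bool (\<rho> = pl s \<rho>) * ?Qh p (pl s p')"
          by (simp only: iff of_bool_conj pl_map[OF s l(2)] mult_ac)
      qed
      finally show "?Y \<rho> = (\<Sum>s\<in>perms n. of_bool (\<rho> = pl s \<rho>) * ?Qh p (pl s p')) / fact n" .
    qed
    also have "\<dots> = (\<Sum>s\<in>perms n. \<Sum>\<rho>\<in>?R. of_bool (\<rho> = pl s \<rho>) * ?Qh p (pl s p')) / fact n"
      unfolding sum_divide_distrib[symmetric] by (rule arg_cong[where f = "\<lambda>x. x / fact n"], rule sum.swap)
    also have "\<dots> = (\<Sum>s\<in>perms n. fixc n {..<r} s * ?Qh p (pl s p')) / fact n"
      unfolding fixc_def sum_distrib_right ..
    also have "\<dots> = (\<Sum>x\<in>?T. ?Qh p x * kop n {..<r} x p')"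
      by (rule sum_kop[symmetric, OF _ p(2)]) simp
    finally show ?thesis by (simp only: mm_def)
  qed
  ultimately show ?thesis unfolding gram_def lift_def avg_sum by simp
qed

lemma avg_of_real: "avg Vs (\<lambda>V. of_real (f V)) = of_real ((\<Sum>V\<leftarrow>Vs. f V) / real (length Vs))"
proof -
  have "(\<Sum>V\<leftarrow>Vs. complex_of_real (f V)) = of_real (\<Sum>V\<leftarrow>Vs. f V)" by (induction Vs) auto
  then show ?thesis by (simp add: avg_def)
qed

lemma avg_nth: "avg Vs f = (\<Sum>i<length Vs. f (Vs ! i)) / of_nat (length Vs)"
  by (simp add: avg_def sum_list_sum_nth atLeast0LessThan)

lemma Re_avg_ge:
  assumes "Vs \<noteq> []" "\<And>V. V \<in> set Vs \<Longrightarrow> f V \<ge> C"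
  shows "Re (avg Vs (\<lambda>V. of_real (f V))) \<ge> C"
proof -
  have "(\<Sum>V\<leftarrow>Vs. f V) \<ge> real (length Vs) * C" using assms(2)
  proof (induction Vs)
    case (Cons V Vs)
    then have "f V \<ge> C" "(\<Sum>V\<leftarrow>Vs. f V) \<ge> real (length Vs) * C" by auto
    then show ?case by (simp add: algebra_simps)
  qed simp
  then show ?thesis unfolding avg_of_real using assms(1) by (simp add: field_simps)
qed

text \<open>Finitely many instances of \<open>haar_moment\<close>, weighted by the coefficients of
  \<open>p\<close>; the threshold remains uniform in \<open>\<psi>\<close>.\<close>

lemma haar_poly_moment:
  assumes D: "D \<ge> 1" and Us: "haar_seq {..<D} N Us" and p: "L + degree p \<le> N" and eta: "\<eta> > 0"
  shows "\<exists>t0. \<forall>t\<ge>t0. \<forall>\<psi>. (\<Sum>r<D. (cmod (\<psi> r))\<^sup>2) = 1 \<longrightarrow>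
    cmod (avg (Us t) (\<lambda>V. of_real (((cmod (cinner {..<D} (\<lambda>r. V r 0) \<psi>))\<^sup>2) ^ L * poly p ((cmod (cinner {..<D} (\<lambda>r. V r 0) \<psi>))\<^sup>2)))
      - of_real (ell D L p)) \<le> \<eta>"
proof -
  define B where "B = (\<Sum>i\<le>degree p. \<bar>coeff p i\<bar>) + 1"
  have B: "B > 0" unfolding B_def by (intro add_nonneg_pos sum_nonneg) auto
  define M where "M = (\<lambda>t \<psi> m. avg (Us t) (\<lambda>V. of_real (cmod (cinner {..<D} (\<lambda>r. V r 0) \<psi>) ^ (2 * m))))"
  have "\<exists>t0. \<forall>t\<ge>t0. \<forall>\<psi>. (\<Sum>r<D. (cmod (\<psi> r))\<^sup>2) = 1 \<longrightarrow> cmod (M t \<psi> (L + i) - of_real (sph D (L + i))) \<le> \<eta> / B"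
    if "i \<le> degree p" for i
  proof -
    have "of_real (sph D (L + i)) = (fact (L + i) / pochhammer (of_nat (card {..<D})) (L + i) :: complex)"
      by (simp add: sph_def pochhammer_of_nat)
    then show ?thesis
      unfolding M_def using haar_moment[OF finite_lessThan Us, of "L + i" 0 "\<eta> / B"] that p D eta B by simp
  qed
  then obtain T where T: "\<And>i t \<psi>. i \<le> degree p \<Longrightarrow> t \<ge> T i \<Longrightarrow> (\<Sum>r<D. (cmod (\<psi> r))\<^sup>2) = 1
      \<Longrightarrow> cmod (M t \<psi> (L + i) - of_real (sph D (L + i))) \<le> \<eta> / B"
    by metis
  define t0 where "t0 = Max (T ` {..degree p})"
  show ?thesis
  proof (intro exI[of _ t0] allI impI)
    fix t and \<psi> :: "nat \<Rightarrow> complex"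
    assume t: "t0 \<le> t" and \<psi>: "(\<Sum>r<D. (cmod (\<psi> r))\<^sup>2) = 1"
    have Tt: "T i \<le> t" if "i \<le> degree p" for i
      using Max_ge[of "T ` {..degree p}" "T i"] that t unfolding t0_def by simp
    let ?h = "\<lambda>V. (cmod (cinner {..<D} (\<lambda>r. V r 0) \<psi>))\<^sup>2"
    have "avg (Us t) (\<lambda>V. of_real (?h V ^ L * poly p (?h V)))
        = avg (Us t) (\<lambda>V. \<Sum>i\<le>degree p. of_real (coeff p i) * of_real (cmod (cinner {..<D} (\<lambda>r. V r 0) \<psi>) ^ (2 * (L + i))))"
    proof (rule avg_cong)
      fix V
      have "?h V ^ L * poly p (?h V) = (\<Sum>i\<le>degree p. coeff p i * cmod (cinner {..<D} (\<lambda>r. V r 0) \<psi>) ^ (2 * (L + i)))"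
        unfolding poly_altdef sum_distrib_left
      proof (intro sum.cong refl)
        fix i
        have "cmod (cinner {..<D} (\<lambda>r. V r 0) \<psi>) ^ (2 * (L + i)) = ?h V ^ L * ?h V ^ i"
          by (simp only: power_mult power_add)
        then show "?h V ^ L * (coeff p i * ?h V ^ i) = coeff p i * cmod (cinner {..<D} (\<lambda>r. V r 0) \<psi>) ^ (2 * (L + i))"
          by (simp only: mult_ac)
      qed
      then show "of_real (?h V ^ L * poly p (?h V)) = (\<Sum>i\<le>degree p. of_real (coeff p i) *
          complex_of_real (cmod (cinner {..<D} (\<lambda>r. V r 0) \<psi>) ^ (2 * (L + i))))"
        by (simp only: of_real_sum of_real_mult)
    qed
    also have "\<dots> = (\<Sum>i\<le>degree p. of_real (coeff p i) * M t \<psi> (L + i))"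
      unfolding avg_sum avg_cmult M_def ..
    finally have "avg (Us t) (\<lambda>V. of_real (?h V ^ L * poly p (?h V))) - of_real (ell D L p)
        = (\<Sum>i\<le>degree p. of_real (coeff p i) * (M t \<psi> (L + i) - of_real (sph D (L + i))))"
      by (simp add: ell_def sum_subtractf right_diff_distrib)
    also have "cmod \<dots> \<le> (\<Sum>i\<le>degree p. \<bar>coeff p i\<bar> * (\<eta> / B))"
    proof (rule sum_norm_le)
      fix i assume "i \<in> {..degree p}"
      then have "cmod (M t \<psi> (L + i) - of_real (sph D (L + i))) \<le> \<eta> / B" using T[OF _ Tt \<psi>] by simp
      then show "cmod (of_real (coeff p i) * (M t \<psi> (L + i) - of_real (sph D (L + i)))) \<le> \<bar>coeff p i\<bar> * (\<eta> / B)"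
        unfolding norm_mult norm_of_real by (intro mult_left_mono) auto
    qed
    also have "\<dots> = (\<Sum>i\<le>degree p. \<bar>coeff p i\<bar>) * \<eta> / B"
      unfolding sum_distrib_right sum_divide_distrib by simp
    also have "\<dots> \<le> B * \<eta> / B" using eta B by (intro divide_right_mono mult_right_mono) (auto simp: B_def)
    also have "\<dots> = \<eta>" using B by simp
    finally show "cmod (avg (Us t) (\<lambda>V. of_real (?h V ^ L * poly p (?h V))) - of_real (ell D L p)) \<le> \<eta>" .
  qed
qed

lemma hermitian_on_diff: "hermitian_on I A \<Longrightarrow> hermitian_on I B \<Longrightarrow> hermitian_on I (\<lambda>i j. A i j - B i j)"
  by (simp add: hermitian_on_def meq_def adj_def)

text \<open>A matrix with entries at most \<open>\<delta>\<close> has operator norm at most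
  \<open>\<delta> * card I\<close>, by Cauchy-Schwarz.\<close>

lemma psd_on_idm_add:
  assumes I: "finite I" and E: "hermitian_on I E" and le: "\<And>i j. i \<in> I \<Longrightarrow> j \<in> I \<Longrightarrow> cmod (E i j) \<le> \<delta>"
    and \<delta>: "\<delta> \<ge> 0" "\<delta> * real (card I) \<le> \<eta>"
  shows "psd_on I (\<lambda>i j. of_real \<eta> * idm i j + E i j)"
  unfolding psd_on_def
proof
  fix v
  let ?S = "\<Sum>i\<in>I. (cmod (v i))\<^sup>2" and ?f = "\<Sum>i\<in>I. \<Sum>j\<in>I. cnj (v i) * E i j * v j"
  have "(\<Sum>i\<in>I. \<Sum>j\<in>I. cnj (v i) * (of_real \<eta> * idm i j + E i j) * v j)
      = (\<Sum>i\<in>I. \<Sum>j\<in>I. cnj (v i) * (of_real \<eta> * idm i j) * v j) + ?f"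
    unfolding sum.distrib[symmetric] by (intro sum.cong refl) (simp only: distrib_left distrib_right)
  also have "(\<Sum>i\<in>I. \<Sum>j\<in>I. cnj (v i) * (of_real \<eta> * idm i j) * v j) = of_real (\<eta> * ?S)"
  proof -
    have "(\<Sum>j\<in>I. cnj (v i) * (of_real \<eta> * idm i j) * v j) = of_real (\<eta> * (cmod (v i))\<^sup>2)" if "i \<in> I" for i
    proof -
      have "(\<Sum>j\<in>I. cnj (v i) * (of_real \<eta> * idm i j) * v j) = (\<Sum>j\<in>I. if i = j then of_real \<eta> * (v i * cnj (v i)) else 0)"
        by (intro sum.cong refl) (auto simp: idm_def)
      then show ?thesis using I that by (simp add: complex_norm_square[symmetric])
    qed
    then show ?thesis by (simp add: sum_distrib_left)
  qed
  finally have e: "(\<Sum>i\<in>I. \<Sum>j\<in>I. cnj (v i) * (of_real \<eta> * idm i j + E i j) * v j) = of_real (\<eta> * ?S) + ?f" .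
  have real: "cnj z = z \<Longrightarrow> Im z = 0" for z by (simp add: complex_eq_iff)
  have "cnj ?f = (\<Sum>i\<in>I. \<Sum>j\<in>I. cnj (v j) * cnj (E i j) * v i)"
    unfolding cnj_sum by (intro sum.cong refl) simp
  also have "\<dots> = (\<Sum>j\<in>I. \<Sum>i\<in>I. cnj (v j) * cnj (E i j) * v i)" by (rule sum.swap)
  also have "\<dots> = ?f"
    using E by (intro sum.cong refl) (simp add: hermitian_on_def meq_def adj_def)
  finally have "cnj ?f = ?f" .
  then have im: "Im ?f = 0" by (rule real)
  have "cmod ?f \<le> (\<Sum>i\<in>I. \<Sum>j\<in>I. cmod (v i) * \<delta> * cmod (v j))"
    by (intro sum_norm_le) (auto simp: norm_mult intro!: mult_right_mono mult_left_mono le)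
  also have "\<dots> = \<delta> * (\<Sum>i\<in>I. 1 * cmod (v i))\<^sup>2"
    unfolding power2_eq_square sum_product mult_1 unfolding sum_distrib_left
    by (intro sum.cong refl) (simp only: mult_ac)
  also have "\<dots> \<le> \<delta> * ((\<Sum>i\<in>I. 1\<^sup>2) * ?S)"
    by (intro mult_left_mono sum_cauchy_schwarz \<delta>)
  also have "\<dots> = (\<delta> * real (card I)) * ?S" by simp
  also have "\<dots> \<le> \<eta> * ?S" by (intro mult_right_mono \<delta> sum_nonneg) auto
  finally have "- (\<eta> * ?S) \<le> Re ?f" using abs_Re_le_cmod[of ?f] by linarith
  then show "0 \<le> (\<Sum>i\<in>I. \<Sum>j\<in>I. cnj (v i) * (of_real \<eta> * idm i j + E i j) * v j)"
    unfolding e less_eq_complex_def plus_complex.simps im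
    by (simp only: Re_complex_of_real Im_complex_of_real zero_complex.simps) simp
qed

lemma unitary_column:
  assumes "unitary_on R V" "c \<in> R"
  shows "(\<Sum>r\<in>R. (cmod (V r c))\<^sup>2) = 1"
proof -
  have "complex_of_real (\<Sum>r\<in>R. (cmod (V r c))\<^sup>2) = mm R (adj V) V c c"
    unfolding of_real_sum complex_norm_square mm_def adj_def by (simp add: mult.commute)
  also have "\<dots> = 1" using unitary_onD(2)[OF assms(1)] assms(2) by (simp add: meq_def idm_def)
  finally show ?thesis by (simp only: of_real_eq_1_iff)
qed

lemma zxz_avg: "zxz I Z (\<lambda>p p'. avg Vs (\<lambda>V. f V p p')) p p' = avg Vs (\<lambda>V. zxz I Z (f V) p p')"
  unfolding zxz_def mm_def avg_sum avg_cmult avg_multc ..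

lemma map_fst_snd_eq: "map fst p = map fst p' \<and> map snd p = map snd p' \<longleftrightarrow> p = p'"
  by (metis zip_map_fst_snd)

text \<open>The averaged probability from \<open>born_limit\<close> is evaluated at the identity.
  There the environment vectors are orthonormal, so it is the trace; it also is the expectation of
  \<open>x^L * (q x)^2\<close> over a random unit vector, which is \<open>ell\<close>.\<close>

lemma trace_zxz_gram:
  fixes q :: "real poly"
  assumes D: "D > 0" and Us: "haar_seq {..<D} N Us" and n: "n \<le> N" and N: "L + degree (q * q) \<le> N"
    and F: "symm_on n {..<D} {..<D} F"
    and amp: "\<And>U. unitary_on {..<D} U \<Longrightarrow> (cmod (\<Sum>a\<in>tup n {..<D}. \<Sum>b\<in>tup n {..<D}. cnj (F a b) * tpow U b a))\<^sup>2
        = ((cmod (U 0 0))\<^sup>2) ^ L * (poly q ((cmod (U 0 0))\<^sup>2))\<^sup>2"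
    and Z: "is_inv_root (tup n {..<D}) (kop n {..<D}) Z"
  shows "(\<Sum>a\<in>tup n {..<D}. zxz (tup n {..<D}) Z (gram n {..<D} F) a a) = of_real (ell D L (q * q))"
proof -
  let ?T = "tup n {..<D}" and ?Q = "zxz (tup n {..<D}) Z (gram n {..<D} F)"
  define I :: "nat \<Rightarrow> nat \<Rightarrow> complex" where "I = idm"
  have I: "unitary_on {..<D} I" unfolding I_def by (rule unitary_on_idm) simp
  let ?h = "\<lambda>V. (cmod (cinner {..<D} (\<lambda>r. V r 0) (\<lambda>r. I r 0)))\<^sup>2"
  let ?s = "\<lambda>t. avg (Us t) (\<lambda>V. of_real (?h V ^ L * poly (q * q) (?h V)))"
  have U: "\<And>t V. V \<in> set (Us t) \<Longrightarrow> unitary_on {..<D} V"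
    using Us by (auto simp: haar_seq_def unitaries_def)
  have val: "(cmod (\<Sum>a\<in>?T. \<Sum>b\<in>?T. cnj (app n {..<D} V F a b) * tpow I b a))\<^sup>2 = ?h V ^ L * poly (q * q) (?h V)"
    if V: "unitary_on {..<D} V" for V
  proof -
    have "(\<Sum>a\<in>?T. \<Sum>b\<in>?T. cnj (app n {..<D} V F a b) * tpow I b a)
        = (\<Sum>a\<in>?T. \<Sum>c\<in>?T. cnj (F a c) * app n {..<D} (adj V) (\<lambda>a b. tpow I b a) a c)"
      by (rule app_pairing)
    also have "\<dots> = (\<Sum>a\<in>?T. \<Sum>c\<in>?T. cnj (F a c) * tpow (mm {..<D} (adj V) I) c a)"
      by (rule sum.cong[OF refl], rule sum.cong[OF refl]) (simp only: app_tpow)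
    finally have "(cmod (\<Sum>a\<in>?T. \<Sum>b\<in>?T. cnj (app n {..<D} V F a b) * tpow I b a))\<^sup>2
        = ((cmod (mm {..<D} (adj V) I 0 0))\<^sup>2) ^ L * (poly q ((cmod (mm {..<D} (adj V) I 0 0))\<^sup>2))\<^sup>2"
      using amp[OF unitary_on_mm[OF finite_lessThan unitary_on_adj[OF V] I]] by simp
    also have "mm {..<D} (adj V) I 0 0 = cinner {..<D} (\<lambda>r. V r 0) (\<lambda>r. I r 0)"
      by (simp add: mm_def adj_def cinner_def)
    finally show ?thesis by (simp add: power2_eq_square)
  qed
  have "(\<lambda>t. avg (Us t) (\<lambda>V. of_real ((cmod (\<Sum>a\<in>?T. \<Sum>b\<in>?T. cnj (app n {..<D} V F a b) * tpow I b a))\<^sup>2)))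
    \<longlonglongrightarrow> (\<Sum>a'\<in>?T. \<Sum>a\<in>?T. ?Q a' a * (\<Sum>b\<in>?T. tpow I b a * cnj (tpow I b a')))"
    by (rule born_limit[OF finite_lessThan finite_lessThan Us n F Z symm_on_tpow])
  moreover have "avg (Us t) (\<lambda>V. of_real ((cmod (\<Sum>a\<in>?T. \<Sum>b\<in>?T. cnj (app n {..<D} V F a b) * tpow I b a))\<^sup>2)) = ?s t" for t
    by (rule avg_cong) (simp only: val[OF U])
  ultimately have 1: "?s \<longlonglongrightarrow> (\<Sum>a'\<in>?T. \<Sum>a\<in>?T. ?Q a' a * (\<Sum>b\<in>?T. tpow I b a * cnj (tpow I b a')))" by simp
  have 2: "?s \<longlonglongrightarrow> of_real (ell D L (q * q))"
  proof (rule LIMSEQ_I)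
    fix e :: real assume e: "0 < e"
    have D1: "D \<ge> 1" using D by simp
    obtain t0 where "\<forall>t\<ge>t0. cmod (?s t - of_real (ell D L (q * q))) \<le> e / 2"
      using haar_poly_moment[OF D1 Us N, of "e / 2"] e unitary_column[OF I, of 0] D by fastforce
    then show "\<exists>no. \<forall>t\<ge>no. cmod (?s t - of_real (ell D L (q * q))) < e"
      using e by (intro exI[of _ t0]) force
  qed
  have "(\<Sum>a'\<in>?T. \<Sum>a\<in>?T. ?Q a' a * (\<Sum>b\<in>?T. tpow I b a * cnj (tpow I b a')))
      = (\<Sum>a'\<in>?T. \<Sum>a\<in>?T. if a' = a then ?Q a' a else 0)"
  proof (rule sum.cong[OF refl], rule sum.cong[OF refl])
    fix a' a assume a: "a' \<in> ?T" "a \<in> ?T"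
    have "(\<Sum>b\<in>?T. tpow I b a * cnj (tpow I b a')) = (\<Sum>b\<in>?T. if b = a then (if a' = a then 1 else 0) else 0)"
    proof (rule sum.cong[OF refl])
      fix b assume b: "b \<in> ?T"
      have "tpow I b a = idm b a" "tpow I b a' = idm b a'"
        unfolding I_def by (rule tpow_idm; simp add: length_tup[OF b] length_tup[OF a(1)] length_tup[OF a(2)])+
      then show "tpow I b a * cnj (tpow I b a') = (if b = a then (if a' = a then 1 else 0) else 0)"
        by (auto simp: idm_def)
    qed
    then show "?Q a' a * (\<Sum>b\<in>?T. tpow I b a * cnj (tpow I b a')) = (if a' = a then ?Q a' a else 0)"
      using a by simp
  qed
  then show ?thesis using LIMSEQ_unique[OF 1 2] by simp
qed

text \<open>The tester in tuple indices: \<open>gs\<close> are the guessed unitaries,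
  \<open>W i\<close> the outcome operators and \<open>\<sigma>\<close> the input state. The bound is
  stated for any set \<open>G\<close> outside of which every guess has small overlap with the true
  column, whichever environment unitary \<open>V\<close> is chosen.\<close>

lemma tester_exists:
  fixes q :: "real poly" and F :: "nat list \<Rightarrow> nat list \<Rightarrow> complex"
  assumes d: "d > 0" and r: "r > 0" and eps: "\<epsilon> > 0"
    and F: "symm_on n {..<d * r} {..<d * r} F"
    and amp: "\<And>U. unitary_on {..<d * r} U \<Longrightarrow>
      (cmod (\<Sum>a\<in>tup n {..<d * r}. \<Sum>b\<in>tup n {..<d * r}. cnj (F a b) * tpow U b a))\<^sup>2
        = ((cmod (U 0 0))\<^sup>2) ^ L * (poly q ((cmod (U 0 0))\<^sup>2))\<^sup>2"
    and nrm: "ell (d * r) L (q * q) = 1"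
    and err: "4 / \<epsilon>\<^sup>2 * ell (d * r) L ([:1, -1:] * (q * q)) \<le> 1 / 4"
  obtains gs :: "(nat \<Rightarrow> nat \<Rightarrow> complex) list" and W :: "nat \<Rightarrow> (nat \<times> nat) list \<Rightarrow> (nat \<times> nat) list \<Rightarrow> complex"
    and \<sigma> :: "nat list \<Rightarrow> nat list \<Rightarrow> complex"
  where "gs \<noteq> []" "\<And>i. i < length gs \<Longrightarrow> unitary_on {..<d * r} (gs ! i)"
    "psd_on (tup n {..<d * r}) \<sigma>" "(\<Sum>a\<in>tup n {..<d * r}. \<sigma> a a) = 1"
    "\<And>i. i < length gs \<Longrightarrow> psd_on (tup n ({..<d} \<times> {..<d * r})) (W i)"
    "psd_on (tup n ({..<d} \<times> {..<d * r})) (\<lambda>p p'. of_bool (map fst p = map fst p') * \<sigma> (map snd p) (map snd p')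
       - (\<Sum>i<length gs. W i p p'))"
    "\<And>U G. unitary_on {..<d * r} U \<Longrightarrow> G \<subseteq> {..<length gs} \<Longrightarrow>
       (\<And>i V. i < length gs \<Longrightarrow> i \<notin> G \<Longrightarrow> unitary_on {..<r} V \<Longrightarrow>
          \<epsilon>\<^sup>2 / 4 \<le> 1 - (cmod (cinner {..<d * r} (\<lambda>c. (gs ! i) c 0) (\<lambda>c. mm {..<d * r} (blk r (adj V)) U c 0)))\<^sup>2) \<Longrightarrow>
       2 / 3 \<le> Re (\<Sum>i\<in>G. \<Sum>p'\<in>tup n ({..<d} \<times> {..<d * r}). \<Sum>p\<in>tup n ({..<d} \<times> {..<d * r}).
          W i p' p * (\<Sum>\<rho>\<in>tup n {..<r}. tpow (env r U) \<rho> p * cnj (tpow (env r U) \<rho> p')))"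
proof -
  let ?D = "{..<d * r}" and ?P = "{..<d} \<times> {..<d * r}" and ?R = "{..<r}"
  let ?T = "tup n ({..<d} \<times> {..<d * r})" and ?TD = "tup n {..<d * r}"
  have D: "d * r > 0" "d * r \<ge> 1" using d r by (simp_all add: Suc_le_eq)
  \<comment> \<open>Markov's inequality as a polynomial: the factor
    \<open>1 - 4 / \<epsilon>^2 * (1 - x)\<close> is at most 1, and at most 0 for far
    guesses.\<close>
  define ps where "ps = q * q - Polynomial.smult (4 / \<epsilon>\<^sup>2) ([:1, -1:] * (q * q))"
  define N where "N = max n (L + degree (q * q) + degree ps)"
  have N: "n \<le> N" "L + degree (q * q) \<le> N" "L + degree ps \<le> N" by (auto simp: N_def)
  obtain Us where Us: "haar_seq ?D N Us" using haar_seq_exists[of ?D N] by auto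
  \<comment> \<open>\<open>Us\<close> supplies the outcomes of the tester. \<open>Vs\<close> occurs
    in the analysis only, where it averages over the environment.\<close>
  obtain Vs where Vs: "haar_seq ?R n Vs" using haar_seq_exists[of ?R n] by auto
  have uU: "\<And>t V. V \<in> set (Us t) \<Longrightarrow> unitary_on ?D V" "\<And>t. Us t \<noteq> []"
    using Us by (auto simp: haar_seq_def unitaries_def)
  have uV: "\<And>t V. V \<in> set (Vs t) \<Longrightarrow> unitary_on ?R V" "\<And>t. Vs t \<noteq> []"
    using Vs by (auto simp: haar_seq_def unitaries_def)
  \<comment> \<open>Two inverse roots: \<open>ZD\<close> for the full output space of
    \<open>U\<close> yields the input state \<open>Q\<close>, \<open>Z\<close> for the environment
    yields the outcome operators.\<close>
  obtain ZD where ZD: "is_inv_root ?TD (kop n ?D) ZD" using kop_inv_root_exists[of ?D ?D n] by auto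
  obtain Z where Z: "is_inv_root ?T (kop n ?R) Z" using kop_inv_root_exists[of ?P ?R n] by auto
  have hZ: "hermitian_on ?T Z" "hermitian_on ?TD ZD" using Z ZD by (auto simp: is_inv_root_def)
  have finT: "finite ?T" "finite ?TD" by auto
  define Q where "Q = zxz ?TD ZD (gram n ?D F)"
  have Q: "psd_on ?TD Q" unfolding Q_def by (intro psd_on_zxz hZ psd_on_gram finT)
  have trQ: "(\<Sum>a\<in>?TD. Q a a) = 1"
    unfolding Q_def using trace_zxz_gram[OF D(1) Us N(1,2) F amp ZD] nrm by simp
  define Qh where "Qh = (\<lambda>(p :: (nat \<times> nat) list) p'. of_bool (map fst p = map fst p') * Q (map snd p) (map snd p'))"
  have sndT: "map snd p \<in> ?TD" "map fst p \<in> tup n {..<d}" if "p \<in> ?T" for p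
    by (rule tup_map[OF that], auto)+
  have Qh: "psd_on ?T Qh"
  proof (rule psd_on_cong)
    show "psd_on ?T (\<lambda>p p'. \<Sum>b\<in>tup n {..<d}. of_bool (map fst p = b) * Q (map snd p) (map snd p') * cnj (of_bool (map fst p' = b)))"
      by (intro psd_on_sum psd_on_pullback[OF finT(1) finT(2) _ Q] sndT)
    show "meq ?T ?T (\<lambda>p p'. \<Sum>b\<in>tup n {..<d}. of_bool (map fst p = b) * Q (map snd p) (map snd p') * cnj (of_bool (map fst p' = b))) Qh"
    proof (rule meqI)
      fix p p' assume p: "p \<in> ?T" "p' \<in> ?T"
      have "(\<Sum>b\<in>tup n {..<d}. of_bool (map fst p = b) * Q (map snd p) (map snd p') * cnj (of_bool (map fst p' = b)))
         = (\<Sum>b\<in>tup n {..<d}. if map fst p = b then Qh p p' else 0)"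
        by (intro sum.cong refl) (auto simp: Qh_def)
      then show "(\<Sum>b\<in>tup n {..<d}. of_bool (map fst p = b) * Q (map snd p) (map snd p') * cnj (of_bool (map fst p' = b))) = Qh p p'"
        using sndT(2)[OF p(1)] by simp
    qed
  qed
  have comm: "commute_on ?T (kop n ?R) Qh"
  proof (rule commute_on_kop)
    fix s p p' assume s: "s \<in> perms n" and p: "p \<in> ?T" "p' \<in> ?T"
    have l: "length p = n" "length p' = n" using p by (auto simp: tup_def)
    have "Q (pl s (map snd p)) (pl s (map snd p')) = Q (map snd p) (map snd p')"
      unfolding Q_def
      by (rule zxz_perm[OF finite_lessThan ZD s sndT(1)[OF p(1)] sndT(1)[OF p(2)]]) (rule gram_symm[OF F s])
    moreover have "pl s (map fst p) = pl s (map fst p') \<longleftrightarrow> map fst p = map fst p'"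
      using pl_inv2[OF s sndT(2)[OF p(1)]] pl_inv2[OF s sndT(2)[OF p(2)]] by metis
    ultimately show "Qh (pl s p) (pl s p') = Qh p p'" by (simp only: Qh_def pl_map[OF s l(1)] pl_map[OF s l(2)])
  qed simp
  define B where "B = zxz ?T Z (mm ?T Qh (kop n ?R))"
  \<comment> \<open>The last clause of \<open>is_inv_root\<close>: the limit \<open>B\<close> of the
    averaged outcome operators is at most \<open>Qh\<close>, the input state tensored with the
    identity on the outputs.\<close>
  have QB: "psd_on ?T (\<lambda>p p'. Qh p p' - B p p')"
    unfolding B_def zxz_def using Z Qh comm by (simp add: is_inv_root_def)
  define Ng where "Ng = (\<lambda>g. gram n ?R (lift r (app n ?D g F)))"
  define WS where "WS = (\<lambda>t p p'. avg (Us t) (\<lambda>g. zxz ?T Z (Ng g) p p'))"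
  have lim: "(\<lambda>t. WS t p p') \<longlonglongrightarrow> B p p'" if p: "p \<in> ?T" "p' \<in> ?T" for p p'
    unfolding WS_def zxz_avg[symmetric] unfolding B_def zxz_def[of ?T Z] mm_def[of ?T Z] mm_def[of ?T _ Z] Ng_def Qh_def Q_def
    by (intro tendsto_sum tendsto_mult tendsto_const avg_gram_lift_limit[OF r Us N(1) F ZD]) (use p in auto)
  \<comment> \<open>Chosen so that \<open>\<eta>\<close> times the identity has trace
    \<open>1 / 48\<close> on the inputs; normalising then costs the factor
    \<open>48 / 49\<close>.\<close>
  define \<eta> where "\<eta> = 1 / (48 * real (card ?TD))"
  have cTD: "card ?TD > 0" using D by (simp add: card_tup)
  have eta: "\<eta> > 0" using cTD by (simp add: \<eta>_def)
  define \<delta> where "\<delta> = \<eta> / (real (card ?T) + 1)"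
  have delta: "\<delta> > 0" "\<delta> * real (card ?T) \<le> \<eta>" using eta by (auto simp: \<delta>_def field_simps)
  have "\<forall>\<^sub>F t in sequentially. \<forall>p\<in>?T. \<forall>p'\<in>?T. cmod (WS t p p' - B p p') < \<delta>"
  proof (intro eventually_ball_finite finT ballI)
    fix p p' assume "p \<in> ?T" "p' \<in> ?T"
    then show "\<forall>\<^sub>F t in sequentially. cmod (WS t p p' - B p p') < \<delta>"
      using tendstoD[OF lim delta(1)] by (simp add: dist_norm)
  qed
  then obtain t1 where t1: "\<And>t p p'. t \<ge> t1 \<Longrightarrow> p \<in> ?T \<Longrightarrow> p' \<in> ?T \<Longrightarrow> cmod (WS t p p' - B p p') < \<delta>"
    unfolding eventually_sequentially by blast
  let ?h = "\<lambda>V \<psi>. (cmod (cinner ?D (\<lambda>r. V r 0) \<psi>))\<^sup>2"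
  obtain t2 where t2: "\<And>t \<psi>. t \<ge> t2 \<Longrightarrow> (\<Sum>r\<in>?D. (cmod (\<psi> r))\<^sup>2) = 1 \<Longrightarrow>
      cmod (avg (Us t) (\<lambda>V. of_real (?h V \<psi> ^ L * poly ps (?h V \<psi>))) - of_real (ell (d * r) L ps)) \<le> 1 / 24"
    using haar_poly_moment[OF D(2) Us N(3), of "1 / 24"] by auto
  define t where "t = max t1 t2"
  define gs where "gs = Us t"
  define m where "m = length gs"
  have m: "m > 0" using uU(2) by (simp add: m_def gs_def)
  define c where "c = 1 / (1 + \<eta> * real (card ?TD))"
  have "\<eta> * real (card ?TD) = 1 / 48"
  proof -
    have "1 / (48 * x) * x = 1 / 48" if "x > 0" for x :: real using that by simp
    then show ?thesis using cTD unfolding \<eta>_def by (simp only: of_nat_0_less_iff)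
  qed
  then have c: "c = 48 / 49" unfolding c_def by (simp only:) simp
  define W where "W = (\<lambda>i p p'. of_real (c / m) * zxz ?T Z (Ng (gs ! i)) p p')"
  \<comment> \<open>The added multiple of the identity provides the slack for replacing the limit
    \<open>B\<close> by the finite average \<open>WS t\<close>.\<close>
  define \<sigma> where "\<sigma> = (\<lambda>a a'. of_real c * (Q a a' + of_real \<eta> * idm a a'))"
  have gsu: "unitary_on ?D (gs ! i)" if "i < length gs" for i
    using uU(1)[of "gs ! i" t] that by (simp add: gs_def)
  have psdN: "psd_on ?T (zxz ?T Z (Ng g))" for g
    unfolding Ng_def by (intro psd_on_zxz hZ psd_on_gram finT)
  have psdW: "psd_on ?T (W i)" for i
    unfolding W_def using psdN m c by (intro psd_on_scale) auto
  have sumW: "(\<Sum>i<m. W i p p') = of_real c * WS t p p'" for p p'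
    unfolding WS_def avg_nth gs_def[symmetric] m_def[symmetric] W_def sum_distrib_left[symmetric] by simp
  have psdWS: "psd_on ?T (WS t)"
  proof (rule psd_on_cong)
    show "psd_on ?T (\<lambda>p p'. of_real (1 / c) * (\<Sum>i<m. W i p p'))"
      by (rule psd_on_scale) (use c psdW in \<open>auto intro: psd_on_sum\<close>)
    show "meq ?T ?T (\<lambda>p p'. of_real (1 / c) * (\<Sum>i<m. W i p p')) (WS t)"
      by (rule meqI) (simp add: sumW c)
  qed
  have psd\<sigma>: "psd_on ?TD \<sigma>"
    unfolding \<sigma>_def using c eta by (intro psd_on_scale psd_on_add psd_on_idm finT Q) auto
  have tr\<sigma>: "(\<Sum>a\<in>?TD. \<sigma> a a) = 1"
  proof -
    have "(\<Sum>a\<in>?TD. \<sigma> a a) = of_real c * ((\<Sum>a\<in>?TD. Q a a) + of_real (\<eta> * real (card ?TD)))"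
      unfolding \<sigma>_def sum_distrib_left[symmetric] sum.distrib by (simp add: idm_def)
    also have "\<dots> = of_real (c * (1 + \<eta> * real (card ?TD)))" unfolding trQ by simp
    also have "c * (1 + \<eta> * real (card ?TD)) = 1"
      using eta unfolding c_def by (simp add: add_pos_nonneg order_less_imp_not_eq2)
    finally show ?thesis by simp
  qed
  \<comment> \<open>The defect is the sum of \<open>Qh - B\<close>, positive by \<open>QB\<close>,
    and \<open>B - WS t\<close> plus \<open>\<eta>\<close> times the identity, positive since the
    approximation error is small. The identity on the inputs in \<open>\<sigma>\<close>, extended by
    equality of the outputs, is the identity on pairs.\<close>
  have junk: "psd_on ?T (\<lambda>p p'. of_bool (map fst p = map fst p') * \<sigma> (map snd p) (map snd p') - (\<Sum>i<length gs. W i p p'))"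
  proof (rule psd_on_cong)
    have "hermitian_on ?T B"
    proof -
      have "hermitian_on ?T (\<lambda>p p'. Qh p p' - (Qh p p' - B p p'))"
        by (intro hermitian_on_diff psd_on_hermitian finT Qh QB)
      then show ?thesis by simp
    qed
    then have "hermitian_on ?T (\<lambda>p p'. B p p' - WS t p p')"
      by (rule hermitian_on_diff) (rule psd_on_hermitian[OF finT(1) psdWS])
    then have "psd_on ?T (\<lambda>p p'. of_real \<eta> * idm p p' + (B p p' - WS t p p'))"
    proof (rule psd_on_idm_add[OF finT(1)])
      fix p p' assume "p \<in> ?T" "p' \<in> ?T"
      then show "cmod (B p p' - WS t p p') \<le> \<delta>"
        using t1[of t p p'] by (simp add: t_def norm_minus_commute less_imp_le)
    qed (use delta in auto)
    then show "psd_on ?T (\<lambda>p p'. of_real c * ((Qh p p' - B p p') + (of_real \<eta> * idm p p' + (B p p' - WS t p p'))))"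
      by (rule psd_on_scale[rotated, OF psd_on_add[OF QB]]) (simp add: c)
    show "meq ?T ?T (\<lambda>p p'. of_real c * ((Qh p p' - B p p') + (of_real \<eta> * idm p p' + (B p p' - WS t p p'))))
       (\<lambda>p p'. of_bool (map fst p = map fst p') * \<sigma> (map snd p) (map snd p') - (\<Sum>i<length gs. W i p p'))"
    proof (rule meqI)
      fix p p' :: "(nat \<times> nat) list"
      have i: "of_bool (map fst p = map fst p') * (idm (map snd p) (map snd p') :: complex) = idm p p'"
        using map_fst_snd_eq[of p p'] by (auto simp: idm_def)
      have "x * (y * (z + e * w)) = y * (x * z + e * (x * w))" for x y z e w :: complex
        by (simp add: algebra_simps)
      then have "of_bool (map fst p = map fst p') * \<sigma> (map snd p) (map snd p') = of_real c * (Qh p p' + of_real \<eta> * idm p p')"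
        unfolding \<sigma>_def Qh_def i[symmetric] .
      then show "of_real c * ((Qh p p' - B p p') + (of_real \<eta> * idm p p' + (B p p' - WS t p p')))
        = of_bool (map fst p = map fst p') * \<sigma> (map snd p) (map snd p') - (\<Sum>i<length gs. W i p p')"
        unfolding m_def[symmetric] sumW by (simp add: algebra_simps)
    qed
  qed
  have born: "2 / 3 \<le> Re (\<Sum>i\<in>G. \<Sum>p'\<in>?T. \<Sum>p\<in>?T.
          W i p' p * (\<Sum>\<rho>\<in>tup n ?R. tpow (env r U) \<rho> p * cnj (tpow (env r U) \<rho> p')))"
    if U: "unitary_on ?D U" and G: "G \<subseteq> {..<length gs}"
      and bad: "\<And>i V. i < length gs \<Longrightarrow> i \<notin> G \<Longrightarrow> unitary_on {..<r} V \<Longrightarrow>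
          \<epsilon>\<^sup>2 / 4 \<le> 1 - (cmod (cinner ?D (\<lambda>c. (gs ! i) c 0) (\<lambda>c. mm ?D (blk r (adj V)) U c 0)))\<^sup>2" for U G
  proof -
    define X where "X = (\<lambda>i. \<Sum>p'\<in>?T. \<Sum>p\<in>?T. zxz ?T Z (Ng (gs ! i)) p' p *
        (\<Sum>\<rho>\<in>tup n ?R. tpow (env r U) \<rho> p * cnj (tpow (env r U) \<rho> p')))"
    define f where "f = (\<lambda>i V. (cmod (\<Sum>p\<in>?T. \<Sum>\<rho>\<in>tup n ?R. cnj (app n ?R V (lift r (app n ?D (gs ! i) F)) p \<rho>) * tpow (env r U) \<rho> p))\<^sup>2)"
    have fin: "finite G" using G finite_subset by blast
    \<comment> \<open>By \<open>born_limit\<close> the operators reproduce averages over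
      \<open>V\<close>, so a bound that holds for each single \<open>V\<close> suffices.\<close>
    have "(\<lambda>t. \<Sum>i\<in>G. avg (Vs t) (\<lambda>V. of_real (f i V))) \<longlonglongrightarrow> (\<Sum>i\<in>G. X i)"
      unfolding X_def f_def Ng_def
      by (intro tendsto_sum born_limit[OF _ _ Vs order_refl symm_on_lift[OF symm_on_app[OF F]] Z symm_on_tpow]) auto
    then have "(\<lambda>t. avg (Vs t) (\<lambda>V. of_real (\<Sum>i\<in>G. f i V))) \<longlonglongrightarrow> (\<Sum>i\<in>G. X i)"
      by (simp only: avg_sum of_real_sum)
    then have limX: "(\<lambda>t. Re (avg (Vs t) (\<lambda>V. of_real (\<Sum>i\<in>G. f i V)))) \<longlonglongrightarrow> Re (\<Sum>i\<in>G. X i)"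
      by (rule tendsto_Re)
    \<comment> \<open>\<open>17 / 24 = 3 / 4 - 1 / 24\<close>: the expectation of \<open>ps\<close>
      minus the error of the finite average.\<close>
    have "17 / 24 * real m \<le> (\<Sum>i\<in>G. f i V)" if V: "unitary_on ?R V" for V
    proof -
      define UV where "UV = mm ?D (blk r (adj V)) U"
      have uUV: "unitary_on ?D UV"
        unfolding UV_def by (intro unitary_on_mm unitary_on_blk r unitary_on_adj V U) simp
      define \<psi> where "\<psi> = (\<lambda>r. UV r 0)"
      have \<psi>1: "(\<Sum>r\<in>?D. (cmod (\<psi> r))\<^sup>2) = 1"
        unfolding \<psi>_def using D by (intro unitary_column[OF uUV]) simp
      define h where "h = (\<lambda>i. ?h (gs ! i) \<psi>)"
      have hmm: "h i = (cmod (mm ?D (adj (gs ! i)) UV 0 0))\<^sup>2" for i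
        by (simp add: h_def \<psi>_def mm_def adj_def cinner_def)
      have u: "unitary_on ?D (mm ?D (adj (gs ! i)) UV)" if "i < m" for i
        using that by (intro unitary_on_mm unitary_on_adj gsu uUV) (auto simp: m_def)
      have fh: "f i V = h i ^ L * poly (q * q) (h i)" if i: "i < m" for i
        unfolding f_def lift_pairing[OF r] UV_def[symmetric] amp[OF u[OF i]] hmm by (simp add: power2_eq_square)
      have h1: "h i \<le> 1" if "i < m" for i
        unfolding hmm using norm_unitary_entry_le[OF _ u[OF that], of 0 0] D by (simp add: power_le_one)
      \<comment> \<open>Pointwise, \<open>ps\<close> is dominated by the probability for guesses in
        \<open>G\<close> and is nonpositive for the others.\<close>
      have psle: "h i ^ L * poly ps (h i) \<le> (if i \<in> G then f i V else 0)" if i: "i < m" for i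
      proof -
        have e: "h i ^ L * poly ps (h i) = h i ^ L * poly (q * q) (h i) * (1 - 4 / \<epsilon>\<^sup>2 * (1 - h i))"
        proof -
          have P: "poly [:1, -1:] x = 1 - x" for x :: real by simp
          have A: "x * (y - c * ((1 - z) * y)) = x * y * (1 - c * (1 - z))" for x y z c :: real
            by (simp add: algebra_simps)
          show ?thesis unfolding ps_def poly_diff poly_smult poly_mult[of "[:1, -1:]"] P by (rule A)
        qed
        have nn: "0 \<le> h i ^ L * poly (q * q) (h i)" unfolding fh[OF i, symmetric] f_def by simp
        show ?thesis
        proof (cases "i \<in> G")
          case True
          have "h i ^ L * poly (q * q) (h i) * (1 - 4 / \<epsilon>\<^sup>2 * (1 - h i)) \<le> h i ^ L * poly (q * q) (h i) * 1"
            using h1[OF i] eps by (intro mult_left_mono nn) simp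
          then show ?thesis using True unfolding e fh[OF i] mult_1_right by (simp only: if_True)
        next
          case False
          have "\<epsilon>\<^sup>2 / 4 \<le> 1 - h i"
            using bad[of i V] i False V by (simp add: h_def \<psi>_def UV_def m_def)
          then have "1 \<le> 4 / \<epsilon>\<^sup>2 * (1 - h i)" using eps by (simp add: field_simps)
          then have "h i ^ L * poly (q * q) (h i) * (1 - 4 / \<epsilon>\<^sup>2 * (1 - h i)) \<le> 0"
            by (intro mult_nonneg_nonpos nn) simp
          then show ?thesis using False unfolding e by (simp only: if_False)
        qed
      qed
      have ellps: "ell (d * r) L ps \<ge> 3 / 4"
        unfolding ps_def ell_diff ell_smult nrm using err by linarith
      have "17 / 24 \<le> Re (avg gs (\<lambda>V. of_real (?h V \<psi> ^ L * poly ps (?h V \<psi>))))"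
      proof -
        have "cmod (avg gs (\<lambda>V. of_real (?h V \<psi> ^ L * poly ps (?h V \<psi>))) - of_real (ell (d * r) L ps)) \<le> 1 / 24"
          unfolding gs_def by (rule t2[OF _ \<psi>1]) (simp add: t_def)
        then have "\<bar>Re (avg gs (\<lambda>V. of_real (?h V \<psi> ^ L * poly ps (?h V \<psi>)))) - ell (d * r) L ps\<bar> \<le> 1 / 24"
          using abs_Re_le_cmod[of "avg gs (\<lambda>V. of_real (?h V \<psi> ^ L * poly ps (?h V \<psi>))) - of_real (ell (d * r) L ps)"] by simp
        then show ?thesis using ellps by linarith
      qed
      also have "avg gs (\<lambda>V. of_real (?h V \<psi> ^ L * poly ps (?h V \<psi>))) = of_real ((\<Sum>i<m. h i ^ L * poly ps (h i)) / m)"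
        unfolding avg_nth m_def[symmetric] h_def by simp
      finally have "17 / 24 * real m \<le> (\<Sum>i<m. h i ^ L * poly ps (h i))" using m by (simp add: field_simps)
      also have "\<dots> \<le> (\<Sum>i<m. if i \<in> G then f i V else 0)" using psle by (intro sum_mono) simp
      also have "\<dots> = (\<Sum>i\<in>G. f i V)"
        using G by (subst sum.inter_restrict[symmetric]) (auto simp: m_def Int_absorb1)
      finally show ?thesis .
    qed
    then have "17 / 24 * real m \<le> Re (avg (Vs t) (\<lambda>V. of_real (\<Sum>i\<in>G. f i V)))" for t
      using uV by (intro Re_avg_ge) auto
    then have Xm: "17 / 24 * real m \<le> Re (\<Sum>i\<in>G. X i)"
      using limX by (intro LIMSEQ_le_const) auto
    have R: "Re (of_real x * z) = x * Re z" for x z by simp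
    have "(\<Sum>i\<in>G. \<Sum>p'\<in>?T. \<Sum>p\<in>?T. W i p' p * (\<Sum>\<rho>\<in>tup n ?R. tpow (env r U) \<rho> p * cnj (tpow (env r U) \<rho> p')))
       = of_real (c / m) * (\<Sum>i\<in>G. X i)"
      unfolding X_def W_def by (simp only: sum_distrib_left mult.assoc)
    then have "Re (\<Sum>i\<in>G. \<Sum>p'\<in>?T. \<Sum>p\<in>?T. W i p' p * (\<Sum>\<rho>\<in>tup n ?R. tpow (env r U) \<rho> p * cnj (tpow (env r U) \<rho> p')))
       = (c / m) * Re (\<Sum>i\<in>G. X i)" by (simp only: R)
    moreover have "(c / m) * (17 / 24 * real m) \<le> (c / m) * Re (\<Sum>i\<in>G. X i)"
      using Xm c by (intro mult_left_mono) auto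
    \<comment> \<open>With \<open>c = 48 / 49\<close> the final value is \<open>34 / 49\<close>,
      just above \<open>2 / 3\<close>.\<close>
    moreover have "(c / m) * (17 / 24 * real m) = 34 / 49" using m c by simp
    ultimately show ?thesis by linarith
  qed
  show ?thesis
    by (rule that[of gs \<sigma> W]) (use m gsu psd\<sigma> tr\<sigma> psdW junk born in \<open>auto simp: m_def\<close>)
qed

section \<open>Parallel testers as sequential ones\<close>

text \<open>The digits of a basis index of \<open>n\<close> queries, latest query first, as pairs (output, input).\<close>

fun dec :: "nat \<Rightarrow> nat \<Rightarrow> nat \<Rightarrow> nat \<Rightarrow> (nat \<times> nat) list" where
  "dec d D 0 p = []"
| "dec d D (Suc n) p = (p div (d * D) ^ n div D, p div (d * D) ^ n mod D) # dec d D n (p mod (d * D) ^ n)"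

lemma dec_tup: "d > 0 \<Longrightarrow> D > 0 \<Longrightarrow> p < (d * D) ^ n \<Longrightarrow> dec d D n p \<in> tup n ({..<d} \<times> {..<D})"
proof (induction n arbitrary: p)
  case (Suc n)
  have "p div (d * D) ^ n < d * D" using Suc.prems by (intro less_mult_imp_div_less) simp
  then have "p div (d * D) ^ n div D < d" by (rule less_mult_imp_div_less)
  moreover have "dec d D n (p mod (d * D) ^ n) \<in> tup n ({..<d} \<times> {..<D})"
    using Suc by simp
  ultimately show ?case using Suc.prems by (auto simp: tup_Suc)
qed simp

lemma sum_dec:
  fixes f :: "(nat \<times> nat) list \<Rightarrow> 'a :: comm_monoid_add"
  assumes d: "d > 0" "D > 0"
  shows "(\<Sum>p<(d * D) ^ n. f (dec d D n p)) = (\<Sum>x\<in>tup n ({..<d} \<times> {..<D}). f x)"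
proof (induction n arbitrary: f)
  case (Suc n)
  let ?K = "(d * D) ^ n"
  have K: "?K > 0" using d by simp
  have pair: "(\<Sum>b<d. \<Sum>a<D. g b a) = (\<Sum>x\<in>{..<d} \<times> {..<D}. g (fst x) (snd x))" for g :: "nat \<Rightarrow> nat \<Rightarrow> 'a"
    by (simp add: sum.cartesian_product case_prod_unfold)
  have "(\<Sum>p<(d * D) ^ Suc n. f (dec d D (Suc n) p)) = (\<Sum>p<(d * D) * ?K. f (dec d D (Suc n) p))" by simp
  also have "\<dots> = (\<Sum>h<d * D. \<Sum>l<?K. f (dec d D (Suc n) (h * ?K + l)))" by (rule sum_pair_index)
  also have "\<dots> = (\<Sum>h<d * D. \<Sum>l<?K. f ((h div D, h mod D) # dec d D n l))"
    using K by (intro sum.cong refl) simp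
  also have "\<dots> = (\<Sum>h<d * D. \<Sum>x\<in>tup n ({..<d} \<times> {..<D}). f ((h div D, h mod D) # x))"
    by (rule sum.cong[OF refl], rule Suc.IH)
  also have "\<dots> = (\<Sum>b<d. \<Sum>a<D. \<Sum>x\<in>tup n ({..<d} \<times> {..<D}). f (((b * D + a) div D, (b * D + a) mod D) # x))"
    by (rule sum_pair_index)
  also have "\<dots> = (\<Sum>b<d. \<Sum>a<D. \<Sum>x\<in>tup n ({..<d} \<times> {..<D}). f ((b, a) # x))"
    by (intro sum.cong refl) simp
  also have "\<dots> = (\<Sum>y\<in>{..<d} \<times> {..<D}. \<Sum>x\<in>tup n ({..<d} \<times> {..<D}). f ((fst y, snd y) # x))"
    by (rule pair)
  finally show ?case by (simp add: sum_tup_Suc)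
qed simp

lemma tensor_power_carrier: "C \<in> carrier_mat k k \<Longrightarrow> tensor_power C n \<in> carrier_mat (k ^ n) (k ^ n)"
  by (induction n) (auto simp: tensor_mat_def)

lemma tensor_power_entry:
  assumes d: "d > 0" "D > 0" and C: "C \<in> carrier_mat (d * D) (d * D)"
    and CU: "\<And>p q. p < d * D \<Longrightarrow> q < d * D \<Longrightarrow> C $$ (p, q)
       = (\<Sum>\<rho><r. U (p div D * r + \<rho>) (p mod D) * cnj (U (q div D * r + \<rho>) (q mod D)))"
  shows "p < (d * D) ^ n \<Longrightarrow> q < (d * D) ^ n \<Longrightarrow> tensor_power C n $$ (p, q)
    = (\<Sum>\<rho>\<in>tup n {..<r}. tpow (env r U) \<rho> (dec d D n p) * cnj (tpow (env r U) \<rho> (dec d D n q)))"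
proof (induction n arbitrary: p q)
  case (Suc n)
  let ?K = "(d * D) ^ n"
  have K: "?K > 0" using d by simp
  have dims: "dim_row (tensor_power C n) = ?K" "dim_col (tensor_power C n) = ?K"
    using tensor_power_carrier[OF C, of n] by auto
  have h: "p div ?K < d * D" "q div ?K < d * D"
    using Suc.prems by (auto intro!: less_mult_imp_div_less)
  have "tensor_power C (Suc n) $$ (p, q) = C $$ (p div ?K, q div ?K) * tensor_power C n $$ (p mod ?K, q mod ?K)"
    using Suc.prems C dims by (simp add: tensor_mat_def)
  also have "\<dots> = (\<Sum>x<r. env r U x (p div ?K div D, p div ?K mod D) * cnj (env r U x (q div ?K div D, q div ?K mod D)))
      * (\<Sum>\<rho>\<in>tup n {..<r}. tpow (env r U) \<rho> (dec d D n (p mod ?K)) * cnj (tpow (env r U) \<rho> (dec d D n (q mod ?K))))"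
  proof -
    have "tensor_power C n $$ (p mod ?K, q mod ?K) = (\<Sum>\<rho>\<in>tup n {..<r}.
        tpow (env r U) \<rho> (dec d D n (p mod ?K)) * cnj (tpow (env r U) \<rho> (dec d D n (q mod ?K))))"
      using K by (intro Suc.IH) simp_all
    moreover have "C $$ (p div ?K, q div ?K)
        = (\<Sum>x<r. env r U x (p div ?K div D, p div ?K mod D) * cnj (env r U x (q div ?K div D, q div ?K mod D)))"
      by (simp add: CU[OF h] env_def)
    ultimately show ?thesis by (simp only:)
  qed
  also have "\<dots> = (\<Sum>x<r. \<Sum>\<rho>\<in>tup n {..<r}. tpow (env r U) (x # \<rho>) (dec d D (Suc n) p) * cnj (tpow (env r U) (x # \<rho>) (dec d D (Suc n) q)))"
    unfolding sum_product by (intro sum.cong refl) (simp add: mult_ac)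
  finally show ?case by (simp only: sum_tup_Suc)
qed simp

text \<open>The partial trace of \<open>\<sigma>\<close> over the inputs of the \<open>k\<close>
  latest queries, which come first in the lists.\<close>

definition sig :: "nat \<Rightarrow> nat \<Rightarrow> (nat list \<Rightarrow> nat list \<Rightarrow> complex) \<Rightarrow> nat list \<Rightarrow> nat list \<Rightarrow> complex" where
  "sig D k \<sigma> x y = (\<Sum>u\<in>tup k {..<D}. \<sigma> (u @ x) (u @ y))"

lemma sig_Suc: "(\<Sum>a<D. sig D k \<sigma> (a # x) (a # y)) = sig D (Suc k) \<sigma> x y"
proof -
  have "(\<Sum>a<D. sig D k \<sigma> (a # x) (a # y)) = (\<Sum>u\<in>tup k {..<D}. \<Sum>a<D. \<sigma> (u @ a # x) (u @ a # y))"
    unfolding sig_def by (rule sum.swap)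
  then show ?thesis by (simp add: sig_def sum_tup_snoc)
qed

text \<open>The operators \<open>X j\<close>: the first \<open>j\<close> inputs of the state \<open>\<sigma>\<close>, with the earlier outputs ignored.
  Everything is transposed, since probabilities pair an outcome operator with the transposed Choi operator.\<close>

definition parX :: "nat \<Rightarrow> nat \<Rightarrow> nat \<Rightarrow> (nat list \<Rightarrow> nat list \<Rightarrow> complex) \<Rightarrow> nat \<Rightarrow> complex mat" where
  "parX d D n \<sigma> j = (let K = (d * D) ^ (j - 1) in mat (D * K) (D * K) (\<lambda>(p, q).
     of_bool (map fst (dec d D (j - 1) (p mod K)) = map fst (dec d D (j - 1) (q mod K))) *
     sig D (n - j) \<sigma> ((q div K) # map snd (dec d D (j - 1) (q mod K))) ((p div K) # map snd (dec d D (j - 1) (p mod K)))))"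

lemma parX_carrier: "parX d D n \<sigma> j \<in> carrier_mat (D * (d * D) ^ (j - 1)) (D * (d * D) ^ (j - 1))"
  by (simp add: parX_def Let_def)

text \<open>The identity tensored on the left supplies the missing output digit of query
  \<open>j\<close>; afterwards all \<open>j\<close> outputs are ignored in the same way.\<close>

lemma tensor_parX:
  assumes d: "d > 0" "D > 0" and j: "1 \<le> j" and p: "p < (d * D) ^ j" "q < (d * D) ^ j"
  shows "tensor_mat (1\<^sub>m d) (parX d D n \<sigma> j) $$ (p, q) = of_bool (map fst (dec d D j p) = map fst (dec d D j q)) *
    sig D (n - j) \<sigma> (map snd (dec d D j q)) (map snd (dec d D j p))"
proof -
  obtain i where i: "j = Suc i" using j by (cases j) auto
  let ?K = "(d * D) ^ i"
  have K: "?K > 0" using d by simp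
  have dims: "dim_row (parX d D n \<sigma> j) = D * ?K" "dim_col (parX d D n \<sigma> j) = D * ?K"
    using parX_carrier[of d D n \<sigma> j] by (auto simp: i)
  have P: "p < d * (D * ?K)" "q < d * (D * ?K)" using p by (simp_all add: i mult.assoc)
  have a: "x mod (D * ?K) div ?K = x div ?K mod D" "x mod (D * ?K) mod ?K = x mod ?K" "x div (D * ?K) = x div ?K div D"
    "x mod (D * ?K) < D * ?K" for x
  proof -
    have "x mod (?K * D) = ?K * (x div ?K mod D) + x mod ?K" by (rule mod_mult2_eq)
    then show "x mod (D * ?K) div ?K = x div ?K mod D" using K by (simp add: mult.commute[of D])
    show "x mod (D * ?K) mod ?K = x mod ?K" by (rule mod_mod_cancel) simp
    show "x div (D * ?K) = x div ?K div D" by (simp add: div_mult2_eq mult.commute[of D])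
    show "x mod (D * ?K) < D * ?K" using K d by simp
  qed
  have b: "p div ?K div D < d" "q div ?K div D < d"
    using P unfolding a(3)[symmetric] by (auto intro!: less_mult_imp_div_less)
  have "tensor_mat (1\<^sub>m d) (parX d D n \<sigma> j) $$ (p, q)
      = 1\<^sub>m d $$ (p div ?K div D, q div ?K div D) * parX d D n \<sigma> j $$ (p mod (D * ?K), q mod (D * ?K))"
    using P dims by (simp add: tensor_mat_def a(3))
  also have "parX d D n \<sigma> j $$ (p mod (D * ?K), q mod (D * ?K)) =
     of_bool (map fst (dec d D i (p mod ?K)) = map fst (dec d D i (q mod ?K))) *
     sig D (n - j) \<sigma> ((q div ?K mod D) # map snd (dec d D i (q mod ?K))) ((p div ?K mod D) # map snd (dec d D i (p mod ?K)))"
    unfolding parX_def Let_def i diff_Suc_1 using a(4) by (simp add: a(1,2))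
  finally show ?thesis using b by (simp add: i)
qed

text \<open>Summing over the input of query \<open>j\<close> moves one more digit into the partial
  trace of \<open>\<sigma>\<close>.\<close>

lemma ptrace_parX:
  assumes d: "d > 0" "D > 0" and j: "2 \<le> j" "j \<le> n"
  shows "ptrace_left D ((d * D) ^ (j - 1)) (parX d D n \<sigma> j) = tensor_mat (1\<^sub>m d) (parX d D n \<sigma> (j - 1))"
proof -
  let ?K = "(d * D) ^ (j - 1)"
  obtain i where i: "j = Suc (Suc i)" using j(1) by (metis Suc_le_D numeral_2_eq_2 Suc_le_mono)
  have dims: "dim_row (tensor_mat (1\<^sub>m d) (parX d D n \<sigma> (j - 1))) = ?K" "dim_col (tensor_mat (1\<^sub>m d) (parX d D n \<sigma> (j - 1))) = ?K"
    using parX_carrier[of d D n \<sigma> "Suc i"] by (auto simp: tensor_mat_def i)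
  show ?thesis
  proof (rule eq_matI)
    fix p q assume "p < dim_row (tensor_mat (1\<^sub>m d) (parX d D n \<sigma> (j - 1)))" "q < dim_col (tensor_mat (1\<^sub>m d) (parX d D n \<sigma> (j - 1)))"
    then have p: "p < ?K" "q < ?K" using dims by auto
    have "ptrace_left D ?K (parX d D n \<sigma> j) $$ (p, q) = (\<Sum>a<D. parX d D n \<sigma> j $$ (a * ?K + p, a * ?K + q))"
      using p by (simp add: ptrace_left_def)
    also have "\<dots> = (\<Sum>a<D. of_bool (map fst (dec d D (j - 1) p) = map fst (dec d D (j - 1) q)) *
        sig D (n - j) \<sigma> (a # map snd (dec d D (j - 1) q)) (a # map snd (dec d D (j - 1) p)))"
    proof (rule sum.cong[OF refl])
      fix a assume "a \<in> {..<D}"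
      then have "a * ?K + p < D * ?K" "a * ?K + q < D * ?K" using p by (auto intro: pair_index_less)
      moreover have "(a * k + x) div k = a \<and> (a * k + x) mod k = x" if "x < k" for x k :: nat
        using that by simp
      note this[OF p(1)] this[OF p(2)]
      ultimately show "parX d D n \<sigma> j $$ (a * ?K + p, a * ?K + q) = of_bool (map fst (dec d D (j - 1) p) = map fst (dec d D (j - 1) q)) *
        sig D (n - j) \<sigma> (a # map snd (dec d D (j - 1) q)) (a # map snd (dec d D (j - 1) p))"
        unfolding parX_def Let_def by simp
    qed
    also have "\<dots> = of_bool (map fst (dec d D (j - 1) p) = map fst (dec d D (j - 1) q)) *
        sig D (Suc (n - j)) \<sigma> (map snd (dec d D (j - 1) q)) (map snd (dec d D (j - 1) p))"
      by (simp only: sum_distrib_left[symmetric] sig_Suc)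
    also have "Suc (n - j) = n - (j - 1)" using j by simp
    finally show "ptrace_left D ?K (parX d D n \<sigma> j) $$ (p, q) = tensor_mat (1\<^sub>m d) (parX d D n \<sigma> (j - 1)) $$ (p, q)"
      using tensor_parX[OF d _ p] j by simp
  qed (simp_all only: ptrace_left_def dims dim_row_mat dim_col_mat)
qed

lemma mtrace_parX:
  assumes n: "1 \<le> n"
  shows "mtrace (parX d D n \<sigma> 1) = (\<Sum>a\<in>tup n {..<D}. \<sigma> a a)"
proof -
  have "mtrace (parX d D n \<sigma> 1) = (\<Sum>a<D. sig D (n - 1) \<sigma> [a] [a])"
    by (simp add: mtrace_def parX_def Let_def)
  also have "\<dots> = sig D (Suc (n - 1)) \<sigma> [] []" by (rule sig_Suc)
  also have "\<dots> = (\<Sum>a\<in>tup n {..<D}. \<sigma> a a)" using n by (simp add: sig_def)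
  finally show ?thesis .
qed

text \<open>A sum of pullbacks of the transposed \<open>\<sigma>\<close>, one for each tuple
  \<open>b\<close> of earlier outputs and each tuple \<open>u\<close> of traced inputs.\<close>

lemma psd_parX:
  assumes d: "d > 0" "D > 0" and j: "1 \<le> j" "j \<le> n" and \<sigma>: "psd_on (tup n {..<D}) \<sigma>"
  shows "psd (D * (d * D) ^ (j - 1)) (parX d D n \<sigma> j)"
  unfolding psd_iff[OF parX_carrier]
proof (rule psd_on_cong)
  let ?K = "(d * D) ^ (j - 1)" and ?B = "tup (j - 1) {..<d}" and ?U = "tup (n - j) {..<D}"
  define f where "f = (\<lambda>p. map fst (dec d D (j - 1) (p mod ?K)))"
  define g where "g = (\<lambda>p. (p div ?K) # map snd (dec d D (j - 1) (p mod ?K)))"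
  have K: "?K > 0" using d by simp
  have dt: "dec d D (j - 1) (p mod ?K) \<in> tup (j - 1) ({..<d} \<times> {..<D})" for p
    using K by (intro dec_tup d) simp
  have f: "f p \<in> ?B" for p unfolding f_def by (rule tup_map[OF dt]) auto
  have g: "u @ g p \<in> tup n {..<D}" if p: "p < D * ?K" and u: "u \<in> ?U" for p u
  proof -
    have "map snd (dec d D (j - 1) (p mod ?K)) \<in> tup (j - 1) {..<D}" by (rule tup_map[OF dt]) auto
    moreover have "p div ?K < D" using p by (rule less_mult_imp_div_less)
    ultimately show ?thesis using u j by (auto simp: tup_def g_def)
  qed
  show "psd_on {..<D * ?K} (\<lambda>p q. \<Sum>b\<in>?B. \<Sum>u\<in>?U. of_bool (f p = b) * \<sigma> (u @ g q) (u @ g p) * cnj (of_bool (f q = b)))"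
    by (intro psd_on_sum psd_on_pullback[where S = "\<lambda>x y. \<sigma> y x", OF _ _ _ psd_on_transpose[OF \<sigma>]] g) auto
  show "meq {..<D * ?K} {..<D * ?K} (\<lambda>p q. \<Sum>b\<in>?B. \<Sum>u\<in>?U. of_bool (f p = b) * \<sigma> (u @ g q) (u @ g p) * cnj (of_bool (f q = b)))
     (\<lambda>p q. parX d D n \<sigma> j $$ (p, q))"
  proof (rule meqI)
    fix p q assume pq: "p \<in> {..<D * ?K}" "q \<in> {..<D * ?K}"
    have "(\<Sum>b\<in>?B. \<Sum>u\<in>?U. of_bool (f p = b) * \<sigma> (u @ g q) (u @ g p) * cnj (of_bool (f q = b)))
       = (\<Sum>b\<in>?B. if f p = b then of_bool (f p = f q) * sig D (n - j) \<sigma> (g q) (g p) else 0)"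
    proof (rule sum.cong[OF refl])
      fix b
      show "(\<Sum>u\<in>?U. of_bool (f p = b) * \<sigma> (u @ g q) (u @ g p) * cnj (of_bool (f q = b)))
         = (if f p = b then of_bool (f p = f q) * sig D (n - j) \<sigma> (g q) (g p) else 0)"
        by (cases "f p = b"; cases "f q = b") (auto simp: sig_def)
    qed
    also have "\<dots> = of_bool (f p = f q) * sig D (n - j) \<sigma> (g q) (g p)" using f[of p] by simp
    also have "\<dots> = parX d D n \<sigma> j $$ (p, q)"
      using pq by (simp add: parX_def Let_def f_def g_def)
    finally show "(\<Sum>b\<in>?B. \<Sum>u\<in>?U. of_bool (f p = b) * \<sigma> (u @ g q) (u @ g p) * cnj (of_bool (f q = b)))
      = parX d D n \<sigma> j $$ (p, q)" .
  qed
qed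

section \<open>The query bound\<close>

text \<open>The output state for input \<open>|0>\<close> of the channel with dilation
  \<open>g\<close>: column 0 of \<open>g\<close> with the environment traced out.\<close>

definition label :: "nat \<Rightarrow> nat \<Rightarrow> (nat \<Rightarrow> nat \<Rightarrow> complex) \<Rightarrow> complex mat" where
  "label d r g = mat d d (\<lambda>(b, c). \<Sum>\<rho><r. g (b * r + \<rho>) 0 * cnj (g (c * r + \<rho>) 0))"

lemma unit_column_pairs:
  fixes d r :: nat
  assumes "unitary_on {..<d * r} g" "d > 0" "r > 0"
  shows "(\<Sum>b<d. \<Sum>\<rho><r. (cmod (g (b * r + \<rho>) 0))\<^sup>2) = 1"
proof -
  have "(\<Sum>c<d * r. (cmod (g c 0))\<^sup>2) = 1" by (rule unitary_column[OF assms(1)]) (use assms in simp)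
  then show ?thesis unfolding sum_pair_index .
qed

lemma label_state:
  assumes g: "unitary_on {..<d * r} g" "d > 0" "r > 0"
  shows "label d r g \<in> states d"
proof -
  have c: "label d r g \<in> carrier_mat d d" by (simp add: label_def)
  have "psd_on {..<d} (\<lambda>b c. \<Sum>\<rho><r. g (b * r + \<rho>) 0 * cnj (g (c * r + \<rho>) 0))"
    by (intro psd_on_sum psd_on_rank_one) simp
  then have "psd d (label d r g)"
    unfolding psd_iff[OF c] by (rule psd_on_cong[rotated]) (auto simp: meq_def label_def)
  moreover have "mtrace (label d r g) = of_real (\<Sum>b<d. \<Sum>\<rho><r. (cmod (g (b * r + \<rho>) 0))\<^sup>2)"
    unfolding of_real_sum complex_norm_square by (simp add: mtrace_def label_def)
  ultimately show ?thesis using unit_column_pairs[OF g] by (simp add: states_def)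
qed

text \<open>A unitary on the environment does not change the output state, so column 0 of
  \<open>UV\<close> purifies it for every \<open>V\<close>, and \<open>trace_norm_ptrace_le\<close>
  bounds each of these overlaps.\<close>

lemma label_far:
  assumes d: "d > 0" and r: "r > 0" and eps: "\<epsilon> > 0" and E: "E \<in> QChan (d * r) d r"
    and U: "unitary_on {..<d * r} U"
    and CU: "\<And>p q. p < d * (d * r) \<Longrightarrow> q < d * (d * r) \<Longrightarrow> choi (d * r) d E $$ (p, q)
       = (\<Sum>\<rho><r. U (p div (d * r) * r + \<rho>) (p mod (d * r)) * cnj (U (q div (d * r) * r + \<rho>) (q mod (d * r))))"
    and g: "unitary_on {..<d * r} g" and V: "unitary_on {..<r} V"
    and far: "\<epsilon> < trace_norm (label d r g - E (outer_prod (unit_vec (d * r) 0) (unit_vec (d * r) 0)))"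
  shows "\<epsilon>\<^sup>2 / 4 \<le> 1 - (cmod (cinner {..<d * r} (\<lambda>c. g c 0) (\<lambda>c. mm {..<d * r} (blk r (adj V)) U c 0)))\<^sup>2"
proof -
  let ?D = "d * r" and ?E0 = "E (outer_prod (unit_vec (d * r) 0) (unit_vec (d * r) 0))"
  define UV where "UV = mm {..<?D} (blk r (adj V)) U"
  have D: "?D > 0" using d r by simp
  have uUV: "unitary_on {..<?D} UV"
    unfolding UV_def by (intro unitary_on_mm unitary_on_blk r unitary_on_adj V U) simp
  have "Defs.linear_map ?D d E" using E by (auto simp: QChan_def quantum_channel_def)
  then have E0: "?E0 \<in> carrier_mat d d" by (simp add: Defs.linear_map_def outer_prod_def)
  have E0e: "?E0 $$ (b, c) = (\<Sum>\<rho><r. UV (b * r + \<rho>) 0 * cnj (UV (c * r + \<rho>) 0))" if bc: "b < d" "c < d" for b c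
  proof -
    have lt: "b * ?D < d * ?D" "c * ?D < d * ?D" using bc D by auto
    have "?E0 $$ (b, c) = choi ?D d E $$ (b * ?D, c * ?D)"
      using choi_entry[OF lt] D by simp
    also have "\<dots> = (\<Sum>\<rho><r. env r U \<rho> (b, 0) * cnj (env r U \<rho> (c, 0)))"
      using D by (simp add: CU[OF lt] env_def)
    also have "\<dots> = (\<Sum>\<sigma><r. (\<Sum>\<rho><r. adj V \<sigma> \<rho> * env r U \<rho> (b, 0)) * cnj (\<Sum>\<rho><r. adj V \<sigma> \<rho> * env r U \<rho> (c, 0)))"
      by (rule unitary_on_isometry[OF finite_lessThan unitary_on_adj[OF V], symmetric])
    also have "\<dots> = (\<Sum>\<sigma><r. env r UV \<sigma> (b, 0) * cnj (env r UV \<sigma> (c, 0)))"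
    proof (rule sum.cong[OF refl])
      fix \<sigma> assume s: "\<sigma> \<in> {..<r}"
      have "(\<Sum>\<rho><r. adj V \<sigma> \<rho> * env r U \<rho> (x, 0)) = env r UV \<sigma> (x, 0)" if "x < d" for x
        using mm_env[OF r, of \<sigma> "(x, 0)" d "adj V" U] s that by (simp add: UV_def mm_def[of "{..<r}"])
      then show "(\<Sum>\<rho><r. adj V \<sigma> \<rho> * env r U \<rho> (b, 0)) * cnj (\<Sum>\<rho><r. adj V \<sigma> \<rho> * env r U \<rho> (c, 0))
        = env r UV \<sigma> (b, 0) * cnj (env r UV \<sigma> (c, 0))" using bc by (simp only:)
    qed
    finally show ?thesis by (simp add: env_def)
  qed
  have "(trace_norm (label d r g - ?E0))\<^sup>2
    \<le> 4 * (1 - (cmod (\<Sum>b<d. \<Sum>\<rho><r. cnj (UV (b * r + \<rho>) 0) * g (b * r + \<rho>) 0))\<^sup>2)"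
  proof (rule trace_norm_ptrace_le)
    show "(\<Sum>b<d. \<Sum>\<rho><r. (cmod (g (b * r + \<rho>) 0))\<^sup>2) = 1" by (rule unit_column_pairs[OF g d r])
    show "(\<Sum>b<d. \<Sum>\<rho><r. (cmod (UV (b * r + \<rho>) 0))\<^sup>2) = 1" by (rule unit_column_pairs[OF uUV d r])
    show "label d r g - ?E0 \<in> carrier_mat d d" using E0 by (simp add: label_def minus_carrier_mat)
    fix b c assume bc: "b < d" "c < d"
    show "(label d r g - ?E0) $$ (b, c) = (\<Sum>\<rho><r. g (b * r + \<rho>) 0 * cnj (g (c * r + \<rho>) 0)) - (\<Sum>\<rho><r. UV (b * r + \<rho>) 0 * cnj (UV (c * r + \<rho>) 0))"
      using bc E0 E0e[OF bc] by (simp add: label_def)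
  qed
  moreover have "cmod (\<Sum>b<d. \<Sum>\<rho><r. cnj (UV (b * r + \<rho>) 0) * g (b * r + \<rho>) 0) = cmod (cinner {..<?D} (\<lambda>c. g c 0) (\<lambda>c. UV c 0))"
  proof -
    have "(\<Sum>b<d. \<Sum>\<rho><r. cnj (UV (b * r + \<rho>) 0) * g (b * r + \<rho>) 0) = (\<Sum>c<?D. cnj (UV c 0) * g c 0)"
      unfolding sum_pair_index ..
    also have "\<dots> = cnj (cinner {..<?D} (\<lambda>c. g c 0) (\<lambda>c. UV c 0))"
      unfolding cinner_def cnj_sum by (intro sum.cong refl) (simp add: mult.commute)
    finally show ?thesis by (simp only: complex_mod_cnj)
  qed
  moreover have "\<epsilon>\<^sup>2 \<le> (trace_norm (label d r g - ?E0))\<^sup>2" using far eps by (intro power_mono) auto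
  ultimately show ?thesis unfolding UV_def[symmetric] by simp
qed

lemma outcome_prob_entries:
  assumes "T i \<in> carrier_mat ((d2 * d1) ^ n) ((d2 * d1) ^ n)"
  shows "outcome_prob d1 d2 n T E i
    = Re (\<Sum>p<(d2 * d1) ^ n. \<Sum>q<(d2 * d1) ^ n. T i $$ (p, q) * tensor_power (choi d1 d2 E) n $$ (p, q))"
proof -
  let ?N = "(d2 * d1) ^ n" and ?C = "tensor_power (choi d1 d2 E) n"
  have C: "?C \<in> carrier_mat ?N ?N"
    by (rule tensor_power_carrier) (simp add: choi_def ampliation_def)
  then have Ct: "transpose_mat ?C \<in> carrier_mat ?N ?N" by simp
  have "mtrace (T i * transpose_mat ?C) = (\<Sum>p<?N. (T i * transpose_mat ?C) $$ (p, p))"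
    using assms by (simp add: mtrace_def)
  also have "\<dots> = (\<Sum>p<?N. \<Sum>q<?N. T i $$ (p, q) * ?C $$ (p, q))"
    by (intro sum.cong refl) (use C in \<open>simp add: mult_mat_entry[OF assms Ct] del: index_mult_mat\<close>)
  finally show ?thesis by (simp only: outcome_prob_def)
qed

lemma sequential_tester_exists:
  fixes q :: "real poly" and F :: "nat list \<Rightarrow> nat list \<Rightarrow> complex"
  assumes d: "d > 0" and r: "r > 0" and eps: "\<epsilon> > 0" and n: "1 \<le> n"
    and F: "symm_on n {..<d * r} {..<d * r} F"
    and amp: "\<And>U. unitary_on {..<d * r} U \<Longrightarrow>
      (cmod (\<Sum>a\<in>tup n {..<d * r}. \<Sum>b\<in>tup n {..<d * r}. cnj (F a b) * tpow U b a))\<^sup>2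
        = ((cmod (U 0 0))\<^sup>2) ^ L * (poly q ((cmod (U 0 0))\<^sup>2))\<^sup>2"
    and nrm: "ell (d * r) L (q * q) = 1"
    and err: "4 / \<epsilon>\<^sup>2 * ell (d * r) L ([:1, -1:] * (q * q)) \<le> 1 / 4"
  shows "\<exists>S T. S \<subseteq> states d \<and> sequential_tester (d * r) d n S T \<and>
    (\<forall>E \<in> QChan (d * r) d r.
       (\<Sum>\<rho> \<in> {\<rho> \<in> S. trace_norm (\<rho> - E (outer_prod (unit_vec (d * r) 0) (unit_vec (d * r) 0))) \<le> \<epsilon>}.
          outcome_prob (d * r) d n T E \<rho>) \<ge> 2 / 3)"
proof -
  let ?D = "d * r" and ?T = "tup n ({..<d} \<times> {..<d * r})"
  have D: "?D > 0" using d r by simp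
  let ?N = "(d * ?D) ^ n"
  show ?thesis
  proof (rule tester_exists[OF d r eps F _ nrm err], goal_cases)
    case (1 U)
    then show ?case by (rule amp)
  next
    case (2 gs W \<sigma>)
    note gs = 2(1,2) and \<sigma> = 2(3,4) and W = 2(5) and J = 2(6) and good = 2(7)
    define m where "m = length gs"
    have m: "m > 0" using gs(1) by (simp add: m_def)
    define lab where "lab = (\<lambda>i. label d r (gs ! i))"
    define S where "S = lab ` {..<m}"
    \<comment> \<open>The positive defect of the family \<open>W\<close>, which has to be assigned
      to some outcome for the operators to sum to a tester.\<close>
    define Jk where "Jk = (\<lambda>p p'. of_bool (map fst p = map fst p') * \<sigma> (map snd p) (map snd p') - (\<Sum>i<length gs. W i p p'))"
    \<comment> \<open>Different guesses may have equal labels, so their operators are added; the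
      defect goes to the label of guess 0.\<close>
    define V where "V = (\<lambda>s x y. (\<Sum>i\<in>{i \<in> {..<m}. lab i = s}. W i x y) + (if s = lab 0 then Jk x y else 0))"
    \<comment> \<open>The arguments are swapped because probabilities pair with the transposed Choi
      operator.\<close>
    define T where "T = (\<lambda>s. mat ?N ?N (\<lambda>(p, q). V s (dec d ?D n q) (dec d ?D n p)))"
    have Tc: "T s \<in> carrier_mat ?N ?N" for s by (simp add: T_def)
    have Ve: "T s $$ (p, q) = V s (dec d ?D n q) (dec d ?D n p)" if "p < ?N" "q < ?N" for s p q
      using that by (simp add: T_def)
    have finS: "finite S" by (simp add: S_def)
    have psdV: "psd_on ?T (V s)" for s
      unfolding V_def
    proof (rule psd_on_add)
      show "psd_on ?T (\<lambda>x y. \<Sum>i\<in>{i \<in> {..<m}. lab i = s}. W i x y)"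
        by (rule psd_on_sum) (use W in \<open>auto simp: m_def\<close>)
      show "psd_on ?T (\<lambda>x y. if s = lab 0 then Jk x y else 0)"
        using J by (cases "s = lab 0") (auto simp: Jk_def psd_on_def)
    qed
    have psdT: "psd ?N (T s)" for s
      unfolding psd_iff[OF Tc]
    proof (rule psd_on_cong)
      show "psd_on {..<?N} (\<lambda>p q. 1 * V s (dec d ?D n q) (dec d ?D n p) * cnj 1)"
        by (rule psd_on_pullback[where S = "\<lambda>x y. V s y x" and f = "dec d ?D n" and J = ?T, OF _ _ _ psd_on_transpose[OF psdV]])
           (use dec_tup[OF d D] in auto)
      show "meq {..<?N} {..<?N} (\<lambda>p q. 1 * V s (dec d ?D n q) (dec d ?D n p) * cnj 1) (\<lambda>p q. T s $$ (p, q))"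
        by (rule meqI) (simp add: Ve)
    qed
    have sumV: "(\<Sum>s\<in>S. V s x y) = of_bool (map fst x = map fst y) * \<sigma> (map snd x) (map snd y)" for x y
    proof -
      have "(\<Sum>s\<in>S. \<Sum>i\<in>{i \<in> {..<m}. lab i = s}. W i x y) = (\<Sum>i<m. W i x y)"
        unfolding S_def by (rule sum.image_gen[symmetric]) simp
      moreover have "(\<Sum>s\<in>S. if s = lab 0 then Jk x y else 0) = Jk x y"
        using finS m by (simp add: S_def)
      ultimately show ?thesis unfolding V_def sum.distrib by (simp add: Jk_def m_def)
    qed
    have fam: "family_sum ?N T S = tensor_mat (1\<^sub>m d) (parX d ?D n \<sigma> n)"
    proof (rule eq_matI)
      have dims: "dim_row (parX d ?D n \<sigma> n) = ?D * (d * ?D) ^ (n - 1)" "dim_col (parX d ?D n \<sigma> n) = ?D * (d * ?D) ^ (n - 1)"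
        using parX_carrier[of d ?D n \<sigma> n] by auto
      have N: "d * (?D * (d * ?D) ^ (n - 1)) = ?N" using n by (cases n) auto
      have dt: "dim_row (tensor_mat (1\<^sub>m d) (parX d ?D n \<sigma> n)) = ?N" "dim_col (tensor_mat (1\<^sub>m d) (parX d ?D n \<sigma> n)) = ?N"
        unfolding tensor_mat_def by (simp_all only: dim_row_mat dim_col_mat dims index_one_mat N)
      then show "dim_row (family_sum ?N T S) = dim_row (tensor_mat (1\<^sub>m d) (parX d ?D n \<sigma> n))"
        "dim_col (family_sum ?N T S) = dim_col (tensor_mat (1\<^sub>m d) (parX d ?D n \<sigma> n))"
        by (simp_all only: family_sum_def dim_row_mat dim_col_mat)
      fix p q assume "p < dim_row (tensor_mat (1\<^sub>m d) (parX d ?D n \<sigma> n))" "q < dim_col (tensor_mat (1\<^sub>m d) (parX d ?D n \<sigma> n))"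
      then have pq: "p < ?N" "q < ?N" using dt by auto
      have "family_sum ?N T S $$ (p, q) = (\<Sum>s\<in>S. V s (dec d ?D n q) (dec d ?D n p))"
        using pq by (simp add: family_sum_def Ve)
      also have "\<dots> = tensor_mat (1\<^sub>m d) (parX d ?D n \<sigma> n) $$ (p, q)"
        unfolding sumV tensor_parX[OF d D n pq] by (simp add: sig_def eq_commute)
      finally show "family_sum ?N T S $$ (p, q) = tensor_mat (1\<^sub>m d) (parX d ?D n \<sigma> n) $$ (p, q)" .
    qed
    have tester: "sequential_tester ?D d n S T"
      unfolding sequential_tester_def
    proof (intro conjI exI[of _ "parX d ?D n \<sigma>"] ballI)
      show "mtrace (parX d ?D n \<sigma> 1) = 1" using mtrace_parX[OF n] \<sigma>(2) by simp
      fix j assume "j \<in> {1..n}"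
      then show "psd (?D * (d * ?D) ^ (j - 1)) (parX d ?D n \<sigma> j)" by (intro psd_parX d D \<sigma>) auto
    next
      fix j assume "j \<in> {2..n}"
      then show "ptrace_left ?D ((d * ?D) ^ (j - 1)) (parX d ?D n \<sigma> j) = tensor_mat (1\<^sub>m d) (parX d ?D n \<sigma> (j - 1))"
        by (intro ptrace_parX d D) auto
    qed (use n finS psdT fam in auto)
    have "2 / 3 \<le> (\<Sum>\<rho> \<in> {\<rho> \<in> S. trace_norm (\<rho> - E (outer_prod (unit_vec ?D 0) (unit_vec ?D 0))) \<le> \<epsilon>}. outcome_prob ?D d n T E \<rho>)"
      if E: "E \<in> QChan ?D d r" for E
    proof -
      obtain U where U: "unitary_on {..<?D} U"
        and CU: "\<And>p q. p < d * ?D \<Longrightarrow> q < d * ?D \<Longrightarrow> choi ?D d E $$ (p, q)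
         = (\<Sum>\<rho><r. U (p div ?D * r + \<rho>) (p mod ?D) * cnj (U (q div ?D * r + \<rho>) (q mod ?D)))"
        using dilation[OF E mult.commute D] by blast
      define H where "H = (\<lambda>p p'. \<Sum>\<rho>\<in>tup n {..<r}. tpow (env r U) \<rho> p * cnj (tpow (env r U) \<rho> p'))"
      define B where "B = (\<lambda>M. \<Sum>y\<in>?T. \<Sum>x\<in>?T. M y x * H x y)"
      have TP: "tensor_power (choi ?D d E) n $$ (p, q) = H (dec d ?D n p) (dec d ?D n q)" if "p < ?N" "q < ?N" for p q
        unfolding H_def by (rule tensor_power_entry[OF d D _ CU that]) (simp add: choi_def ampliation_def)
      have prob: "outcome_prob ?D d n T E s = Re (B (V s))" for s
      proof -
        have "(\<Sum>p<?N. \<Sum>q<?N. T s $$ (p, q) * tensor_power (choi ?D d E) n $$ (p, q))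
            = (\<Sum>p<?N. \<Sum>q<?N. V s (dec d ?D n q) (dec d ?D n p) * H (dec d ?D n p) (dec d ?D n q))"
          by (intro sum.cong refl) (simp add: Ve TP)
        also have "\<dots> = (\<Sum>p<?N. \<Sum>y\<in>?T. V s y (dec d ?D n p) * H (dec d ?D n p) y)"
          by (rule sum.cong[OF refl], rule sum_dec[OF d D])
        also have "\<dots> = (\<Sum>x\<in>?T. \<Sum>y\<in>?T. V s y x * H x y)" by (rule sum_dec[OF d D])
        also have "\<dots> = B (V s)" unfolding B_def by (rule sum.swap)
        finally show ?thesis unfolding outcome_prob_entries[where T = T and i = s, OF Tc] by simp
      qed
      have Badd: "B (\<lambda>x y. M x y + M' x y) = B M + B M'" for M M'
        unfolding B_def by (simp add: distrib_right sum.distrib)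
      have Bsum: "B (\<lambda>x y. \<Sum>i\<in>K. M i x y) = (\<Sum>i\<in>K. B (M i))" for K :: "nat set" and M
      proof -
        have "B (\<lambda>x y. \<Sum>i\<in>K. M i x y) = (\<Sum>y\<in>?T. \<Sum>x\<in>?T. \<Sum>i\<in>K. M i y x * H x y)"
          unfolding B_def sum_distrib_right ..
        also have "\<dots> = (\<Sum>y\<in>?T. \<Sum>i\<in>K. \<Sum>x\<in>?T. M i y x * H x y)"
          by (rule sum.cong[OF refl], rule sum.swap)
        also have "\<dots> = (\<Sum>i\<in>K. B (M i))" unfolding B_def by (rule sum.swap)
        finally show ?thesis .
      qed
      have BV: "B (V s) = (\<Sum>i\<in>{i \<in> {..<m}. lab i = s}. B (W i)) + (if s = lab 0 then B Jk else 0)" for s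
        unfolding V_def Badd Bsum by (cases "s = lab 0") (auto simp: B_def)
      \<comment> \<open>Attaching the defect to a label can only increase the probability of that
        label, so it does no harm even if the label is good.\<close>
      have BJ: "Re (B Jk) \<ge> 0"
      proof -
        have "B Jk = (\<Sum>y\<in>?T. \<Sum>x\<in>?T. \<Sum>\<rho>\<in>tup n {..<r}. cnj (tpow (env r U) \<rho> y) * Jk y x * tpow (env r U) \<rho> x)"
          unfolding B_def H_def sum_distrib_left by (intro sum.cong refl) (simp only: mult_ac)
        also have "\<dots> = (\<Sum>y\<in>?T. \<Sum>\<rho>\<in>tup n {..<r}. \<Sum>x\<in>?T. cnj (tpow (env r U) \<rho> y) * Jk y x * tpow (env r U) \<rho> x)"
          by (rule sum.cong[OF refl], rule sum.swap)
        also have "\<dots> = (\<Sum>\<rho>\<in>tup n {..<r}. \<Sum>y\<in>?T. \<Sum>x\<in>?T. cnj (tpow (env r U) \<rho> y) * Jk y x * tpow (env r U) \<rho> x)"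
          by (rule sum.swap)
        finally have e: "Re (B Jk) = (\<Sum>\<rho>\<in>tup n {..<r}. Re (\<Sum>y\<in>?T. \<Sum>x\<in>?T. cnj (tpow (env r U) \<rho> y) * Jk y x * tpow (env r U) \<rho> x))"
          by (simp only: Re_sum[of _ "tup n {..<r}"])
        have nn: "0 \<le> z \<Longrightarrow> 0 \<le> Re z" for z by (simp add: less_eq_complex_def)
        show ?thesis
          unfolding e by (rule sum_nonneg, rule nn, rule J[folded Jk_def, unfolded psd_on_def, rule_format])
      qed
      define Gd where "Gd = {\<rho> \<in> S. trace_norm (\<rho> - E (outer_prod (unit_vec ?D 0) (unit_vec ?D 0))) \<le> \<epsilon>}"
      define G where "G = {i \<in> {..<m}. lab i \<in> Gd}"
      have finG: "finite Gd" "finite G" using finS by (auto simp: Gd_def G_def)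
      have "2 / 3 \<le> Re (\<Sum>i\<in>G. B (W i))"
        unfolding B_def H_def
      proof (rule good[OF U])
        show "G \<subseteq> {..<length gs}" by (auto simp: G_def m_def)
        fix i V assume i: "i < length gs" "i \<notin> G" and V: "unitary_on {..<r} V"
        have "lab i \<in> S" using i by (auto simp: S_def m_def)
        then have "\<epsilon> < trace_norm (lab i - E (outer_prod (unit_vec ?D 0) (unit_vec ?D 0)))"
          using i by (auto simp: G_def Gd_def m_def)
        then show "\<epsilon>\<^sup>2 / 4 \<le> 1 - (cmod (cinner {..<d * r} (\<lambda>c. (gs ! i) c 0) (\<lambda>c. mm {..<d * r} (blk r (adj V)) U c 0)))\<^sup>2"
          unfolding lab_def by (rule label_far[OF d r eps E U _ gs(2)[OF i(1)] V, rotated]) (rule CU)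
      qed
      also have "(\<Sum>i\<in>G. B (W i)) = (\<Sum>s\<in>Gd. \<Sum>i\<in>{i \<in> {..<m}. lab i = s}. B (W i))"
      proof -
        have "(\<Sum>i\<in>G. B (W i)) = (\<Sum>s\<in>Gd. \<Sum>i\<in>{i \<in> G. lab i = s}. B (W i))"
          by (rule sum.group[symmetric]) (use finG in \<open>auto simp: G_def\<close>)
        also have "\<dots> = (\<Sum>s\<in>Gd. \<Sum>i\<in>{i \<in> {..<m}. lab i = s}. B (W i))"
          by (rule sum.cong[OF refl], rule sum.cong) (auto simp: G_def)
        finally show ?thesis .
      qed
      also have "Re (\<Sum>s\<in>Gd. \<Sum>i\<in>{i \<in> {..<m}. lab i = s}. B (W i)) \<le> (\<Sum>s\<in>Gd. outcome_prob ?D d n T E s)"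
        unfolding Re_sum[of _ Gd] prob BV by (rule sum_mono) (use BJ in auto)
      finally show ?thesis by (simp only: Gd_def)
    qed
    moreover have "S \<subseteq> states d"
      unfolding S_def lab_def using gs(2) by (auto simp: m_def intro!: label_state d r)
    ultimately show ?thesis using tester by blast
  qed
qed

text \<open>For \<open>\<epsilon> \<ge> d1\<^bsup>-1/2\<^esup>\<close> the copies of the state alone suffice; otherwise the additional
  \<open>U\<close>-dependent factor \<open>q\<close> concentrates the outcome distribution.\<close>

lemma polynomial_exists:
  assumes D: "D \<ge> 1" and eps: "0 < \<epsilon>" "\<epsilon> < 1"
  shows "\<exists>n L k (q :: real poly). real n \<le> 243 * min (real D powr (3 / 2) / \<epsilon>) (real D / \<epsilon>\<^sup>2) \<and> 1 \<le> n \<and>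
    degree q \<le> k \<and> n = L + D * k \<and> ell D L (q * q) = 1 \<and> 4 / \<epsilon>\<^sup>2 * ell D L ([:1, -1:] * (q * q)) \<le> 1 / 4"
proof -
  have pw: "real D powr (3 / 2) = real D * sqrt D"
  proof -
    have "real D powr (3 / 2) = real D powr (1 + 1 / 2)" by simp
    also have "\<dots> = real D * sqrt D" using D by (simp only: powr_add powr_half_sqrt) simp
    finally show ?thesis .
  qed
  have sq: "sqrt (real D) \<ge> 1" "sqrt (real D) * sqrt (real D) = real D" using D by auto
  have e2: "\<epsilon>\<^sup>2 > 0" using eps by simp
  have const: "ell D L ([:1 / sqrt (sph D L):] * [:1 / sqrt (sph D L):]) = 1"
    "ell D L ([:1, -1:] * ([:1 / sqrt (sph D L):] * [:1 / sqrt (sph D L):])) = (real D - 1) / (D + L)" for L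
  proof -
    let ?c = "1 / sph D L"
    have s: "sph D L > 0" using D by (simp add: sph_def pochhammer_pos)
    have c: "[:1 / sqrt (sph D L):] * [:1 / sqrt (sph D L):] = Polynomial.smult ?c 1"
      using s by (simp add: real_sqrt_mult_self one_pCons)
    show "ell D L ([:1 / sqrt (sph D L):] * [:1 / sqrt (sph D L):]) = 1"
      unfolding c ell_smult ell_one(2)[OF D] using s by simp
    show "ell D L ([:1, -1:] * ([:1 / sqrt (sph D L):] * [:1 / sqrt (sph D L):])) = (real D - 1) / (D + L)"
      unfolding c mult_smult_right ell_smult ell_one(1)[OF D] using s by simp
  qed
  \<comment> \<open>\<open>\<epsilon> * sqrt D = 1\<close> is where the two terms of the minimum
    agree. The case \<open>D = 1\<close> is separate as \<open>jacobi_trial\<close> needs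
    \<open>D \<ge> 2\<close>; there the error \<open>(D - 1) / (D + L)\<close> is 0.\<close>
  consider "D = 1" | "D \<ge> 2" "\<epsilon> * sqrt D \<ge> 1" | "D \<ge> 2" "\<epsilon> * sqrt D < 1" using D by linarith
  then show ?thesis
  proof cases
    case 1
    have "1 / \<epsilon> \<ge> 1" "1 / \<epsilon>\<^sup>2 \<ge> 1" using eps by (auto simp: power_le_one)
    then have "real 1 \<le> 243 * min (real D powr (3 / 2) / \<epsilon>) (real D / \<epsilon>\<^sup>2)" using 1 by simp
    then show ?thesis
      using const[of 1] 1
      by (intro exI[of _ "1 :: nat"] exI[of _ "0 :: nat"] exI[of _ "[:1 / sqrt (sph D 1):]"] conjI) simp_all
  next
    case 2
    \<comment> \<open>With constant \<open>q\<close> the error is at most \<open>D / L\<close>, and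
      \<open>4 / \<epsilon>^2 * (D / L) \<le> 1 / 4\<close> asks for
      \<open>L \<ge> 16 * D / \<epsilon>^2\<close>.\<close>
    define L where "L = nat \<lceil>16 * real D / \<epsilon>\<^sup>2\<rceil>"
    have x1: "1 \<le> real D / \<epsilon>\<^sup>2" using eps D by (simp add: power_le_one field_simps order_trans[of _ 1])
    have L: "16 * real D / \<epsilon>\<^sup>2 \<le> real L" "real L \<le> 16 * real D / \<epsilon>\<^sup>2 + 1"
      using x1 by (auto simp: L_def)
    have "real D / \<epsilon>\<^sup>2 \<le> real D * sqrt D / \<epsilon>"
    proof -
      have "real D / \<epsilon>\<^sup>2 * 1 \<le> real D / \<epsilon>\<^sup>2 * (\<epsilon> * sqrt D)" using 2 x1 by (intro mult_left_mono) auto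
      then show ?thesis using eps by (simp add: power2_eq_square field_simps)
    qed
    then have "min (real D powr (3 / 2) / \<epsilon>) (real D / \<epsilon>\<^sup>2) = real D / \<epsilon>\<^sup>2" unfolding pw by simp
    moreover have "real L \<le> 243 * (real D / \<epsilon>\<^sup>2)" using L(2) x1 by simp
    moreover have "1 \<le> L" using L(1) x1 by (cases L) auto
    moreover have "4 / \<epsilon>\<^sup>2 * ((real D - 1) / (real D + real L)) \<le> 1 / 4"
    proof -
      have "4 / \<epsilon>\<^sup>2 * ((real D - 1) / (real D + real L)) \<le> 4 / \<epsilon>\<^sup>2 * (real D / (16 * real D / \<epsilon>\<^sup>2))"
        using D L(1) e2 by (intro mult_left_mono frac_le) auto
      also have "\<dots> = 1 / 4" using e2 D by simp
      finally show ?thesis .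
    qed
    ultimately show ?thesis
      using const[of L]
      by (intro exI[of _ L] exI[of _ "0 :: nat"] exI[of _ "[:1 / sqrt (sph D L):]"] conjI) simp_all
  next
    case 3
    \<comment> \<open>\<open>4 / \<epsilon>^2 * (400 * D / k^2) \<le> 1 / 4\<close> asks for
      \<open>k \<ge> 80 * sqrt D / \<epsilon>\<close>. Rounding up costs at most one more
      \<open>sqrt D / \<epsilon>\<close>, so \<open>3 * D * k\<close> queries give the constant
      \<open>3 * 81 = 243\<close>.\<close>
    define k where "k = nat \<lceil>80 * sqrt D / \<epsilon>\<rceil>"
    have x1: "1 \<le> sqrt D / \<epsilon>" unfolding pos_le_divide_eq[OF eps(1)] using eps sq(1) by linarith
    have k: "80 * sqrt D / \<epsilon> \<le> real k" "real k \<le> 80 * sqrt D / \<epsilon> + 1"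
      using x1 by (auto simp: k_def)
    have k1: "k \<ge> 1" using k(1) x1 by (cases k) auto
    obtain q where q: "degree q \<le> 2 * k" "ell D (D * k) (q * q) = 1"
      "ell D (D * k) ([:1, -1:] * (q * q)) \<le> 400 * real D / (real k)\<^sup>2"
      using jacobi_trial[OF 3(1) k1] by blast
    have "6400 * real D / \<epsilon>\<^sup>2 = (80 * sqrt D / \<epsilon>)\<^sup>2" using sq by (simp add: power2_eq_square)
    also have "\<dots> \<le> (real k)\<^sup>2" using k(1) x1 by (intro power_mono) auto
    finally have k2: "6400 * real D / \<epsilon>\<^sup>2 \<le> (real k)\<^sup>2" .
    have "4 / \<epsilon>\<^sup>2 * ell D (D * k) ([:1, -1:] * (q * q)) \<le> 4 / \<epsilon>\<^sup>2 * (400 * real D / (real k)\<^sup>2)"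
      using q(3) e2 by (intro mult_left_mono) auto
    also have "\<dots> \<le> 4 / \<epsilon>\<^sup>2 * (400 * real D / (6400 * real D / \<epsilon>\<^sup>2))"
      using k2 e2 D k1 by (intro mult_left_mono divide_left_mono) (auto intro!: mult_pos_pos divide_pos_pos)
    also have "\<dots> = 1 / 4" using e2 D by simp
    finally have err: "4 / \<epsilon>\<^sup>2 * ell D (D * k) ([:1, -1:] * (q * q)) \<le> 1 / 4" .
    have "real D * sqrt D / \<epsilon> \<le> real D / \<epsilon>\<^sup>2"
    proof -
      have "real D / \<epsilon>\<^sup>2 * (\<epsilon> * sqrt D) \<le> real D / \<epsilon>\<^sup>2 * 1" using 3 e2 by (intro mult_left_mono) auto
      then show ?thesis using eps by (simp add: power2_eq_square field_simps)
    qed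
    then have mn: "min (real D powr (3 / 2) / \<epsilon>) (real D / \<epsilon>\<^sup>2) = real D * (sqrt D / \<epsilon>)" unfolding pw by simp
    have "real k \<le> 81 * (sqrt D / \<epsilon>)" using k(2) x1 by simp
    then have "3 * real D * real k \<le> 3 * real D * (81 * (sqrt D / \<epsilon>))" by (intro mult_left_mono) auto
    then have "real (D * k + D * (2 * k)) \<le> 243 * min (real D powr (3 / 2) / \<epsilon>) (real D / \<epsilon>\<^sup>2)"
      unfolding mn by simp
    moreover have "1 \<le> D * k + D * (2 * k)" using k1 D by simp
    ultimately show ?thesis using q(1,2) err by blast
  qed
qed

theorem corollary1p6:
  shows "\<exists>K :: real. K > 0 \<and>
    (\<forall>(d1 :: nat) (d2 :: nat) (r :: nat) (\<epsilon> :: real).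
       d1 > 0 \<longrightarrow> d2 > 0 \<longrightarrow> r > 0 \<longrightarrow> r * d2 = d1 \<longrightarrow> 0 < \<epsilon> \<longrightarrow> \<epsilon> < 1 \<longrightarrow>
       (\<exists>(n :: nat) (S :: complex mat set) (T :: complex mat \<Rightarrow> complex mat).
          real n \<le> K * min (real d1 powr (3 / 2) / \<epsilon>) (real d1 / \<epsilon>\<^sup>2) \<and>
          S \<subseteq> states d2 \<and>
          sequential_tester d1 d2 n S T \<and>
          (\<forall>E \<in> QChan d1 d2 r.
             (\<Sum>\<rho> \<in> {\<rho> \<in> S. trace_norm (\<rho> - E (outer_prod (unit_vec d1 0) (unit_vec d1 0))) \<le> \<epsilon>}.
                outcome_prob d1 d2 n T E \<rho>) \<ge> 2 / 3)))"
proof (intro exI[of _ "243 :: real"] conjI allI impI)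
  fix d1 d2 r :: nat and \<epsilon> :: real
  assume d1: "d1 > 0" and d2: "d2 > 0" and r: "r > 0" and rd: "r * d2 = d1" and eps: "0 < \<epsilon>" "\<epsilon> < 1"
  have D: "d1 = d2 * r" using rd by (simp add: mult.commute)
  have D1: "d2 * r \<ge> 1" using d1 D by simp
  obtain n L k and q :: "real poly" where b: "real n \<le> 243 * min (real (d2 * r) powr (3 / 2) / \<epsilon>) (real (d2 * r) / \<epsilon>\<^sup>2)"
    and n: "1 \<le> n" and q: "degree q \<le> k" and nk: "n = L + (d2 * r) * k" and nrm: "ell (d2 * r) L (q * q) = 1"
    and err: "4 / \<epsilon>\<^sup>2 * ell (d2 * r) L ([:1, -1:] * (q * q)) \<le> 1 / 4"
    using polynomial_exists[OF D1 eps] by blast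
  obtain F where F: "symm_on n {..<d2 * r} {..<d2 * r} F"
    and amp: "\<And>U. unitary_on {..<d2 * r} U \<Longrightarrow>
      (cmod (\<Sum>a\<in>tup n {..<d2 * r}. \<Sum>b\<in>tup n {..<d2 * r}. cnj (F a b) * tpow U b a))\<^sup>2
        = ((cmod (U 0 0))\<^sup>2) ^ L * (poly q ((cmod (U 0 0))\<^sup>2))\<^sup>2"
    using amplitude_exists[OF D1 q nk] by blast
  from sequential_tester_exists[OF d2 r eps(1) n F amp nrm err] b
  show "\<exists>n S T. real n \<le> 243 * min (real d1 powr (3 / 2) / \<epsilon>) (real d1 / \<epsilon>\<^sup>2) \<and> S \<subseteq> states d2 \<and>
      sequential_tester d1 d2 n S T \<and>
      (\<forall>E \<in> QChan d1 d2 r.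
         (\<Sum>\<rho> \<in> {\<rho> \<in> S. trace_norm (\<rho> - E (outer_prod (unit_vec d1 0) (unit_vec d1 0))) \<le> \<epsilon>}.
            outcome_prob d1 d2 n T E \<rho>) \<ge> 2 / 3)"
    unfolding D by blast
qed simp

end
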